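(* Let $\Omega$ be a locally convex differential graded algebra, $m\in\mathbb N$, and $g\in\mathrm{GL}_m(\Omega^0)$. Let $\omega=g^{-1}dg\in\mathrm{Mat}_m(\Omega^1)$ and, for $s\in[0,1]$, put $\mathcal A^s(g)=s\omega-s(1-s)\sigma\omega^2$ and $\mathcal B^s(g)=\sigma\omega$ in $\mathrm{Mat}_m(\Omega_{\mathbb T})$. Define $\mathrm{Ch}_0(g)=0$ and, for $N\ge1$, $$\mathrm{Ch}_N(g)=\mathrm{Tr}\Big(\int_0^1\mathbf 1\otimes\sum_{k=1}^N\mathcal A^s(g)^{\otimes(k-1)}\otimes\mathcal B^s(g)\otimes\mathcal A^s(g)^{\otimes(N-k)}\,ds\Big)\in\Omega_{\mathbb T}\otimes\underline{\Omega_{\mathbb T}}[1]^{\otimes N}.$$ Then: (1) $\mathrm{Ch}(g)=(\mathrm{Ch}_N(g))_{N\ge0}$ is an odd entire chain, $\mathrm{Ch}(g)\in\mathrm C^\epsilon_-(\Omega_{\mathbb T})$. (2) $(\underline d_{\mathbb T}+\underline b-\underline B)\mathrm{Ch}(g)=0$ in the Chen normalized entire complex $\mathrm N^{\mathbb T,\epsilon}(\Omega)=\mathrm C^\epsilon(\Omega_{\mathbb T})/\overline{\mathrm D^{\mathbb T}(\Omega)}$.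
   Context: All vector spaces are over $\mathbb C$. **Locally convex dg algebra.** An associative unital $\mathbb Z$-graded algebra $\Omega$ with unit $\mathbf 1$ and degree $+1$ differential $d$ with $d(ab)=(da)b+(-1)^{|a|}a\,db$, carrying a Hausdorff locally convex topology for which $d$ is continuous, multiplication is jointly continuous, and $\Omega$ is the topological direct sum of its homogeneous subspaces. Its acyclic extension is $\Omega_{\mathbb T}=\Omega[\sigma]$, with $\sigma$ of degree $-1$, $\sigma^2=0$, supercommuting with $\Omega$; elements are uniquely $\theta=\theta'+\sigma\theta''$ with $\theta',\theta''\in\Omega$; the differential is $d_{\mathbb T}=d-\iota$, $d\theta=d\theta'-\sigma d\theta''$, $\iota\theta=\theta''$. It is again a locally convex dg algebra (as a topological vector space, $\Omega\oplus\Omega$). Degree and differential on matrices $\mathrm{Mat}_m(\Omega_{\mathbb T})$ are taken entrywise. **Cyclic complex.** For a locally convex dg algebra $(\Lambda,d)$: $\mathrm C(\Lambda)=\bigoplus_{N\ge0}\Lambda\otimes\underline\Lambda[1]^{\otimes N}$, $\underline\Lambda=\Lambda/\mathbb C\mathbf 1$; $(\theta_0,\dots,\theta_N)$ denotes $\theta_0\otimes\dots\otimes\theta_N$ and has degree $|\theta_0|+\dots+|\theta_N|-N$. With $m_k=|\theta_0|+\dots+|\theta_k|-k$, $m_{-1}=1$: $\underline d(\theta_0,\dots,\theta_N)=(d\theta_0,\theta_1,\dots,\theta_N)-\sum_{k=1}^N(-1)^{m_{k-1}}(\theta_0,\dots,d\theta_k,\dots,\theta_N)$; $\underline b(\theta_0,\dots,\theta_N)=-\sum_{k=0}^{N-1}(-1)^{m_k}(\theta_0,\dots,\theta_k\theta_{k+1},\dots,\theta_N)+(-1)^{(|\theta_N|-1)m_{N-1}}(\theta_N\theta_0,\theta_1,\dots,\theta_{N-1})$;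 $\underline B(\theta_0,\dots,\theta_N)=\sum_{k=0}^N(-1)^{(m_{k-1}+1)(m_N-m_{k-1})}(\mathbf 1,\theta_k,\dots,\theta_N,\theta_0,\dots,\theta_{k-1})$. For $\Lambda=\Omega_{\mathbb T}$ one uses $d_{\mathbb T}$ and writes $\underline d_{\mathbb T}$. **Entire chains.** For a continuous seminorm $\nu$ on $\Lambda$ let $\pi_{\nu,N}$ be the induced projective tensor seminorm on $\Lambda\otimes\underline\Lambda[1]^{\otimes N}$ and $\epsilon_\nu(c)=\sum_N\pi_{\nu,N}(c_N)/\lfloor N/2\rfloor!$. $\mathrm C^\epsilon(\Lambda)$ is the completion of $\mathrm C(\Lambda)$ with respect to all $\epsilon_\nu$; it is $\mathbb Z_2$-graded by parity of degree, $\mathrm C^\epsilon_-$ being the odd part, and $\underline d,\underline b,\underline B$ extend continuously. **Chen subcomplex.** For $f\in\Omega^0$, $i\in\mathbb N_0$ define on $\mathrm C(\Omega_{\mathbb T})$: $S_i^{(f)}(\theta_0,\dots,\theta_N)=(-1)^{m_i}(\theta_0,\dots,\theta_i,f,\theta_{i+1},\dots,\theta_N)$ for $0\le i\le N$ (for $i=N$, $f$ is appended at the end) and $0$ for $i>N$; $T_i^{(f)}(\theta_0,\dots,\theta_N)=(\theta_0,\dots,\theta_i,f\theta_{i+1},\dots,\theta_N)-(\theta_0,\dots,\theta_if,\theta_{i+1},\dots,\theta_N)-(\theta_0,\dots,\theta_i,df,\theta_{i+1},\dots,\theta_N)$ for $0\le i\le N-1$, $T_N^{(f)}(\theta_0,\dots,\theta_N)=(f\theta_0,\dots,\theta_N)-(\theta_0,\dots,\theta_Nf)-(\theta_0,\dots,\theta_N,df)$,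 and $0$ for $i>N$; $S(\theta_0,\dots,\theta_N)=\sum_{k=0}^N(\theta_0,\dots,\theta_k,\sigma,\theta_{k+1},\dots,\theta_N)$; $R(\theta_0,\dots,\theta_N)=(\sigma\theta_0,\theta_1,\dots,\theta_N)$. $\mathrm D^{\mathbb T}(\Omega)$ is the smallest subcomplex of $(\mathrm C(\Omega_{\mathbb T}),\underline d_{\mathbb T}+\underline b-\underline B)$ containing the images of $S+\mathbf 1$, $R$, $S_i^{(f)}$, $T_i^{(f)}$ for all $i\in\mathbb N_0$, $f\in\Omega^0$; its closure is taken in $\mathrm C^\epsilon(\Omega_{\mathbb T})$. **Generalized trace.** For matrices $\theta_0,\dots,\theta_N$ over $\Omega_{\mathbb T}$, $\mathrm{Tr}(\theta_0\otimes\dots\otimes\theta_N)=\sum_{i_0,\dots,i_N=1}^m\big((\theta_0)_{i_0i_1},(\theta_1)_{i_1i_2},\dots,(\theta_N)_{i_Ni_0}\big)$. The integral over $s$ is of a polynomial in $s$ with values in the tensor product. *)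

theory Defs
  imports "HOL-Analysis.Infinite_Sum" "HOL-Library.Poly_Mapping" "Jordan_Normal_Form.Matrix"
begin

class complex_vec = ab_group_add +
  fixes scaleC :: "complex \<Rightarrow> 'a \<Rightarrow> 'a"  (infixr \<open>*\<^sub>C\<close> 75)
  assumes scaleC_add_right: "a *\<^sub>C (x + y) = a *\<^sub>C x + a *\<^sub>C y"
    and scaleC_add_left: "(a + b) *\<^sub>C x = a *\<^sub>C x + b *\<^sub>C x"
    and scaleC_scaleC: "a *\<^sub>C b *\<^sub>C x = (a * b) *\<^sub>C x"
    and scaleC_one: "1 *\<^sub>C x = x"
begin

definition seminorm :: "('a \<Rightarrow> real) \<Rightarrow> bool" where
  "seminorm p \<longleftrightarrow> (\<forall>x y. p (x + y) \<le> p x + p y) \<and> (\<forall>a x. p (a *\<^sub>C x) = cmod a * p x)"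

end

global_interpretation complex_vector: vector_space "scaleC :: complex \<Rightarrow> 'a \<Rightarrow> 'a::complex_vec"
  defines csubspace = complex_vector.subspace
    and cspan = complex_vector.span
  by unfold_locales (simp_all add: scaleC_add_right scaleC_add_left scaleC_scaleC scaleC_one)

text \<open>A locally convex topology is presented by its continuous seminorms: a set is open iff around each of
  its points it contains an open unit ball of some continuous seminorm. Joint continuity of the vector space
  operations follows.\<close>

class complex_lcs = complex_vec + t2_space +
  assumes open_iff_seminorm:
    "open U \<longleftrightarrow> (\<forall>x\<in>U. \<exists>p. seminorm p \<and> (\<forall>z. (p \<longlongrightarrow> p z) (nhds z)) \<and> (\<forall>y. p (y - x) < 1 \<longrightarrow> y \<in> U))"

text \<open>The sort \<^class>\<open>ring\<close> with a unit is used instead of \<^class>\<open>ring_1\<close> so that the zero algebra is not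
  excluded. The assumptions \<open>homog_decomposition\<close> and \<open>homog_topological\<close> say that the algebra is the direct sum of
  its homogeneous subspaces, algebraically and with the locally convex direct sum topology: a seminorm is
  continuous as soon as its restrictions to all homogeneous subspaces are.\<close>

class locally_convex_dga = complex_lcs + ring + monoid_mult +
  fixes homog :: "int \<Rightarrow> 'a set"
    and diff :: "'a \<Rightarrow> 'a"
  assumes mult_scaleC_left: "(a *\<^sub>C x) * y = a *\<^sub>C (x * y)"
    and mult_scaleC_right: "x * (a *\<^sub>C y) = a *\<^sub>C (x * y)"
    and tendsto_mult_nhds: "filterlim (\<lambda>(v, w). v * w) (nhds (x * y)) (nhds x \<times>\<^sub>F nhds y)"
    and homog_zero: "0 \<in> homog n"
    and homog_add: "x \<in> homog n \<Longrightarrow> y \<in> homog n \<Longrightarrow> x + y \<in> homog n"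
    and homog_scaleC: "x \<in> homog n \<Longrightarrow> a *\<^sub>C x \<in> homog n"
    and homog_decomposition: "\<exists>!c. finite {n. c n \<noteq> 0} \<and> (\<forall>n. c n \<in> homog n) \<and> x = (\<Sum>n | c n \<noteq> 0. c n)"
    and homog_topological: "seminorm p \<Longrightarrow> (\<And>n x. x \<in> homog n \<Longrightarrow> (p \<longlongrightarrow> p x) (at x within homog n)) \<Longrightarrow> (p \<longlongrightarrow> p z) (nhds z)"
    and homog_one: "1 \<in> homog 0"
    and homog_mult: "x \<in> homog i \<Longrightarrow> y \<in> homog j \<Longrightarrow> x * y \<in> homog (i + j)"
    and diff_add: "diff (x + y) = diff x + diff y"
    and diff_scaleC: "diff (a *\<^sub>C x) = a *\<^sub>C diff x"
    and diff_homog: "x \<in> homog n \<Longrightarrow> diff x \<in> homog (n + 1)"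
    and diff_diff: "diff (diff x) = 0"
    and diff_mult: "x \<in> homog n \<Longrightarrow> diff (x * y) = diff x * y + (-1) powi n *\<^sub>C (x * diff y)"
    and tendsto_diff_nhds: "(diff \<longlongrightarrow> diff x) (nhds x)"


instantiation complex :: complex_vec
begin
definition scaleC_complex :: "complex \<Rightarrow> complex \<Rightarrow> complex" where "scaleC_complex = (*)"
instance by standard (simp_all add: scaleC_complex_def algebra_simps)
end

lemma seminorm_add: "seminorm p \<Longrightarrow> p (x + y) \<le> p x + p y"
  and seminorm_scaleC: "seminorm p \<Longrightarrow> p (a *\<^sub>C x) = cmod a * p x"
  by (auto simp: seminorm_def)

lemma seminorm_zero: "seminorm p \<Longrightarrow> p 0 = 0"
  using seminorm_scaleC[of p 0 0] by simp

lemma seminorm_uminus: "seminorm p \<Longrightarrow> p (- x) = p x"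
  using seminorm_scaleC[of p "-1" x] by simp

lemma seminorm_minus_commute: "seminorm p \<Longrightarrow> p (x - y) = p (y - x)"
  using seminorm_uminus[of p "x - y"] by simp

lemma seminorm_nonneg: "seminorm p \<Longrightarrow> 0 \<le> p x"
  using seminorm_add[of p x "- x"] by (simp add: seminorm_uminus seminorm_zero)

lemma seminorm_diff_le: "seminorm p \<Longrightarrow> \<bar>p x - p y\<bar> \<le> p (x - y)"
  using seminorm_add[of p "x - y" y] seminorm_add[of p "y - x" x] by (simp add: seminorm_minus_commute[of p y x])

lemma seminorm_max: "seminorm p \<Longrightarrow> seminorm q \<Longrightarrow> seminorm (\<lambda>x. max (p x) (q x))"
  unfolding seminorm_def by (auto simp: max_mult_distrib_left add_mono max_def intro: order_trans) (smt (verit))+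

lemma seminorm_mult_left: "seminorm p \<Longrightarrow> 0 \<le> r \<Longrightarrow> seminorm (\<lambda>x. r * p x)"
  unfolding seminorm_def by (auto simp: distrib_left[symmetric] mult_left_mono)

definition cont_seminorm :: "('a::{complex_vec, topological_space} \<Rightarrow> real) \<Rightarrow> bool" where
  "cont_seminorm p \<longleftrightarrow> seminorm p \<and> continuous_on UNIV p"

lemma continuous_on_UNIV_nhds: "continuous_on UNIV f \<longleftrightarrow> (\<forall>z. (f \<longlongrightarrow> f z) (nhds z))"
  by (simp add: continuous_on_def tendsto_at_iff_tendsto_nhds)

lemma cont_seminorm_seminorm: "cont_seminorm p \<Longrightarrow> seminorm p"
  by (simp add: cont_seminorm_def)

lemma cont_seminorm_zero: "cont_seminorm (\<lambda>_. 0)"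
  by (auto simp: cont_seminorm_def seminorm_def)

lemma cont_seminorm_max: "cont_seminorm p \<Longrightarrow> cont_seminorm q \<Longrightarrow> cont_seminorm (\<lambda>x. max (p x) (q x))"
  by (auto simp: cont_seminorm_def seminorm_max intro!: continuous_on_max)

lemma cont_seminorm_mult_left: "cont_seminorm p \<Longrightarrow> 0 \<le> r \<Longrightarrow> cont_seminorm (\<lambda>x. r * p x)"
  by (auto simp: cont_seminorm_def seminorm_mult_left intro!: continuous_intros)

lemma open_iff_cont_seminorm:
  "open (U :: 'a::complex_lcs set) \<longleftrightarrow> (\<forall>x\<in>U. \<exists>p. cont_seminorm p \<and> (\<forall>y. p (y - x) < 1 \<longrightarrow> y \<in> U))"
  unfolding open_iff_seminorm[of U] cont_seminorm_def continuous_on_UNIV_nhds by (simp add: conj_assoc)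

lemma open_seminorm_ball:
  fixes x :: "'a::complex_lcs"
  assumes "cont_seminorm p" "0 < e"
  shows "open {y. p (y - x) < e}"
  unfolding open_iff_cont_seminorm
proof safe
  fix z assume z: "p (z - x) < e"
  define r where "r = 1 / (e - p (z - x))"
  have r: "0 < r" using z by (simp add: r_def)
  have "p (y - x) < e" if "r * p (y - z) < 1" for y
  proof -
    have "p (y - z) < e - p (z - x)" using that z by (simp add: r_def field_simps)
    moreover have "p (y - x) \<le> p (y - z) + p (z - x)"
      using seminorm_add[OF cont_seminorm_seminorm[OF assms(1)], of "y - z" "z - x"] by simp
    ultimately show ?thesis by simp
  qed
  then show "\<exists>p'. cont_seminorm p' \<and> (\<forall>y. p' (y - z) < 1 \<longrightarrow> y \<in> {y. p (y - x) < e})"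
    using cont_seminorm_mult_left[OF assms(1), of r] r by (intro exI[of _ "\<lambda>x. r * p x"]) auto
qed

lemma tendsto_lcs_iff:
  fixes l :: "'a::complex_lcs"
  shows "(f \<longlongrightarrow> l) F \<longleftrightarrow> (\<forall>p. cont_seminorm p \<longrightarrow> ((\<lambda>x. p (f x - l)) \<longlongrightarrow> 0) F)"
proof safe
  fix p :: "'a \<Rightarrow> real" assume f: "(f \<longlongrightarrow> l) F" and p: "cont_seminorm p"
  show "((\<lambda>x. p (f x - l)) \<longlongrightarrow> 0) F"
  proof (rule tendstoI)
    fix e :: real assume "0 < e"
    have "\<forall>\<^sub>F x in F. f x \<in> {y. p (y - l) < e}"
      by (rule topological_tendstoD[OF f open_seminorm_ball[OF p \<open>0 < e\<close>]])
         (use \<open>0 < e\<close> p in \<open>simp add: seminorm_zero cont_seminorm_def\<close>)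
    then show "\<forall>\<^sub>F x in F. dist (p (f x - l)) 0 < e"
      using p by (simp add: seminorm_nonneg cont_seminorm_def)
  qed
next
  assume *: "\<forall>p. cont_seminorm p \<longrightarrow> ((\<lambda>x. p (f x - l)) \<longlongrightarrow> 0) F"
  show "(f \<longlongrightarrow> l) F"
  proof (rule topological_tendstoI)
    fix S assume "open S" "l \<in> S"
    then obtain p where p: "cont_seminorm p" "\<And>y. p (y - l) < 1 \<Longrightarrow> y \<in> S"
      unfolding open_iff_cont_seminorm by blast
    from * p(1) have "((\<lambda>x. p (f x - l)) \<longlongrightarrow> 0) F" by blast
    then have "\<forall>\<^sub>F x in F. p (f x - l) < 1" by (rule order_tendstoD) simp
    then show "\<forall>\<^sub>F x in F. f x \<in> S" by eventually_elim (rule p)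
  qed
qed

instance complex_lcs \<subseteq> topological_group_add
proof
  fix a b :: 'a
  show "((\<lambda>x. fst x + snd x) \<longlongrightarrow> a + b) (nhds a \<times>\<^sub>F nhds b)"
    unfolding tendsto_lcs_iff
  proof safe
    fix p :: "'a \<Rightarrow> real" assume p: "cont_seminorm p"
    have 1: "((\<lambda>x. p (fst x - a)) \<longlongrightarrow> 0) (nhds a \<times>\<^sub>F nhds b)"
      using tendsto_lcs_iff[of fst a "nhds a \<times>\<^sub>F nhds b"] p filterlim_fst by blast
    have 2: "((\<lambda>x. p (snd x - b)) \<longlongrightarrow> 0) (nhds a \<times>\<^sub>F nhds b)"
      using tendsto_lcs_iff[of snd b "nhds a \<times>\<^sub>F nhds b"] p filterlim_snd by blast
    have le: "p (fst x + snd x - (a + b)) \<le> p (fst x - a) + p (snd x - b)" for x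
      using seminorm_add[OF cont_seminorm_seminorm[OF p], of "fst x - a" "snd x - b"] by (simp add: algebra_simps)
    show "((\<lambda>x. p (fst x + snd x - (a + b))) \<longlongrightarrow> 0) (nhds a \<times>\<^sub>F nhds b)"
      by (rule tendsto_sandwich[OF _ _ tendsto_const tendsto_add_zero[OF 1 2]])
         (use le p in \<open>auto simp: seminorm_nonneg cont_seminorm_def\<close>)
  qed
  show "(uminus \<longlongrightarrow> - a) (nhds a)"
    unfolding tendsto_lcs_iff
  proof safe
    fix p :: "'a \<Rightarrow> real" assume p: "cont_seminorm p"
    then have "((\<lambda>x. p (x - a)) \<longlongrightarrow> 0) (nhds a)"
      using tendsto_lcs_iff[of "\<lambda>x. x" a "nhds a"] filterlim_ident by blast
    moreover have "p (- x - - a) = p (x - a)" for x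
      using p seminorm_uminus[of p "x - a"] by (simp add: cont_seminorm_def)
    ultimately show "((\<lambda>x. p (- x - - a)) \<longlongrightarrow> 0) (nhds a)" by simp
  qed
qed

lemma continuous_linear_lcs:
  fixes f :: "'a::complex_lcs \<Rightarrow> 'b::complex_lcs"
  assumes f: "\<And>x y. f (x - y) = f x - f y" and p: "\<And>p. cont_seminorm p \<Longrightarrow> cont_seminorm (\<lambda>x. p (f x))"
  shows "(f \<longlongrightarrow> f z) (nhds z)"
  unfolding tendsto_lcs_iff
proof safe
  fix q :: "'b \<Rightarrow> real" assume "cont_seminorm q"
  from p[OF this] show "((\<lambda>x. q (f x - f z)) \<longlongrightarrow> 0) (nhds z)"
    using tendsto_lcs_iff[of "\<lambda>x. x" z "nhds z"] filterlim_ident unfolding f[symmetric] by blast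
qed

text \<open>The component of degree \<open>n\<close>.\<close>

definition hcomp :: "int \<Rightarrow> 'a::locally_convex_dga \<Rightarrow> 'a" where
  "hcomp n x = (THE c. finite {n. c n \<noteq> 0} \<and> (\<forall>n. c n \<in> homog n) \<and> x = (\<Sum>n | c n \<noteq> 0. c n)) n"

lemma hcomp_props:
  fixes x :: "'a::locally_convex_dga"
  shows finite_hcomp: "finite {n. hcomp n x \<noteq> 0}" and hcomp_homog: "hcomp n x \<in> homog n"
    and sum_hcomp: "(\<Sum>n | hcomp n x \<noteq> 0. hcomp n x) = x"
proof -
  have "(\<lambda>n. hcomp n x) = (THE c. finite {n. c n \<noteq> 0} \<and> (\<forall>n. c n \<in> homog n) \<and> x = (\<Sum>n | c n \<noteq> 0. c n))"
    by (simp add: hcomp_def)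
  note eq = this
  have "finite {n. hcomp n x \<noteq> 0} \<and> (\<forall>n. hcomp n x \<in> homog n) \<and> x = (\<Sum>n | hcomp n x \<noteq> 0. hcomp n x)"
    using theI'[OF homog_decomposition[of x]] unfolding eq[symmetric] .
  then show "finite {n. hcomp n x \<noteq> 0}" "hcomp n x \<in> homog n" "(\<Sum>n | hcomp n x \<noteq> 0. hcomp n x) = x" by auto
qed

lemma hcomp_unique:
  fixes x :: "'a::locally_convex_dga"
  assumes "finite A" "\<And>n. n \<in> A \<Longrightarrow> c n \<in> homog n" "x = (\<Sum>n\<in>A. c n)"
  shows "hcomp n x = (if n \<in> A then c n else 0)"
proof -
  define c' where "c' n = (if n \<in> A then c n else 0)" for n
  have "(\<Sum>n | c' n \<noteq> 0. c' n) = (\<Sum>n\<in>A. c' n)"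
    by (rule sum.mono_neutral_left) (use assms(1) in \<open>auto simp: c'_def split: if_splits\<close>)
  also have "\<dots> = x" by (simp add: assms(3) c'_def)
  finally have "finite {n. c' n \<noteq> 0} \<and> (\<forall>n. c' n \<in> homog n) \<and> x = (\<Sum>n | c' n \<noteq> 0. c' n)"
    using assms(1,2) finite_subset[of "{n. c' n \<noteq> 0}" A] by (auto simp: c'_def homog_zero)
  then have "(THE c. finite {n. c n \<noteq> 0} \<and> (\<forall>n. c n \<in> homog n) \<and> x = (\<Sum>n | c n \<noteq> 0. c n)) = c'"
    by (rule the1_equality[OF homog_decomposition])
  then show ?thesis by (simp add: hcomp_def c'_def)
qed

lemma hcomp_eq: "x \<in> homog n \<Longrightarrow> hcomp m x = (if m = n then x else 0)"
  using hcomp_unique[of "{n}" "\<lambda>_. x" x m] by simp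

lemma sum_hcomp_superset: "finite A \<Longrightarrow> {n. hcomp n x \<noteq> 0} \<subseteq> A \<Longrightarrow> (\<Sum>n\<in>A. hcomp n x) = x"
  by (rule trans[OF sum.mono_neutral_right sum_hcomp]) auto

lemma hcomp_zero [simp]: "hcomp n 0 = 0"
  using hcomp_eq[OF homog_zero[of n], of n] by simp

lemma hcomp_add: "hcomp n (x + y) = hcomp n x + hcomp n y"
proof -
  define A where "A = {n. hcomp n x \<noteq> 0} \<union> {n. hcomp n y \<noteq> 0}"
  have A: "finite A" by (simp add: A_def finite_hcomp)
  have "hcomp n (x + y) = (if n \<in> A then hcomp n x + hcomp n y else 0)"
  proof (rule hcomp_unique[OF A])
    have "(\<Sum>n\<in>A. hcomp n x) = x" "(\<Sum>n\<in>A. hcomp n y) = y"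
      by (rule sum_hcomp_superset[OF A]; simp add: A_def)+
    then show "x + y = (\<Sum>n\<in>A. hcomp n x + hcomp n y)" by (simp add: sum.distrib)
  qed (simp add: homog_add hcomp_homog)
  then show ?thesis by (auto simp: A_def)
qed

lemma hcomp_scaleC: "hcomp n (r *\<^sub>C x) = r *\<^sub>C hcomp n x"
proof -
  have "hcomp n (r *\<^sub>C x) = (if n \<in> {n. hcomp n x \<noteq> 0} then r *\<^sub>C hcomp n x else 0)"
    by (rule hcomp_unique[OF finite_hcomp])
       (auto simp: homog_scaleC hcomp_homog complex_vector.scale_sum_right[symmetric] sum_hcomp)
  then show ?thesis by auto
qed

lemma homog_sum: "(\<And>i. i \<in> I \<Longrightarrow> f i \<in> homog n) \<Longrightarrow> (\<Sum>i\<in>I. f i) \<in> homog n"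
  by (induction I rule: infinite_finite_induct) (auto simp: homog_zero homog_add)

lemma homog_uminus: "x \<in> homog n \<Longrightarrow> - x \<in> homog n"
  using homog_scaleC[of x n "-1"] by simp

lemma homog_diff: "x \<in> homog n \<Longrightarrow> y \<in> homog n \<Longrightarrow> x - y \<in> homog n"
  using homog_add[of x n "- y"] homog_uminus[of y n] by simp

lemma homog_induct [case_names homog add]:
  assumes "\<And>n x. x \<in> homog n \<Longrightarrow> P x" "\<And>x y. P x \<Longrightarrow> P y \<Longrightarrow> P (x + y)"
  shows "P (x :: 'a::locally_convex_dga)"
proof -
  have "P (\<Sum>n\<in>A. hcomp n x)" if "finite A" for A
    using that
  proof induction
    case empty
    show ?case using assms(1)[OF homog_zero] by simp
  next
    case (insert n A)
    show ?case using assms(2)[OF assms(1)[OF hcomp_homog[of n x]] insert.IH] insert.hyps by simp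
  qed
  from this[OF finite_hcomp[of x]] show ?thesis by (simp add: sum_hcomp)
qed

lemma scaleC_sum_left_lin: "(\<Sum>n\<in>A. r *\<^sub>C f n) = r *\<^sub>C (\<Sum>n\<in>A. f n)"
  by (simp add: complex_vector.scale_sum_right)

text \<open>The parity automorphism, multiplication by \<open>(-1)^n\<close> in degree \<open>n\<close>.\<close>

definition sgn_grading :: "'a::locally_convex_dga \<Rightarrow> 'a" where
  "sgn_grading x = (\<Sum>n | hcomp n x \<noteq> 0. (-1) powi n *\<^sub>C hcomp n x)"

lemma sgn_grading_superset:
  "finite A \<Longrightarrow> {n. hcomp n x \<noteq> 0} \<subseteq> A \<Longrightarrow> sgn_grading x = (\<Sum>n\<in>A. (-1) powi n *\<^sub>C hcomp n x)"
  unfolding sgn_grading_def by (rule sum.mono_neutral_left) auto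

lemma sgn_grading_homog:
  assumes x: "x \<in> homog n"
  shows "sgn_grading x = (-1) powi n *\<^sub>C x"
proof -
  have "{m. hcomp m x \<noteq> 0} \<subseteq> {n}" using hcomp_eq[OF x] by auto
  from sgn_grading_superset[OF _ this] show ?thesis by (simp add: hcomp_eq[OF x])
qed

lemma sgn_grading_add: "sgn_grading (x + y) = sgn_grading x + sgn_grading y"
proof -
  define A where "A = {n. hcomp n x \<noteq> 0} \<union> {n. hcomp n y \<noteq> 0}"
  have A: "finite A" by (simp add: A_def finite_hcomp)
  show ?thesis
    by (subst (1 2 3) sgn_grading_superset[OF A])
       (auto simp: A_def hcomp_add scaleC_add_right sum.distrib)
qed

lemma sgn_grading_scaleC: "sgn_grading (r *\<^sub>C x) = r *\<^sub>C sgn_grading x"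
proof -
  have "finite {n. hcomp n x \<noteq> 0}" by (rule finite_hcomp)
  then have "sgn_grading (r *\<^sub>C x) = (\<Sum>n | hcomp n x \<noteq> 0. (-1) powi n *\<^sub>C hcomp n (r *\<^sub>C x))"
    by (rule sgn_grading_superset) (auto simp: hcomp_scaleC)
  then show ?thesis
    unfolding sgn_grading_def[of x] hcomp_scaleC complex_vector.scale_sum_right
    by (simp add: scaleC_scaleC mult.commute)
qed

lemma sgn_grading_zero [simp]: "sgn_grading 0 = 0"
  by (simp add: sgn_grading_def)

lemma sgn_grading_uminus: "sgn_grading (- x) = - sgn_grading x"
  using sgn_grading_scaleC[of "-1" x] by simp

lemma sgn_grading_diff: "sgn_grading (x - y) = sgn_grading x - sgn_grading y"
  using sgn_grading_add[of x "- y"] by (simp add: sgn_grading_uminus)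

lemma sgn_grading_one [simp]: "sgn_grading 1 = 1"
  using sgn_grading_homog[OF homog_one] by (simp add: scaleC_one)

lemma sgn_grading_mult: "sgn_grading (x * y) = sgn_grading x * sgn_grading y"
proof (induction x rule: homog_induct)
  case (homog n x)
  show ?case
  proof (induction y rule: homog_induct)
    case (homog m y)
    with \<open>x \<in> homog n\<close> show ?case
      by (simp add: sgn_grading_homog[OF homog_mult] sgn_grading_homog mult_scaleC_left mult_scaleC_right
          scaleC_scaleC power_int_add)
  qed (simp add: distrib_left sgn_grading_add)
qed (simp add: distrib_right sgn_grading_add)

lemma cont_seminorm_homogI:
  fixes p :: "'a::locally_convex_dga \<Rightarrow> real"
  assumes "seminorm p" "\<And>n. continuous_on (homog n) p"
  shows "cont_seminorm p"
  unfolding cont_seminorm_def continuous_on_UNIV_nhds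
  using assms by (auto intro: homog_topological simp: continuous_on_def)

lemma cont_seminorm_sgn_grading:
  assumes "cont_seminorm p" shows "cont_seminorm (\<lambda>x. p (sgn_grading x))"
proof (rule cont_seminorm_homogI)
  have p: "seminorm p" "continuous_on UNIV p" using assms by (auto simp: cont_seminorm_def)
  from p(1) show "seminorm (\<lambda>x. p (sgn_grading x))"
    by (auto simp: seminorm_def sgn_grading_add sgn_grading_scaleC)
  fix n
  have "p (sgn_grading x) = p x" if "x \<in> homog n" for x
    using that by (simp add: sgn_grading_homog seminorm_scaleC[OF p(1)] norm_power_int)
  then show "continuous_on (homog n) (\<lambda>x. p (sgn_grading x))"
    using continuous_on_subset[OF p(2)] by (subst continuous_on_cong[OF refl]) auto
qed

lemma tendsto_sgn_grading: "(sgn_grading \<longlongrightarrow> sgn_grading z) (nhds z)"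
  by (rule continuous_linear_lcs) (auto simp: sgn_grading_diff cont_seminorm_sgn_grading)

lemma tendsto_sgn_grading' [tendsto_intros]:
  "(f \<longlongrightarrow> l) F \<Longrightarrow> ((\<lambda>x. sgn_grading (f x)) \<longlongrightarrow> sgn_grading l) F"
  by (rule filterlim_compose[OF tendsto_sgn_grading])

lemma tendsto_diff_op:
  "(f \<longlongrightarrow> l) F \<Longrightarrow> ((\<lambda>x. diff (f x)) \<longlongrightarrow> diff l) F"
  by (rule filterlim_compose[OF tendsto_diff_nhds])

lemma tendsto_mult_dga:
  fixes k l :: "'a::locally_convex_dga"
  assumes "(f \<longlongrightarrow> k) F" "(g \<longlongrightarrow> l) F"
  shows "((\<lambda>x. f x * g x) \<longlongrightarrow> k * l) F"
  using filterlim_compose[OF tendsto_mult_nhds filterlim_Pair[OF assms]] by simp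

lemma diff_zero [simp]: "diff 0 = (0 :: 'a::locally_convex_dga)"
  using diff_scaleC[of 0 0] by simp

lemma diff_uminus: "diff (- x) = - diff (x :: 'a::locally_convex_dga)"
  using diff_scaleC[of "-1" x] by simp

lemma diff_minus: "diff (x - y) = diff x - diff (y :: 'a::locally_convex_dga)"
  using diff_add[of x "- y"] by (simp add: diff_uminus)

lemma diff_mult_general: "diff (x * y) = diff x * y + sgn_grading x * diff y"
  by (induction x rule: homog_induct)
     (simp_all add: diff_mult sgn_grading_homog mult_scaleC_left distrib_right diff_add sgn_grading_add)

lemma diff_sgn_grading: "diff (sgn_grading x) = - sgn_grading (diff x)"
  by (induction x rule: homog_induct)
     (simp_all add: sgn_grading_homog diff_homog sgn_grading_homog[OF diff_homog] diff_scaleC power_int_add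
       sgn_grading_add diff_add)

lemma sgn_grading_sgn_grading: "sgn_grading (sgn_grading x) = x"
  by (induction x rule: homog_induct)
     (simp_all add: sgn_grading_homog sgn_grading_scaleC scaleC_scaleC scaleC_one sgn_grading_add
       power_int_mult_distrib[symmetric])

text \<open>The acyclic extension: \<open>Acyc a b\<close> stands for \<open>a + \<sigma> b\<close>. Since \<open>\<sigma>\<close> is odd, \<open>a \<sigma> = \<sigma> (sgn_grading a)\<close>, which gives
  the product below; see the lemmas \<open>acyc_decompose\<close>, \<open>sigma_supercommutes\<close> and \<open>diff_acyc\<close>.\<close>

datatype 'a acyc = Acyc (form: 'a) (sform: 'a)

lemma acyc_eq_iff: "x = y \<longleftrightarrow> form x = form y \<and> sform x = sform y"
  by (cases x; cases y) simp

instantiation acyc :: (ab_group_add) ab_group_add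
begin
definition zero_acyc where "0 = Acyc 0 0"
definition plus_acyc where "x + y = Acyc (form x + form y) (sform x + sform y)"
definition minus_acyc where "x - y = Acyc (form x - form y) (sform x - sform y)"
definition uminus_acyc where "- x = Acyc (- form x) (- sform x)"
instance by standard (simp_all add: zero_acyc_def plus_acyc_def minus_acyc_def uminus_acyc_def acyc_eq_iff add.assoc add.commute)
end

lemma acyc_add_simps [simp]:
  "form 0 = 0" "sform 0 = 0"
  "form (x + y) = form x + form y" "sform (x + y) = sform x + sform y"
  "form (x - y) = form x - form y" "sform (x - y) = sform x - sform y"
  "form (- x) = - form x" "sform (- x) = - sform x"
  by (simp_all add: zero_acyc_def plus_acyc_def minus_acyc_def uminus_acyc_def)

lemma form_sum: "form (sum f A) = (\<Sum>i\<in>A. form (f i))"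
  and sform_sum: "sform (sum f A) = (\<Sum>i\<in>A. sform (f i))"
  by (induction A rule: infinite_finite_induct; simp)+

instantiation acyc :: (complex_vec) complex_vec
begin
definition scaleC_acyc where "r *\<^sub>C x = Acyc (r *\<^sub>C form x) (r *\<^sub>C sform x)"
instance by standard (simp_all add: scaleC_acyc_def acyc_eq_iff scaleC_add_right scaleC_add_left scaleC_scaleC scaleC_one)
end

lemma acyc_scaleC_simps [simp]:
  "form (r *\<^sub>C x) = r *\<^sub>C form x" "sform (r *\<^sub>C x) = r *\<^sub>C sform x"
  by (simp_all add: scaleC_acyc_def)

instantiation acyc :: (t2_space) t2_space
begin
definition open_acyc where "open (U :: 'a acyc set) \<longleftrightarrow> open {(a, b). Acyc a b \<in> U}"
instance
proof
  show "open (UNIV :: 'a acyc set)" by (simp add: open_acyc_def case_prod_beta)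
  show "open (S \<inter> T)" if "open S" "open T" for S T :: "'a acyc set"
  proof -
    have "{(a, b). Acyc a b \<in> S \<inter> T} = {(a, b). Acyc a b \<in> S} \<inter> {(a, b). Acyc a b \<in> T}" by auto
    with that show ?thesis by (simp add: open_acyc_def open_Int)
  qed
  show "open (\<Union>K)" if "\<forall>S\<in>K. open S" for K :: "'a acyc set set"
  proof -
    have "{(a, b). Acyc a b \<in> \<Union>K} = (\<Union>S\<in>K. {(a, b). Acyc a b \<in> S})" by auto
    with that show ?thesis by (simp add: open_acyc_def open_UN)
  qed
  fix x y :: "'a acyc" assume "x \<noteq> y"
  then have "(form x, sform x) \<noteq> (form y, sform y)" by (simp add: acyc_eq_iff)
  from hausdorff[OF this] obtain U V where UV: "open U" "open V" "(form x, sform x) \<in> U" "(form y, sform y) \<in> V" "U \<inter> V = {}"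
    by blast
  let ?T = "\<lambda>W. {z. (form z, sform z) \<in> W}"
  have "open (?T U)" "open (?T V)" using UV(1,2) by (simp_all add: open_acyc_def case_prod_beta)
  then show "\<exists>U V. open U \<and> open V \<and> x \<in> U \<and> y \<in> V \<and> U \<inter> V = {}"
    using UV(3-5) by (intro exI[of _ "?T U"] exI[of _ "?T V"]) auto
qed
end

lemma tendsto_Acyc:
  assumes "(f \<longlongrightarrow> a) F" "(g \<longlongrightarrow> b) F"
  shows "((\<lambda>x. Acyc (f x) (g x)) \<longlongrightarrow> Acyc a b) F"
proof (rule topological_tendstoI)
  fix S assume "open S" "Acyc a b \<in> S"
  then have "\<forall>\<^sub>F x in F. (f x, g x) \<in> {(a, b). Acyc a b \<in> S}"
    by (intro topological_tendstoD[OF tendsto_Pair[OF assms]]) (auto simp: open_acyc_def)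
  then show "\<forall>\<^sub>F x in F. Acyc (f x) (g x) \<in> S" by simp
qed

lemma tendsto_form_nhds: "(form \<longlongrightarrow> form z) (nhds z)"
  and tendsto_sform_nhds: "(sform \<longlongrightarrow> sform z) (nhds z)"
proof -
  show "(form \<longlongrightarrow> form z) (nhds z)"
  proof (rule topological_tendstoI)
    fix S assume S: "open S" "form z \<in> S"
    have "{(a, b). Acyc a b \<in> {z. form z \<in> S}} = S \<times> UNIV" by auto
    then have "open {z. form z \<in> S}" using S by (simp only: open_acyc_def) (simp add: open_Times)
    from eventually_nhds_in_open[OF this] S show "\<forall>\<^sub>F x in nhds z. form x \<in> S" by simp
  qed
  show "(sform \<longlongrightarrow> sform z) (nhds z)"
  proof (rule topological_tendstoI)
    fix S assume S: "open S" "sform z \<in> S"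
    have "{(a, b). Acyc a b \<in> {z. sform z \<in> S}} = UNIV \<times> S" by auto
    then have "open {z. sform z \<in> S}" using S by (simp only: open_acyc_def) (simp add: open_Times)
    from eventually_nhds_in_open[OF this] S show "\<forall>\<^sub>F x in nhds z. sform x \<in> S" by simp
  qed
qed

lemmas tendsto_form = filterlim_compose[OF tendsto_form_nhds]
lemmas tendsto_sform = filterlim_compose[OF tendsto_sform_nhds]

lemma cont_seminorm_form: "cont_seminorm p \<Longrightarrow> cont_seminorm (\<lambda>x. p (form x))"
  and cont_seminorm_sform: "cont_seminorm p \<Longrightarrow> cont_seminorm (\<lambda>x. p (sform x))"
  for p :: "'a::complex_lcs \<Rightarrow> real"
  unfolding cont_seminorm_def continuous_on_UNIV_nhds
  by (auto simp: seminorm_def intro: filterlim_compose[OF _ tendsto_form_nhds] filterlim_compose[OF _ tendsto_sform_nhds])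

lemma cont_seminorm_Acyc:
  fixes p :: "'a::complex_lcs acyc \<Rightarrow> real"
  assumes "cont_seminorm p"
  shows "cont_seminorm (\<lambda>a. p (Acyc a 0))" "cont_seminorm (\<lambda>b. p (Acyc 0 b))"
proof -
  have p: "seminorm p" "(p \<longlongrightarrow> p z) (nhds z)" for z using assms by (auto simp: cont_seminorm_def continuous_on_UNIV_nhds)
  have eq: "Acyc (x + y) 0 = Acyc x 0 + Acyc y 0" "Acyc 0 (x + y) = Acyc 0 x + Acyc 0 y"
    "Acyc (r *\<^sub>C x) 0 = r *\<^sub>C Acyc x 0" "Acyc 0 (r *\<^sub>C x) = r *\<^sub>C Acyc 0 x" for x y :: 'a and r
    by (simp_all add: acyc_eq_iff)
  show "cont_seminorm (\<lambda>a. p (Acyc a 0))" "cont_seminorm (\<lambda>b. p (Acyc 0 b))"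
    unfolding cont_seminorm_def continuous_on_UNIV_nhds seminorm_def eq
    using p(1) by (auto simp: seminorm_def intro!: filterlim_compose[OF p(2)] tendsto_Acyc tendsto_const filterlim_ident)
qed

lemma seminorm_Acyc_le: "seminorm p \<Longrightarrow> p x \<le> p (Acyc (form x) 0) + p (Acyc 0 (sform x))"
  using seminorm_add[of p "Acyc (form x) 0" "Acyc 0 (sform x)"] by (simp add: plus_acyc_def)

lemma seminorm_tendsto_nhdsI:
  fixes p :: "'a::complex_vec \<Rightarrow> real"
  assumes "seminorm p" "((\<lambda>x. p (x - z)) \<longlongrightarrow> 0) F"
  shows "(p \<longlongrightarrow> p z) F"
proof (rule tendstoI)
  fix e :: real assume "0 < e"
  with assms(2) have "\<forall>\<^sub>F x in F. p (x - z) < e" by (rule order_tendstoD)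
  then show "\<forall>\<^sub>F x in F. dist (p x) (p z) < e"
    by eventually_elim (use seminorm_diff_le[OF assms(1)] in \<open>auto simp: dist_real_def intro: le_less_trans\<close>)
qed

lemma cont_seminorm_AcycI:
  fixes p :: "'a::complex_lcs acyc \<Rightarrow> real"
  assumes p: "seminorm p" and "cont_seminorm (\<lambda>a. p (Acyc a 0))" "cont_seminorm (\<lambda>b. p (Acyc 0 b))"
  shows "cont_seminorm p"
  unfolding cont_seminorm_def continuous_on_UNIV_nhds
proof (intro conjI allI p seminorm_tendsto_nhdsI)
  fix z
  have 1: "((\<lambda>x. p (Acyc (form x - form z) 0)) \<longlongrightarrow> 0) (nhds z)"
    using tendsto_lcs_iff[of form "form z" "nhds z"] tendsto_form_nhds assms(2) by blast
  have 2: "((\<lambda>x. p (Acyc 0 (sform x - sform z))) \<longlongrightarrow> 0) (nhds z)"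
    using tendsto_lcs_iff[of sform "sform z" "nhds z"] tendsto_sform_nhds assms(3) by blast
  have "p (x - z) \<le> p (Acyc (form x - form z) 0) + p (Acyc 0 (sform x - sform z))" for x
    using seminorm_Acyc_le[OF p, of "x - z"] by simp
  then show "((\<lambda>x. p (x - z)) \<longlongrightarrow> 0) (nhds z)"
    by (intro tendsto_sandwich[OF _ _ tendsto_const tendsto_add_zero[OF 1 2]])
       (auto simp: seminorm_nonneg[OF p])
qed

instance acyc :: (complex_lcs) complex_lcs
proof
  fix U :: "'a acyc set"
  have "open U \<longleftrightarrow> (\<forall>x\<in>U. \<exists>p. cont_seminorm p \<and> (\<forall>y. p (y - x) < 1 \<longrightarrow> y \<in> U))"
  proof safe
    fix x assume "open U" "x \<in> U"
    then have "open {(a, b). Acyc a b \<in> U}" "(form x, sform x) \<in> {(a, b). Acyc a b \<in> U}" by (auto simp: open_acyc_def)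
    then obtain A B where AB: "open A" "open B" "form x \<in> A" "sform x \<in> B" "A \<times> B \<subseteq> {(a, b). Acyc a b \<in> U}"
      by (elim open_prod_elim) auto
    obtain p where p: "cont_seminorm p" "\<And>y. p (y - form x) < 1 \<Longrightarrow> y \<in> A"
      using AB(1,3) unfolding open_iff_cont_seminorm by blast
    obtain q where q: "cont_seminorm q" "\<And>y. q (y - sform x) < 1 \<Longrightarrow> y \<in> B"
      using AB(2,4) unfolding open_iff_cont_seminorm by blast
    have "y \<in> U" if "p (form y - form x) < 1" "q (sform y - sform x) < 1" for y
      using p(2)[OF that(1)] q(2)[OF that(2)] AB(5) by (cases y) auto
    then show "\<exists>p. cont_seminorm p \<and> (\<forall>y. p (y - x) < 1 \<longrightarrow> y \<in> U)"
      using cont_seminorm_max[OF cont_seminorm_form[OF p(1)] cont_seminorm_sform[OF q(1)]]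
      by (intro exI[of _ "\<lambda>x. max (p (form x)) (q (sform x))"]) auto
  next
    assume *: "\<forall>x\<in>U. \<exists>p. cont_seminorm p \<and> (\<forall>y. p (y - x) < 1 \<longrightarrow> y \<in> U)"
    show "open U"
      unfolding open_acyc_def open_prod_def
    proof (clarify)
      fix a b assume "Acyc a b \<in> U"
      with * obtain p where p: "cont_seminorm p" "\<And>y. p (y - Acyc a b) < 1 \<Longrightarrow> y \<in> U" by blast
      have sp: "seminorm p" using p(1) by (rule cont_seminorm_seminorm)
      let ?A = "{y. p (Acyc (y - a) 0) < 1/2}" and ?B = "{y. p (Acyc 0 (y - b)) < 1/2}"
      have "open ?A" "open ?B"
        using open_seminorm_ball[OF cont_seminorm_Acyc(1)[OF p(1)], of "1/2"]
          open_seminorm_ball[OF cont_seminorm_Acyc(2)[OF p(1)], of "1/2"] by auto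
      moreover have "(a, b) \<in> ?A \<times> ?B"
        using seminorm_zero[OF sp] by (simp add: zero_acyc_def)
      moreover have "?A \<times> ?B \<subseteq> {(a, b). Acyc a b \<in> U}"
      proof safe
        fix y z assume "p (Acyc (y - a) 0) < 1/2" "p (Acyc 0 (z - b)) < 1/2"
        with seminorm_Acyc_le[OF sp, of "Acyc y z - Acyc a b"] show "Acyc y z \<in> U"
          by (intro p(2)) simp
      qed
      ultimately show "\<exists>A B. open A \<and> open B \<and> (a, b) \<in> A \<times> B \<and> A \<times> B \<subseteq> {(a, b). Acyc a b \<in> U}" by blast
    qed
  qed
  then show "open U \<longleftrightarrow> (\<forall>x\<in>U. \<exists>p. seminorm p \<and> (\<forall>z. (p \<longlongrightarrow> p z) (nhds z)) \<and> (\<forall>y. p (y - x) < 1 \<longrightarrow> y \<in> U))"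
    by (simp add: cont_seminorm_def continuous_on_UNIV_nhds conj_assoc)
qed

instantiation acyc :: (locally_convex_dga) locally_convex_dga
begin

definition one_acyc where "1 = Acyc 1 0"
definition times_acyc where
  "x * y = Acyc (form x * form y) (sform x * form y + sgn_grading (form x) * sform y)"
definition homog_acyc where "homog n = {x. form x \<in> homog n \<and> sform x \<in> homog (n + 1)}"
definition diff_acyc where "diff x = Acyc (diff (form x) - sform x) (- diff (sform x))"

instance
proof
  fix x y z :: "'a acyc" and r :: complex and n i j :: int
  note defs = one_acyc_def times_acyc_def homog_acyc_def diff_acyc_def acyc_eq_iff
  show "x * y * z = x * (y * z)" "(x + y) * z = x * z + y * z" "x * (y + z) = x * y + x * z"
    by (simp_all add: defs algebra_simps sgn_grading_mult sgn_grading_add)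
  show "1 * x = x" "x * 1 = x" by (simp_all add: defs)
  show "(r *\<^sub>C x) * y = r *\<^sub>C (x * y)" "x * (r *\<^sub>C y) = r *\<^sub>C (x * y)"
    by (simp_all add: defs mult_scaleC_left mult_scaleC_right scaleC_add_right sgn_grading_scaleC)
  have "filterlim (\<lambda>w. fst w * snd w) (nhds (x * y)) (nhds x \<times>\<^sub>F nhds y)"
    unfolding times_acyc_def
    by (intro tendsto_Acyc tendsto_mult_dga tendsto_add tendsto_sgn_grading' tendsto_form tendsto_sform
         filterlim_fst filterlim_snd)
  then show "filterlim (\<lambda>(v, w). v * w) (nhds (x * y)) (nhds x \<times>\<^sub>F nhds y)"
    by (simp add: case_prod_unfold)
  show "(0 :: 'a acyc) \<in> homog n" by (simp add: homog_acyc_def homog_zero)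
  show "x + y \<in> homog n" if "x \<in> homog n" "y \<in> homog n"
    using that by (simp add: homog_acyc_def homog_add)
  show "r *\<^sub>C x \<in> homog n" if "x \<in> homog n"
    using that by (simp add: homog_acyc_def homog_scaleC)
  show "(1 :: 'a acyc) \<in> homog 0" by (simp add: defs homog_one homog_zero)
  show "x * y \<in> homog (i + j)" if "x \<in> homog i" "y \<in> homog j"
    using that homog_mult[of "form x" i "form y" j] homog_mult[of "sform x" "i + 1" "form y" j]
      homog_mult[of "form x" i "sform y" "j + 1"]
    by (auto simp: defs sgn_grading_homog mult_scaleC_left algebra_simps intro!: homog_add homog_scaleC)
  show "diff (x + y) = diff x + diff y" "diff (r *\<^sub>C x) = r *\<^sub>C diff x" "diff (diff x) = 0"
    by (simp_all add: defs diff_add diff_scaleC diff_minus diff_uminus diff_diff complex_vector.scale_right_diff_distrib)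
  show "diff x \<in> homog (n + 1)" if "x \<in> homog n"
    using that diff_homog[of "sform x" "n + 1"]
    by (auto simp: defs intro!: homog_diff homog_uminus diff_homog)
  show "diff (x * y) = diff x * y + (-1) powi n *\<^sub>C (x * diff y)" if "x \<in> homog n"
  proof -
    have gx: "(-1) powi n *\<^sub>C form x = sgn_grading (form x)" "(-1) powi n *\<^sub>C sform x = - sgn_grading (sform x)"
      using that sgn_grading_homog[of "form x" n] sgn_grading_homog[of "sform x" "n + 1"]
      by (simp_all add: homog_acyc_def power_int_add)
    then have gg: "(-1) powi n *\<^sub>C sgn_grading (form x) = form x"
      by (metis sgn_grading_scaleC sgn_grading_sgn_grading)
    have gs: "(-1) powi n *\<^sub>C (x * diff y) =
      Acyc (sgn_grading (form x) * (diff (form y) - sform y))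
        (- (sgn_grading (sform x) * (diff (form y) - sform y)) - form x * diff (sform y))"
      by (simp add: diff_acyc_def times_acyc_def scaleC_acyc_def complex_vector.scale_right_diff_distrib mult_scaleC_left[symmetric] gx gg)
    have d: "diff (sgn_grading (form x)) = - sgn_grading (diff (form x))" by (rule diff_sgn_grading)
    show ?thesis unfolding gs
      by (simp add: defs diff_mult_general sgn_grading_sgn_grading diff_add diff_minus d algebra_simps sgn_grading_add sgn_grading_diff)
  qed
  show "(diff \<longlongrightarrow> diff x) (nhds x)"
    unfolding diff_acyc_def
    by (intro tendsto_Acyc tendsto_diff tendsto_diff_op tendsto_minus tendsto_form tendsto_sform filterlim_ident)
  show "\<exists>!c. finite {n. c n \<noteq> 0} \<and> (\<forall>n. c n \<in> homog n) \<and> x = (\<Sum>n | c n \<noteq> 0. c n)"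
  proof (rule ex1I)
    define c where "c n = Acyc (hcomp n (form x)) (hcomp (n + 1) (sform x))" for n
    have sub: "{n. c n \<noteq> 0} \<subseteq> {n. hcomp n (form x) \<noteq> 0} \<union> (\<lambda>n. n - 1) ` {n. hcomp n (sform x) \<noteq> 0}" (is "_ \<subseteq> ?A")
      by (auto simp: c_def acyc_eq_iff image_iff) (metis add_diff_cancel_right')+
    have fin: "finite ?A" by (simp add: finite_hcomp)
    then have fin': "finite {n. c n \<noteq> 0}" by (rule finite_subset[OF sub])
    have "(\<Sum>n | c n \<noteq> 0. c n) = (\<Sum>n\<in>?A. c n)"
      by (rule sum.mono_neutral_left[OF fin sub]) auto
    also have "\<dots> = x"
    proof -
      have "(\<Sum>n\<in>?A. hcomp n (form x)) = form x" by (rule sum_hcomp_superset[OF fin]) auto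
      moreover have "(\<Sum>n\<in>?A. hcomp (n + 1) (sform x)) = (\<Sum>n\<in>(\<lambda>n. n + 1) ` ?A. hcomp n (sform x))"
        by (subst sum.reindex) (auto simp: inj_on_def)
      moreover have "\<dots> = sform x"
        by (rule sum_hcomp_superset) (use fin in \<open>auto simp: image_Un image_image\<close>)
      ultimately show ?thesis by (simp add: acyc_eq_iff form_sum sform_sum c_def)
    qed
    finally show "finite {n. c n \<noteq> 0} \<and> (\<forall>n. c n \<in> homog n) \<and> x = (\<Sum>n | c n \<noteq> 0. c n)"
      using fin' by (simp add: homog_acyc_def c_def hcomp_homog)
    fix c' assume c': "finite {n. c' n \<noteq> 0} \<and> (\<forall>n. c' n \<in> homog n) \<and> x = (\<Sum>n | c' n \<noteq> 0. c' n)"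
    show "c' = c"
    proof
      fix n
      have "hcomp n (form x) = (if n \<in> {n. c' n \<noteq> 0} then form (c' n) else 0)"
        by (rule hcomp_unique) (use c' in \<open>auto simp: homog_acyc_def form_sum[symmetric]\<close>)
      moreover have "hcomp (n + 1) (sform x) = (if n + 1 \<in> (\<lambda>n. n + 1) ` {n. c' n \<noteq> 0} then sform (c' (n + 1 - 1)) else 0)"
        by (rule hcomp_unique)
           (use c' in \<open>auto simp: homog_acyc_def sform_sum[symmetric] sum.reindex inj_on_def\<close>)
      ultimately show "c' n = c n"
        by (auto simp: c_def acyc_eq_iff split: if_splits)
    qed
  qed
next
  fix p :: "'a acyc \<Rightarrow> real" and z
  assume p: "seminorm p" and c: "\<And>n x. x \<in> homog n \<Longrightarrow> (p \<longlongrightarrow> p x) (at x within homog n)"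
  have c': "continuous_on (homog n) p" for n by (simp add: continuous_on_def c)
  have "cont_seminorm (\<lambda>a. p (Acyc a 0))"
  proof (rule cont_seminorm_homogI)
    show "seminorm (\<lambda>a. p (Acyc a 0))"
      using seminorm_add[OF p, of "Acyc _ 0" "Acyc _ 0"] seminorm_scaleC[OF p, of _ "Acyc _ 0"]
      by (simp add: seminorm_def plus_acyc_def scaleC_acyc_def)
    fix n
    show "continuous_on (homog n) (\<lambda>a. p (Acyc a 0))"
      by (rule continuous_on_compose2[OF c'[of n]])
         (auto simp: homog_acyc_def homog_zero continuous_on_def intro!: tendsto_Acyc tendsto_const tendsto_ident_at)
  qed
  moreover have "cont_seminorm (\<lambda>b. p (Acyc 0 b))"
  proof (rule cont_seminorm_homogI)
    show "seminorm (\<lambda>a. p (Acyc 0 a))"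
      using seminorm_add[OF p, of "Acyc 0 _" "Acyc 0 _"] seminorm_scaleC[OF p, of _ "Acyc 0 _"]
      by (simp add: seminorm_def plus_acyc_def scaleC_acyc_def)
    fix n :: int
    show "continuous_on (homog n) (\<lambda>b. p (Acyc 0 b))"
      by (rule continuous_on_compose2[OF c'[of "n - 1"]])
         (auto simp: homog_acyc_def homog_zero continuous_on_def intro!: tendsto_Acyc tendsto_const tendsto_ident_at)
  qed
  ultimately have "cont_seminorm p" by (rule cont_seminorm_AcycI[OF p])
  then show "(p \<longlongrightarrow> p z) (nhds z)" by (simp add: cont_seminorm_def continuous_on_UNIV_nhds)
qed

end

text \<open>The Hausdorff completion of a uniform space, as Cauchy filters modulo equivalence. The type \<open>'a completion\<close>
  is shown to be Hausdorff and complete, with \<open>to_completion\<close> of dense range and inducing the given uniformity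
  (\<open>closure_range_to_completion\<close>, \<open>eventually_to_completion_iff\<close>).\<close>

definition cauchy_equiv :: "'a::uniform_space filter \<Rightarrow> 'a filter \<Rightarrow> bool" where
  "cauchy_equiv F G \<longleftrightarrow> F \<noteq> bot \<and> G \<noteq> bot \<and> F \<times>\<^sub>F G \<le> uniformity"

lemma cauchy_equiv_sym: "cauchy_equiv F G \<Longrightarrow> cauchy_equiv G F"
  unfolding cauchy_equiv_def
proof safe
  assume "F \<times>\<^sub>F G \<le> uniformity"
  then have "filtermap prod.swap (F \<times>\<^sub>F G) \<le> filtermap prod.swap uniformity" by (rule filtermap_mono)
  moreover have "filtermap prod.swap (uniformity :: ('a \<times> 'a) filter) \<le> uniformity"
    using uniformity_sym by (auto simp: le_filter_def eventually_filtermap case_prod_unfold prod.swap_def)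
  ultimately show "G \<times>\<^sub>F F \<le> uniformity"
    by (subst prod_filter_commute) simp
qed

lemma prod_le_uniformityD:
  assumes "F \<times>\<^sub>F G \<le> uniformity" "eventually E uniformity"
  obtains P Q where "eventually P F" "eventually Q G" "\<And>x y. P x \<Longrightarrow> Q y \<Longrightarrow> E (x, y)"
  using assms unfolding le_filter_def eventually_prod_filter by blast

lemma cauchy_equiv_trans:
  assumes "cauchy_equiv F G" "cauchy_equiv G H"
  shows "cauchy_equiv F H"
  unfolding cauchy_equiv_def
proof safe
  show "F = bot \<Longrightarrow> False" "H = bot \<Longrightarrow> False" using assms by (auto simp: cauchy_equiv_def)
  show "F \<times>\<^sub>F H \<le> uniformity"
  proof (rule filter_leI)
    fix E :: "'a \<times> 'a \<Rightarrow> bool" assume "eventually E uniformity"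
    then obtain D where D: "eventually D uniformity" "\<And>x y z. D (x, y) \<Longrightarrow> D (y, z) \<Longrightarrow> E (x, z)"
      by (rule uniformity_transE) blast
    obtain P Q where PQ: "eventually P F" "eventually Q G" "\<And>x y. P x \<Longrightarrow> Q y \<Longrightarrow> D (x, y)"
      using prod_le_uniformityD assms(1) D(1) unfolding cauchy_equiv_def by metis
    obtain Q' R where QR: "eventually Q' G" "eventually R H" "\<And>x y. Q' x \<Longrightarrow> R y \<Longrightarrow> D (x, y)"
      using prod_le_uniformityD assms(2) D(1) unfolding cauchy_equiv_def by metis
    have "eventually (\<lambda>x. Q x \<and> Q' x) G" "G \<noteq> bot"
      using PQ(2) QR(1) assms by (auto intro: eventually_conj simp: cauchy_equiv_def)
    then obtain y where "Q y" "Q' y" using eventually_happens by blast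
    then show "eventually E (F \<times>\<^sub>F H)"
      unfolding eventually_prod_filter using PQ QR D(2) by blast
  qed
qed

lemma cauchy_equiv_nhds: "cauchy_equiv (nhds x) (nhds x)"
  using nhds_imp_cauchy_filter[of "nhds x" x] by (simp add: cauchy_equiv_def cauchy_filter_def)

lemma cauchy_equiv_refl_iff: "cauchy_equiv F F \<longleftrightarrow> F \<noteq> bot \<and> cauchy_filter F"
  by (simp add: cauchy_equiv_def cauchy_filter_def)

quotient_type (overloaded) 'a completion = "'a::uniform_space filter" / partial: cauchy_equiv
  by (rule part_equivpI) (auto intro!: sympI transpI cauchy_equiv_nhds intro: cauchy_equiv_sym cauchy_equiv_trans)

definition to_completion :: "'a::uniform_space \<Rightarrow> 'a completion" where
  "to_completion x = abs_completion (nhds x)"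

definition completion_entourage :: "('a::uniform_space \<times> 'a \<Rightarrow> bool) \<Rightarrow> 'a completion \<times> 'a completion \<Rightarrow> bool" where
  "completion_entourage E = (\<lambda>(x, y). \<exists>F G. cauchy_equiv F F \<and> cauchy_equiv G G \<and>
      x = abs_completion F \<and> y = abs_completion G \<and> eventually E (F \<times>\<^sub>F G))"

lemma completion_entourageI:
  "cauchy_equiv F F \<Longrightarrow> cauchy_equiv G G \<Longrightarrow> eventually E (F \<times>\<^sub>F G) \<Longrightarrow>
    completion_entourage E (abs_completion F, abs_completion G)"
  unfolding completion_entourage_def by blast

lemma completion_cases:
  obtains F where "cauchy_equiv F F" "x = abs_completion F"
  by (rule that[of "rep_completion x"])
     (simp_all add: Quotient3_rel_rep[OF Quotient3_completion] Quotient3_abs_rep[OF Quotient3_completion])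

lemma abs_completion_eq: "cauchy_equiv F F \<Longrightarrow> cauchy_equiv G G \<Longrightarrow> abs_completion F = abs_completion G \<longleftrightarrow> cauchy_equiv F G"
  using Quotient3_rel[OF Quotient3_completion, of F G] by blast

lemma completion_entourage_mono:
  "(\<And>z. E z \<Longrightarrow> E' z) \<Longrightarrow> completion_entourage E w \<Longrightarrow> completion_entourage E' w"
proof -
  assume "\<And>z. E z \<Longrightarrow> E' z" "completion_entourage E w"
  then obtain F G where "cauchy_equiv F F" "cauchy_equiv G G" "w = (abs_completion F, abs_completion G)"
    "eventually E (F \<times>\<^sub>F G)" "\<And>z. E z \<Longrightarrow> E' z"
    unfolding completion_entourage_def by auto
  moreover from this have "eventually E' (F \<times>\<^sub>F G)" by (metis (mono_tags, lifting) eventually_mono)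
  ultimately show ?thesis by (simp add: completion_entourageI)
qed

instantiation completion :: (uniform_space) uniform_space
begin

definition uniformity_completion :: "('a completion \<times> 'a completion) filter" where
  "uniformity_completion = (INF E\<in>{E. eventually E uniformity}. principal (Collect (completion_entourage E)))"

definition open_completion :: "'a completion set \<Rightarrow> bool" where
  "open_completion U \<longleftrightarrow> (\<forall>x\<in>U. eventually (\<lambda>(x', y). x' = x \<longrightarrow> y \<in> U) uniformity)"

lemma eventually_uniformity_completion:
  "eventually P (uniformity :: ('a completion \<times> 'a completion) filter) \<longleftrightarrow>
    (\<exists>E. eventually E uniformity \<and> (\<forall>w. completion_entourage E w \<longrightarrow> P w))"
  unfolding uniformity_completion_def
proof (subst eventually_INF_base)
  show "{E. eventually E (uniformity :: ('a \<times> 'a) filter)} \<noteq> {}"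
    using eventually_True by blast
  fix E D assume "E \<in> {E. eventually E (uniformity :: ('a \<times> 'a) filter)}" "D \<in> {E. eventually E (uniformity :: ('a \<times> 'a) filter)}"
  then show "\<exists>x\<in>{E. eventually E uniformity}.
      principal (Collect (completion_entourage x))
      \<le> inf (principal (Collect (completion_entourage E))) (principal (Collect (completion_entourage D)))"
    by (intro bexI[of _ "\<lambda>z. E z \<and> D z"])
       (auto intro: completion_entourage_mono[rotated] eventually_conj)
qed (auto simp: eventually_principal)

instance
proof
  show "open U \<longleftrightarrow> (\<forall>x\<in>U. eventually (\<lambda>(x', y). x' = x \<longrightarrow> y \<in> U) uniformity)" for U :: "'a completion set"
    by (rule open_completion_def)
  fix P :: "'a completion \<times> 'a completion \<Rightarrow> bool" and x
  assume "eventually P uniformity"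
  then obtain E where E: "eventually E uniformity" "\<And>w. completion_entourage E w \<Longrightarrow> P w"
    unfolding eventually_uniformity_completion by blast
  show "P (x, x)"
  proof (rule E(2))
    obtain F where "cauchy_equiv F F" "x = abs_completion F" by (rule completion_cases)
    then show "completion_entourage E (x, x)"
      unfolding completion_entourage_def using E(1) by (auto simp: cauchy_equiv_def le_filter_def)
  qed
  show "\<forall>\<^sub>F (x, y) in uniformity. P (y, x)"
    unfolding eventually_uniformity_completion
  proof (intro exI conjI allI impI)
    show "\<forall>\<^sub>F (x, y) in uniformity. E (y, x)" by (rule uniformity_sym[OF E(1)])
    fix w assume "completion_entourage (\<lambda>(x, y). E (y, x)) w"
    then obtain F G where *: "cauchy_equiv F F" "cauchy_equiv G G" "w = (abs_completion F, abs_completion G)"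
      "\<forall>\<^sub>F (x, y) in F \<times>\<^sub>F G. E (y, x)"
      unfolding completion_entourage_def by auto
    from *(4) have "eventually E (G \<times>\<^sub>F F)"
      by (subst prod_filter_commute) (simp add: eventually_filtermap case_prod_unfold prod.swap_def)
    with *(1-3) show "case w of (x, y) \<Rightarrow> P (y, x)"
      by (auto intro!: E(2) completion_entourageI)
  qed
  obtain D1 where D1: "eventually D1 uniformity" "\<And>x y z. D1 (x, y) \<Longrightarrow> D1 (y, z) \<Longrightarrow> E (x, z)"
    using uniformity_transE[OF E(1)] by blast
  obtain D where D: "eventually D uniformity" "\<And>x y z. D (x, y) \<Longrightarrow> D (y, z) \<Longrightarrow> D1 (x, z)"
    using uniformity_transE[OF D1(1)] by blast
  have D_D1: "D (x, y) \<Longrightarrow> D1 (x, y)" for x y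
    using D(2)[of x x y] uniformity_refl[OF D(1)] by blast
  show "\<exists>D. eventually D uniformity \<and> (\<forall>x y z. D (x, y) \<longrightarrow> D (y, z) \<longrightarrow> P (x, z))"
  proof (intro exI conjI allI impI)
    show "eventually (completion_entourage D) uniformity"
      unfolding eventually_uniformity_completion using D(1) by blast
    fix x y z assume "completion_entourage D (x, y)" "completion_entourage D (y, z)"
    then obtain F G G' H where *: "cauchy_equiv F F" "cauchy_equiv G G" "cauchy_equiv G' G'" "cauchy_equiv H H"
      "x = abs_completion F" "y = abs_completion G" "y = abs_completion G'" "z = abs_completion H"
      "eventually D (F \<times>\<^sub>F G)" "eventually D (G' \<times>\<^sub>F H)"
      unfolding completion_entourage_def by auto
    then have "cauchy_equiv G G'" using abs_completion_eq by metis
    then obtain R S where RS: "eventually R G" "eventually S G'" "\<And>x y. R x \<Longrightarrow> S y \<Longrightarrow> D (x, y)"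
      using prod_le_uniformityD D(1) unfolding cauchy_equiv_def by metis
    obtain A B where AB: "eventually A F" "eventually B G" "\<And>x y. A x \<Longrightarrow> B y \<Longrightarrow> D (x, y)"
      using *(9) unfolding eventually_prod_filter by blast
    obtain B' C where BC: "eventually B' G'" "eventually C H" "\<And>x y. B' x \<Longrightarrow> C y \<Longrightarrow> D (x, y)"
      using *(10) unfolding eventually_prod_filter by blast
    have "eventually (\<lambda>x. B x \<and> R x) G" "eventually (\<lambda>x. B' x \<and> S x) G'" "G \<noteq> bot" "G' \<noteq> bot"
      using AB(2) RS(1,2) BC(1) * by (auto intro: eventually_conj simp: cauchy_equiv_def)
    then obtain b b' where "B b" "R b" "B' b'" "S b'"
      using eventually_happens[of _ G] eventually_happens[of _ G'] by blast
    then have "A a \<Longrightarrow> C c \<Longrightarrow> E (a, c)" for a c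
      using D1(2)[OF D(2)[OF AB(3)[of a b] RS(3)[of b b']] D_D1[OF BC(3)[of b' c]]] by blast
    then have "eventually E (F \<times>\<^sub>F H)" unfolding eventually_prod_filter using AB(1) BC(2) by blast
    with * show "P (x, z)" by (auto intro!: E(2) completion_entourageI)
  qed
qed

end

lemma completion_entourage_all:
  assumes "eventually E uniformity"
  obtains D where "eventually D uniformity"
    "\<And>F G. cauchy_equiv F F \<Longrightarrow> cauchy_equiv G G \<Longrightarrow> completion_entourage D (abs_completion F, abs_completion G)
        \<Longrightarrow> eventually E (F \<times>\<^sub>F G)"
proof -
  obtain D1 where D1: "eventually D1 uniformity" "\<And>x y z. D1 (x, y) \<Longrightarrow> D1 (y, z) \<Longrightarrow> E (x, z)"
    using uniformity_transE[OF assms] by blast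
  obtain D where D: "eventually D uniformity" "\<And>x y z. D (x, y) \<Longrightarrow> D (y, z) \<Longrightarrow> D1 (x, z)"
    using uniformity_transE[OF D1(1)] by blast
  have D_D1: "D (x, y) \<Longrightarrow> D1 (x, y)" for x y
    using D(2)[of x x y] uniformity_refl[OF D(1)] by blast
  show ?thesis
  proof (rule that[OF D(1)])
    fix F G assume FG: "cauchy_equiv F F" "cauchy_equiv G G" "completion_entourage D (abs_completion F, abs_completion G)"
    then obtain F' G' where *: "cauchy_equiv F' F'" "cauchy_equiv G' G'" "abs_completion F = abs_completion F'"
       "abs_completion G = abs_completion G'" "eventually D (F' \<times>\<^sub>F G')"
      unfolding completion_entourage_def by auto
    have "cauchy_equiv F F'" "cauchy_equiv G' G" using abs_completion_eq FG * by metis+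
    then have le: "F \<times>\<^sub>F F' \<le> uniformity" "G' \<times>\<^sub>F G \<le> uniformity" by (simp_all add: cauchy_equiv_def)
    obtain A A' where A: "eventually A F" "eventually A' F'" "\<And>x y. A x \<Longrightarrow> A' y \<Longrightarrow> D (x, y)"
      by (rule prod_le_uniformityD[OF le(1) D(1)]) blast
    obtain B B' where B: "eventually B' G'" "eventually B G" "\<And>x y. B' x \<Longrightarrow> B y \<Longrightarrow> D (x, y)"
      by (rule prod_le_uniformityD[OF le(2) D(1)]) blast
    obtain R S where RS: "eventually R F'" "eventually S G'" "\<And>x y. R x \<Longrightarrow> S y \<Longrightarrow> D (x, y)"
      using *(5) unfolding eventually_prod_filter by blast
    have "eventually (\<lambda>x. A' x \<and> R x) F'" "eventually (\<lambda>x. S x \<and> B' x) G'" "F' \<noteq> bot" "G' \<noteq> bot"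
      using A(2) RS(1,2) B(1) * by (auto intro: eventually_conj simp: cauchy_equiv_def)
    then obtain a b where "A' a" "R a" "S b" "B' b"
      using eventually_happens[of _ F'] eventually_happens[of _ G'] by blast
    then have "A x \<Longrightarrow> B y \<Longrightarrow> E (x, y)" for x y
      using D1(2)[OF D(2)[OF A(3)[of x a] RS(3)[of a b]] D_D1[OF B(3)[of b y]]] by blast
    then show "eventually E (F \<times>\<^sub>F G)" unfolding eventually_prod_filter using A(1) B(2) by blast
  qed
qed

lemma cauchy_equiv_iff_entourages:
  assumes "cauchy_equiv F F" "cauchy_equiv G G"
  shows "cauchy_equiv F G \<longleftrightarrow> (\<forall>P. eventually P uniformity \<longrightarrow> P (abs_completion F, abs_completion G))"
proof
  assume "cauchy_equiv F G"
  then have "abs_completion F = abs_completion G" using abs_completion_eq assms by blast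
  then show "\<forall>P. eventually P uniformity \<longrightarrow> P (abs_completion F, abs_completion G)"
    using uniformity_refl by auto
next
  assume *: "\<forall>P. eventually P uniformity \<longrightarrow> P (abs_completion F, abs_completion G)"
  have "F \<times>\<^sub>F G \<le> uniformity"
  proof (rule filter_leI)
    fix E :: "'a \<times> 'a \<Rightarrow> bool" assume "eventually E uniformity"
    then obtain D where D: "eventually D uniformity"
      "completion_entourage D (abs_completion F, abs_completion G) \<Longrightarrow> eventually E (F \<times>\<^sub>F G)"
      using completion_entourage_all assms by metis
    have "eventually (completion_entourage D) uniformity"
      unfolding eventually_uniformity_completion using D(1) by blast
    then show "eventually E (F \<times>\<^sub>F G)" using * D(2) by blast
  qed
  then show "cauchy_equiv F G" using assms by (simp add: cauchy_equiv_def)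
qed

instance completion :: (uniform_space) t2_space
proof
  fix x y :: "'a completion" assume "x \<noteq> y"
  obtain F where F: "cauchy_equiv F F" "x = abs_completion F" by (rule completion_cases)
  obtain G where G: "cauchy_equiv G G" "y = abs_completion G" by (rule completion_cases)
  note FG = F G
  with \<open>x \<noteq> y\<close> have "\<not> cauchy_equiv F G" using abs_completion_eq by blast
  then obtain P where P: "eventually P uniformity" "\<not> P (x, y)"
    using cauchy_equiv_iff_entourages FG by blast
  obtain D where D: "eventually D uniformity" "\<And>x y z. D (x, y) \<Longrightarrow> D (y, z) \<Longrightarrow> P (x, z)"
    using uniformity_transE[OF P(1)] by blast
  have "eventually (\<lambda>z. D (x, z)) (nhds x)" "eventually (\<lambda>z. D (z, y)) (nhds y)"
    unfolding eventually_nhds_uniformity using D(1) uniformity_sym[OF D(1)]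
    by (auto elim: eventually_mono)
  then obtain U V where "open U" "x \<in> U" "\<forall>z\<in>U. D (x, z)" "open V" "y \<in> V" "\<forall>z\<in>V. D (z, y)"
    unfolding eventually_nhds by blast
  moreover from this have "U \<inter> V = {}" using D(2)[of x _ y] P(2) by auto
  ultimately show "\<exists>U V. open U \<and> open V \<and> x \<in> U \<and> y \<in> V \<and> U \<inter> V = {}" by blast
qed

lemma tendsto_to_completion:
  assumes "cauchy_equiv F F"
  shows "(to_completion \<longlongrightarrow> abs_completion F) F"
  unfolding filterlim_def le_filter_def
proof (intro allI impI)
  fix P assume "eventually P (nhds (abs_completion F))"
  then obtain E where E: "eventually E uniformity"
    "\<And>x y. completion_entourage E (x, y) \<Longrightarrow> x = abs_completion F \<Longrightarrow> P y"
    unfolding eventually_nhds_uniformity eventually_uniformity_completion by auto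
  obtain D where D: "eventually D uniformity" "\<And>x y z. D (x, y) \<Longrightarrow> D (y, z) \<Longrightarrow> E (x, z)"
    using uniformity_transE[OF E(1)] by blast
  obtain A B where AB: "eventually A F" "eventually B F" "\<And>x y. A x \<Longrightarrow> B y \<Longrightarrow> D (x, y)"
    using prod_le_uniformityD assms D(1) unfolding cauchy_equiv_def by metis
  have "P (to_completion y)" if "B y" for y
  proof (rule E(2)[OF _ refl])
    have "eventually (\<lambda>z. D (y, z)) (nhds y)"
      unfolding eventually_nhds_uniformity using D(1) by (auto elim: eventually_mono)
    moreover have "A x \<Longrightarrow> D (y, z) \<Longrightarrow> E (x, z)" for x z using D(2) AB(3) that by blast
    ultimately have "eventually E (F \<times>\<^sub>F nhds y)"
      unfolding eventually_prod_filter using AB(1) by blast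
    then show "completion_entourage E (abs_completion F, to_completion y)"
      unfolding completion_entourage_def to_completion_def using assms cauchy_equiv_nhds by blast
  qed
  then show "eventually P (filtermap to_completion F)"
    unfolding eventually_filtermap using AB(2) by (auto elim: eventually_mono)
qed

lemma closure_range_to_completion: "closure (range to_completion) = UNIV"
proof -
  have "x \<in> closure (range to_completion)" for x :: "'a completion"
  proof -
    obtain F where F: "cauchy_equiv F F" "x = abs_completion F" by (rule completion_cases)
    have "\<forall>\<^sub>F y in F. to_completion y \<in> closure (range to_completion)"
      using closure_subset[of "range to_completion"] by (intro always_eventually) auto
    with F show ?thesis
      using Lim_in_closed_set[OF closed_closure _ _ tendsto_to_completion[OF F(1)]] by (auto simp: cauchy_equiv_def)
  qed
  then show ?thesis by auto
qed

lemma eventually_to_completion_iff: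
  "eventually E uniformity \<longleftrightarrow> (\<exists>P. eventually P uniformity \<and> (\<forall>x y. P (to_completion x, to_completion y) \<longrightarrow> E (x, y)))"
proof
  assume E: "eventually E uniformity"
  obtain D where D: "eventually D uniformity"
    "\<And>F G. cauchy_equiv F F \<Longrightarrow> cauchy_equiv G G \<Longrightarrow> completion_entourage D (abs_completion F, abs_completion G)
        \<Longrightarrow> eventually E (F \<times>\<^sub>F G)"
    using completion_entourage_all[OF E] by metis
  have "eventually (completion_entourage D) uniformity"
    unfolding eventually_uniformity_completion using D(1) by blast
  moreover have "E (x, y)" if "completion_entourage D (to_completion x, to_completion y)" for x y
    using D(2)[OF cauchy_equiv_nhds cauchy_equiv_nhds that[unfolded to_completion_def]]
    unfolding eventually_prod_filter by (auto dest!: eventually_nhds_x_imp_x)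
  ultimately show "\<exists>P. eventually P uniformity \<and> (\<forall>x y. P (to_completion x, to_completion y) \<longrightarrow> E (x, y))" by blast
next
  assume "\<exists>P. eventually P uniformity \<and> (\<forall>x y. P (to_completion x, to_completion y) \<longrightarrow> E (x, y))"
  then obtain D where D: "eventually D uniformity" "\<And>x y. completion_entourage D (to_completion x, to_completion y) \<Longrightarrow> E (x, y)"
    unfolding eventually_uniformity_completion by blast
  obtain D1 where D1: "eventually D1 uniformity" "\<And>x y z. D1 (x, y) \<Longrightarrow> D1 (y, z) \<Longrightarrow> D (x, z)"
    using uniformity_transE[OF D(1)] by blast
  obtain D2 where D2: "eventually D2 uniformity" "\<And>x y z. D2 (x, y) \<Longrightarrow> D2 (y, z) \<Longrightarrow> D1 (x, z)"
    using uniformity_transE[OF D1(1)] by blast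
  have 12: "D2 (x, y) \<Longrightarrow> D1 (x, y)" for x y
    using D2(2)[of x x y] uniformity_refl[OF D2(1)] by blast
  show "eventually E uniformity"
  proof (rule eventually_mono[OF D2(1)])
    fix w assume w: "D2 w"
    obtain x y where [simp]: "w = (x, y)" by (cases w)
    have "eventually (\<lambda>z. D2 (z, x)) (nhds x)" "eventually (\<lambda>z. D2 (y, z)) (nhds y)"
      unfolding eventually_nhds_uniformity using D2(1) uniformity_sym[OF D2(1)]
      by (auto elim: eventually_mono)
    moreover have "D2 (a, x) \<Longrightarrow> D2 (y, b) \<Longrightarrow> D (a, b)" for a b
      using w D1(2)[OF D2(2)[of a x y] 12[of y b]] by simp
    ultimately have "eventually D (nhds x \<times>\<^sub>F nhds y)" unfolding eventually_prod_filter by blast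
    then show "E w"
      by (auto intro!: D(2) completion_entourageI cauchy_equiv_nhds simp: to_completion_def)
  qed
qed

lemma to_completion_dense:
  assumes "eventually P uniformity"
  shows "\<exists>a. P (to_completion a, y)"
proof -
  obtain F where F: "cauchy_equiv F F" "y = abs_completion F" by (rule completion_cases)
  have "eventually (\<lambda>z. P (z, y)) (nhds y)"
    unfolding eventually_nhds_uniformity using uniformity_sym[OF assms] by (auto elim: eventually_mono)
  then have "eventually (\<lambda>a. P (to_completion a, y)) F"
    using tendsto_to_completion[OF F(1)] F(2) unfolding filterlim_iff by blast
  moreover have "F \<noteq> bot" using F(1) by (simp add: cauchy_equiv_def)
  ultimately show ?thesis using eventually_happens by blast
qed

instance completion :: (uniform_space) complete_uniform_space
proof
  fix \<F> :: "'a completion filter"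
  assume cauchy: "cauchy_filter \<F>" and nb: "\<F> \<noteq> bot"
  define ev where "ev Q \<longleftrightarrow> (\<exists>P S. eventually P uniformity \<and> eventually S \<F> \<and>
     (\<forall>a y. S y \<longrightarrow> P (to_completion a, y) \<longrightarrow> Q a))" for Q :: "'a \<Rightarrow> bool"
  have "is_filter ev"
  proof (unfold_locales)
    show "ev (\<lambda>x. True)" unfolding ev_def by (intro exI[of _ "\<lambda>_. True"]) simp
    fix Q R assume "ev Q" "ev R"
    then obtain P S P' S' where "eventually P uniformity" "eventually S \<F>" "\<And>a y. S y \<Longrightarrow> P (to_completion a, y) \<Longrightarrow> Q a"
      "eventually P' uniformity" "eventually S' \<F>" "\<And>a y. S' y \<Longrightarrow> P' (to_completion a, y) \<Longrightarrow> R a"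
      unfolding ev_def by blast
    then show "ev (\<lambda>x. Q x \<and> R x)"
      unfolding ev_def
      by (intro exI[of _ "\<lambda>w. P w \<and> P' w"] exI[of _ "\<lambda>w. S w \<and> S' w"]) (auto intro: eventually_conj)
  next
    fix Q R :: "'a \<Rightarrow> bool" assume "\<forall>x. Q x \<longrightarrow> R x" "ev Q"
    then show "ev R" unfolding ev_def by blast
  qed
  define F where "F = Abs_filter ev"
  have evF: "eventually Q F \<longleftrightarrow> ev Q" for Q
    unfolding F_def by (rule eventually_Abs_filter) fact
  have "F \<noteq> bot"
  proof
    assume "F = bot"
    then have "ev (\<lambda>_. False)" unfolding evF[symmetric] by simp
    then obtain P S where PS: "eventually P uniformity" "eventually S \<F>" "\<And>a y. S y \<Longrightarrow> \<not> P (to_completion a, y)"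
      unfolding ev_def by blast
    obtain y where "S y" using eventually_happens[OF PS(2)] nb by blast
    with PS(3) to_completion_dense[OF PS(1)] show False by blast
  qed
  have "F \<times>\<^sub>F F \<le> uniformity"
  proof (rule filter_leI)
    fix E :: "'a \<times> 'a \<Rightarrow> bool" assume "eventually E uniformity"
    then obtain P where P: "eventually P uniformity" "\<And>x y. P (to_completion x, to_completion y) \<Longrightarrow> E (x, y)"
      using eventually_to_completion_iff[of E] by blast
    obtain D1 where D1: "eventually D1 uniformity" "\<And>x y z. D1 (x, y) \<Longrightarrow> D1 (y, z) \<Longrightarrow> P (x, z)"
      using uniformity_transE[OF P(1)] by blast
    obtain D where D: "eventually D uniformity" "\<And>x y z. D (x, y) \<Longrightarrow> D (y, z) \<Longrightarrow> D1 (x, z)"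
      using uniformity_transE[OF D1(1)] by blast
    have 1: "D (x, y) \<Longrightarrow> D1 (x, y)" for x y
      using D(2)[of x x y] uniformity_refl[OF D(1)] by blast
    obtain S where S: "eventually S \<F>" "\<And>y z. S y \<Longrightarrow> S z \<Longrightarrow> D (y, z)"
      using cauchy D(1) unfolding cauchy_filter_def le_filter_def eventually_prod_same by blast
    let ?Q = "\<lambda>a. \<exists>y. S y \<and> D (to_completion a, y) \<and> D (y, to_completion a)"
    have "eventually ?Q F"
      unfolding evF ev_def
      by (intro exI[of _ "\<lambda>(x, y). D (x, y) \<and> D (y, x)"] exI[of _ S])
         (use S(1) D(1) uniformity_sym[OF D(1)] in \<open>auto simp: case_prod_unfold intro: eventually_conj\<close>)
    moreover have "E (a, b)" if "?Q a" "?Q b" for a b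
      using that P(2) D1(2) D(2) 1 S(2) by meson
    ultimately show "eventually E (F \<times>\<^sub>F F)" unfolding eventually_prod_same by blast
  qed
  with \<open>F \<noteq> bot\<close> have F: "cauchy_equiv F F" by (simp add: cauchy_equiv_def)
  have "\<F> \<le> nhds (abs_completion F)"
  proof (rule filter_leI)
    fix P assume "eventually P (nhds (abs_completion F))"
    then have "eventually (\<lambda>(x', y). x' = abs_completion F \<longrightarrow> P y) uniformity"
      by (simp add: eventually_nhds_uniformity)
    then obtain D where D: "eventually D uniformity" "\<And>y z. D (abs_completion F, y) \<Longrightarrow> D (y, z) \<Longrightarrow> P z"
      by (rule uniformity_transE) auto
    have "eventually (\<lambda>z. D (abs_completion F, z)) (nhds (abs_completion F))"
      unfolding eventually_nhds_uniformity using D(1) by (auto elim: eventually_mono)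
    then have "eventually (\<lambda>a. D (abs_completion F, to_completion a)) F"
      using tendsto_to_completion[OF F] unfolding filterlim_iff by blast
    then obtain Q S where QS: "eventually Q uniformity" "eventually S \<F>"
      "\<And>a y. S y \<Longrightarrow> Q (to_completion a, y) \<Longrightarrow> D (abs_completion F, to_completion a)"
      unfolding evF ev_def by blast
    show "eventually P \<F>"
    proof (rule eventually_mono[OF QS(2)])
      fix y assume "S y"
      obtain a where "Q (to_completion a, y)" "D (to_completion a, y)"
        using to_completion_dense[OF eventually_conj[OF QS(1) D(1)]] by blast
      with \<open>S y\<close> QS(3) D(2) show "P y" by blast
    qed
  qed
  then show "convergent_filter \<F>" unfolding convergent_filter_iff by blast
qed

lemma cauchy_equiv_filtermap_plus:
  fixes F F' G G' :: "'a::uniform_topological_group_add filter"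
  assumes "cauchy_equiv F F'" "cauchy_equiv G G'"
  shows "cauchy_equiv (filtermap (\<lambda>(a, b). a + b) (F \<times>\<^sub>F G)) (filtermap (\<lambda>(a, b). a + b) (F' \<times>\<^sub>F G'))"
  unfolding cauchy_equiv_def
proof (intro conjI filter_leI)
  show "filtermap (\<lambda>(a, b). a + b) (F \<times>\<^sub>F G) \<noteq> bot" "filtermap (\<lambda>(a, b). a + b) (F' \<times>\<^sub>F G') \<noteq> bot"
    using assms by (auto simp: cauchy_equiv_def filtermap_bot_iff prod_filter_eq_bot)
  fix E :: "'a \<times> 'a \<Rightarrow> bool" assume "eventually E uniformity"
  with uniformly_continuous_add'[where 'a='a]
  have "eventually (\<lambda>((a, b), (c, d)). E (a + c, b + d)) (uniformity \<times>\<^sub>F uniformity)"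
    unfolding filterlim_iff case_prod_unfold by blast
  then obtain D where D: "eventually D uniformity" "\<And>a b c d. D (a, b) \<Longrightarrow> D (c, d) \<Longrightarrow> E (a + c, b + d)"
    unfolding eventually_prod_same by auto
  have le: "F \<times>\<^sub>F F' \<le> uniformity" "G \<times>\<^sub>F G' \<le> uniformity" using assms by (simp_all add: cauchy_equiv_def)
  obtain P Q where P: "eventually P F" "eventually Q F'" "\<And>x y. P x \<Longrightarrow> Q y \<Longrightarrow> D (x, y)"
    by (rule prod_le_uniformityD[OF le(1) D(1)]) blast
  obtain R S where R: "eventually R G" "eventually S G'" "\<And>x y. R x \<Longrightarrow> S y \<Longrightarrow> D (x, y)"
    by (rule prod_le_uniformityD[OF le(2) D(1)]) blast
  have "eventually (\<lambda>z. \<exists>a b. P a \<and> R b \<and> z = a + b) (filtermap (\<lambda>(a, b). a + b) (F \<times>\<^sub>F G))"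
    unfolding eventually_filtermap eventually_prod_filter using P(1) R(1) by auto
  moreover have "eventually (\<lambda>z. \<exists>a b. Q a \<and> S b \<and> z = a + b) (filtermap (\<lambda>(a, b). a + b) (F' \<times>\<^sub>F G'))"
    unfolding eventually_filtermap eventually_prod_filter using P(2) R(2) by auto
  ultimately show "eventually E (filtermap (\<lambda>(a, b). a + b) (F \<times>\<^sub>F G) \<times>\<^sub>F filtermap (\<lambda>(a, b). a + b) (F' \<times>\<^sub>F G'))"
    unfolding eventually_prod_filter using P(3) R(3) D(2) by blast
qed

lemma cauchy_equiv_filtermap_uminus:
  fixes F G :: "'a::uniform_topological_group_add filter"
  assumes "cauchy_equiv F G"
  shows "cauchy_equiv (filtermap uminus F) (filtermap uminus G)"
  unfolding cauchy_equiv_def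
proof (intro conjI filter_leI)
  show "filtermap uminus F \<noteq> bot" "filtermap uminus G \<noteq> bot"
    using assms by (auto simp: cauchy_equiv_def filtermap_bot_iff)
  fix E :: "'a \<times> 'a \<Rightarrow> bool" assume "eventually E uniformity"
  with uniformly_continuous_uminus'[where 'a='a]
  have D: "eventually (\<lambda>(a, b). E (- a, - b)) uniformity"
    unfolding filterlim_iff case_prod_unfold by blast
  have le: "F \<times>\<^sub>F G \<le> uniformity" using assms by (simp add: cauchy_equiv_def)
  obtain P Q where P: "eventually P F" "eventually Q G" "\<And>x y. P x \<Longrightarrow> Q y \<Longrightarrow> E (- x, - y)"
    by (rule prod_le_uniformityD[OF le D]) blast
  then have "eventually (\<lambda>x. P (- x)) (filtermap uminus F)" "eventually (\<lambda>x. Q (- x)) (filtermap uminus G)"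
    by (simp_all add: eventually_filtermap)
  then show "eventually E (filtermap uminus F \<times>\<^sub>F filtermap uminus G)"
    unfolding eventually_prod_filter using P(3) by (metis minus_minus)
qed

lemma cauchy_equiv_nhds_principal: "cauchy_equiv (nhds x) (principal {x})"
proof -
  have "principal {x} \<le> nhds x"
    by (rule filter_leI) (auto simp: eventually_principal dest: eventually_nhds_x_imp_x)
  then have "nhds x \<times>\<^sub>F principal {x} \<le> nhds x \<times>\<^sub>F nhds x"
    by (rule prod_filter_mono[OF order_refl])
  also have "\<dots> \<le> uniformity" using cauchy_equiv_nhds[of x] by (simp add: cauchy_equiv_def)
  finally show ?thesis by (simp add: cauchy_equiv_def principal_eq_bot_iff)
qed

lemma cauchy_equiv_principal: "cauchy_equiv (principal {x}) (principal {x})"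
  using cauchy_equiv_nhds_principal cauchy_equiv_sym cauchy_equiv_trans by metis

lemma to_completion_principal: "to_completion x = abs_completion (principal {x})"
  unfolding to_completion_def
  by (simp add: abs_completion_eq cauchy_equiv_nhds cauchy_equiv_principal cauchy_equiv_nhds_principal)

instantiation completion :: ("{uniform_topological_group_add, ab_group_add}") ab_group_add
begin

lift_definition zero_completion :: "'a completion" is "principal {0}" by (rule cauchy_equiv_principal)

lift_definition plus_completion :: "'a completion \<Rightarrow> 'a completion \<Rightarrow> 'a completion"
  is "\<lambda>F G. filtermap (\<lambda>(a, b). a + b) (F \<times>\<^sub>F G)" by (rule cauchy_equiv_filtermap_plus)

lift_definition uminus_completion :: "'a completion \<Rightarrow> 'a completion"
  is "filtermap uminus" by (rule cauchy_equiv_filtermap_uminus)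

definition minus_completion :: "'a completion \<Rightarrow> 'a completion \<Rightarrow> 'a completion" where
  "minus_completion x y = x + (- y)"

lemma abs_completion_add:
  "cauchy_equiv F F \<Longrightarrow> cauchy_equiv G G \<Longrightarrow>
    abs_completion F + abs_completion G = abs_completion (filtermap (\<lambda>(a, b). a + b) (F \<times>\<^sub>F G))"
  by (rule plus_completion.abs_eq)

instance
proof
  fix x y z :: "'a completion"
  obtain F where F: "cauchy_equiv F F" "x = abs_completion F" by (rule completion_cases)
  obtain G where G: "cauchy_equiv G G" "y = abs_completion G" by (rule completion_cases)
  obtain H where H: "cauchy_equiv H H" "z = abs_completion H" by (rule completion_cases)
  note r = cauchy_equiv_filtermap_plus[unfolded case_prod_unfold] cauchy_equiv_principal cauchy_equiv_filtermap_uminus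
  note p = plus_completion.abs_eq[unfolded case_prod_unfold]
  show "x + y + z = x + (y + z)"
    by (simp add: F G H p r prod_filtermap1 prod_filtermap2 prod_filter_assoc filtermap_filtermap
        case_prod_unfold add.assoc)
  show "x + y = y + x"
    unfolding F G p[OF F(1) G(1)] p[OF G(1) F(1)] prod_filter_commute[of G F]
    by (simp add: filtermap_filtermap add.commute)
  show "0 + x = x"
    by (simp add: F zero_completion_def p r prod_filter_principal_singleton filtermap_filtermap)
  show "x - y = x + - y" by (rule minus_completion_def)
  have "cauchy_equiv (filtermap (\<lambda>(a, b). a + b) (filtermap uminus F \<times>\<^sub>F F)) (principal {0})"
    unfolding cauchy_equiv_def
  proof (intro conjI filter_leI)
    show "filtermap (\<lambda>(a, b). a + b) (filtermap uminus F \<times>\<^sub>F F) \<noteq> bot" "principal {0 :: 'a} \<noteq> bot"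
      using F(1) by (auto simp: cauchy_equiv_def filtermap_bot_iff prod_filter_eq_bot principal_eq_bot_iff)
    fix E :: "'a \<times> 'a \<Rightarrow> bool" assume "eventually E uniformity"
    with uniformly_continuous_minus'[where 'a='a]
    have "eventually (\<lambda>((a, b), (c, d)). E (a - c, b - d)) (uniformity \<times>\<^sub>F uniformity)"
      unfolding filterlim_iff case_prod_unfold by blast
    then obtain D where D: "eventually D uniformity" "\<And>a b c d. D (a, b) \<Longrightarrow> D (c, d) \<Longrightarrow> E (a - c, b - d)"
      unfolding eventually_prod_same by auto
    have le: "F \<times>\<^sub>F F \<le> uniformity" using F(1) by (simp add: cauchy_equiv_def)
    obtain P Q where P: "eventually P F" "eventually Q F" "\<And>x y. P x \<Longrightarrow> Q y \<Longrightarrow> D (x, y)"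
      by (rule prod_le_uniformityD[OF le D(1)]) blast
    have "E (- b + a, 0)" if "P a" "Q b" for a b :: 'a
      using D(2)[OF P(3)[OF that] uniformity_refl[OF D(1), of b]] by simp
    then have "eventually (\<lambda>p. E (- fst p + snd p, 0)) (F \<times>\<^sub>F F)"
      unfolding eventually_prod_filter using P(1,2) by (intro exI[of _ Q] exI[of _ P]) auto
    then show "eventually E (filtermap (\<lambda>(a, b). a + b) (filtermap uminus F \<times>\<^sub>F F) \<times>\<^sub>F principal {0})"
      by (simp add: prod_filter_principal_singleton2 prod_filtermap1 eventually_filtermap case_prod_unfold)
  qed
  then show "- x + x = 0"
    by (simp add: F zero_completion_def p uminus_completion.abs_eq r abs_completion_eq case_prod_unfold)
qed

end

lemma to_completion_add: "to_completion (x + y) = to_completion x + to_completion y"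
  for x y :: "'a::{uniform_topological_group_add, ab_group_add}"
  by (simp add: to_completion_principal abs_completion_add cauchy_equiv_principal
      prod_filter_principal_singleton filtermap_filtermap)

instantiation poly_mapping :: (type, complex_vec) complex_vec
begin
definition scaleC_poly_mapping :: "complex \<Rightarrow> ('a \<Rightarrow>\<^sub>0 'b) \<Rightarrow> 'a \<Rightarrow>\<^sub>0 'b" where
  "scaleC_poly_mapping r = Poly_Mapping.map ((*\<^sub>C) r)"

lemma lookup_scaleC: "Poly_Mapping.lookup (r *\<^sub>C u) k = r *\<^sub>C Poly_Mapping.lookup u k"
  by (simp add: scaleC_poly_mapping_def Poly_Mapping.map.rep_eq when_def)

instance
  by standard (auto intro!: poly_mapping_eqI simp: lookup_scaleC lookup_add scaleC_add_right scaleC_add_left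
      scaleC_scaleC scaleC_one)
end

text \<open>The direct sum over \<open>N\<close> of the tensor products of the algebra with \<open>N\<close> copies of its quotient by the
  scalars: the free vector space on lists \<open>[\<theta>\<^sub>0, \<dots>, \<theta>\<^sub>N]\<close> modulo multilinearity and modulo the unit in positions
  \<open>1, \<dots>, N\<close>. The empty list is set to zero.\<close>

definition chain_relators :: "('a::locally_convex_dga list \<Rightarrow>\<^sub>0 complex) set" where
  "chain_relators =
     {Poly_Mapping.single [] 1}
   \<union> {Poly_Mapping.single (\<theta>[i := x + y]) 1 - Poly_Mapping.single (\<theta>[i := x]) 1 - Poly_Mapping.single (\<theta>[i := y]) 1
        | \<theta> i x y. i < length \<theta>}
   \<union> {Poly_Mapping.single (\<theta>[i := r *\<^sub>C x]) 1 - Poly_Mapping.single (\<theta>[i := x]) r | \<theta> i r x. i < length \<theta>}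
   \<union> {Poly_Mapping.single (\<theta>[i := 1]) 1 | \<theta> i. 0 < i \<and> i < length \<theta>}"

quotient_type (overloaded) 'a chain = "'a::locally_convex_dga list \<Rightarrow>\<^sub>0 complex"
  / "\<lambda>u v. u - v \<in> cspan chain_relators"
proof (rule equivpI)
  let ?R = "\<lambda>u v :: 'a list \<Rightarrow>\<^sub>0 complex. u - v \<in> cspan chain_relators"
  show "reflp ?R" by (rule reflpI) (simp add: complex_vector.span_zero)
  show "symp ?R"
  proof (rule sympI)
    fix u v :: "'a list \<Rightarrow>\<^sub>0 complex" assume "u - v \<in> cspan chain_relators"
    from complex_vector.span_neg[OF this] show "v - u \<in> cspan chain_relators" by simp
  qed
  show "transp ?R"
  proof (rule transpI)
    fix u v w :: "'a list \<Rightarrow>\<^sub>0 complex" assume "u - v \<in> cspan chain_relators" "v - w \<in> cspan chain_relators"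
    from complex_vector.span_add[OF this] show "u - w \<in> cspan chain_relators" by simp
  qed
qed

instantiation chain :: (locally_convex_dga) complex_vec
begin

lift_definition zero_chain :: "'a chain" is 0 .
lift_definition plus_chain :: "'a chain \<Rightarrow> 'a chain \<Rightarrow> 'a chain" is "(+)"
  by (drule (1) complex_vector.span_add) (simp add: algebra_simps)
lift_definition minus_chain :: "'a chain \<Rightarrow> 'a chain \<Rightarrow> 'a chain" is "(-)"
  by (drule (1) complex_vector.span_diff) (simp add: algebra_simps)
lift_definition uminus_chain :: "'a chain \<Rightarrow> 'a chain" is uminus
  by (drule complex_vector.span_neg) (simp add: algebra_simps)
lift_definition scaleC_chain :: "complex \<Rightarrow> 'a chain \<Rightarrow> 'a chain" is scaleC
  by (drule complex_vector.span_scale) (simp add: complex_vector.scale_right_diff_distrib)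

instance
  by standard (transfer; simp add: algebra_simps complex_vector.span_zero scaleC_add_right scaleC_add_left
      scaleC_scaleC scaleC_one)+

end

lift_definition tensor :: "'a::locally_convex_dga list \<Rightarrow> 'a chain" is "\<lambda>\<theta>. Poly_Mapping.single \<theta> 1" .

definition normalized_multilinear :: "('a::locally_convex_dga list \<Rightarrow> 'b::complex_vec) \<Rightarrow> bool" where
  "normalized_multilinear f \<longleftrightarrow> f [] = 0
     \<and> (\<forall>\<theta> i x y. i < length \<theta> \<longrightarrow> f (\<theta>[i := x + y]) = f (\<theta>[i := x]) + f (\<theta>[i := y]))
     \<and> (\<forall>\<theta> i r x. i < length \<theta> \<longrightarrow> f (\<theta>[i := r *\<^sub>C x]) = r *\<^sub>C f (\<theta>[i := x]))
     \<and> (\<forall>\<theta> i. 0 < i \<and> i < length \<theta> \<longrightarrow> f (\<theta>[i := 1]) = 0)"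

lemma single_scaleC: "Poly_Mapping.single k (r::complex) = r *\<^sub>C Poly_Mapping.single k 1"
  by (rule poly_mapping_eqI) (simp add: lookup_scaleC lookup_single scaleC_complex_def when_def)

lemma normalized_multilinear_tensor: "normalized_multilinear tensor"
  unfolding normalized_multilinear_def
proof (intro conjI allI impI)
  show "tensor [] = (0 :: 'a chain)"
    by transfer (rule complex_vector.span_base, simp add: chain_relators_def)
  show "tensor (\<theta>[i := x + y]) = tensor (\<theta>[i := x]) + tensor (\<theta>[i := y])" if "i < length \<theta>" for \<theta> i and x y :: 'a
    using that by transfer (rule complex_vector.span_base, unfold chain_relators_def diff_diff_eq, blast)
  show "tensor (\<theta>[i := r *\<^sub>C x]) = r *\<^sub>C tensor (\<theta>[i := x])" if "i < length \<theta>" for \<theta> i r and x :: 'a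
    using that by transfer (rule complex_vector.span_base, unfold chain_relators_def single_scaleC[symmetric], blast)
  show "tensor (\<theta>[i := 1]) = 0" if "0 < i \<and> i < length \<theta>" for \<theta> :: "'a list" and i
    using that by transfer (rule complex_vector.span_base, unfold chain_relators_def diff_0_right, blast)
qed

definition linear_extension :: "('k \<Rightarrow> 'b::complex_vec) \<Rightarrow> ('k \<Rightarrow>\<^sub>0 complex) \<Rightarrow> 'b" where
  "linear_extension f u = (\<Sum>k\<in>Poly_Mapping.keys u. Poly_Mapping.lookup u k *\<^sub>C f k)"

lemma linear_extension_superset:
  "finite A \<Longrightarrow> Poly_Mapping.keys u \<subseteq> A \<Longrightarrow> linear_extension f u = (\<Sum>k\<in>A. Poly_Mapping.lookup u k *\<^sub>C f k)"
  unfolding linear_extension_def by (rule sum.mono_neutral_left) (auto simp: in_keys_iff)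

lemma linear_extension_add: "linear_extension f (u + v) = linear_extension f u + linear_extension f v"
proof -
  have fin: "finite (Poly_Mapping.keys u \<union> Poly_Mapping.keys v)" by simp
  show ?thesis
    by (subst (1 2 3) linear_extension_superset[OF fin])
       (auto simp: lookup_add scaleC_add_left sum.distrib keys_add)
qed

lemma linear_extension_scaleC: "linear_extension f (r *\<^sub>C u) = r *\<^sub>C linear_extension f u"
proof -
  have fin: "finite (Poly_Mapping.keys u)" by simp
  show ?thesis
    by (subst (1 2) linear_extension_superset[OF fin])
       (auto simp: lookup_scaleC scaleC_complex_def in_keys_iff complex_vector.scale_sum_right scaleC_scaleC)
qed

lemma linear_extension_diff: "linear_extension f (u - v) = linear_extension f u - linear_extension f v"
  using linear_extension_add[of f u "- v"] linear_extension_scaleC[of f "-1" v] by simp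

lemma linear_extension_zero [simp]: "linear_extension f 0 = 0"
  by (simp add: linear_extension_def)

lemma linear_extension_single: "linear_extension f (Poly_Mapping.single k r) = r *\<^sub>C f k"
  by (subst linear_extension_superset[of "{k}"]) (auto simp: lookup_single)

text \<open>The linear map on chains with prescribed values on elementary tensors; meaningful for
  \<^const>\<open>normalized_multilinear\<close> functions (\<open>chain_ext_tensor\<close>).\<close>

definition chain_ext :: "('a::locally_convex_dga list \<Rightarrow> 'b::complex_vec) \<Rightarrow> 'a chain \<Rightarrow> 'b" where
  "chain_ext f c = linear_extension f (rep_chain c)"

lemma chain_ext_abs:
  assumes "normalized_multilinear f"
  shows "chain_ext f (abs_chain u) = linear_extension f u"
proof -
  have "linear_extension f v = 0" if "v \<in> cspan chain_relators" for v
  proof -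
    have "complex_vector.subspace {v. linear_extension f v = 0}"
      by (auto simp: complex_vector.subspace_def linear_extension_add linear_extension_scaleC)
    moreover have "chain_relators \<subseteq> {v. linear_extension f v = 0}"
      using assms unfolding chain_relators_def normalized_multilinear_def
      by (auto simp: linear_extension_diff linear_extension_single scaleC_one)
    ultimately have "cspan chain_relators \<subseteq> {v. linear_extension f v = 0}"
      by (intro complex_vector.span_minimal)
    with that show ?thesis by auto
  qed
  moreover have "rep_chain (abs_chain u) - u \<in> cspan chain_relators"
    using Quotient3_rep_abs[OF Quotient3_chain, of u] by (simp add: complex_vector.span_zero)
  ultimately have "linear_extension f (rep_chain (abs_chain u) - u) = 0" by blast
  then show ?thesis by (simp add: chain_ext_def linear_extension_diff)
qed

lemma chain_cases: obtains u where "c = abs_chain u"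
  using Quotient3_abs_rep[OF Quotient3_chain, of c] by metis

lemma chain_ext_tensor: "normalized_multilinear f \<Longrightarrow> chain_ext f (tensor \<theta>) = f \<theta>"
  by (simp add: tensor.abs_eq chain_ext_abs linear_extension_single scaleC_one)

lemma chain_ext_add: "normalized_multilinear f \<Longrightarrow> chain_ext f (c + d) = chain_ext f c + chain_ext f d"
  by (rule chain_cases[of c], rule chain_cases[of d])
     (simp add: plus_chain.abs_eq chain_ext_abs linear_extension_add)

lemma chain_ext_scaleC: "normalized_multilinear f \<Longrightarrow> chain_ext f (r *\<^sub>C c) = r *\<^sub>C chain_ext f c"
  by (rule chain_cases[of c]) (simp add: scaleC_chain.abs_eq chain_ext_abs linear_extension_scaleC)

definition chain_component :: "nat \<Rightarrow> 'a::locally_convex_dga chain \<Rightarrow> 'a chain" where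
  "chain_component N = chain_ext (\<lambda>\<theta>. if length \<theta> = Suc N then tensor \<theta> else 0)"

text \<open>The quotient seminorm on the algebra modulo the scalars.\<close>

definition quotient_seminorm :: "('a::locally_convex_dga \<Rightarrow> real) \<Rightarrow> 'a \<Rightarrow> real" where
  "quotient_seminorm \<nu> x = (INF r. \<nu> (x + r *\<^sub>C 1))"

definition tensor_weight :: "('a::locally_convex_dga \<Rightarrow> real) \<Rightarrow> 'a list \<Rightarrow> real" where
  "tensor_weight \<nu> \<theta> = \<nu> (hd \<theta>) * (\<Prod>x\<leftarrow>tl \<theta>. quotient_seminorm \<nu> x)"

definition projective_seminorm :: "('a::locally_convex_dga \<Rightarrow> real) \<Rightarrow> nat \<Rightarrow> 'a chain \<Rightarrow> real" where
  "projective_seminorm \<nu> N c =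
     (INF u\<in>{u. abs_chain u = c \<and> (\<forall>\<theta>\<in>Poly_Mapping.keys u. length \<theta> = Suc N)}.
        \<Sum>\<theta>\<in>Poly_Mapping.keys u. cmod (Poly_Mapping.lookup u \<theta>) * tensor_weight \<nu> \<theta>)"

definition entire_seminorm :: "('a::locally_convex_dga \<Rightarrow> real) \<Rightarrow> 'a chain \<Rightarrow> real" where
  "entire_seminorm \<nu> c = suminf (\<lambda>N. projective_seminorm \<nu> N (chain_component N c) / fact (N div 2))"

lemma quotient_seminorm_nonneg: "seminorm \<nu> \<Longrightarrow> 0 \<le> quotient_seminorm \<nu> x"
  unfolding quotient_seminorm_def by (rule cINF_greatest) (auto simp: seminorm_nonneg)

lemma quotient_seminorm_mono:
  assumes "seminorm \<nu>" "\<And>x. \<nu> x \<le> \<mu> x"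
  shows "quotient_seminorm \<nu> x \<le> quotient_seminorm \<mu> x"
  unfolding quotient_seminorm_def
  by (rule cINF_mono) (use assms in \<open>auto intro!: bdd_belowI2[of _ 0] simp: seminorm_nonneg\<close>)

lemma tensor_weight_nonneg: "seminorm \<nu> \<Longrightarrow> 0 \<le> tensor_weight \<nu> \<theta>"
  unfolding tensor_weight_def
  by (auto intro!: mult_nonneg_nonneg prod_list_nonneg simp: seminorm_nonneg quotient_seminorm_nonneg)

lemma tensor_weight_mono:
  assumes "seminorm \<nu>" "seminorm \<mu>" "\<And>x. \<nu> x \<le> \<mu> x"
  shows "tensor_weight \<nu> \<theta> \<le> tensor_weight \<mu> \<theta>"
proof -
  have "(\<Prod>x\<leftarrow>xs. quotient_seminorm \<nu> x) \<le> (\<Prod>x\<leftarrow>xs. quotient_seminorm \<mu> x)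
      \<and> 0 \<le> (\<Prod>x\<leftarrow>xs. quotient_seminorm \<nu> x)" for xs
    by (induction xs) (auto intro!: mult_mono quotient_seminorm_mono assms simp: quotient_seminorm_nonneg assms)
  then show ?thesis unfolding tensor_weight_def
    using assms by (auto intro!: mult_mono simp: seminorm_nonneg)
qed

lemma normalized_multilinear_component:
  "normalized_multilinear (\<lambda>\<theta>. if length \<theta> = Suc N then tensor \<theta> else 0)"
  using normalized_multilinear_tensor by (auto simp: normalized_multilinear_def)

lemma chain_component_add: "chain_component N (c + d) = chain_component N c + chain_component N d"
  unfolding chain_component_def by (rule chain_ext_add[OF normalized_multilinear_component])

lemma chain_component_scaleC: "chain_component N (r *\<^sub>C c) = r *\<^sub>C chain_component N c"
  unfolding chain_component_def by (rule chain_ext_scaleC[OF normalized_multilinear_component])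

lemma chain_component_zero [simp]: "chain_component N 0 = 0"
  using chain_component_scaleC[of N 0 0] by simp

lemma chain_component_uminus: "chain_component N (- c) = - chain_component N c"
  using chain_component_scaleC[of N "-1" c] by simp

lemma chain_component_tensor: "chain_component N (tensor \<theta>) = (if length \<theta> = Suc N then tensor \<theta> else 0)"
  unfolding chain_component_def by (rule chain_ext_tensor[OF normalized_multilinear_component])

lemma abs_chain_sum: "abs_chain (\<Sum>i\<in>I. u i) = (\<Sum>i\<in>I. abs_chain (u i))"
  by (induction I rule: infinite_finite_induct) (simp_all add: zero_chain.abs_eq plus_chain.abs_eq[symmetric] zero_chain_def)

lemma chain_component_rep:
  obtains u where "abs_chain u = chain_component N c" "\<And>\<theta>. \<theta> \<in> Poly_Mapping.keys u \<Longrightarrow> length \<theta> = Suc N"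
proof -
  obtain u where u: "c = abs_chain u" by (rule chain_cases)
  define K where "K = {\<theta> \<in> Poly_Mapping.keys u. length \<theta> = Suc N}"
  define w where "w = (\<Sum>\<theta>\<in>K. Poly_Mapping.single \<theta> (Poly_Mapping.lookup u \<theta>))"
  have "abs_chain w = (\<Sum>\<theta>\<in>K. Poly_Mapping.lookup u \<theta> *\<^sub>C tensor \<theta>)"
    unfolding w_def abs_chain_sum
    by (rule sum.cong) (auto simp: single_scaleC[of _ "Poly_Mapping.lookup u _"] scaleC_chain.abs_eq[symmetric] tensor.abs_eq)
  also have "\<dots> = chain_component N c"
    unfolding chain_component_def u chain_ext_abs[OF normalized_multilinear_component] linear_extension_def
    by (rule sum.mono_neutral_cong_left) (auto simp: K_def)
  finally have "abs_chain w = chain_component N c" .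
  moreover have "length \<theta> = Suc N" if "\<theta> \<in> Poly_Mapping.keys w" for \<theta>
  proof -
    have "Poly_Mapping.keys w \<subseteq> (\<Union>\<theta>\<in>K. Poly_Mapping.keys (Poly_Mapping.single \<theta> (Poly_Mapping.lookup u \<theta>)))"
      unfolding w_def by (rule Poly_Mapping.keys_sum)
    with that show ?thesis by (auto simp: K_def split: if_splits)
  qed
  ultimately show thesis by (rule that)
qed

lemma chain_component_eventually_zero: "\<exists>M. \<forall>N\<ge>M. chain_component N c = 0"
proof -
  obtain u where u: "c = abs_chain u" by (rule chain_cases)
  have "finite (length ` Poly_Mapping.keys u)" by simp
  then obtain M where M: "\<And>\<theta>. \<theta> \<in> Poly_Mapping.keys u \<Longrightarrow> length \<theta> \<le> M"
    by (auto simp: finite_nat_set_iff_bounded_le)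
  have "chain_component N c = 0" if "M \<le> N" for N
    unfolding chain_component_def u chain_ext_abs[OF normalized_multilinear_component] linear_extension_def
    by (rule sum.neutral) (use M that in force)
  then show ?thesis by blast
qed

definition rep_weight :: "('a::locally_convex_dga \<Rightarrow> real) \<Rightarrow> ('a list \<Rightarrow>\<^sub>0 complex) \<Rightarrow> real" where
  "rep_weight \<nu> u = (\<Sum>\<theta>\<in>Poly_Mapping.keys u. cmod (Poly_Mapping.lookup u \<theta>) * tensor_weight \<nu> \<theta>)"

lemma rep_weight_superset:
  "finite A \<Longrightarrow> Poly_Mapping.keys u \<subseteq> A \<Longrightarrow> rep_weight \<nu> u = (\<Sum>\<theta>\<in>A. cmod (Poly_Mapping.lookup u \<theta>) * tensor_weight \<nu> \<theta>)"
  unfolding rep_weight_def by (rule sum.mono_neutral_left) (auto simp: in_keys_iff)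

lemma rep_weight_nonneg: "seminorm \<nu> \<Longrightarrow> 0 \<le> rep_weight \<nu> u"
  unfolding rep_weight_def by (auto intro!: sum_nonneg mult_nonneg_nonneg tensor_weight_nonneg)

lemma rep_weight_mono:
  "seminorm \<nu> \<Longrightarrow> seminorm \<mu> \<Longrightarrow> (\<And>x. \<nu> x \<le> \<mu> x) \<Longrightarrow> rep_weight \<nu> u \<le> rep_weight \<mu> u"
  unfolding rep_weight_def by (auto intro!: sum_mono mult_left_mono tensor_weight_mono)

lemma rep_weight_add:
  assumes "seminorm \<nu>"
  shows "rep_weight \<nu> (u + v) \<le> rep_weight \<nu> u + rep_weight \<nu> v"
proof -
  have fin: "finite (Poly_Mapping.keys u \<union> Poly_Mapping.keys v)" by simp
  show ?thesis
    by (subst (1 2 3) rep_weight_superset[OF fin])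
       (auto simp: lookup_add keys_add sum.distrib[symmetric] distrib_right[symmetric]
          intro!: sum_mono mult_right_mono norm_triangle_ineq tensor_weight_nonneg[OF assms])
qed

lemma keys_uminus: "Poly_Mapping.keys (- u) = Poly_Mapping.keys (u :: 'k \<Rightarrow>\<^sub>0 complex)"
  by (auto simp: in_keys_iff)

lemma rep_weight_uminus: "rep_weight \<nu> (- u) = rep_weight \<nu> u"
  unfolding rep_weight_def by (simp add: keys_uminus)

lemma projective_seminorm_alt:
  "projective_seminorm \<nu> N c = (INF u\<in>{u. abs_chain u = c \<and> (\<forall>\<theta>\<in>Poly_Mapping.keys u. length \<theta> = Suc N)}. rep_weight \<nu> u)"
  by (simp add: projective_seminorm_def rep_weight_def)

lemma bdd_below_rep_weight: "seminorm \<nu> \<Longrightarrow> bdd_below (rep_weight \<nu> ` A)"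
  by (rule bdd_belowI2[of _ 0]) (rule rep_weight_nonneg)

lemma projective_seminorm_le:
  "seminorm \<nu> \<Longrightarrow> abs_chain u = c \<Longrightarrow> (\<And>\<theta>. \<theta> \<in> Poly_Mapping.keys u \<Longrightarrow> length \<theta> = Suc N) \<Longrightarrow>
    projective_seminorm \<nu> N c \<le> rep_weight \<nu> u"
  unfolding projective_seminorm_alt by (rule cINF_lower[OF bdd_below_rep_weight]) auto

lemma projective_seminorm_component_nonneg:
  assumes "seminorm \<nu>"
  shows "0 \<le> projective_seminorm \<nu> N (chain_component N c)"
proof -
  obtain u where "abs_chain u = chain_component N c" "\<And>\<theta>. \<theta> \<in> Poly_Mapping.keys u \<Longrightarrow> length \<theta> = Suc N"
    using chain_component_rep by blast
  then show ?thesis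
    unfolding projective_seminorm_alt by (intro cINF_greatest rep_weight_nonneg assms) auto
qed

lemma projective_seminorm_zero:
  assumes "seminorm \<nu>"
  shows "projective_seminorm \<nu> N 0 = 0"
proof -
  have "projective_seminorm \<nu> N 0 \<le> rep_weight \<nu> 0"
    by (rule projective_seminorm_le[OF assms]) (auto simp: zero_chain.abs_eq)
  moreover have "0 \<le> projective_seminorm \<nu> N (chain_component N 0)" by (rule projective_seminorm_component_nonneg[OF assms])
  ultimately show ?thesis by (simp add: rep_weight_def chain_component_zero)
qed

lemma projective_seminorm_add:
  assumes "seminorm \<nu>"
  shows "projective_seminorm \<nu> N (chain_component N c + chain_component N d)
     \<le> projective_seminorm \<nu> N (chain_component N c) + projective_seminorm \<nu> N (chain_component N d)"
proof (rule field_le_epsilon)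
  fix e :: real assume "0 < e"
  have *: "\<exists>u. abs_chain u = chain_component N c \<and> (\<forall>\<theta>\<in>Poly_Mapping.keys u. length \<theta> = Suc N)
     \<and> rep_weight \<nu> u < projective_seminorm \<nu> N (chain_component N c) + e / 2" for c :: "'a chain"
  proof -
    let ?A = "{u. abs_chain u = chain_component N c \<and> (\<forall>\<theta>\<in>Poly_Mapping.keys u. length \<theta> = Suc N)}"
    obtain u where "abs_chain u = chain_component N c" "\<And>\<theta>. \<theta> \<in> Poly_Mapping.keys u \<Longrightarrow> length \<theta> = Suc N"
      using chain_component_rep by blast
    then have "?A \<noteq> {}" by blast
    moreover have "(INF u\<in>?A. rep_weight \<nu> u) < projective_seminorm \<nu> N (chain_component N c) + e / 2"
      using \<open>0 < e\<close> by (simp add: projective_seminorm_alt)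
    ultimately show ?thesis
      using cINF_less_iff[OF _ bdd_below_rep_weight[OF assms], of ?A] by auto
  qed
  obtain u where u: "abs_chain u = chain_component N c" "\<forall>\<theta>\<in>Poly_Mapping.keys u. length \<theta> = Suc N"
     "rep_weight \<nu> u < projective_seminorm \<nu> N (chain_component N c) + e / 2" using * by blast
  obtain v where v: "abs_chain v = chain_component N d" "\<forall>\<theta>\<in>Poly_Mapping.keys v. length \<theta> = Suc N"
     "rep_weight \<nu> v < projective_seminorm \<nu> N (chain_component N d) + e / 2" using * by blast
  have "projective_seminorm \<nu> N (chain_component N c + chain_component N d) \<le> rep_weight \<nu> (u + v)"
  proof (rule projective_seminorm_le[OF assms])
    show "abs_chain (u + v) = chain_component N c + chain_component N d"
      using u(1) v(1) by (simp add: plus_chain.abs_eq[symmetric])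
    show "length \<theta> = Suc N" if "\<theta> \<in> Poly_Mapping.keys (u + v)" for \<theta>
      using that keys_add[of u v] u(2) v(2) by blast
  qed
  with rep_weight_add[OF assms, of u v] u(3) v(3)
  show "projective_seminorm \<nu> N (chain_component N c + chain_component N d)
     \<le> projective_seminorm \<nu> N (chain_component N c) + projective_seminorm \<nu> N (chain_component N d) + e"
    by simp
qed

lemma projective_seminorm_uminus_le:
  assumes "seminorm \<nu>"
  shows "projective_seminorm \<nu> N (- chain_component N c) \<le> projective_seminorm \<nu> N (chain_component N c)"
proof -
  obtain w where "abs_chain w = chain_component N c" "\<And>\<theta>. \<theta> \<in> Poly_Mapping.keys w \<Longrightarrow> length \<theta> = Suc N"
    using chain_component_rep by blast
  then have "projective_seminorm \<nu> N (- chain_component N c) \<le>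
     (INF u\<in>{u. abs_chain u = chain_component N c \<and> (\<forall>\<theta>\<in>Poly_Mapping.keys u. length \<theta> = Suc N)}. rep_weight \<nu> u)"
  proof (intro cINF_greatest)
    fix u assume "u \<in> {u. abs_chain u = chain_component N c \<and> (\<forall>\<theta>\<in>Poly_Mapping.keys u. length \<theta> = Suc N)}"
    then show "projective_seminorm \<nu> N (- chain_component N c) \<le> rep_weight \<nu> u"
      using projective_seminorm_le[OF assms, of "- u" "- chain_component N c" N]
      by (auto simp: rep_weight_uminus uminus_chain.abs_eq[symmetric] keys_uminus)
  qed blast
  then show ?thesis by (simp add: projective_seminorm_alt)
qed

lemma projective_seminorm_mono:
  assumes "seminorm \<nu>" "seminorm \<mu>" "\<And>x. \<nu> x \<le> \<mu> x"
  shows "projective_seminorm \<nu> N (chain_component N c) \<le> projective_seminorm \<mu> N (chain_component N c)"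
proof -
  obtain w where "abs_chain w = chain_component N c" "\<And>\<theta>. \<theta> \<in> Poly_Mapping.keys w \<Longrightarrow> length \<theta> = Suc N"
    using chain_component_rep by blast
  then show ?thesis
    unfolding projective_seminorm_alt
    by (intro cINF_mono bdd_below_rep_weight[OF assms(1)]) (auto intro: rep_weight_mono[OF assms])
qed

lemma summable_entire_seminorm:
  assumes "seminorm \<nu>"
  shows "summable (\<lambda>N. projective_seminorm \<nu> N (chain_component N c) / fact (N div 2))"
proof -
  obtain M where "\<And>N. M \<le> N \<Longrightarrow> chain_component N c = 0" using chain_component_eventually_zero by blast
  then show ?thesis
    by (intro summable_finite[of "{..<M}"]) (auto simp: projective_seminorm_zero[OF assms] not_less)
qed

lemma entire_seminorm_zero: "seminorm \<nu> \<Longrightarrow> entire_seminorm \<nu> 0 = 0"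
  by (simp add: entire_seminorm_def projective_seminorm_zero)

lemma entire_seminorm_add:
  assumes "seminorm \<nu>"
  shows "entire_seminorm \<nu> (c + d) \<le> entire_seminorm \<nu> c + entire_seminorm \<nu> d"
  unfolding entire_seminorm_def suminf_add[OF summable_entire_seminorm[OF assms] summable_entire_seminorm[OF assms]]
  by (intro suminf_le summable_add summable_entire_seminorm assms)
     (auto simp: chain_component_add add_divide_distrib[symmetric] intro!: divide_right_mono projective_seminorm_add assms)

lemma entire_seminorm_uminus:
  assumes "seminorm \<nu>"
  shows "entire_seminorm \<nu> (- c) = entire_seminorm \<nu> c"
proof -
  have "entire_seminorm \<nu> (- c) \<le> entire_seminorm \<nu> c" for c
    unfolding entire_seminorm_def
    by (intro suminf_le summable_entire_seminorm assms)
       (auto simp: chain_component_uminus intro!: divide_right_mono projective_seminorm_uminus_le assms)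
  from this[of c] this[of "- c"] show ?thesis by simp
qed

lemma entire_seminorm_mono:
  assumes "seminorm \<nu>" "seminorm \<mu>" "\<And>x. \<nu> x \<le> \<mu> x"
  shows "entire_seminorm \<nu> c \<le> entire_seminorm \<mu> c"
  unfolding entire_seminorm_def
  by (intro suminf_le summable_entire_seminorm assms) (auto intro!: divide_right_mono projective_seminorm_mono assms)

lemma entire_seminorm_minus_commute: "seminorm \<nu> \<Longrightarrow> entire_seminorm \<nu> (c - d) = entire_seminorm \<nu> (d - c)"
  using entire_seminorm_uminus[of \<nu> "c - d"] by simp

instantiation chain :: (locally_convex_dga) uniform_space
begin

definition uniformity_chain :: "('a chain \<times> 'a chain) filter" where
  "uniformity_chain = (INF (\<nu>, e)\<in>{(\<nu>, e). cont_seminorm \<nu> \<and> 0 < e}. principal {(c, d). entire_seminorm \<nu> (c - d) < e})"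

definition open_chain :: "'a chain set \<Rightarrow> bool" where
  "open_chain U \<longleftrightarrow> (\<forall>x\<in>U. eventually (\<lambda>(x', y). x' = x \<longrightarrow> y \<in> U) uniformity)"

lemma eventually_uniformity_chain:
  "eventually P (uniformity :: ('a chain \<times> 'a chain) filter) \<longleftrightarrow>
    (\<exists>\<nu> e. cont_seminorm \<nu> \<and> 0 < e \<and> (\<forall>c d. entire_seminorm \<nu> (c - d) < e \<longrightarrow> P (c, d)))"
  unfolding uniformity_chain_def
proof (subst eventually_INF_base)
  let ?I = "{(\<nu> :: 'a \<Rightarrow> real, e :: real). cont_seminorm \<nu> \<and> 0 < e}"
  show "?I \<noteq> {}" using cont_seminorm_zero by (auto intro!: exI[of _ "\<lambda>_. 0"] exI[of _ 1])
  fix a b assume "a \<in> ?I" "b \<in> ?I"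
  then obtain \<nu> e \<mu> d where [simp]: "a = (\<nu>, e)" "b = (\<mu>, d)" and *: "cont_seminorm \<nu>" "0 < e" "cont_seminorm \<mu>" "0 < d" by auto
  let ?m = "\<lambda>x. max (\<nu> x) (\<mu> x)"
  have m: "cont_seminorm ?m" by (rule cont_seminorm_max) fact+
  have "entire_seminorm \<nu> c \<le> entire_seminorm ?m c" "entire_seminorm \<mu> c \<le> entire_seminorm ?m c" for c
    using * m by (auto intro!: entire_seminorm_mono simp: cont_seminorm_def)
  then have "principal {(c, c'). entire_seminorm ?m (c - c') < min e d} \<le>
     inf (principal {(c, c'). entire_seminorm \<nu> (c - c') < e}) (principal {(c, c'). entire_seminorm \<mu> (c - c') < d})"
    by (auto intro: le_less_trans)
  then show "\<exists>x\<in>?I. (case x of (\<nu>, e) \<Rightarrow> principal {(c, d). entire_seminorm \<nu> (c - d) < e})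
     \<le> inf (case a of (\<nu>, e) \<Rightarrow> principal {(c, d). entire_seminorm \<nu> (c - d) < e})
         (case b of (\<nu>, e) \<Rightarrow> principal {(c, d). entire_seminorm \<nu> (c - d) < e})"
    using m * by (intro bexI[of _ "(?m, min e d)"]) auto
qed (auto simp: eventually_principal)

instance
proof
  show "open U \<longleftrightarrow> (\<forall>x\<in>U. eventually (\<lambda>(x', y). x' = x \<longrightarrow> y \<in> U) uniformity)" for U :: "'a chain set"
    by (rule open_chain_def)
  fix P :: "'a chain \<times> 'a chain \<Rightarrow> bool" and x
  assume "eventually P uniformity"
  then obtain \<nu> e where \<nu>: "cont_seminorm \<nu>" "0 < e" "\<And>c d. entire_seminorm \<nu> (c - d) < e \<Longrightarrow> P (c, d)"
    unfolding eventually_uniformity_chain by blast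
  have s: "seminorm \<nu>" using \<nu>(1) by (rule cont_seminorm_seminorm)
  show "P (x, x)" using \<nu>(2) by (intro \<nu>(3)) (simp add: entire_seminorm_zero[OF s])
  show "\<forall>\<^sub>F (x, y) in uniformity. P (y, x)"
    unfolding eventually_uniformity_chain
    using \<nu> by (intro exI[of _ \<nu>] exI[of _ e]) (auto simp: entire_seminorm_minus_commute[OF s])
  show "\<exists>D. eventually D uniformity \<and> (\<forall>x y z. D (x, y) \<longrightarrow> D (y, z) \<longrightarrow> P (x, z))"
  proof (intro exI conjI allI impI)
    show "eventually (\<lambda>(c, d). entire_seminorm \<nu> (c - d) < e / 2) uniformity"
      unfolding eventually_uniformity_chain using \<nu>(1,2) by (intro exI[of _ \<nu>] exI[of _ "e / 2"]) auto
    fix x y z :: "'a chain"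
    assume "case (x, y) of (c, d) \<Rightarrow> entire_seminorm \<nu> (c - d) < e / 2" "case (y, z) of (c, d) \<Rightarrow> entire_seminorm \<nu> (c - d) < e / 2"
    then show "P (x, z)"
      using entire_seminorm_add[OF s, of "x - y" "y - z"] by (intro \<nu>(3)) simp
  qed
qed

end

lemma uniform_add_chain:
  assumes "eventually P (uniformity :: ('a::locally_convex_dga chain \<times> 'a chain) filter)"
  obtains D where "eventually D uniformity" "\<And>a b c d. D (a, b) \<Longrightarrow> D (c, d) \<Longrightarrow> P (a + c, b + d)"
proof -
  obtain \<nu> e where \<nu>: "cont_seminorm \<nu>" "0 < e" "\<And>c d. entire_seminorm \<nu> (c - d) < e \<Longrightarrow> P (c, d)"
    using assms unfolding eventually_uniformity_chain by blast
  have s: "seminorm \<nu>" using \<nu>(1) by (rule cont_seminorm_seminorm)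
  show thesis
  proof (rule that[of "\<lambda>(c, d). entire_seminorm \<nu> (c - d) < e / 2"])
    show "eventually (\<lambda>(c, d). entire_seminorm \<nu> (c - d) < e / 2) uniformity"
      unfolding eventually_uniformity_chain using \<nu>(1,2) by (intro exI[of _ \<nu>] exI[of _ "e / 2"]) auto
    fix a b c d :: "'a chain"
    assume "case (a, b) of (c, d) \<Rightarrow> entire_seminorm \<nu> (c - d) < e / 2" "case (c, d) of (c, d) \<Rightarrow> entire_seminorm \<nu> (c - d) < e / 2"
    then show "P (a + c, b + d)"
      using entire_seminorm_add[OF s, of "a - b" "c - d"] by (intro \<nu>(3)) (simp add: algebra_simps)
  qed
qed

lemma uniform_uminus_chain:
  assumes "eventually P (uniformity :: ('a::locally_convex_dga chain \<times> 'a chain) filter)"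
  shows "eventually (\<lambda>(a, b). P (- a, - b)) uniformity"
proof -
  obtain \<nu> e where \<nu>: "cont_seminorm \<nu>" "0 < e" "\<And>c d. entire_seminorm \<nu> (c - d) < e \<Longrightarrow> P (c, d)"
    using assms unfolding eventually_uniformity_chain by blast
  then show ?thesis
    unfolding eventually_uniformity_chain
    by (intro exI[of _ \<nu>] exI[of _ e]) (auto simp: entire_seminorm_minus_commute[OF cont_seminorm_seminorm] intro!: \<nu>(3))
qed

instance chain :: (locally_convex_dga) uniform_topological_group_add
proof
  fix a b :: "'a chain"
  show "((\<lambda>x. fst x + snd x) \<longlongrightarrow> a + b) (nhds a \<times>\<^sub>F nhds b)"
    unfolding filterlim_iff
  proof (intro allI impI)
    fix P assume "eventually P (nhds (a + b))"
    then obtain D where D: "eventually D uniformity"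
      "\<And>v v' w w'. D (v, v') \<Longrightarrow> D (w, w') \<Longrightarrow> (\<lambda>(x', y). x' = a + b \<longrightarrow> P y) (v + w, v' + w')"
      unfolding eventually_nhds_uniformity by (rule uniform_add_chain) blast
    have "eventually (\<lambda>y. D (a, y)) (nhds a)" "eventually (\<lambda>y. D (b, y)) (nhds b)"
      unfolding eventually_nhds_uniformity using D(1) by (auto elim: eventually_mono)
    then show "\<forall>\<^sub>F x in nhds a \<times>\<^sub>F nhds b. P (fst x + snd x)"
      unfolding eventually_prod_filter using D(2) by fastforce
  qed
  show "(uminus \<longlongrightarrow> - a) (nhds a)"
    unfolding filterlim_iff
  proof (intro allI impI)
    fix P assume "eventually P (nhds (- a))"
    then have "eventually (\<lambda>(x', y). (\<lambda>(x', y). x' = - a \<longrightarrow> P y) (- x', - y)) uniformity"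
      unfolding eventually_nhds_uniformity by (rule uniform_uminus_chain)
    then show "\<forall>\<^sub>F x in nhds a. P (- x)" unfolding eventually_nhds_uniformity by simp
  qed
  show "filterlim (\<lambda>((a :: 'a chain, b), (c, d)). (a + c, b + d)) uniformity (uniformity \<times>\<^sub>F uniformity)"
    unfolding filterlim_iff
  proof (intro allI impI)
    fix P :: "'a chain \<times> 'a chain \<Rightarrow> bool" assume "eventually P uniformity"
    then obtain D where D: "eventually D uniformity" "\<And>a b c d. D (a, b) \<Longrightarrow> D (c, d) \<Longrightarrow> P (a + c, b + d)"
      by (rule uniform_add_chain) blast
    then show "\<forall>\<^sub>F x in uniformity \<times>\<^sub>F uniformity. P (case x of (x, xa) \<Rightarrow> (case x of (a, b) \<Rightarrow> \<lambda>(c, d). (a + c, b + d)) xa)"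
      unfolding eventually_prod_same by (intro exI[of _ D]) auto
  qed
  show "filterlim (\<lambda>(a :: 'a chain, b). (- a, - b)) uniformity uniformity"
    unfolding filterlim_iff using uniform_uminus_chain by (auto simp: case_prod_unfold)
qed

text \<open>Formulas with signs are given for homogeneous entries, \<open>ns\<close> being the list of degrees, and are extended by
  decomposing every entry into its homogeneous components.\<close>

definition homogeneous_extension ::
    "(int list \<Rightarrow> 'a::locally_convex_dga list \<Rightarrow> 'b::complex_vec) \<Rightarrow> 'a list \<Rightarrow> 'b" where
  "homogeneous_extension f \<theta> =
     (\<Sum>ns | length ns = length \<theta> \<and> (\<forall>i<length \<theta>. hcomp (ns ! i) (\<theta> ! i) \<noteq> 0). f ns (map2 hcomp ns \<theta>))"

definition homogeneous_tuple :: "int list \<Rightarrow> 'a::locally_convex_dga list \<Rightarrow> bool" where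
  "homogeneous_tuple ns \<theta> \<longleftrightarrow> \<theta> \<noteq> [] \<and> list_all2 (\<lambda>n x. x \<in> homog n) ns \<theta>"

text \<open>\<open>mdeg ns k\<close> is \<open>m\<^bsub>k-1\<^esub> = |\<theta>\<^sub>0| + \<dots> + |\<theta>\<^bsub>k-1\<^esub>| - (k - 1)\<close>; in particular \<open>mdeg ns 0 = 1\<close>.\<close>

definition mdeg :: "int list \<Rightarrow> nat \<Rightarrow> int" where
  "mdeg ns k = (\<Sum>i<k. ns ! i) - (int k - 1)"

definition d_tensor :: "int list \<Rightarrow> 'a::locally_convex_dga list \<Rightarrow> 'a chain" where
  "d_tensor ns \<theta> = tensor (\<theta>[0 := diff (\<theta> ! 0)])
     - (\<Sum>k=1..<length \<theta>. (-1) powi mdeg ns k *\<^sub>C tensor (\<theta>[k := diff (\<theta> ! k)]))"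

text \<open>There is nothing to multiply in tensor length \<open>N = 0\<close>, where the operator is zero.\<close>

definition b_tensor :: "int list \<Rightarrow> 'a::locally_convex_dga list \<Rightarrow> 'a chain" where
  "b_tensor ns \<theta> = (let N = length \<theta> - 1 in if N = 0 then 0 else
     - (\<Sum>k<N. (-1) powi mdeg ns (Suc k) *\<^sub>C tensor (take k \<theta> @ [\<theta> ! k * \<theta> ! Suc k] @ drop (k + 2) \<theta>))
     + (-1) powi ((ns ! N - 1) * mdeg ns N) *\<^sub>C tensor ((\<theta> ! N * \<theta> ! 0) # tl (take N \<theta>)))"

definition B_tensor :: "int list \<Rightarrow> 'a::locally_convex_dga list \<Rightarrow> 'a chain" where
  "B_tensor ns \<theta> = (\<Sum>k<length \<theta>. (-1) powi ((mdeg ns k + 1) * (mdeg ns (length \<theta>) - mdeg ns k))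
     *\<^sub>C tensor (1 # drop k \<theta> @ take k \<theta>))"

definition chain_d :: "'a::locally_convex_dga chain \<Rightarrow> 'a chain" where
  "chain_d = chain_ext (homogeneous_extension d_tensor)"

definition chain_b :: "'a::locally_convex_dga chain \<Rightarrow> 'a chain" where
  "chain_b = chain_ext (homogeneous_extension b_tensor)"

definition chain_B :: "'a::locally_convex_dga chain \<Rightarrow> 'a chain" where
  "chain_B = chain_ext (homogeneous_extension B_tensor)"

definition slot_linear :: "nat \<Rightarrow> ('a::complex_vec list \<Rightarrow> 'b::complex_vec) \<Rightarrow> bool" where
  "slot_linear n g \<longleftrightarrow> (\<forall>\<theta> i. length \<theta> = n \<and> i < n \<longrightarrow>
     (\<forall>x y. g (\<theta>[i := x + y]) = g (\<theta>[i := x]) + g (\<theta>[i := y])) \<and>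
     (\<forall>r x. g (\<theta>[i := r *\<^sub>C x]) = r *\<^sub>C g (\<theta>[i := x])))"

definition graded_multilinear :: "(int list \<Rightarrow> 'a::locally_convex_dga list \<Rightarrow> 'b::complex_vec) \<Rightarrow> bool" where
  "graded_multilinear f \<longleftrightarrow> f [] [] = 0 \<and> (\<forall>ns. slot_linear (length ns) (f ns)) \<and>
     (\<forall>ns \<theta> i. length ns = length \<theta> \<and> 0 < i \<and> i < length \<theta> \<and> ns ! i = 0 \<longrightarrow> f ns (\<theta>[i := 1]) = 0)"

lemma slot_linearD:
  assumes "slot_linear (length \<theta>) g" "i < length \<theta>"
  shows "g (\<theta>[i := x + y]) = g (\<theta>[i := x]) + g (\<theta>[i := y])"
    "g (\<theta>[i := r *\<^sub>C x]) = r *\<^sub>C g (\<theta>[i := x])"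
    "g (\<theta>[i := 0]) = 0"
proof -
  show "g (\<theta>[i := x + y]) = g (\<theta>[i := x]) + g (\<theta>[i := y])"
    "g (\<theta>[i := r *\<^sub>C x]) = r *\<^sub>C g (\<theta>[i := x])"
    using assms by (auto simp: slot_linear_def)
  have "g (\<theta>[i := 0 *\<^sub>C 0]) = 0 *\<^sub>C g (\<theta>[i := 0])"
    using assms unfolding slot_linear_def by blast
  then show "g (\<theta>[i := 0]) = 0" by simp
qed

lemma slot_linear_add: "slot_linear n f \<Longrightarrow> slot_linear n g \<Longrightarrow> slot_linear n (\<lambda>\<theta>. f \<theta> + g \<theta>)"
  by (simp add: slot_linear_def scaleC_add_right algebra_simps)

lemma slot_linear_zero: "slot_linear n (\<lambda>\<theta>. 0)"
  by (simp add: slot_linear_def)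

lemma slot_linear_sum: "(\<And>k. k \<in> K \<Longrightarrow> slot_linear n (f k)) \<Longrightarrow> slot_linear n (\<lambda>\<theta>. \<Sum>k\<in>K. f k \<theta>)"
  by (induction K rule: infinite_finite_induct) (auto intro: slot_linear_add slot_linear_zero)

lemma slot_linear_scaleC: "slot_linear n f \<Longrightarrow> slot_linear n (\<lambda>\<theta>. r *\<^sub>C f \<theta>)"
  by (simp add: slot_linear_def scaleC_add_right scaleC_scaleC mult.commute)

lemma slot_linear_uminus: "slot_linear n f \<Longrightarrow> slot_linear n (\<lambda>\<theta>. - f \<theta>)"
  using slot_linear_scaleC[of n f "-1"] by simp

lemma slot_linear_diff: "slot_linear n f \<Longrightarrow> slot_linear n g \<Longrightarrow> slot_linear n (\<lambda>\<theta>. f \<theta> - g \<theta>)"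
  using slot_linear_add[of n f "\<lambda>\<theta>. - g \<theta>"] slot_linear_uminus[of n g] by simp

lemma slot_linear_cong: "slot_linear n f \<Longrightarrow> (\<And>\<theta>. length \<theta> = n \<Longrightarrow> f \<theta> = g \<theta>) \<Longrightarrow> slot_linear n g"
  by (simp add: slot_linear_def)

lemma slot_linear_tensorI:
  fixes g :: "'a::locally_convex_dga list \<Rightarrow> 'a chain"
  assumes "\<And>\<theta> i. length \<theta> = n \<Longrightarrow> i < n \<Longrightarrow> \<exists>\<eta> j L. j < length \<eta> \<and> (\<forall>x y. L (x + y) = L x + L y) \<and>
     (\<forall>r x. L (r *\<^sub>C x) = r *\<^sub>C L x) \<and> (\<forall>x. g (\<theta>[i := x]) = tensor (\<eta>[j := L x]))"
  shows "slot_linear n g"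
  unfolding slot_linear_def
proof (intro allI impI)
  fix \<theta> :: "'a list" and i assume "length \<theta> = n \<and> i < n"
  then obtain \<eta> j L where j: "j < length \<eta>" and L: "\<And>x y. L (x + y) = L x + L y" "\<And>r x. L (r *\<^sub>C x) = r *\<^sub>C L x"
    and g: "\<And>x. g (\<theta>[i := x]) = tensor (\<eta>[j := L x])" using assms by metis
  show "(\<forall>x y. g (\<theta>[i := x + y]) = g (\<theta>[i := x]) + g (\<theta>[i := y])) \<and>
        (\<forall>r x. g (\<theta>[i := r *\<^sub>C x]) = r *\<^sub>C g (\<theta>[i := x]))"
    using normalized_multilinear_tensor j unfolding g L normalized_multilinear_def by blast
qed

lemma graded_multilinear_slot: "graded_multilinear f \<Longrightarrow> length ns = n \<Longrightarrow> slot_linear n (f ns)"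
  by (auto simp: graded_multilinear_def)

lemma slot_linear_tensor: "slot_linear n tensor"
  unfolding slot_linear_def using normalized_multilinear_tensor unfolding normalized_multilinear_def by blast

lemma tensor_update_zero: "i < length \<theta> \<Longrightarrow> tensor (\<theta>[i := 0]) = 0"
  by (rule slot_linearD(3)[OF slot_linear_tensor])

lemma tensor_one: "0 < i \<Longrightarrow> i < length \<theta> \<Longrightarrow> \<theta> ! i = 1 \<Longrightarrow> tensor \<theta> = 0"
  using normalized_multilinear_tensor unfolding normalized_multilinear_def
  by (metis list_update_id)

lemma tensor_zero: "0 \<in> set \<theta> \<Longrightarrow> tensor \<theta> = 0"
  by (metis in_set_conv_nth list_update_id tensor_update_zero)

lemma tensor_Nil [simp]: "tensor [] = 0"
  by (rule normalized_multilinear_tensor[unfolded normalized_multilinear_def, THEN conjunct1])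

lemma diff_one [simp]: "diff (1 :: 'a::locally_convex_dga) = 0"
  using diff_mult[OF homog_one, of 1] by (simp add: scaleC_one)

lemma map2_hcomp_update:
  "length ns = length \<theta> \<Longrightarrow> i < length \<theta> \<Longrightarrow> map2 hcomp ns (\<theta>[i := x]) = (map2 hcomp ns \<theta>)[i := hcomp (ns ! i) x]"
  by (rule nth_equalityI) (auto simp: nth_list_update)

lemma homogeneous_extension_superset:
  assumes f: "graded_multilinear f" and A: "finite A" "\<And>x. x \<in> set \<theta> \<Longrightarrow> {n. hcomp n x \<noteq> 0} \<subseteq> A"
  shows "homogeneous_extension f \<theta> = (\<Sum>ns | set ns \<subseteq> A \<and> length ns = length \<theta>. f ns (map2 hcomp ns \<theta>))"
  unfolding homogeneous_extension_def
proof (rule sum.mono_neutral_left)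
  show "finite {ns. set ns \<subseteq> A \<and> length ns = length \<theta>}" by (rule finite_lists_length_eq[OF A(1)])
  show "{ns. length ns = length \<theta> \<and> (\<forall>i<length \<theta>. hcomp (ns ! i) (\<theta> ! i) \<noteq> 0)} \<subseteq> {ns. set ns \<subseteq> A \<and> length ns = length \<theta>}"
  proof safe
    fix ns n assume *: "length ns = length \<theta>" "\<forall>i<length \<theta>. hcomp (ns ! i) (\<theta> ! i) \<noteq> 0" "n \<in> set ns"
    then obtain i where "i < length \<theta>" "n = ns ! i" by (metis in_set_conv_nth)
    with * A(2)[of "\<theta> ! i"] show "n \<in> A" by auto
  qed
  show "\<forall>ns\<in>{ns. set ns \<subseteq> A \<and> length ns = length \<theta>} - {ns. length ns = length \<theta> \<and> (\<forall>i<length \<theta>. hcomp (ns ! i) (\<theta> ! i) \<noteq> 0)}.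
      f ns (map2 hcomp ns \<theta>) = 0"
  proof
    fix ns assume "ns \<in> {ns. set ns \<subseteq> A \<and> length ns = length \<theta>} - {ns. length ns = length \<theta> \<and> (\<forall>i<length \<theta>. hcomp (ns ! i) (\<theta> ! i) \<noteq> 0)}"
    then obtain i where i: "length ns = length \<theta>" "i < length \<theta>" "hcomp (ns ! i) (\<theta> ! i) = 0" by auto
    then have "map2 hcomp ns \<theta> = (map2 hcomp ns \<theta>)[i := 0]"
      using map2_hcomp_update[of ns \<theta> i "\<theta> ! i"] by simp
    moreover have "f ns ((map2 hcomp ns \<theta>)[i := 0]) = 0"
      using i by (intro slot_linearD(3)) (auto intro: graded_multilinear_slot[OF f])
    ultimately show "f ns (map2 hcomp ns \<theta>) = 0" by simp
  qed
qed

lemma normalized_multilinear_homogeneous_extension: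
  assumes f: "graded_multilinear f"
  shows "normalized_multilinear (homogeneous_extension f)"
proof -
  have sl: "slot_linear (length ns) (f ns)" for ns using f by (simp add: graded_multilinear_def)
  define S where "S \<theta> = (\<Union>x\<in>set \<theta>. {n. hcomp n x \<noteq> 0})" for \<theta> :: "'a list"
  have fin: "finite (S \<theta>)" for \<theta> by (simp add: S_def finite_hcomp)
  have ext: "homogeneous_extension f (\<theta>[i := x]) =
      (\<Sum>ns | set ns \<subseteq> A \<and> length ns = length \<theta>. f ns ((map2 hcomp ns \<theta>)[i := hcomp (ns ! i) x]))"
    if "finite A" "S \<theta> \<subseteq> A" "{n. hcomp n x \<noteq> 0} \<subseteq> A" "i < length \<theta>" for \<theta> i x A
  proof (subst homogeneous_extension_superset[OF f that(1)])
    fix y assume "y \<in> set (\<theta>[i := x])"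
    then have "y = x \<or> y \<in> set \<theta>" using set_update_subset_insert[of \<theta> i x] by blast
    then show "{n. hcomp n y \<noteq> 0} \<subseteq> A" using that(2,3) by (auto simp: S_def)
  qed (use that(4) in \<open>auto intro!: sum.cong simp: map2_hcomp_update\<close>)
  show ?thesis
    unfolding normalized_multilinear_def
  proof (intro conjI allI impI)
    have "{ns :: int list. length ns = length ([] :: 'a list) \<and> (\<forall>i<length ([] :: 'a list). hcomp (ns ! i) (([] :: 'a list) ! i) \<noteq> 0)} = {[]}" by auto
    then show "homogeneous_extension f [] = 0"
      using f by (simp add: homogeneous_extension_def graded_multilinear_def)
    fix \<theta> :: "'a list" and i and x y :: 'a assume i: "i < length \<theta>"
    define A where "A = S \<theta> \<union> {n. hcomp n x \<noteq> 0} \<union> {n. hcomp n y \<noteq> 0} \<union> {n. hcomp n (x + y) \<noteq> 0}"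
    have A: "finite A" "S \<theta> \<subseteq> A" "{n. hcomp n x \<noteq> 0} \<subseteq> A" "{n. hcomp n y \<noteq> 0} \<subseteq> A" "{n. hcomp n (x + y) \<noteq> 0} \<subseteq> A"
      by (auto simp: A_def fin finite_hcomp)
    show "homogeneous_extension f (\<theta>[i := x + y]) = homogeneous_extension f (\<theta>[i := x]) + homogeneous_extension f (\<theta>[i := y])"
      unfolding ext[OF A(1,2,3) i] ext[OF A(1,2,4) i] ext[OF A(1,2,5) i] sum.distrib[symmetric]
    proof (rule sum.cong[OF refl], clarify)
      fix ns :: "int list" assume "length ns = length \<theta>"
      then show "f ns ((map2 hcomp ns \<theta>)[i := hcomp (ns ! i) (x + y)]) =
         f ns ((map2 hcomp ns \<theta>)[i := hcomp (ns ! i) x]) + f ns ((map2 hcomp ns \<theta>)[i := hcomp (ns ! i) y])"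
        unfolding hcomp_add using sl[of ns] i by (intro slot_linearD(1)) auto
    qed
  next
    fix \<theta> :: "'a list" and i r and x :: 'a assume i: "i < length \<theta>"
    define A where "A = S \<theta> \<union> {n. hcomp n x \<noteq> 0} \<union> {n. hcomp n (r *\<^sub>C x) \<noteq> 0}"
    have A: "finite A" "S \<theta> \<subseteq> A" "{n. hcomp n x \<noteq> 0} \<subseteq> A" "{n. hcomp n (r *\<^sub>C x) \<noteq> 0} \<subseteq> A"
      by (auto simp: A_def fin finite_hcomp)
    show "homogeneous_extension f (\<theta>[i := r *\<^sub>C x]) = r *\<^sub>C homogeneous_extension f (\<theta>[i := x])"
      unfolding ext[OF A(1,2,3) i] ext[OF A(1,2,4) i] complex_vector.scale_sum_right
    proof (rule sum.cong[OF refl], clarify)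
      fix ns :: "int list" assume "length ns = length \<theta>"
      then show "f ns ((map2 hcomp ns \<theta>)[i := hcomp (ns ! i) (r *\<^sub>C x)]) = r *\<^sub>C f ns ((map2 hcomp ns \<theta>)[i := hcomp (ns ! i) x])"
        unfolding hcomp_scaleC using sl[of ns] i by (intro slot_linearD(2)) auto
    qed
  next
    fix \<theta> :: "'a list" and i assume i: "0 < i \<and> i < length \<theta>"
    define A where "A = S \<theta> \<union> {n. hcomp n (1::'a) \<noteq> 0}"
    have A: "finite A" "S \<theta> \<subseteq> A" "{n. hcomp n (1::'a) \<noteq> 0} \<subseteq> A" by (auto simp: A_def fin finite_hcomp)
    show "homogeneous_extension f (\<theta>[i := 1]) = 0"
      unfolding ext[OF A conjunct2[OF i]]
    proof (rule sum.neutral, clarify)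
      fix ns :: "int list" assume l: "length ns = length \<theta>"
      show "f ns ((map2 hcomp ns \<theta>)[i := hcomp (ns ! i) 1]) = 0"
      proof (cases "ns ! i = 0")
        case True
        with f l i show ?thesis unfolding graded_multilinear_def hcomp_eq[OF homog_one] by simp
      next
        case False
        with l i sl[of ns] show ?thesis
          unfolding hcomp_eq[OF homog_one] by (simp add: slot_linearD(3))
      qed
    qed
  qed
qed

lemma homogeneous_extension_homogeneous:
  assumes f: "graded_multilinear f" and h: "homogeneous_tuple ns \<theta>"
  shows "homogeneous_extension f \<theta> = f ns \<theta>"
proof -
  have l: "length ns = length \<theta>" and hom: "\<And>i. i < length \<theta> \<Longrightarrow> \<theta> ! i \<in> homog (ns ! i)"
    using h by (auto simp: homogeneous_tuple_def list_all2_conv_all_nth)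
  define A where "A = (\<Union>x\<in>set \<theta>. {n. hcomp n x \<noteq> 0}) \<union> set ns"
  have "homogeneous_extension f \<theta> = (\<Sum>ns | set ns \<subseteq> A \<and> length ns = length \<theta>. f ns (map2 hcomp ns \<theta>))"
    by (rule homogeneous_extension_superset[OF f]) (auto simp: A_def finite_hcomp)
  also have "\<dots> = (\<Sum>ns'\<in>{ns}. f ns' (map2 hcomp ns' \<theta>))"
  proof (rule sum.mono_neutral_right)
    show "finite {ns. set ns \<subseteq> A \<and> length ns = length \<theta>}"
      by (rule finite_lists_length_eq) (simp add: A_def finite_hcomp)
    show "{ns} \<subseteq> {ns. set ns \<subseteq> A \<and> length ns = length \<theta>}" using l by (auto simp: A_def)
    show "\<forall>ns'\<in>{ns. set ns \<subseteq> A \<and> length ns = length \<theta>} - {ns}. f ns' (map2 hcomp ns' \<theta>) = 0"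
    proof
      fix ns' assume "ns' \<in> {ns. set ns \<subseteq> A \<and> length ns = length \<theta>} - {ns}"
      then have ns': "length ns' = length \<theta>" "ns' \<noteq> ns" by auto
      then obtain i where i: "i < length \<theta>" "ns' ! i \<noteq> ns ! i" using l by (metis nth_equalityI)
      then have "map2 hcomp ns' \<theta> = (map2 hcomp ns' \<theta>)[i := 0]"
        using map2_hcomp_update[of ns' \<theta> i "\<theta> ! i"] hcomp_eq[OF hom[OF i(1)], of "ns' ! i"] ns'(1) by simp
      moreover have "f ns' ((map2 hcomp ns' \<theta>)[i := 0]) = 0"
        using i ns' by (intro slot_linearD(3)) (auto intro: graded_multilinear_slot[OF f])
      ultimately show "f ns' (map2 hcomp ns' \<theta>) = 0" by simp
    qed
  qed
  also have "\<dots> = f ns (map2 hcomp ns \<theta>)" by simp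
  also have "map2 hcomp ns \<theta> = \<theta>"
    by (rule nth_equalityI) (auto simp: l hcomp_eq[OF hom])
  finally show ?thesis .
qed

lemma chain_ext_homogeneous:
  "graded_multilinear f \<Longrightarrow> homogeneous_tuple ns \<theta> \<Longrightarrow> chain_ext (homogeneous_extension f) (tensor \<theta>) = f ns \<theta>"
  by (simp add: chain_ext_tensor normalized_multilinear_homogeneous_extension homogeneous_extension_homogeneous)

lemma slot_linear_tensor_update:
  fixes L :: "'a::locally_convex_dga \<Rightarrow> 'a"
  assumes "\<And>x y. L (x + y) = L x + L y" "\<And>r x. L (r *\<^sub>C x) = r *\<^sub>C L x"
  shows "slot_linear n (\<lambda>\<theta>. tensor (\<theta>[k := L (\<theta> ! k)]))"
proof (rule slot_linear_tensorI)
  fix \<theta> :: "'a list" and i assume l: "length \<theta> = n" "i < n"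
  show "\<exists>\<eta> j L'. j < length \<eta> \<and> (\<forall>x y. L' (x + y) = L' x + L' y) \<and>
       (\<forall>r x. L' (r *\<^sub>C x) = r *\<^sub>C L' x) \<and>
       (\<forall>x. tensor (\<theta>[i := x, k := L (\<theta>[i := x] ! k)]) = tensor (\<eta>[j := L' x]))"
  proof (cases "k = i")
    case True
    with l assms show ?thesis by (intro exI[of _ \<theta>] exI[of _ i] exI[of _ L]) auto
  next
    case False
    with l show ?thesis
      by (intro exI[of _ "\<theta>[k := L (\<theta> ! k)]"] exI[of _ i] exI[of _ "\<lambda>x. x"]) (auto simp: list_update_swap)
  qed
qed

lemma slot_linear_tensor_mult:
  assumes "Suc k < n"
  shows "slot_linear n (\<lambda>\<theta>. tensor (take k \<theta> @ [\<theta> ! k * \<theta> ! Suc k] @ drop (k + 2) \<theta>))"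
proof (rule slot_linear_tensorI)
  fix \<theta> :: "'a list" and i assume l: "length \<theta> = n" "i < n"
  let ?h = "\<lambda>\<theta> :: 'a list. take k \<theta> @ [\<theta> ! k * \<theta> ! Suc k] @ drop (k + 2) \<theta>"
  consider "i < k" | "i = k" | "i = Suc k" | "Suc k < i" by linarith
  then have "\<exists>j L. j < length (?h \<theta>) \<and> (\<forall>x y. L (x + y) = L x + L y) \<and>
       (\<forall>r x. L (r *\<^sub>C x) = r *\<^sub>C L x) \<and> (\<forall>x. ?h (\<theta>[i := x]) = (?h \<theta>)[j := L x])"
  proof cases
    case 1
    with l assms show ?thesis
      by (intro exI[of _ i] exI[of _ "\<lambda>x. x"]) (auto simp: list_update_append take_update_swap)
  next
    case 2
    with l assms show ?thesis
      by (intro exI[of _ k] exI[of _ "\<lambda>x. x * \<theta> ! Suc k"])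
         (auto simp: list_update_append distrib_right mult_scaleC_left)
  next
    case 3
    with l assms show ?thesis
      by (intro exI[of _ k] exI[of _ "\<lambda>x. \<theta> ! k * x"])
         (auto simp: list_update_append distrib_left mult_scaleC_right)
  next
    case 4
    then obtain j where j: "i = Suc (Suc k) + j" using less_imp_Suc_add by (metis add_Suc_right add_Suc_shift)
    with l assms show ?thesis
      by (intro exI[of _ "Suc k + j"] exI[of _ "\<lambda>x. x"])
         (auto simp: list_update_append drop_update_swap)
  qed
  then obtain j L where jL: "j < length (?h \<theta>)" "\<forall>x y. L (x + y) = L x + L y"
       "\<forall>r x. L (r *\<^sub>C x) = r *\<^sub>C L x" "\<forall>x. ?h (\<theta>[i := x]) = (?h \<theta>)[j := L x]" by blast
  from jL(4) have "\<forall>x. tensor (?h (\<theta>[i := x])) = tensor ((?h \<theta>)[j := L x])" by simp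
  with jL(1-3) show "\<exists>\<eta> j L'. j < length \<eta> \<and> (\<forall>x y. L' (x + y) = L' x + L' y) \<and>
       (\<forall>r x. L' (r *\<^sub>C x) = r *\<^sub>C L' x) \<and> (\<forall>x. tensor (?h (\<theta>[i := x])) = tensor (\<eta>[j := L' x]))"
    by blast
qed

lemma tl_list_update_pos: "0 < i \<Longrightarrow> tl (xs[i := x]) = (tl xs)[i - 1 := x]"
  and tl_list_update_zero: "tl (xs[0 := x]) = tl xs"
  by (cases xs; cases i; simp)+

lemma slot_linear_tensor_cyclic_mult:
  assumes "0 < N" "n = Suc N"
  shows "slot_linear n (\<lambda>\<theta>. tensor ((\<theta> ! N * \<theta> ! 0) # tl (take N \<theta>)))"
proof (rule slot_linear_tensorI)
  fix \<theta> :: "'a list" and i assume l: "length \<theta> = n" "i < n"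
  let ?h = "\<lambda>\<theta> :: 'a list. (\<theta> ! N * \<theta> ! 0) # tl (take N \<theta>)"
  consider "i = 0" | "i = N" | "0 < i" "i < N" using l assms by linarith
  then have "\<exists>j L. j < length (?h \<theta>) \<and> (\<forall>x y. L (x + y) = L x + L y) \<and>
       (\<forall>r x. L (r *\<^sub>C x) = r *\<^sub>C L x) \<and> (\<forall>x. ?h (\<theta>[i := x]) = (?h \<theta>)[j := L x])"
  proof cases
    case 1
    with l assms show ?thesis
      by (intro exI[of _ 0] exI[of _ "\<lambda>x. \<theta> ! N * x"])
         (auto simp: distrib_left mult_scaleC_right take_update_swap tl_list_update_zero)
  next
    case 2
    with l assms show ?thesis
      by (intro exI[of _ 0] exI[of _ "\<lambda>x. x * \<theta> ! 0"])
         (auto simp: distrib_right mult_scaleC_left)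
  next
    case 3
    then show ?thesis using l assms
      by (intro exI[of _ i] exI[of _ "\<lambda>x. x"])
         (auto simp: take_update_swap tl_list_update_pos list_update.simps split: nat.split)
  qed
  then obtain j L where jL: "j < length (?h \<theta>)" "\<forall>x y. L (x + y) = L x + L y"
       "\<forall>r x. L (r *\<^sub>C x) = r *\<^sub>C L x" "\<forall>x. ?h (\<theta>[i := x]) = (?h \<theta>)[j := L x]" by blast
  from jL(4) have "\<forall>x. tensor (?h (\<theta>[i := x])) = tensor ((?h \<theta>)[j := L x])" by simp
  with jL(1-3) show "\<exists>\<eta> j L'. j < length \<eta> \<and> (\<forall>x y. L' (x + y) = L' x + L' y) \<and>
       (\<forall>r x. L' (r *\<^sub>C x) = r *\<^sub>C L' x) \<and> (\<forall>x. tensor (?h (\<theta>[i := x])) = tensor (\<eta>[j := L' x]))"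
    by blast
qed

lemma slot_linear_tensor_rotate:
  assumes "k < n"
  shows "slot_linear n (\<lambda>\<theta>. tensor (1 # drop k \<theta> @ take k \<theta>))"
proof (rule slot_linear_tensorI)
  fix \<theta> :: "'a list" and i assume l: "length \<theta> = n" "i < n"
  let ?h = "\<lambda>\<theta> :: 'a list. 1 # drop k \<theta> @ take k \<theta>"
  have "\<exists>j. j < length (?h \<theta>) \<and> (\<forall>x. ?h (\<theta>[i := x]) = (?h \<theta>)[j := x])"
  proof (cases "i < k")
    case True
    with l assms show ?thesis
      by (intro exI[of _ "Suc (n - k + i)"]) (auto simp: list_update_append take_update_swap)
  next
    case False
    with l assms show ?thesis
      by (intro exI[of _ "Suc (i - k)"]) (auto simp: list_update_append drop_update_swap)
  qed
  then obtain j where j: "j < length (?h \<theta>)" "\<forall>x. ?h (\<theta>[i := x]) = (?h \<theta>)[j := x]" by blast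
  from j(2) have "\<forall>x. tensor (?h (\<theta>[i := x])) = tensor ((?h \<theta>)[j := x])" by simp
  with j(1) show "\<exists>\<eta> j L'. j < length \<eta> \<and> (\<forall>x y. L' (x + y) = L' x + L' y) \<and>
       (\<forall>r x. L' (r *\<^sub>C x) = r *\<^sub>C L' x) \<and> (\<forall>x. tensor (?h (\<theta>[i := x])) = tensor (\<eta>[j := L' x]))"
    by (intro exI[of _ "?h \<theta>"] exI[of _ j] exI[of _ "\<lambda>x. x"]) simp
qed

lemma graded_multilinear_d: "graded_multilinear d_tensor"
  unfolding graded_multilinear_def
proof (intro conjI allI impI)
  show "d_tensor [] [] = (0 :: 'a chain)" by (simp add: d_tensor_def)
  show "slot_linear (length ns) (d_tensor ns :: 'a list \<Rightarrow> 'a chain)" for ns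
  proof (rule slot_linear_cong)
    show "slot_linear (length ns) (\<lambda>\<theta>. tensor (\<theta>[0 := diff (\<theta> ! 0)])
      - (\<Sum>k=1..<length ns. (-1) powi mdeg ns k *\<^sub>C tensor (\<theta>[k := diff (\<theta> ! k :: 'a)])))"
      by (intro slot_linear_diff slot_linear_sum slot_linear_scaleC slot_linear_tensor_update diff_add diff_scaleC)
  qed (simp add: d_tensor_def)
  fix ns :: "int list" and \<theta> :: "'a list" and i assume *: "length ns = length \<theta> \<and> 0 < i \<and> i < length \<theta> \<and> ns ! i = 0"
  let ?\<eta> = "\<theta>[i := 1]"
  have "tensor (?\<eta>[k := diff (?\<eta> ! k)]) = 0" for k
  proof (cases "k = i")
    case True
    with * show ?thesis by (simp add: tensor_update_zero)
  next
    case False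
    with * show ?thesis by (intro tensor_one[of i]) auto
  qed
  then show "d_tensor ns ?\<eta> = 0" unfolding d_tensor_def by simp
qed

lemma mdeg_Suc: "mdeg ns (Suc k) = mdeg ns k + ns ! k - 1"
  by (simp add: mdeg_def)

lemma graded_multilinear_b: "graded_multilinear b_tensor"
  unfolding graded_multilinear_def
proof (intro conjI allI impI)
  show "b_tensor [] [] = (0 :: 'a chain)" by (simp add: b_tensor_def)
  show "slot_linear (length ns) (b_tensor ns :: 'a list \<Rightarrow> 'a chain)" for ns
  proof (cases "length ns - 1 = 0")
    case True
    show ?thesis by (rule slot_linear_cong[OF slot_linear_zero]) (simp add: b_tensor_def True[simplified])
  next
    case False
    define N where "N = length ns - 1"
    have N: "0 < N" "length ns = Suc N" using False by (auto simp: N_def)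
    show ?thesis
    proof (rule slot_linear_cong)
      show "slot_linear (length ns) (\<lambda>\<theta> :: 'a list. - (\<Sum>k<N. (-1) powi mdeg ns (Suc k) *\<^sub>C tensor (take k \<theta> @ [\<theta> ! k * \<theta> ! Suc k] @ drop (k + 2) \<theta>))
          + (-1) powi ((ns ! N - 1) * mdeg ns N) *\<^sub>C tensor ((\<theta> ! N * \<theta> ! 0) # tl (take N \<theta>)))"
        by (intro slot_linear_add slot_linear_uminus slot_linear_sum slot_linear_scaleC slot_linear_tensor_mult
            slot_linear_tensor_cyclic_mult) (use N in auto)
    qed (use N in \<open>simp add: b_tensor_def Let_def\<close>)
  qed
  fix ns :: "int list" and \<theta> :: "'a list" and i assume *: "length ns = length \<theta> \<and> 0 < i \<and> i < length \<theta> \<and> ns ! i = 0"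
  define \<eta> where "\<eta> = \<theta>[i := 1]"
  define N where "N = length \<theta> - 1"
  have N: "0 < N" "length \<eta> = Suc N" "i \<le> N" and \<eta>: "\<eta> ! i = 1" using * by (auto simp: N_def \<eta>_def)
  define t where "t k = tensor (take k \<eta> @ [\<eta> ! k * \<eta> ! Suc k] @ drop (k + 2) \<eta>)" for k
  have t0: "t k = 0" if "k < N" "k \<noteq> i" "Suc k \<noteq> i" for k
  proof (cases "i < k")
    case True
    then show ?thesis unfolding t_def using * N \<eta> that by (intro tensor_one[of i]) (auto simp: nth_append)
  next
    case False
    then have "Suc (Suc (i - 2)) = i" using that by linarith
    then show ?thesis unfolding t_def using * N \<eta> that False
      by (intro tensor_one[of "i - 1"]) (auto simp: nth_append nth_Cons')
  qed
  obtain i' where i': "i = Suc i'" using * by (cases i) auto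
  have t1: "t i' = tensor (take i \<eta> @ drop (Suc i) \<eta>)"
    using N i' \<eta> by (simp add: t_def take_Suc_conv_app_nth)
  have t2: "t i = tensor (take i \<eta> @ drop (Suc i) \<eta>)" if "i < N"
    using N i' \<eta> that by (simp add: t_def Cons_nth_drop_Suc)
  show "b_tensor ns \<eta> = 0"
  proof (cases "i = N")
    case True
    have "(\<Sum>k<N. (-1) powi mdeg ns (Suc k) *\<^sub>C t k) = (\<Sum>k\<in>{i'}. (-1) powi mdeg ns (Suc k) *\<^sub>C t k)"
      by (rule sum.mono_neutral_right) (use True i' t0 in auto)
    moreover have "(\<eta> ! N * \<eta> ! 0) # tl (take N \<eta>) = take i \<eta> @ drop (Suc i) \<eta>"
      using True N \<eta> by (cases \<eta>) (auto simp: take_Cons')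
    moreover have "(-1 :: complex) powi ((ns ! N - 1) * mdeg ns N) = (-1) powi mdeg ns (Suc i')"
      using True * i' by (simp add: power_int_minus_one_minus del: power_int_minus_left)
    ultimately show ?thesis
      using N t1 i' unfolding b_tensor_def t_def by (simp add: Let_def)
  next
    case False
    then have "i < N" using N by simp
    have "(\<Sum>k<N. (-1) powi mdeg ns (Suc k) *\<^sub>C t k) = (\<Sum>k\<in>{i', i}. (-1) powi mdeg ns (Suc k) *\<^sub>C t k)"
      by (rule sum.mono_neutral_right) (use \<open>i < N\<close> i' t0 in auto)
    also have "\<dots> = 0"
    proof -
      have "mdeg ns (Suc i) = mdeg ns (Suc i') - 1" using * i' mdeg_Suc[of ns i] by simp
      then show ?thesis using i' t1 t2[OF \<open>i < N\<close>] by (simp add: power_int_diff)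
    qed
    moreover have "tensor ((\<eta> ! N * \<eta> ! 0) # tl (take N \<eta>)) = 0"
      using \<open>i < N\<close> * N \<eta> by (intro tensor_one[of i]) (auto simp: nth_Cons' nth_tl)
    ultimately show ?thesis
      using N unfolding b_tensor_def t_def by (simp add: Let_def)
  qed
qed

lemma graded_multilinear_B: "graded_multilinear B_tensor"
  unfolding graded_multilinear_def
proof (intro conjI allI impI)
  show "B_tensor [] [] = (0 :: 'a chain)" by (simp add: B_tensor_def)
  show "slot_linear (length ns) (B_tensor ns :: 'a list \<Rightarrow> 'a chain)" for ns
  proof (rule slot_linear_cong)
    show "slot_linear (length ns) (\<lambda>\<theta>. \<Sum>k<length ns. (-1) powi ((mdeg ns k + 1) * (mdeg ns (length ns) - mdeg ns k))
       *\<^sub>C tensor (1 # drop k \<theta> @ take k \<theta> :: 'a list))"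
      by (intro slot_linear_sum slot_linear_scaleC slot_linear_tensor_rotate) simp
  qed (simp add: B_tensor_def)
  fix ns :: "int list" and \<theta> :: "'a list" and i assume *: "length ns = length \<theta> \<and> 0 < i \<and> i < length \<theta> \<and> ns ! i = 0"
  let ?\<eta> = "\<theta>[i := 1]"
  have "tensor (1 # drop k ?\<eta> @ take k ?\<eta>) = 0" if "k < length \<theta>" for k
  proof (cases "i < k")
    case True
    with * that show ?thesis by (intro tensor_one[of "Suc (length \<theta> - k + i)"]) (auto simp: nth_append)
  next
    case False
    with * that show ?thesis by (intro tensor_one[of "Suc (i - k)"]) (auto simp: nth_append)
  qed
  then show "B_tensor ns ?\<eta> = 0" unfolding B_tensor_def by simp
qed

lemma chain_d_tensor: "homogeneous_tuple ns \<theta> \<Longrightarrow> chain_d (tensor \<theta>) = d_tensor ns \<theta>"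
  and chain_b_tensor: "homogeneous_tuple ns \<theta> \<Longrightarrow> chain_b (tensor \<theta>) = b_tensor ns \<theta>"
  and chain_B_tensor: "homogeneous_tuple ns \<theta> \<Longrightarrow> chain_B (tensor \<theta>) = B_tensor ns \<theta>"
  unfolding chain_d_def chain_b_def chain_B_def
  by (simp_all add: chain_ext_homogeneous graded_multilinear_d graded_multilinear_b graded_multilinear_B)

lemma chain_ops_add:
  "chain_d (c + e) = chain_d c + chain_d e" "chain_b (c + e) = chain_b c + chain_b e" "chain_B (c + e) = chain_B c + chain_B e"
  unfolding chain_d_def chain_b_def chain_B_def
  by (simp_all add: chain_ext_add normalized_multilinear_homogeneous_extension
      graded_multilinear_d graded_multilinear_b graded_multilinear_B)

lemma chain_ops_scaleC:
  "chain_d (r *\<^sub>C c) = r *\<^sub>C chain_d c" "chain_b (r *\<^sub>C c) = r *\<^sub>C chain_b c" "chain_B (r *\<^sub>C c) = r *\<^sub>C chain_B c"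
  unfolding chain_d_def chain_b_def chain_B_def
  by (simp_all add: chain_ext_scaleC normalized_multilinear_homogeneous_extension
      graded_multilinear_d graded_multilinear_b graded_multilinear_B)

text \<open>Extension by continuity to the completion (\<open>completion_ext_abs\<close>, \<open>completion_ext_to_completion\<close>).\<close>

definition completion_ext :: "('a::uniform_space \<Rightarrow> 'b::uniform_space) \<Rightarrow> 'a completion \<Rightarrow> 'b completion" where
  "completion_ext f x = Lim (filtercomap to_completion (nhds x)) (\<lambda>c. to_completion (f c))"

lemma cauchy_equiv_filtermap_uniformly_continuous:
  fixes f :: "'a::uniform_space \<Rightarrow> 'b::uniform_space"
  assumes f: "uniformly_continuous_on UNIV f" and FG: "cauchy_equiv F G"
  shows "cauchy_equiv (filtermap f F) (filtermap f G)"
  unfolding cauchy_equiv_def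
proof (intro conjI filter_leI)
  show "filtermap f F \<noteq> bot" "filtermap f G \<noteq> bot" using FG by (auto simp: cauchy_equiv_def filtermap_bot_iff)
  fix E :: "'b \<times> 'b \<Rightarrow> bool" assume "eventually E uniformity"
  then have "eventually (\<lambda>(x, y). E (f x, f y)) uniformity"
    using uniformly_continuous_onD[OF f] by fastforce
  with FG have "eventually (\<lambda>(x, y). E (f x, f y)) (F \<times>\<^sub>F G)" by (auto simp: cauchy_equiv_def le_filter_def)
  then obtain P Q where PQ: "eventually P F" "eventually Q G" "\<And>x y. P x \<Longrightarrow> Q y \<Longrightarrow> E (f x, f y)"
    unfolding eventually_prod_filter by auto
  have "eventually (\<lambda>y. \<exists>x. P x \<and> y = f x) (filtermap f F)" "eventually (\<lambda>y. \<exists>x. Q x \<and> y = f x) (filtermap f G)"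
    using PQ(1,2) by (auto simp: eventually_filtermap elim: eventually_mono)
  then show "eventually E (filtermap f F \<times>\<^sub>F filtermap f G)"
    unfolding eventually_prod_filter using PQ(3) by blast
qed

lemma completion_ext_abs:
  fixes f :: "'a::uniform_space \<Rightarrow> 'b::uniform_space"
  assumes f: "uniformly_continuous_on UNIV f" and F: "cauchy_equiv F F"
  shows "completion_ext f (abs_completion F) = abs_completion (filtermap f F)"
proof -
  define G where "G = filtercomap to_completion (nhds (abs_completion F))"
  have "G \<noteq> bot"
  proof
    assume "G = bot"
    then obtain P where P: "eventually P (nhds (abs_completion F))" "\<And>c. \<not> P (to_completion c)"
      unfolding G_def trivial_limit_def eventually_filtercomap by auto
    have "\<forall>\<^sub>F c in F. P (to_completion c)"
      using tendsto_to_completion[OF F] P(1) unfolding filterlim_iff by blast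
    with P(2) F show False by (simp add: cauchy_equiv_def trivial_limit_def)
  qed
  have "cauchy_equiv G F"
    unfolding cauchy_equiv_def
  proof (intro conjI filter_leI \<open>G \<noteq> bot\<close>)
    show "F \<noteq> bot" using F by (simp add: cauchy_equiv_def)
    fix E :: "'a \<times> 'a \<Rightarrow> bool" assume "eventually E uniformity"
    then obtain P where P: "eventually P uniformity" "\<And>x y. P (to_completion x, to_completion y) \<Longrightarrow> E (x, y)"
      using eventually_to_completion_iff[of E] by blast
    obtain D where D: "eventually D uniformity" "\<And>x y z. D (x, y) \<Longrightarrow> D (y, z) \<Longrightarrow> P (x, z)"
      using uniformity_transE[OF P(1)] by blast
    have n: "eventually (\<lambda>z. D (z, abs_completion F)) (nhds (abs_completion F))"
      "eventually (\<lambda>z. D (abs_completion F, z)) (nhds (abs_completion F))"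
      unfolding eventually_nhds_uniformity using D(1) uniformity_sym[OF D(1)]
      by (auto elim: eventually_mono)
    have "eventually (\<lambda>c. D (to_completion c, abs_completion F)) G"
      unfolding G_def eventually_filtercomap using n(1) by blast
    moreover have "eventually (\<lambda>c. D (abs_completion F, to_completion c)) F"
      using tendsto_to_completion[OF F] n(2) unfolding filterlim_iff by blast
    ultimately show "eventually E (G \<times>\<^sub>F F)"
      unfolding eventually_prod_filter using D(2) P(2) by blast
  qed
  then have eq: "cauchy_equiv (filtermap f G) (filtermap f F)"
    by (rule cauchy_equiv_filtermap_uniformly_continuous[OF f])
  have r: "cauchy_equiv (filtermap f G) (filtermap f G)" "cauchy_equiv (filtermap f F) (filtermap f F)"
    using eq cauchy_equiv_sym cauchy_equiv_trans by blast+
  have "(to_completion \<longlongrightarrow> abs_completion (filtermap f F)) (filtermap f G)"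
    using tendsto_to_completion[OF r(1)] abs_completion_eq[OF r] eq by simp
  then have "((\<lambda>c. to_completion (f c)) \<longlongrightarrow> abs_completion (filtermap f F)) G"
    by (simp add: filterlim_filtermap)
  then show ?thesis
    unfolding completion_ext_def G_def[symmetric] by (rule tendsto_Lim[OF \<open>G \<noteq> bot\<close>])
qed

lemma completion_ext_to_completion:
  assumes "uniformly_continuous_on UNIV f"
  shows "completion_ext f (to_completion c) = to_completion (f c)"
  by (simp add: to_completion_principal completion_ext_abs[OF assms cauchy_equiv_principal] filtermap_principal)

type_synonym 'a entire_chain = "'a chain completion"

definition odd_chains :: "'a::locally_convex_dga chain set" where
  "odd_chains = cspan {tensor \<theta> | ns \<theta>. homogeneous_tuple ns \<theta> \<and> odd (sum_list ns - int (length \<theta> - 1))}"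

definition odd_entire_chains :: "'a::locally_convex_dga entire_chain set" where
  "odd_entire_chains = closure (to_completion ` odd_chains)"

definition incl :: "'a \<Rightarrow> 'a::locally_convex_dga acyc" where
  "incl x = Acyc x 0"

definition sigma :: "'a::locally_convex_dga acyc" where
  "sigma = Acyc 0 1"

lemma acyc_decompose: "\<theta> = incl (form \<theta>) + sigma * incl (sform \<theta>)"
  by (simp add: incl_def sigma_def times_acyc_def acyc_eq_iff)

lemma sigma_supercommutes: "x \<in> homog n \<Longrightarrow> incl x * sigma = (-1) powi n *\<^sub>C (sigma * incl x)"
  by (simp add: incl_def sigma_def times_acyc_def acyc_eq_iff sgn_grading_homog)

lemma sigma_homog: "sigma \<in> homog (-1)" and sigma_square: "sigma * sigma = 0"
  by (simp_all add: sigma_def homog_acyc_def homog_zero homog_one times_acyc_def acyc_eq_iff)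

lemma incl_simps: "incl (x + y) = incl x + incl y" "incl (x * y) = incl x * incl y" "incl 1 = 1"
  "x \<in> homog n \<Longrightarrow> incl x \<in> homog n" "diff (incl x) = incl (diff x)"
  by (simp_all add: incl_def acyc_eq_iff times_acyc_def one_acyc_def homog_acyc_def homog_zero diff_acyc_def)

lemma diff_acyc: "diff \<theta> = incl (diff (form \<theta>)) - sigma * incl (diff (sform \<theta>)) - incl (sform \<theta>)"
  by (simp add: incl_def sigma_def times_acyc_def acyc_eq_iff diff_acyc_def)

definition chen_S :: "'a::locally_convex_dga acyc list \<Rightarrow> 'a acyc chain" where
  "chen_S \<theta> = (\<Sum>k<length \<theta>. tensor (take (Suc k) \<theta> @ [sigma] @ drop (Suc k) \<theta>))"

definition chen_R :: "'a::locally_convex_dga acyc list \<Rightarrow> 'a acyc chain" where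
  "chen_R \<theta> = tensor (\<theta>[0 := sigma * \<theta> ! 0])"

definition chen_Si :: "'a \<Rightarrow> nat \<Rightarrow> int list \<Rightarrow> 'a::locally_convex_dga acyc list \<Rightarrow> 'a acyc chain" where
  "chen_Si f i ns \<theta> = (if i < length \<theta>
     then (-1) powi mdeg ns (Suc i) *\<^sub>C tensor (take (Suc i) \<theta> @ [incl f] @ drop (Suc i) \<theta>) else 0)"

text \<open>Unlike the other operators, \<open>chen_Ti\<close> does not respect the unit relations (they hold only up to images of
  \<open>chen_Si\<close>); its image is the span of its values on all tuples.\<close>

definition chen_Ti :: "'a \<Rightarrow> nat \<Rightarrow> 'a::locally_convex_dga acyc list \<Rightarrow> 'a acyc chain" where
  "chen_Ti f i \<theta> = (let N = length \<theta> - 1 in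
     if i < N then tensor (\<theta>[Suc i := incl f * \<theta> ! Suc i]) - tensor (\<theta>[i := \<theta> ! i * incl f])
                   - tensor (take (Suc i) \<theta> @ [incl (diff f)] @ drop (Suc i) \<theta>)
     else if i = N then tensor (\<theta>[0 := incl f * \<theta> ! 0]) - tensor (\<theta>[N := \<theta> ! N * incl f])
                   - tensor (\<theta> @ [incl (diff f)])
     else 0)"

definition chen_generators :: "'a::locally_convex_dga acyc chain set" where
  "chen_generators = {c. \<exists>ns \<theta>. homogeneous_tuple ns \<theta> \<and>
     (c = chen_S \<theta> + tensor \<theta> \<or> c = chen_R \<theta> \<or>
      (\<exists>f\<in>homog 0. \<exists>i. c = chen_Si f i ns \<theta> \<or> c = chen_Ti f i \<theta>))}"

definition chen_subcomplex :: "'a::locally_convex_dga acyc chain set" where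
  "chen_subcomplex = \<Inter>{V. csubspace V \<and> chen_generators \<subseteq> V \<and> (\<forall>c\<in>V. chain_d c + chain_b c - chain_B c \<in> V)}"

text \<open>Equality in the quotient of the entire chains by the closure of the Chen subcomplex.\<close>

definition chen_normalized_eq :: "'a::locally_convex_dga acyc entire_chain \<Rightarrow> 'a acyc entire_chain \<Rightarrow> bool" where
  "chen_normalized_eq x y \<longleftrightarrow> x - y \<in> closure (to_completion ` chen_subcomplex)"

definition mat_over :: "nat \<Rightarrow> 'a set \<Rightarrow> 'a mat set" where
  "mat_over m S = {A \<in> carrier_mat m m. \<forall>i<m. \<forall>j<m. A $$ (i, j) \<in> S}"

definition GL :: "nat \<Rightarrow> 'a::locally_convex_dga set \<Rightarrow> 'a mat set" where
  "GL m S = {g \<in> mat_over m S. \<exists>h\<in>mat_over m S. g * h = 1\<^sub>m m \<and> h * g = 1\<^sub>m m}"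

definition mat_inverse :: "'a::locally_convex_dga mat \<Rightarrow> 'a mat" where
  "mat_inverse g = (THE h. h \<in> carrier_mat (dim_row g) (dim_row g) \<and> g * h = 1\<^sub>m (dim_row g) \<and> h * g = 1\<^sub>m (dim_row g))"

text \<open>\<open>g\<^sup>-\<^sup>1 dg\<close>\<close>

definition maurer_cartan :: "'a::locally_convex_dga mat \<Rightarrow> 'a mat" where
  "maurer_cartan g = mat_inverse g * map_mat diff g"

definition form_A :: "'a::locally_convex_dga mat \<Rightarrow> real \<Rightarrow> 'a acyc mat" where
  "form_A g s = (let \<omega> = maurer_cartan g in
     map_mat (\<lambda>x. complex_of_real s *\<^sub>C incl x) \<omega>
     - map_mat (\<lambda>x. complex_of_real (s * (1 - s)) *\<^sub>C (sigma * incl x)) (\<omega> * \<omega>))"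

definition form_B :: "'a::locally_convex_dga mat \<Rightarrow> 'a acyc mat" where
  "form_B g = map_mat (\<lambda>x. sigma * incl x) (maurer_cartan g)"

definition generalized_trace :: "nat \<Rightarrow> 'a::locally_convex_dga mat list \<Rightarrow> 'a chain" where
  "generalized_trace m \<Theta> = (\<Sum>is | length is = length \<Theta> \<and> set is \<subseteq> {..<m}.
     tensor (map (\<lambda>j. (\<Theta> ! j) $$ (is ! j, is ! (Suc j mod length \<Theta>))) [0..<length \<Theta>]))"

text \<open>The integral over \<open>[0, 1]\<close> of a polynomial with coefficients in a vector space
  (\<open>polynomial_integral_eq\<close> shows independence of the presentation).\<close>

definition polynomial_integral :: "(real \<Rightarrow> 'b::complex_vec) \<Rightarrow> 'b" where
  "polynomial_integral F = (THE I. \<exists>n v. (\<forall>s\<in>{0..1}. F s = (\<Sum>k\<le>n. complex_of_real (s ^ k) *\<^sub>C v k))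
     \<and> I = (\<Sum>k\<le>n. complex_of_real (1 / real (Suc k)) *\<^sub>C v k))"

definition chern_component :: "'a::locally_convex_dga mat \<Rightarrow> nat \<Rightarrow> 'a acyc chain" where
  "chern_component g N = (if N = 0 then 0 else polynomial_integral (\<lambda>s. \<Sum>k=1..N.
     generalized_trace (dim_row g)
       ([1\<^sub>m (dim_row g)] @ replicate (k - 1) (form_A g s) @ [form_B g] @ replicate (N - k) (form_A g s))))"

definition chern_character :: "'a::locally_convex_dga mat \<Rightarrow> 'a acyc entire_chain" where
  "chern_character g = suminf (\<lambda>N. to_completion (chern_component g N))"

lemma polynomial_coeffs_zero:
  fixes v :: "nat \<Rightarrow> 'b::complex_vec"
  assumes "\<And>s. 0 \<le> s \<Longrightarrow> s \<le> 1 \<Longrightarrow> (\<Sum>k\<le>n. complex_of_real (s ^ k) *\<^sub>C v k) = 0" "k \<le> n"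
  shows "v k = 0"
  using assms
proof (induction n arbitrary: v k)
  case 0
  from 0(1)[of 1] 0(2) show ?case by (simp add: scaleC_one)
next
  case (Suc n)
  define w where "w k = complex_of_real (1 - 2 ^ Suc n * (1 / 2) ^ k) *\<^sub>C v k" for k
  have "(\<Sum>k\<le>n. complex_of_real (s ^ k) *\<^sub>C w k) = 0" if s: "0 \<le> s" "s \<le> 1" for s
  proof -
    let ?F = "\<lambda>s. \<Sum>k\<le>Suc n. complex_of_real (s ^ k) *\<^sub>C v k"
    have "?F s - complex_of_real (2 ^ Suc n) *\<^sub>C ?F (s / 2) = (\<Sum>k\<le>Suc n. complex_of_real (s ^ k) *\<^sub>C w k)"
      unfolding complex_vector.scale_sum_right sum_subtractf[symmetric]
      by (rule sum.cong) (auto simp: w_def scaleC_scaleC power_divide algebra_simps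
          complex_vector.scale_left_diff_distrib)
    moreover have "w (Suc n) = 0" by (simp add: w_def power_divide)
    moreover have "?F s = 0" "?F (s / 2) = 0" by (rule Suc.prems(1); use s in simp)+
    ultimately show ?thesis by simp
  qed
  then have w: "w k = 0" if "k \<le> n" for k using Suc.IH[of w k] that by blast
  have v: "v k = 0" if "k \<le> n" for k
  proof -
    have "(2::real) ^ Suc n * (1 / 2) ^ k \<noteq> 1"
    proof -
      have "(2::real) ^ k < 2 ^ Suc n" using that by (intro power_strict_increasing) auto
      then show ?thesis by (simp add: power_divide field_simps)
    qed
    then have "complex_of_real (1 - 2 ^ Suc n * (1 / 2) ^ k) \<noteq> 0" by (simp only: of_real_eq_0_iff)
    with w[OF that] show ?thesis unfolding w_def complex_vector.scale_eq_0_iff by blast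
  qed
  moreover have "v (Suc n) = 0" using Suc.prems(1)[of 1] v by (simp add: scaleC_one)
  ultimately show ?case using Suc.prems(2) by (auto simp: le_Suc_eq)
qed

lemma polynomial_integral_eq:
  assumes F: "\<And>s. 0 \<le> s \<Longrightarrow> s \<le> 1 \<Longrightarrow> F s = (\<Sum>k\<le>n. complex_of_real (s ^ k) *\<^sub>C v k)"
  shows "polynomial_integral F = (\<Sum>k\<le>n. complex_of_real (1 / real (Suc k)) *\<^sub>C v k)"
  unfolding polynomial_integral_def
proof (rule the_equality)
  fix I assume "\<exists>n v. (\<forall>s\<in>{0..1}. F s = (\<Sum>k\<le>n. complex_of_real (s ^ k) *\<^sub>C v k))
     \<and> I = (\<Sum>k\<le>n. complex_of_real (1 / real (Suc k)) *\<^sub>C v k)"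
  then obtain n' v' where F': "\<And>s. 0 \<le> s \<Longrightarrow> s \<le> 1 \<Longrightarrow> F s = (\<Sum>k\<le>n'. complex_of_real (s ^ k) *\<^sub>C v' k)"
    and I: "I = (\<Sum>k\<le>n'. complex_of_real (1 / real (Suc k)) *\<^sub>C v' k)" by auto
  define N where "N = max n n'"
  define pad where "pad n v k = (if k \<le> n then v k else 0)" for n and v :: "nat \<Rightarrow> 'a" and k
  have pad: "(\<Sum>k\<le>N. a k *\<^sub>C pad n v k) = (\<Sum>k\<le>n. a k *\<^sub>C v k)" if "n \<le> N" for n v and a :: "nat \<Rightarrow> complex"
  proof -
    have "(\<Sum>k\<le>N. a k *\<^sub>C pad n v k) = (\<Sum>k\<le>n. a k *\<^sub>C pad n v k)"
      by (rule sum.mono_neutral_right) (use that in \<open>auto simp: pad_def\<close>)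
    then show ?thesis by (simp add: pad_def)
  qed
  have nN: "n \<le> N" "n' \<le> N" by (auto simp: N_def)
  have "pad n v k - pad n' v' k = 0" if "k \<le> N" for k
  proof (rule polynomial_coeffs_zero[OF _ that])
    fix s :: real assume "0 \<le> s" "s \<le> 1"
    then show "(\<Sum>k\<le>N. complex_of_real (s ^ k) *\<^sub>C (pad n v k - pad n' v' k)) = 0"
      using F[of s] F'[of s] unfolding complex_vector.scale_right_diff_distrib sum_subtractf pad[OF nN(1)] pad[OF nN(2)] by simp
  qed
  then have "(\<Sum>k\<le>N. complex_of_real (1 / real (Suc k)) *\<^sub>C pad n v k) = (\<Sum>k\<le>N. complex_of_real (1 / real (Suc k)) *\<^sub>C pad n' v' k)"
    by (intro sum.cong) auto
  then show "I = (\<Sum>k\<le>n. complex_of_real (1 / real (Suc k)) *\<^sub>C v k)"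
    unfolding I pad[OF nN(1)] pad[OF nN(2)] by simp
qed (use F in auto)

end

theory Submission
  imports Defs
begin

text \<open>Write \<open>\<omega> = g\<^sup>-\<^sup>1 dg\<close>, so \<open>d\<omega> + \<omega>\<^sup>2 = 0\<close>. In the acyclic extension this gives \<open>dA + A\<^sup>2 = 0\<close> and
  \<open>dB + AB - BA = - dA/ds\<close> for \<open>A = \<A>\<^sup>s(g)\<close> and \<open>B = \<B>(g)\<close>, so before integrating, the component of \<open>d + b\<close> with
  \<open>N\<close> slots is the derivative in \<open>s\<close> of \<open>Tr (1 \<otimes> A\<^sup>\<otimes>\<^sup>N)\<close>. As the Connes operator vanishes on chains with
  leading entry \<open>1\<close>, the boundary of \<open>Ch g\<close> is the sum over \<open>N \<ge> 1\<close> of \<open>Tr (1 \<otimes> \<omega>\<^sup>\<otimes>\<^sup>N)\<close>. This sum telescopes modulo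
  the Chen subcomplex: the relation \<open>T\<close> at position \<open>0\<close>, with \<open>f\<close> running over the entries of \<open>g\<close>, together with
  \<open>g \<omega> = dg\<close>, gives \<open>Tr (1 \<otimes> \<omega>\<^sup>\<otimes>\<^sup>N) = U\<^bsub>N-1\<^esub> - U\<^sub>N\<close> for \<open>U\<^sub>N = Tr (g\<^sup>-\<^sup>1 \<otimes> dg \<otimes> \<omega>\<^sup>\<otimes>\<^sup>N)\<close>. Here
  \<open>U\<^sub>0\<close> is itself a cyclic \<open>T\<close>-relation, and \<open>U\<^sub>N\<close> tends to zero in the entire topology.\<close>

subsection \<open>Estimates for the entire seminorms\<close>

text \<open>Two obstacles shape the proof. The operators have explicit formulas on homogeneous
  tuples only, while their extensions live on a completion. Each operator is therefore estimated on
  homogeneous tuples, and the estimate is carried to all tuples, to entries modulo scalars and to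
  infima over representatives. The number of terms of an operator and the loss in the factorial grow
  polynomially with the number of slots; rescaling a seminorm by R multiplies a tensor with N + 1
  entries by R^(N + 1), which absorbs both. Secondly, an element of the completion is only a class
  of Cauchy filters, so the boundary is computed on partial sums. A partial sum leaves its last d
  Ch_n without partner, and the telescoping leaves U_n; both are of order R^n / floor(n/2)!, which
  is how the closure of the Chen subcomplex enters. The integral is algebraic: it commutes with
  linear maps through formal antiderivatives, and its seminorms are bounded by a discrete mean value
  argument.\<close>

lemma seminormI_le:
  assumes "\<And>x y. p (x + y) \<le> p x + p y" and sc: "\<And>r x. p (r *\<^sub>C x) \<le> cmod r * p x"
  shows "seminorm p"
  unfolding seminorm_def
proof (intro conjI allI)
  show "p (x + y) \<le> p x + p y" for x y by fact
  show "p (r *\<^sub>C x) = cmod r * p x" for r x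
  proof (cases "r = 0")
    case True
    then show ?thesis using sc[of 0 x] assms(1)[of 0 0] by simp
  next
    case False
    \<comment> \<open>The reverse inequality is the hypothesis applied to
      \<open>inverse r\<close>.\<close>
    have "p x \<le> cmod (inverse r) * p (r *\<^sub>C x)"
      using sc[of "inverse r" "r *\<^sub>C x"] False by (simp add: scaleC_scaleC scaleC_one)
    then have "cmod r * p x \<le> p (r *\<^sub>C x)" using False by (simp add: norm_divide field_simps)
    with sc[of r x] show ?thesis by simp
  qed
qed

lemma seminorm_sum_le: "seminorm p \<Longrightarrow> p (sum f A) \<le> (\<Sum>i\<in>A. p (f i))"
  by (induction A rule: infinite_finite_induct)
     (auto simp: seminorm_zero intro: order_trans[OF seminorm_add])

lemma rep_weight_scaleC: "seminorm \<nu> \<Longrightarrow> rep_weight \<nu> (r *\<^sub>C u) = cmod r * rep_weight \<nu> u"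
proof -
  have "Poly_Mapping.keys (r *\<^sub>C u) \<subseteq> Poly_Mapping.keys u" by (auto simp: in_keys_iff lookup_scaleC)
  from rep_weight_superset[OF finite_keys this] show ?thesis
    by (simp add: rep_weight_def lookup_scaleC scaleC_complex_def norm_mult sum_distrib_left mult.assoc)
qed

text \<open>Scaling a representative scales its weight. The claim concerns components because for a
  chain without representative of length \<open>Suc N\<close> the infimum runs over the empty
  set.\<close>

lemma projective_seminorm_scaleC_le:
  assumes "seminorm \<nu>"
  shows "projective_seminorm \<nu> N (r *\<^sub>C chain_component N c) \<le> cmod r * projective_seminorm \<nu> N (chain_component N c)"
proof (cases "r = 0")
  case True
  then show ?thesis by (simp add: projective_seminorm_zero[OF assms])
next
  case False
  obtain w where "abs_chain w = chain_component N c" "\<And>\<theta>. \<theta> \<in> Poly_Mapping.keys w \<Longrightarrow> length \<theta> = Suc N"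
    using chain_component_rep by blast
  then have "projective_seminorm \<nu> N (r *\<^sub>C chain_component N c) / cmod r \<le>
     (INF u\<in>{u. abs_chain u = chain_component N c \<and> (\<forall>\<theta>\<in>Poly_Mapping.keys u. length \<theta> = Suc N)}. rep_weight \<nu> u)"
  proof (intro cINF_greatest)
    fix u assume "u \<in> {u. abs_chain u = chain_component N c \<and> (\<forall>\<theta>\<in>Poly_Mapping.keys u. length \<theta> = Suc N)}"
    moreover have "Poly_Mapping.keys (r *\<^sub>C u) \<subseteq> Poly_Mapping.keys u" by (auto simp: in_keys_iff lookup_scaleC)
    ultimately have "projective_seminorm \<nu> N (r *\<^sub>C chain_component N c) \<le> rep_weight \<nu> (r *\<^sub>C u)"
      by (intro projective_seminorm_le[OF assms]) (auto simp: scaleC_chain.abs_eq[symmetric])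
    then show "projective_seminorm \<nu> N (r *\<^sub>C chain_component N c) / cmod r \<le> rep_weight \<nu> u"
      using False by (simp add: rep_weight_scaleC[OF assms] field_simps)
  qed blast
  then show ?thesis using False by (simp add: projective_seminorm_alt field_simps)
qed

lemma seminorm_entire_seminorm:
  assumes "seminorm \<nu>"
  shows "seminorm (entire_seminorm \<nu>)"
proof (rule seminormI_le)
  show "entire_seminorm \<nu> (c + d) \<le> entire_seminorm \<nu> c + entire_seminorm \<nu> d" for c d
    by (rule entire_seminorm_add[OF assms])
  fix r and c :: "'a chain"
  have "entire_seminorm \<nu> (r *\<^sub>C c) \<le> suminf (\<lambda>N. cmod r * (projective_seminorm \<nu> N (chain_component N c) / fact (N div 2)))"
    unfolding entire_seminorm_def
    by (intro suminf_le summable_mult summable_entire_seminorm assms)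
       (auto simp: chain_component_scaleC intro!: divide_right_mono projective_seminorm_scaleC_le assms)
  also have "\<dots> = cmod r * entire_seminorm \<nu> c"
    unfolding entire_seminorm_def by (rule suminf_mult[OF summable_entire_seminorm[OF assms]])
  finally show "entire_seminorm \<nu> (r *\<^sub>C c) \<le> cmod r * entire_seminorm \<nu> c" .
qed

text \<open>A tensor has a single nonzero component, and the tuple itself is a representative that
  bounds the infimum.\<close>

lemma entire_seminorm_tensor_weight_le:
  assumes "seminorm \<nu>"
  shows "entire_seminorm \<nu> (tensor \<theta>) \<le> tensor_weight \<nu> \<theta> / fact ((length \<theta> - 1) div 2)"
proof (cases "\<theta> = []")
  case True
  then show ?thesis by (simp add: entire_seminorm_zero[OF assms] tensor_weight_nonneg[OF assms])
next
  case False
  then obtain n where n: "length \<theta> = Suc n" by (cases \<theta>) auto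
  have "entire_seminorm \<nu> (tensor \<theta>) = (\<Sum>N\<in>{n}. projective_seminorm \<nu> N (chain_component N (tensor \<theta>)) / fact (N div 2))"
    unfolding entire_seminorm_def
    by (rule suminf_finite) (auto simp: chain_component_tensor n projective_seminorm_zero[OF assms])
  also have "\<dots> = projective_seminorm \<nu> n (tensor \<theta>) / fact (n div 2)" by (simp add: chain_component_tensor n)
  also have "projective_seminorm \<nu> n (tensor \<theta>) \<le> rep_weight \<nu> (Poly_Mapping.single \<theta> 1)"
    by (rule projective_seminorm_le[OF assms]) (auto simp: tensor.abs_eq n)
  then have "projective_seminorm \<nu> n (tensor \<theta>) / fact (n div 2) \<le> tensor_weight \<nu> \<theta> / fact (n div 2)"
    by (intro divide_right_mono) (auto simp: rep_weight_def)
  finally show ?thesis by (simp add: n)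
qed

lemma quotient_seminorm_le: "seminorm \<nu> \<Longrightarrow> quotient_seminorm \<nu> x \<le> \<nu> x"
  unfolding quotient_seminorm_def
  by (rule cINF_lower2[where x = 0]) (auto intro!: bdd_belowI2[of _ 0] simp: seminorm_nonneg)

lemma prod_list_seminorm_nonneg: "seminorm \<nu> \<Longrightarrow> 0 \<le> prod_list (map \<nu> \<theta>)"
  by (induction \<theta>) (auto simp: seminorm_nonneg)

lemma prod_list_map_mono:
  fixes f g :: "'a \<Rightarrow> real"
  assumes "\<And>x. x \<in> set xs \<Longrightarrow> 0 \<le> f x" "\<And>x. x \<in> set xs \<Longrightarrow> f x \<le> g x"
  shows "prod_list (map f xs) \<le> prod_list (map g xs)"
proof -
  have "prod_list (map f xs) \<le> prod_list (map g xs) \<and> 0 \<le> prod_list (map f xs)"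
    using assms
  proof (induction xs)
    case (Cons x xs)
    then have "0 \<le> f x" "f x \<le> g x" by auto
    moreover from this have "0 \<le> g x" by linarith
    ultimately show ?case using Cons by (auto intro!: mult_mono)
  qed simp
  then show ?thesis ..
qed

lemma prod_list_map_le_power:
  fixes f :: "'a \<Rightarrow> real"
  assumes "\<And>x. x \<in> set xs \<Longrightarrow> 0 \<le> f x" "\<And>x. x \<in> set xs \<Longrightarrow> f x \<le> K"
  shows "prod_list (map f xs) \<le> K ^ length xs"
  using prod_list_map_mono[of xs f "\<lambda>_. K"] assms by (simp add: map_replicate_const prod_list_replicate)

lemma prod_list_map_mult_const:
  fixes f :: "'a \<Rightarrow> real"
  shows "prod_list (map (\<lambda>x. r * f x) xs) = r ^ length xs * prod_list (map f xs)"
  by (induction xs) auto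

text \<open>Zero is an admissible scalar in the quotient seminorm, which is thus at most \<nu>. This
  coarser bound serves for every explicit tensor below.\<close>

lemma entire_seminorm_tensor_le:
  assumes "seminorm \<nu>"
  shows "entire_seminorm \<nu> (tensor \<theta>) \<le> prod_list (map \<nu> \<theta>) / fact ((length \<theta> - 1) div 2)"
proof (cases \<theta>)
  case Nil
  then show ?thesis by (simp add: entire_seminorm_zero[OF assms])
next
  case (Cons x xs)
  have "tensor_weight \<nu> \<theta> \<le> prod_list (map \<nu> \<theta>)"
    unfolding tensor_weight_def Cons
    by (auto intro!: mult_left_mono prod_list_map_mono simp: seminorm_nonneg assms quotient_seminorm_nonneg quotient_seminorm_le)
  then show ?thesis
    by (intro order_trans[OF entire_seminorm_tensor_weight_le[OF assms]] divide_right_mono) auto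
qed

section \<open>From bounds on tuples to bounds on chains\<close>

lemma tensor_slot_add: "tensor (xs @ (x + y) # zs) = tensor (xs @ x # zs) + tensor (xs @ y # zs)"
  and tensor_slot_scaleC: "tensor (xs @ (r *\<^sub>C x) # zs) = r *\<^sub>C tensor (xs @ x # zs)"
  using slot_linearD(1,2)[OF slot_linear_tensor, of "length xs" "xs @ x # zs"] by simp_all

lemma tensor_slot_zero: "tensor (xs @ 0 # zs) = 0"
  by (rule tensor_zero) simp

lemma tensor_slot_one: "xs \<noteq> [] \<Longrightarrow> tensor (xs @ 1 # zs) = 0"
  by (rule tensor_one[of "length xs"]) auto

lemma tensor_slot_sum: "tensor (xs @ (\<Sum>i\<in>I. u i) # zs) = (\<Sum>i\<in>I. tensor (xs @ u i # zs))"
  by (induction I rule: infinite_finite_induct) (simp_all add: tensor_slot_zero tensor_slot_add)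

text \<open>Since the unit is zero in the positions \<open>1, \<dots>, N\<close>, every representative modulo scalars may be used there.\<close>

lemma bound_tensor_weightI:
  fixes \<Phi> :: "'a::locally_convex_dga chain \<Rightarrow> real"
  assumes \<mu>: "seminorm \<mu>" and C: "0 \<le> C"
    and bound: "\<And>\<eta>. length \<eta> = length \<theta> \<Longrightarrow> \<Phi> (tensor \<eta>) \<le> C * prod_list (map \<mu> \<eta>)"
    and "\<theta> \<noteq> []"
  shows "\<Phi> (tensor \<theta>) \<le> C * tensor_weight \<mu> \<theta>"
proof -
  obtain x ys where \<theta>: "\<theta> = x # ys" using \<open>\<theta> \<noteq> []\<close> by (cases \<theta>) auto
  \<comment> \<open>The slots in \<open>us\<close> already carry the quotient seminorm, those in
    \<open>vs\<close> still carry \<mu>; the induction moves one slot at a time.\<close>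
  have "\<Phi> (tensor (x # us @ vs)) \<le> C * (\<mu> x * prod_list (map (quotient_seminorm \<mu>) us) * prod_list (map \<mu> vs))"
    if "length (us @ vs) = length ys" for us vs
    using that
  proof (induction us arbitrary: vs rule: rev_induct)
    case Nil
    then show ?case using bound[of "x # vs"] by (simp add: \<theta>)
  next
    case (snoc u us)
    define K where "K = C * (\<mu> x * prod_list (map (quotient_seminorm \<mu>) us) * prod_list (map \<mu> vs))"
    have K: "0 \<le> K"
      unfolding K_def
      by (intro mult_nonneg_nonneg C seminorm_nonneg[OF \<mu>] prod_list_nonneg)
         (auto simp: quotient_seminorm_nonneg seminorm_nonneg \<mu>)
    have le: "\<Phi> (tensor (x # (us @ [u]) @ vs)) \<le> K * \<mu> (u + r *\<^sub>C 1)" for r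
    proof -
      have "tensor (x # us @ (u + r *\<^sub>C 1) # vs) = tensor (x # us @ u # vs)"
        using tensor_slot_add[of "x # us" u "r *\<^sub>C 1" vs] tensor_slot_scaleC[of "x # us" r 1 vs]
          tensor_slot_one[of "x # us" vs] by simp
      with snoc.IH[of "(u + r *\<^sub>C 1) # vs"] snoc.prems show ?thesis by (simp add: K_def algebra_simps)
    qed
    have "\<Phi> (tensor (x # (us @ [u]) @ vs)) \<le> K * quotient_seminorm \<mu> u"
    \<comment> \<open>Division by \<open>K\<close> turns the bounds for all \<open>r\<close> into a
      lower bound of the infimum.\<close>
    proof (cases "K = 0")
      case True
      with le[of 0] show ?thesis by simp
    next
      case False
      then have "\<Phi> (tensor (x # (us @ [u]) @ vs)) / K \<le> quotient_seminorm \<mu> u"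
        unfolding quotient_seminorm_def using le K
        by (intro cINF_greatest) (auto simp: field_simps)
      then show ?thesis using False K by (simp add: field_simps)
    qed
    then show ?case by (simp add: K_def algebra_simps)
  qed
  from this[of ys "[]"] show ?thesis by (simp add: \<theta> tensor_weight_def)
qed

text \<open>A bound on homogeneous tuples extends to all tuples at the price of replacing \<open>\<mu>\<close> by this seminorm, which is
  continuous because the topology is that of the direct sum of the homogeneous subspaces.\<close>

definition graded_seminorm :: "('a::locally_convex_dga \<Rightarrow> real) \<Rightarrow> 'a \<Rightarrow> real" where
  "graded_seminorm \<mu> x = (\<Sum>n | hcomp n x \<noteq> 0. \<mu> (hcomp n x))"

lemma graded_seminorm_superset:
  "seminorm \<mu> \<Longrightarrow> finite A \<Longrightarrow> {n. hcomp n x \<noteq> 0} \<subseteq> A \<Longrightarrow> graded_seminorm \<mu> x = (\<Sum>n\<in>A. \<mu> (hcomp n x))"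
  unfolding graded_seminorm_def by (rule sum.mono_neutral_left) (auto simp: seminorm_zero)

lemma cont_seminorm_graded_seminorm:
  assumes "cont_seminorm \<mu>"
  shows "cont_seminorm (graded_seminorm \<mu>)"
proof (rule cont_seminorm_homogI)
  have \<mu>: "seminorm \<mu>" using assms by (rule cont_seminorm_seminorm)
  show "seminorm (graded_seminorm \<mu>)"
  proof (rule seminormI_le)
    fix x y :: 'a and r
    define A where "A = {n. hcomp n x \<noteq> 0} \<union> {n. hcomp n y \<noteq> 0}"
    have A: "finite A" by (simp add: A_def finite_hcomp)
    show "graded_seminorm \<mu> (x + y) \<le> graded_seminorm \<mu> x + graded_seminorm \<mu> y"
      by (subst (1 2 3) graded_seminorm_superset[OF \<mu> A])
         (auto simp: A_def hcomp_add sum.distrib[symmetric] intro!: sum_mono seminorm_add[OF \<mu>])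
    show "graded_seminorm \<mu> (r *\<^sub>C x) \<le> cmod r * graded_seminorm \<mu> x"
      by (subst (1 2) graded_seminorm_superset[OF \<mu> A])
         (auto simp: A_def hcomp_scaleC seminorm_scaleC[OF \<mu>] sum_distrib_left)
  qed
  fix n
  have "graded_seminorm \<mu> x = \<mu> x" if "x \<in> homog n" for x
    by (subst graded_seminorm_superset[OF \<mu>, of "{n}"]) (auto simp: hcomp_eq[OF that])
  moreover have "continuous_on UNIV \<mu>" using assms by (simp add: cont_seminorm_def)
  ultimately show "continuous_on (homog n) (graded_seminorm \<mu>)"
    by (subst continuous_on_cong[OF refl]) (auto intro: continuous_on_subset)
qed

lemma bound_graded_seminormI:
  fixes L :: "'a::locally_convex_dga chain \<Rightarrow> 'b::complex_vec"
  assumes \<mu>: "seminorm \<mu>" and p: "seminorm p" and L: "\<And>c d. L (c + d) = L c + L d"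
    and bound: "\<And>ns \<eta>. homogeneous_tuple ns \<eta> \<Longrightarrow> length \<eta> = length \<theta> \<Longrightarrow> p (L (tensor \<eta>)) \<le> C * prod_list (map \<mu> \<eta>)"
    and "\<theta> \<noteq> []" "0 \<le> C"
  shows "p (L (tensor \<theta>)) \<le> C * prod_list (map (graded_seminorm \<mu>) \<theta>)"
proof -
  have L0: "L 0 = 0" using L[of 0 0] by simp
  have Lsum: "L (sum c I) = (\<Sum>i\<in>I. L (c i))" for c and I :: "int set"
    by (induction I rule: infinite_finite_induct) (simp_all add: L0 L)
  \<comment> \<open>The entries in \<open>us\<close> are already homogeneous; the induction splits
    the first entry of \<open>vs\<close> into its components, and the resulting sum factors.\<close>
  have "p (L (tensor (us @ vs))) \<le> C * (prod_list (map \<mu> us) * prod_list (map (graded_seminorm \<mu>) vs))"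
    if "length (us @ vs) = length \<theta>" "list_all2 (\<lambda>n x. x \<in> homog n) ns us" for us vs ns
    using that
  proof (induction vs arbitrary: us ns)
    case Nil
    then have "homogeneous_tuple ns us" using \<open>\<theta> \<noteq> []\<close> by (auto simp: homogeneous_tuple_def)
    with bound Nil show ?case by simp
  next
    case (Cons v vs)
    let ?S = "{n. hcomp n v \<noteq> 0}" and ?K = "prod_list (map \<mu> us)" and ?M = "prod_list (map (graded_seminorm \<mu>) vs)"
    have "p (L (tensor (us @ v # vs))) = p (\<Sum>n\<in>?S. L (tensor (us @ hcomp n v # vs)))"
      using tensor_slot_sum[of us "\<lambda>n. hcomp n v" ?S vs] by (simp add: sum_hcomp Lsum)
    also have "\<dots> \<le> (\<Sum>n\<in>?S. p (L (tensor (us @ hcomp n v # vs))))" by (rule seminorm_sum_le[OF p])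
    also have "\<dots> \<le> (\<Sum>n\<in>?S. C * ((?K * \<mu> (hcomp n v)) * ?M))"
    proof (rule sum_mono)
      fix n
      have "list_all2 (\<lambda>n x. x \<in> homog n) (ns @ [n]) (us @ [hcomp n v])"
        using Cons.prems(2) by (auto intro!: list_all2_appendI simp: hcomp_homog)
      from Cons.IH[OF _ this] Cons.prems(1) show "p (L (tensor (us @ hcomp n v # vs))) \<le> C * ((?K * \<mu> (hcomp n v)) * ?M)"
        by simp
    qed
    also have "\<dots> = C * (?K * (graded_seminorm \<mu> v * ?M))"
      by (simp add: graded_seminorm_def sum_distrib_left sum_distrib_right mult.assoc)
    finally show ?case by simp
  qed
  from this[of "[]" \<theta> "[]"] show ?thesis by simp
qed

lemma abs_chain_eq_sum:
  "abs_chain u = (\<Sum>\<theta>\<in>Poly_Mapping.keys u. Poly_Mapping.lookup u \<theta> *\<^sub>C tensor \<theta>)"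
proof -
  have "u = (\<Sum>\<theta>\<in>Poly_Mapping.keys u. Poly_Mapping.single \<theta> (Poly_Mapping.lookup u \<theta>))"
    by (rule poly_mapping_eqI) (simp add: lookup_sum lookup_single when_def in_keys_iff)
  then have "abs_chain u = abs_chain (\<Sum>\<theta>\<in>Poly_Mapping.keys u. Poly_Mapping.single \<theta> (Poly_Mapping.lookup u \<theta>))"
    by simp
  then show ?thesis
    unfolding abs_chain_sum
    by (simp add: single_scaleC[of _ "Poly_Mapping.lookup u _"] scaleC_chain.abs_eq[symmetric] tensor.abs_eq)
qed

lemma chain_eq_sum_components:
  "\<exists>M. (\<Sum>N<M. chain_component N c) = c \<and> (\<forall>N\<ge>M. chain_component N c = 0)"
proof -
  obtain u where u: "c = abs_chain u" by (rule chain_cases)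
  have "finite (length ` Poly_Mapping.keys u)" by simp
  then obtain M where M: "\<And>\<theta>. \<theta> \<in> Poly_Mapping.keys u \<Longrightarrow> length \<theta> < M"
    by (auto simp: finite_nat_set_iff_bounded)
  have comp: "chain_component N c = (\<Sum>\<theta>\<in>Poly_Mapping.keys u. if length \<theta> = Suc N then Poly_Mapping.lookup u \<theta> *\<^sub>C tensor \<theta> else 0)" for N
    unfolding chain_component_def u chain_ext_abs[OF normalized_multilinear_component] linear_extension_def
    by (rule sum.cong) auto
  have "(\<Sum>N<M. chain_component N c) = (\<Sum>\<theta>\<in>Poly_Mapping.keys u. \<Sum>N<M. if length \<theta> = Suc N then Poly_Mapping.lookup u \<theta> *\<^sub>C tensor \<theta> else 0)"
    unfolding comp by (rule sum.swap)
  also have "\<dots> = (\<Sum>\<theta>\<in>Poly_Mapping.keys u. Poly_Mapping.lookup u \<theta> *\<^sub>C tensor \<theta>)"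
  proof (rule sum.cong[OF refl])
    fix \<theta> assume \<theta>: "\<theta> \<in> Poly_Mapping.keys u"
    show "(\<Sum>N<M. if length \<theta> = Suc N then Poly_Mapping.lookup u \<theta> *\<^sub>C tensor \<theta> else 0) = Poly_Mapping.lookup u \<theta> *\<^sub>C tensor \<theta>"
    \<comment> \<open>The empty list belongs to no component; its tensor is zero, so both sides
      vanish.\<close>
    proof (cases \<theta>)
      case (Cons x xs)
      then have "(length \<theta> = Suc N) = (N = length xs)" for N by auto
      moreover have "length xs < M" using M[OF \<theta>] Cons by simp
      ultimately show ?thesis by simp
    qed simp
  qed
  also have "\<dots> = abs_chain u" by (rule abs_chain_eq_sum[symmetric])
  finally have "(\<Sum>N<M. chain_component N c) = c" by (simp add: u)
  moreover have "chain_component N c = 0" if "M \<le> N" for N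
    unfolding comp by (rule sum.neutral) (use M that in force)
  ultimately show ?thesis by blast
qed

text \<open>The universal property of the projective seminorm, degree by degree: a bound on
  elementary tensors passes to sums over a representative and then to the infimum over
  representatives.\<close>

lemma entire_seminorm_bound_from_tensors:
  fixes L :: "'a::locally_convex_dga chain \<Rightarrow> 'b::complex_vec"
  assumes \<mu>: "seminorm \<mu>" and p: "seminorm p"
    and L: "\<And>c d. L (c + d) = L c + L d" "\<And>r c. L (r *\<^sub>C c) = r *\<^sub>C L c"
    and bound: "\<And>\<theta>. \<theta> \<noteq> [] \<Longrightarrow> p (L (tensor \<theta>)) \<le> C * tensor_weight \<mu> \<theta> / fact ((length \<theta> - 1) div 2)"
    and C: "0 \<le> C"
  shows "p (L c) \<le> C * entire_seminorm \<mu> c"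
proof -
  have L0: "L 0 = 0" using L(1)[of 0 0] by simp
  have Lsum: "L (sum f I) = (\<Sum>i\<in>I. L (f i))" for f and I :: "'i set"
    by (induction I rule: infinite_finite_induct) (simp_all add: L0 L)
  have comp: "p (L (chain_component N c)) \<le> C * projective_seminorm \<mu> N (chain_component N c) / fact (N div 2)" for N
  proof -
    have le: "p (L (chain_component N c)) \<le> C / fact (N div 2) * rep_weight \<mu> u"
      if u: "abs_chain u = chain_component N c" "\<forall>\<theta>\<in>Poly_Mapping.keys u. length \<theta> = Suc N" for u
    proof -
      have "chain_component N c = (\<Sum>\<theta>\<in>Poly_Mapping.keys u. Poly_Mapping.lookup u \<theta> *\<^sub>C tensor \<theta>)"
        unfolding u(1)[symmetric] by (rule abs_chain_eq_sum)
      then have "L (chain_component N c) = (\<Sum>\<theta>\<in>Poly_Mapping.keys u. Poly_Mapping.lookup u \<theta> *\<^sub>C L (tensor \<theta>))"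
        by (simp add: Lsum L)
      then have "p (L (chain_component N c)) \<le> (\<Sum>\<theta>\<in>Poly_Mapping.keys u. cmod (Poly_Mapping.lookup u \<theta>) * p (L (tensor \<theta>)))"
        by (simp add: seminorm_scaleC[OF p, symmetric] seminorm_sum_le[OF p])
      also have "\<dots> \<le> (\<Sum>\<theta>\<in>Poly_Mapping.keys u. cmod (Poly_Mapping.lookup u \<theta>) * (C / fact (N div 2) * tensor_weight \<mu> \<theta>))"
      proof (intro sum_mono mult_left_mono norm_ge_zero)
        fix \<theta> assume "\<theta> \<in> Poly_Mapping.keys u"
        with u(2) have "length \<theta> = Suc N" by blast
        with bound[of \<theta>] show "p (L (tensor \<theta>)) \<le> C / fact (N div 2) * tensor_weight \<mu> \<theta>" by fastforce
      qed
      also have "\<dots> = C / fact (N div 2) * rep_weight \<mu> u"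
        by (simp add: rep_weight_def sum_distrib_left algebra_simps)
      finally show ?thesis .
    qed
    obtain w where w: "abs_chain w = chain_component N c" "\<And>\<theta>. \<theta> \<in> Poly_Mapping.keys w \<Longrightarrow> length \<theta> = Suc N"
      using chain_component_rep by blast
    show ?thesis
    proof (cases "C = 0")
      case True
      with le[of w] w show ?thesis by simp
    next
      case False
      with C have pos: "0 < C / fact (N div 2)" by simp
      have "p (L (chain_component N c)) / (C / fact (N div 2)) \<le> projective_seminorm \<mu> N (chain_component N c)"
        unfolding projective_seminorm_alt
      proof (rule cINF_greatest)
        fix u assume "u \<in> {u. abs_chain u = chain_component N c \<and> (\<forall>\<theta>\<in>Poly_Mapping.keys u. length \<theta> = Suc N)}"
        then show "p (L (chain_component N c)) / (C / fact (N div 2)) \<le> rep_weight \<mu> u"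
          using le[of u] pos by (subst pos_divide_le_eq[OF pos]) (simp add: mult.commute)
      qed (use w in blast)
      then show ?thesis by (subst (asm) pos_divide_le_eq[OF pos]) (simp add: mult.commute)
    qed
  qed
  obtain M where M: "(\<Sum>N<M. chain_component N c) = c" "\<And>N. M \<le> N \<Longrightarrow> chain_component N c = 0"
    using chain_eq_sum_components[of c] by blast
  have "p (L c) = p (\<Sum>N<M. L (chain_component N c))" using M(1) Lsum[of "\<lambda>N. chain_component N c" "{..<M}"] by simp
  also have "\<dots> \<le> (\<Sum>N<M. p (L (chain_component N c)))" by (rule seminorm_sum_le[OF p])
  also have "\<dots> \<le> (\<Sum>N<M. C * (projective_seminorm \<mu> N (chain_component N c) / fact (N div 2)))"
    using comp by (intro sum_mono) simp
  also have "\<dots> = C * entire_seminorm \<mu> c"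
    unfolding entire_seminorm_def sum_distrib_left[symmetric]
    by (subst suminf_finite[of "{..<M}"]) (auto simp: M(2) projective_seminorm_zero[OF \<mu>])
  finally show ?thesis .
qed

text \<open>Since \<open>entire_seminorm \<mu>\<close> is not homogeneous in \<mu>, the constant
  \<open>C\<close> is kept apart from the seminorm.\<close>

definition bounded_chain_map :: "('a::locally_convex_dga chain \<Rightarrow> 'b::locally_convex_dga chain) \<Rightarrow> bool" where
  "bounded_chain_map L \<longleftrightarrow> (\<forall>\<nu>. cont_seminorm \<nu> \<longrightarrow>
     (\<exists>C \<mu>. 0 \<le> C \<and> cont_seminorm \<mu> \<and> (\<forall>c. entire_seminorm \<nu> (L c) \<le> C * entire_seminorm \<mu> c)))"

text \<open>Reduces continuity to homogeneous tuples, where the signed formulas hold: the graded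
  seminorm reaches all tuples, the unit relations give tensor weights, and representatives give
  chains.\<close>

lemma bounded_chain_mapI:
  fixes L :: "'a::locally_convex_dga chain \<Rightarrow> 'b::locally_convex_dga chain"
  assumes L: "\<And>c d. L (c + d) = L c + L d" "\<And>r c. L (r *\<^sub>C c) = r *\<^sub>C L c"
    and bound: "\<And>\<nu>. cont_seminorm \<nu> \<Longrightarrow> \<exists>C \<mu>. 0 \<le> C \<and> cont_seminorm \<mu> \<and> (\<forall>ns \<theta>. homogeneous_tuple ns \<theta> \<longrightarrow>
       entire_seminorm \<nu> (L (tensor \<theta>)) \<le> C * prod_list (map \<mu> \<theta>) / fact ((length \<theta> - 1) div 2))"
  shows "bounded_chain_map L"
  unfolding bounded_chain_map_def
proof (intro allI impI)
  fix \<nu> :: "'b \<Rightarrow> real" assume \<nu>: "cont_seminorm \<nu>"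
  then obtain C \<mu> where C: "0 \<le> C" and \<mu>: "cont_seminorm \<mu>" and b: "\<And>ns \<theta>. homogeneous_tuple ns \<theta> \<Longrightarrow>
       entire_seminorm \<nu> (L (tensor \<theta>)) \<le> C * prod_list (map \<mu> \<theta>) / fact ((length \<theta> - 1) div 2)"
    using bound by metis
  have s: "seminorm (entire_seminorm \<nu>)" "seminorm \<mu>" "seminorm (graded_seminorm \<mu>)"
    using \<nu> \<mu> by (auto intro: seminorm_entire_seminorm cont_seminorm_seminorm cont_seminorm_graded_seminorm)
  have "entire_seminorm \<nu> (L c) \<le> C * entire_seminorm (graded_seminorm \<mu>) c" for c
  proof (rule entire_seminorm_bound_from_tensors[OF s(3,1) L _ C])
    fix \<theta> :: "'a list" assume "\<theta> \<noteq> []"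
    let ?F = "fact ((length \<theta> - 1) div 2) :: real"
    have "entire_seminorm \<nu> (L (tensor \<theta>)) \<le> C / ?F * tensor_weight (graded_seminorm \<mu>) \<theta>"
    proof (rule bound_tensor_weightI[where \<Phi> = "\<lambda>c. entire_seminorm \<nu> (L c)", OF s(3) _ _ \<open>\<theta> \<noteq> []\<close>])
      fix \<eta> :: "'a list" assume "length \<eta> = length \<theta>"
      then show "entire_seminorm \<nu> (L (tensor \<eta>)) \<le> C / ?F * prod_list (map (graded_seminorm \<mu>) \<eta>)"
        using \<open>\<theta> \<noteq> []\<close> C b by (intro bound_graded_seminormI[OF s(2,1) L(1)]) fastforce+
    qed (use C in simp)
    then show "entire_seminorm \<nu> (L (tensor \<theta>)) \<le> C * tensor_weight (graded_seminorm \<mu>) \<theta> / ?F" by simp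
  qed
  then show "\<exists>C \<mu>. 0 \<le> C \<and> cont_seminorm \<mu> \<and> (\<forall>c. entire_seminorm \<nu> (L c) \<le> C * entire_seminorm \<mu> c)"
    using C cont_seminorm_graded_seminorm[OF \<mu>] by blast
qed

lemma bounded_chain_map_uniformly_continuous:
  fixes L :: "'a::locally_convex_dga chain \<Rightarrow> 'b::locally_convex_dga chain"
  assumes L: "\<And>c d. L (c - d) = L c - L d" and "bounded_chain_map L"
  shows "uniformly_continuous_on UNIV L"
  unfolding uniformly_continuous_on_uniformity filterlim_iff
proof (intro allI impI)
  fix P :: "'b chain \<times> 'b chain \<Rightarrow> bool" assume "eventually P uniformity"
  then obtain \<nu> e where \<nu>: "cont_seminorm \<nu>" "0 < e" "\<And>c d. entire_seminorm \<nu> (c - d) < e \<Longrightarrow> P (c, d)"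
    unfolding eventually_uniformity_chain by blast
  then obtain C \<mu> where C: "0 \<le> C" "cont_seminorm \<mu>" "\<And>c. entire_seminorm \<nu> (L c) \<le> C * entire_seminorm \<mu> c"
    using assms(2) unfolding bounded_chain_map_def by metis
  \<comment> \<open>\<open>C + 1\<close> replaces \<open>C\<close>, which may be zero.\<close>
  have "P (L c, L d)" if "entire_seminorm \<mu> (c - d) < e / (C + 1)" for c d
  proof (rule \<nu>(3))
    have "0 \<le> entire_seminorm \<mu> (c - d)"
      using C(2) by (intro seminorm_nonneg seminorm_entire_seminorm cont_seminorm_seminorm)
    then have "C * entire_seminorm \<mu> (c - d) \<le> (C + 1) * entire_seminorm \<mu> (c - d)" by (simp add: mult_right_mono)
    also have "\<dots> < e" using that C(1) by (simp add: field_simps)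
    finally show "entire_seminorm \<nu> (L c - L d) < e" using C(3)[of "c - d"] by (simp add: L)
  qed
  moreover have "0 < e / (C + 1)" using C \<nu> by simp
  ultimately show "\<forall>\<^sub>F x in inf uniformity (principal (UNIV \<times> UNIV)). P (case x of (x, y) \<Rightarrow> (L x, L y))"
    using C(2) by (auto simp: eventually_uniformity_chain)
qed

subsection \<open>Continuity of the operators\<close>

lemma cont_seminorm_diff_comp:
  fixes \<nu> :: "'a::locally_convex_dga \<Rightarrow> real"
  assumes "cont_seminorm \<nu>"
  shows "cont_seminorm (\<lambda>x. \<nu> (diff x))"
  using assms unfolding cont_seminorm_def continuous_on_UNIV_nhds
  by (auto simp: seminorm_def diff_add diff_scaleC intro: filterlim_compose[OF _ tendsto_diff_nhds])

text \<open>Continuity at the origin gives \<mu> with \<open>\<nu> (v * w) < 1\<close> on its unit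
  ball. Scaling \<open>x\<close> and \<open>y\<close> into that ball needs positive divisors, hence
  \<open>\<mu> x + e\<close> with \<open>e\<close> tending to zero.\<close>

lemma cont_seminorm_mult_le:
  fixes \<nu> :: "'a::locally_convex_dga \<Rightarrow> real"
  assumes "cont_seminorm \<nu>"
  obtains \<mu> where "cont_seminorm \<mu>" "\<And>x y. \<nu> (x * y) \<le> \<mu> x * \<mu> y"
proof -
  have s: "seminorm \<nu>" using assms by (rule cont_seminorm_seminorm)
  have "open {z. \<nu> (z - 0) < 1}" by (rule open_seminorm_ball[OF assms]) simp
  then have "eventually (\<lambda>z. \<nu> z < 1) (nhds (0 * 0))"
    using eventually_nhds_in_open[of "{z. \<nu> (z - 0) < 1}" "0 * 0"] by (simp add: seminorm_zero[OF s])
  from eventually_compose_filterlim[OF this tendsto_mult_nhds]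
  have "eventually (\<lambda>(v, w). \<nu> (v * w) < 1) (nhds 0 \<times>\<^sub>F nhds 0)"
    by (simp add: case_prod_unfold)
  then obtain P where P: "eventually P (nhds (0::'a))" "\<And>v w. P v \<Longrightarrow> P w \<Longrightarrow> \<nu> (v * w) < 1"
    unfolding eventually_prod_same by auto
  then obtain U where U: "open U" "0 \<in> U" "\<And>v. v \<in> U \<Longrightarrow> P v" unfolding eventually_nhds by blast
  then obtain \<mu> where \<mu>: "cont_seminorm \<mu>" "\<And>v. \<mu> (v - 0) < 1 \<Longrightarrow> v \<in> U"
    unfolding open_iff_cont_seminorm by blast
  have s\<mu>: "seminorm \<mu>" using \<mu>(1) by (rule cont_seminorm_seminorm)
  have lt: "\<nu> (v * w) < 1" if "\<mu> v < 1" "\<mu> w < 1" for v w using P(2) U(3) \<mu>(2) that by simp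
  have "\<nu> (x * y) \<le> \<mu> x * \<mu> y" for x y
  proof (rule tendsto_lowerbound)
    have e: "\<nu> (x * y) \<le> (\<mu> x + e) * (\<mu> y + e)" if "0 < e" for e
    proof -
      define a b where "a = \<mu> x + e" and "b = \<mu> y + e"
      have ab: "0 < a" "0 < b" "\<mu> x < a" "\<mu> y < b"
        using that seminorm_nonneg[OF s\<mu>] by (auto simp: a_def b_def add_nonneg_pos)
      have "\<nu> ((complex_of_real (1 / a) *\<^sub>C x) * (complex_of_real (1 / b) *\<^sub>C y)) < 1"
        using ab by (intro lt) (auto simp: seminorm_scaleC[OF s\<mu>] norm_divide)
      then show ?thesis
        using ab unfolding mult_scaleC_left mult_scaleC_right seminorm_scaleC[OF s] a_def[symmetric] b_def[symmetric]
        by (simp add: norm_divide field_simps)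
    qed
    show "\<forall>\<^sub>F e in at_right 0. \<nu> (x * y) \<le> (\<mu> x + e) * (\<mu> y + e)"
      using eventually_at_right_less[of "0::real"] by eventually_elim (rule e)
    show "((\<lambda>e. (\<mu> x + e) * (\<mu> y + e)) \<longlongrightarrow> \<mu> x * \<mu> y) (at_right 0)"
      by (auto intro!: tendsto_eq_intros)
  qed simp
  with \<mu>(1) show thesis by (rule that)
qed

lemma prod_list_mono_nonneg:
  assumes "list_all2 (\<lambda>a b :: real. 0 \<le> a \<and> a \<le> b) xs ys"
  shows "0 \<le> prod_list xs" "prod_list xs \<le> prod_list ys"
proof -
  have "0 \<le> prod_list xs \<and> prod_list xs \<le> prod_list ys"
    using assms by (induction) (auto intro!: mult_mono intro: order_trans)
  then show "0 \<le> prod_list xs" "prod_list xs \<le> prod_list ys" by auto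
qed

lemma entire_seminorm_tensor_leI:
  assumes "seminorm \<nu>" "length \<theta> = Suc N" "prod_list (map \<nu> \<theta>) \<le> K"
  shows "entire_seminorm \<nu> (tensor \<theta>) \<le> K / fact (N div 2)"
  using entire_seminorm_tensor_le[OF assms(1), of \<theta>] divide_right_mono[OF assms(3), of "fact (N div 2)"]
  by (simp add: assms(2))

lemma seminorm_sgn_scale: "seminorm p \<Longrightarrow> p ((-1) powi n *\<^sub>C x) = p x"
  by (simp add: seminorm_scaleC norm_power_int)

lemma real_le_two_power: "real n \<le> 2 ^ n"
  by (rule less_imp_le[OF of_nat_less_two_power])

lemma chain_ops_minus:
  "chain_d (c - e) = chain_d c - chain_d e" "chain_b (c - e) = chain_b c - chain_b e" "chain_B (c - e) = chain_B c - chain_B e"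
  using chain_ops_add[of c "(-1) *\<^sub>C e"] chain_ops_scaleC[of "-1" e] by simp_all

text \<open>The length and so the factorial are preserved; the number of terms is at most
  \<open>2 ^ length \<theta>\<close>, whence the factor 2 in the seminorm.\<close>

lemma bounded_chain_map_d: "bounded_chain_map (chain_d :: 'a::locally_convex_dga chain \<Rightarrow> _)"
proof (rule bounded_chain_mapI[OF chain_ops_add(1) chain_ops_scaleC(1)])
  fix \<nu> :: "'a \<Rightarrow> real" assume \<nu>: "cont_seminorm \<nu>"
  define m where "m x = max (\<nu> x) (\<nu> (diff x))" for x
  have m: "cont_seminorm m" unfolding m_def by (intro cont_seminorm_max cont_seminorm_diff_comp \<nu>)
  have s: "seminorm \<nu>" "seminorm (entire_seminorm \<nu>)"
    using \<nu> by (auto intro: seminorm_entire_seminorm cont_seminorm_seminorm)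
  have "entire_seminorm \<nu> (chain_d (tensor \<theta>)) \<le> 1 * prod_list (map (\<lambda>x. 2 * m x) \<theta>) / fact ((length \<theta> - 1) div 2)"
    if h: "homogeneous_tuple ns \<theta>" for ns \<theta>
  proof -
    let ?F = "fact ((length \<theta> - 1) div 2) :: real" and ?t = "\<lambda>k. tensor (\<theta>[k := diff (\<theta> ! k)])"
    have \<theta>: "0 < length \<theta>" using h by (auto simp: homogeneous_tuple_def)
    have t: "entire_seminorm \<nu> (?t k) \<le> prod_list (map m \<theta>) / ?F" if "k < length \<theta>" for k
    proof -
      have "prod_list (map \<nu> (\<theta>[k := diff (\<theta> ! k)])) \<le> prod_list (map m \<theta>)"
        by (rule prod_list_mono_nonneg) (use that in \<open>auto simp: list_all2_conv_all_nth m_def nth_list_update seminorm_nonneg s\<close>)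
      then show ?thesis
        using entire_seminorm_tensor_le[OF s(1), of "\<theta>[k := diff (\<theta> ! k)]"]
        by (elim order_trans) (simp add: divide_right_mono)
    qed
    have "d_tensor ns \<theta> = ?t 0 + (\<Sum>k=1..<length \<theta>. - ((-1) powi mdeg ns k *\<^sub>C ?t k))"
      by (simp add: d_tensor_def sum_negf)
    then have "entire_seminorm \<nu> (d_tensor ns \<theta>) \<le> entire_seminorm \<nu> (?t 0) + (\<Sum>k=1..<length \<theta>. entire_seminorm \<nu> (?t k))"
      using seminorm_sum_le[OF s(2), of "\<lambda>k. - ((-1) powi mdeg ns k *\<^sub>C ?t k)" "{1..<length \<theta>}"]
      by (auto simp: seminorm_uminus[OF s(2)] seminorm_sgn_scale[OF s(2)] intro: order_trans[OF seminorm_add[OF s(2)]])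
    also have "\<dots> = (\<Sum>k<length \<theta>. entire_seminorm \<nu> (?t k))"
      using \<theta> by (simp add: lessThan_atLeast0 sum.atLeast_Suc_lessThan)
    also have "\<dots> \<le> (\<Sum>k<length \<theta>. prod_list (map m \<theta>) / ?F)" by (intro sum_mono t) simp
    also have "\<dots> = real (length \<theta>) * (prod_list (map m \<theta>) / ?F)" by simp
    also have "\<dots> \<le> 2 ^ length \<theta> * (prod_list (map m \<theta>) / ?F)"
      using prod_list_seminorm_nonneg[OF cont_seminorm_seminorm[OF m]]
      by (intro mult_right_mono real_le_two_power) auto
    finally show ?thesis by (simp add: chain_d_tensor[OF h] prod_list_map_mult_const)
  qed
  moreover have "cont_seminorm (\<lambda>x. 2 * m x)" by (rule cont_seminorm_mult_left[OF m]) simp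
  ultimately show "\<exists>C \<mu>. 0 \<le> C \<and> cont_seminorm \<mu> \<and> (\<forall>ns \<theta>. homogeneous_tuple ns \<theta> \<longrightarrow>
     entire_seminorm \<nu> (chain_d (tensor \<theta>)) \<le> C * prod_list (map \<mu> \<theta>) / fact ((length \<theta> - 1) div 2))"
    by (intro exI[of _ 1] exI[of _ "\<lambda>x. 2 * m x"]) auto
qed

text \<open>One slot is added, which only improves the factorial. The new unit contributes the
  constant \<open>\<nu> 1\<close>, the number of rotations the factor 2 in the seminorm.\<close>

lemma bounded_chain_map_B: "bounded_chain_map (chain_B :: 'a::locally_convex_dga chain \<Rightarrow> _)"
proof (rule bounded_chain_mapI[OF chain_ops_add(3) chain_ops_scaleC(3)])
  fix \<nu> :: "'a \<Rightarrow> real" assume \<nu>: "cont_seminorm \<nu>"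
  have s: "seminorm \<nu>" "seminorm (entire_seminorm \<nu>)"
    using \<nu> by (auto intro: seminorm_entire_seminorm cont_seminorm_seminorm)
  have "entire_seminorm \<nu> (chain_B (tensor \<theta>)) \<le> \<nu> 1 * prod_list (map (\<lambda>x. 2 * \<nu> x) \<theta>) / fact ((length \<theta> - 1) div 2)"
    if h: "homogeneous_tuple ns \<theta>" for ns \<theta>
  proof -
    let ?F = "fact ((length \<theta> - 1) div 2) :: real" and ?t = "\<lambda>k. tensor (1 # drop k \<theta> @ take k \<theta>)"
    let ?P = "\<nu> 1 * prod_list (map \<nu> \<theta>)"
    have P: "0 \<le> ?P" by (intro mult_nonneg_nonneg seminorm_nonneg prod_list_seminorm_nonneg s)
    have t: "entire_seminorm \<nu> (?t k) \<le> ?P / ?F" if "k < length \<theta>" for k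
    proof -
      have "prod_list (map \<nu> (1 # drop k \<theta> @ take k \<theta>)) = ?P"
        by (subst (3) append_take_drop_id[of k \<theta>, symmetric]) (simp del: append_take_drop_id)
      then have "entire_seminorm \<nu> (?t k) \<le> ?P / fact (length \<theta> div 2)"
        by (intro entire_seminorm_tensor_leI[OF s(1)]) (use that in auto)
      also have "\<dots> \<le> ?P / ?F"
        by (intro divide_left_mono P fact_mono) (auto simp: div_le_mono)
      finally show ?thesis .
    qed
    have "entire_seminorm \<nu> (B_tensor ns \<theta>) \<le> (\<Sum>k<length \<theta>. entire_seminorm \<nu> (?t k))"
      unfolding B_tensor_def
      by (rule order_trans[OF seminorm_sum_le[OF s(2)]]) (simp add: seminorm_sgn_scale[OF s(2)])
    also have "\<dots> \<le> (\<Sum>k<length \<theta>. ?P / ?F)" by (intro sum_mono t) simp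
    also have "\<dots> = real (length \<theta>) * (?P / ?F)" by simp
    also have "\<dots> \<le> 2 ^ length \<theta> * (?P / ?F)"
      using P by (intro mult_right_mono real_le_two_power) auto
    finally show ?thesis
      unfolding chain_B_tensor[OF h] prod_list_map_mult_const by (simp add: algebra_simps)
  qed
  moreover have "cont_seminorm (\<lambda>x. 2 * \<nu> x)" by (rule cont_seminorm_mult_left[OF \<nu>]) simp
  ultimately show "\<exists>C \<mu>. 0 \<le> C \<and> cont_seminorm \<mu> \<and> (\<forall>ns \<theta>. homogeneous_tuple ns \<theta> \<longrightarrow>
     entire_seminorm \<nu> (chain_B (tensor \<theta>)) \<le> C * prod_list (map \<mu> \<theta>) / fact ((length \<theta> - 1) div 2))"
    using seminorm_nonneg[OF s(1)] by (intro exI[of _ "\<nu> 1"] exI[of _ "\<lambda>x. 2 * \<nu> x"]) auto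
qed

text \<open>The cost of losing one slot under \<open>b\<close>: for even positive N the half-index
  drops by one and the factorial loses the factor N/2; otherwise it is unchanged.\<close>

lemma inverse_fact_half_le: "1 / fact ((N - 1) div 2) \<le> real (Suc N) / fact (N div 2)"
proof (cases "even N \<and> 0 < N")
  case True
  then obtain b where "N = 2 * b" "0 < b" by auto
  then obtain j where "N = 2 * Suc j" by (cases b) auto
  moreover have "1 / fact j = (real j + 1) / fact (Suc j)"
  proof -
    have "1 + real j \<noteq> 0" by (simp add: add_nonneg_eq_0_iff)
    then show ?thesis by (simp add: add.commute)
  qed
  moreover have "(real j + 1) / fact (Suc j) \<le> real (Suc (2 * Suc j)) / fact (Suc j)" by (rule divide_right_mono) auto
  ultimately show ?thesis by simp
next
  case False
  then have "(N - 1) div 2 = N div 2" by (cases N) auto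
  then show ?thesis by (simp add: divide_right_mono)
qed

text \<open>Two factors \<open>Suc N\<close> arise, one from the number of terms and one from the
  shorter tensors; each is at most \<open>2 ^ Suc N\<close>, whence the 4 in the seminorm.\<close>

lemma bounded_chain_map_b: "bounded_chain_map (chain_b :: 'a::locally_convex_dga chain \<Rightarrow> _)"
proof (rule bounded_chain_mapI[OF chain_ops_add(2) chain_ops_scaleC(2)])
  fix \<nu> :: "'a \<Rightarrow> real" assume \<nu>: "cont_seminorm \<nu>"
  obtain \<mu> where \<mu>: "cont_seminorm \<mu>" "\<And>x y. \<nu> (x * y) \<le> \<mu> x * \<mu> y" using cont_seminorm_mult_le[OF \<nu>] by blast
  define m where "m x = max (\<nu> x) (\<mu> x)" for x
  have m: "cont_seminorm m" unfolding m_def by (intro cont_seminorm_max \<mu>(1) \<nu>)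
  have s: "seminorm \<nu>" "seminorm (entire_seminorm \<nu>)" "seminorm m"
    using \<nu> m by (auto intro: seminorm_entire_seminorm cont_seminorm_seminorm)
  have mono: "prod_list (map \<nu> xs) \<le> prod_list (map m xs)" for xs
    by (rule prod_list_map_mono) (auto simp: m_def seminorm_nonneg s)
  have m_mult: "\<nu> (x * y) \<le> m x * m y" for x y
  proof -
    have "0 \<le> \<mu> x" "0 \<le> \<mu> y" using \<mu>(1) by (simp_all add: seminorm_nonneg cont_seminorm_seminorm)
    then have "\<mu> x * \<mu> y \<le> m x * m y" by (intro mult_mono) (auto simp: m_def)
    with \<mu>(2)[of x y] show ?thesis by linarith
  qed
  note nn = prod_list_seminorm_nonneg[OF s(1)] prod_list_seminorm_nonneg[OF s(3)] seminorm_nonneg[OF s(1)] seminorm_nonneg[OF s(3)]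
  have "entire_seminorm \<nu> (chain_b (tensor \<theta>)) \<le> 1 * prod_list (map (\<lambda>x. 4 * m x) \<theta>) / fact ((length \<theta> - 1) div 2)"
    if h: "homogeneous_tuple ns \<theta>" for ns \<theta>
  proof (cases "length \<theta> - 1 = 0")
    case True
    then show ?thesis
      using nn by (simp add: chain_b_tensor[OF h] b_tensor_def seminorm_zero[OF s(2)] prod_list_map_mult_const)
  next
    case False
    define N where "N = length \<theta> - 1"
    have N: "0 < N" "length \<theta> = Suc N" using False by (auto simp: N_def)
    let ?F = "fact ((N - 1) div 2) :: real" and ?P = "prod_list (map m \<theta>)"
    let ?t = "\<lambda>k. tensor (take k \<theta> @ [\<theta> ! k * \<theta> ! Suc k] @ drop (k + 2) \<theta>)"
    let ?u = "tensor ((\<theta> ! N * \<theta> ! 0) # tl (take N \<theta>))"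
    have t: "entire_seminorm \<nu> (?t k) \<le> ?P / ?F" if k: "k < N" for k
    proof -
      have eq: "\<theta> = take k \<theta> @ [\<theta> ! k, \<theta> ! Suc k] @ drop (k + 2) \<theta>"
        using k N by (simp add: Cons_nth_drop_Suc)
      have "?P = prod_list (map m (take k \<theta>)) * ((m (\<theta> ! k) * m (\<theta> ! Suc k)) * prod_list (map m (drop (k + 2) \<theta>)))"
        by (subst eq) (simp add: algebra_simps)
      moreover have "prod_list (map \<nu> (take k \<theta> @ [\<theta> ! k * \<theta> ! Suc k] @ drop (k + 2) \<theta>))
          \<le> prod_list (map m (take k \<theta>)) * ((m (\<theta> ! k) * m (\<theta> ! Suc k)) * prod_list (map m (drop (k + 2) \<theta>)))"
        using mono m_mult nn by (simp, intro mult_mono mult_nonneg_nonneg) auto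
      ultimately show ?thesis by (intro entire_seminorm_tensor_leI[OF s(1)]) (use k N in auto)
    qed
    have u: "entire_seminorm \<nu> ?u \<le> ?P / ?F"
    proof -
      have eq: "\<theta> = \<theta> ! 0 # tl (take N \<theta>) @ [\<theta> ! N]"
      proof -
        obtain x ys where ys: "\<theta> = x # ys" "ys \<noteq> []" using N by (cases \<theta>) auto
        then show ?thesis using N by (cases ys rule: rev_cases) auto
      qed
      have "?P = m (\<theta> ! N) * m (\<theta> ! 0) * prod_list (map m (tl (take N \<theta>)))"
        by (subst eq) (simp add: algebra_simps)
      moreover have "prod_list (map \<nu> ((\<theta> ! N * \<theta> ! 0) # tl (take N \<theta>)))
          \<le> m (\<theta> ! N) * m (\<theta> ! 0) * prod_list (map m (tl (take N \<theta>)))"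
        using mono m_mult nn by (simp, intro mult_mono mult_nonneg_nonneg) auto
      ultimately show ?thesis by (intro entire_seminorm_tensor_leI[OF s(1)]) (use N in auto)
    qed
    have "b_tensor ns \<theta> = - (\<Sum>k<N. (-1) powi mdeg ns (Suc k) *\<^sub>C ?t k) + (-1) powi ((ns ! N - 1) * mdeg ns N) *\<^sub>C ?u"
      using N by (simp add: b_tensor_def Let_def)
    then have "entire_seminorm \<nu> (b_tensor ns \<theta>) \<le> (\<Sum>k<N. entire_seminorm \<nu> (?t k)) + entire_seminorm \<nu> ?u"
      using seminorm_sum_le[OF s(2), of "\<lambda>k. (-1) powi mdeg ns (Suc k) *\<^sub>C ?t k" "{..<N}"]
        seminorm_add[OF s(2), of "- (\<Sum>k<N. (-1) powi mdeg ns (Suc k) *\<^sub>C ?t k)" "(-1) powi ((ns ! N - 1) * mdeg ns N) *\<^sub>C ?u"]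
      by (simp only: seminorm_uminus[OF s(2)] seminorm_sgn_scale[OF s(2)])
    also have "\<dots> \<le> (\<Sum>k<N. ?P / ?F) + ?P / ?F" by (intro add_mono sum_mono t u) simp
    also have "\<dots> = (?P * real (Suc N)) * (1 / ?F)" by (simp add: field_simps)
    also have "\<dots> \<le> (?P * real (Suc N)) * (real (Suc N) / fact (N div 2))"
      using nn by (intro mult_left_mono inverse_fact_half_le mult_nonneg_nonneg) auto
    also have "\<dots> = ?P * (real (Suc N) * real (Suc N)) / fact (N div 2)" by simp
    also have "\<dots> \<le> ?P * (2 ^ Suc N * 2 ^ Suc N) / fact (N div 2)"
      using nn by (intro divide_right_mono mult_left_mono mult_mono real_le_two_power) auto
    also have "(2::real) ^ Suc N * 2 ^ Suc N = 4 ^ Suc N" by (simp flip: power_mult_distrib)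
    finally show ?thesis
      unfolding chain_b_tensor[OF h] prod_list_map_mult_const N by (simp add: algebra_simps)
  qed
  moreover have "cont_seminorm (\<lambda>x. 4 * m x)" by (rule cont_seminorm_mult_left[OF m]) simp
  ultimately show "\<exists>C \<mu>. 0 \<le> C \<and> cont_seminorm \<mu> \<and> (\<forall>ns \<theta>. homogeneous_tuple ns \<theta> \<longrightarrow>
     entire_seminorm \<nu> (chain_b (tensor \<theta>)) \<le> C * prod_list (map \<mu> \<theta>) / fact ((length \<theta> - 1) div 2))"
    by (intro exI[of _ 1] exI[of _ "\<lambda>x. 4 * m x"]) auto
qed

subsection \<open>Integration of polynomials\<close>

text \<open>\<open>polynomial_integral\<close> is defined through coefficients; formal antiderivatives avoid comparing presentations.\<close>

inductive poly_deriv :: "(real \<Rightarrow> 'b::complex_vec) \<Rightarrow> (real \<Rightarrow> 'b) \<Rightarrow> bool" where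
  monom: "poly_deriv (\<lambda>s. complex_of_real (s ^ k) *\<^sub>C v) (\<lambda>s. complex_of_real (real k * s ^ (k - 1)) *\<^sub>C v)"
| add: "poly_deriv F F' \<Longrightarrow> poly_deriv G G' \<Longrightarrow> poly_deriv (\<lambda>s. F s + G s) (\<lambda>s. F' s + G' s)"

lemma poly_deriv_const: "poly_deriv (\<lambda>s. v) (\<lambda>s. 0)"
  using poly_deriv.monom[of 0 v] by (simp add: scaleC_one)

lemma poly_deriv_sum:
  "(\<And>i. i \<in> I \<Longrightarrow> poly_deriv (F i) (F' i)) \<Longrightarrow> poly_deriv (\<lambda>s. \<Sum>i\<in>I. F i s) (\<lambda>s. \<Sum>i\<in>I. F' i s)"
  by (induction I rule: infinite_finite_induct) (auto intro: poly_deriv_const poly_deriv.add)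

lemma poly_deriv_scale_monom:
  assumes "poly_deriv F F'"
  shows "poly_deriv (\<lambda>s. complex_of_real (s ^ k) *\<^sub>C F s)
    (\<lambda>s. complex_of_real (real k * s ^ (k - 1)) *\<^sub>C F s + complex_of_real (s ^ k) *\<^sub>C F' s)"
  using assms
proof induction
  case (monom j v)
  have "real (k + j) * s ^ (k + j - 1) = real k * s ^ (k - 1) * s ^ j + s ^ k * (real j * s ^ (j - 1))" for s :: real
    by (cases k; cases j) (simp_all add: power_add algebra_simps)
  then have 1: "complex_of_real (real (k + j) * s ^ (k + j - 1)) *\<^sub>C v =
     complex_of_real (real k * s ^ (k - 1)) *\<^sub>C complex_of_real (s ^ j) *\<^sub>C v +
     complex_of_real (s ^ k) *\<^sub>C complex_of_real (real j * s ^ (j - 1)) *\<^sub>C v" for s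
    unfolding scaleC_scaleC scaleC_add_left[symmetric] of_real_mult[symmetric] of_real_add[symmetric] by simp
  have 2: "complex_of_real (s ^ (k + j)) *\<^sub>C v = complex_of_real (s ^ k) *\<^sub>C complex_of_real (s ^ j) *\<^sub>C v" for s
    by (simp add: scaleC_scaleC power_add)
  from poly_deriv.monom[of "k + j" v] show ?case by (simp only: 1 2)
next
  case (add F F' G G')
  from poly_deriv.add[OF add.IH] show ?case by (simp add: scaleC_add_right add_ac)
qed

lemma poly_deriv_linear:
  assumes "poly_deriv F F'" and L: "\<And>x y. L (x + y) = L x + L y" "\<And>r x. L (r *\<^sub>C x) = r *\<^sub>C L x"
  shows "poly_deriv (\<lambda>s. L (F s)) (\<lambda>s. L (F' s))"
  using assms(1) by induction (simp_all only: L poly_deriv.intros)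

text \<open>The product rule for a family linear in its vector argument: on a monomial, linearity
  pulls the power of \<open>s\<close> out of \<open>F\<close>.\<close>

lemma poly_deriv_bilinear:
  assumes "poly_deriv u u'" and F: "\<And>x. poly_deriv (F x) (F' x)"
    and "\<And>x y s. F (x + y) s = F x s + F y s" "\<And>r x s. F (r *\<^sub>C x) s = r *\<^sub>C F x s"
    and "\<And>x y s. F' (x + y) s = F' x s + F' y s" "\<And>r x s. F' (r *\<^sub>C x) s = r *\<^sub>C F' x s"
  shows "poly_deriv (\<lambda>s. F (u s) s) (\<lambda>s. F (u' s) s + F' (u s) s)"
  using assms(1)
proof induction
  case (monom k v)
  from poly_deriv_scale_monom[OF F[of v], of k] show ?case by (simp add: assms)
next
  case (add u u' v v')
  from poly_deriv.add[OF add.IH] show ?case by (simp add: assms add_ac)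
qed

lemma poly_deriv_antiderivative:
  assumes "poly_deriv F F'"
  obtains G where "poly_deriv G F"
proof -
  from assms have "\<exists>G. poly_deriv G F"
  proof induction
    case (monom k v)
    have "complex_of_real (real (Suc k) * s ^ (Suc k - 1)) *\<^sub>C complex_of_real (1 / real (Suc k)) *\<^sub>C v
       = complex_of_real (s ^ k) *\<^sub>C v" for s
      unfolding scaleC_scaleC of_real_mult[symmetric] by simp
    with poly_deriv.monom[of "Suc k" "complex_of_real (1 / real (Suc k)) *\<^sub>C v"] show ?case by (auto simp only:)
  next
    case (add F F' G G')
    then show ?case using poly_deriv.add by blast
  qed
  then show thesis using that by blast
qed

text \<open>The fundamental theorem of calculus. The coefficient formula is proved for every
  \<open>N \<ge> n\<close>, so that two presentations can be added at a common length.\<close>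

lemma polynomial_integral_poly_deriv:
  assumes "poly_deriv G F"
  shows "polynomial_integral F = G 1 - G 0"
proof -
  from assms have "\<exists>n v. \<forall>N\<ge>n. (\<forall>s. F s = (\<Sum>k\<le>N. complex_of_real (s ^ k) *\<^sub>C v k)) \<and>
     G 1 - G 0 = (\<Sum>k\<le>N. complex_of_real (1 / real (Suc k)) *\<^sub>C v k)"
  proof induction
    case (monom k v)
    \<comment> \<open>The derivative of \<open>s ^ k\<close> has the single coefficient
      \<open>k\<close>, at index \<open>k - 1\<close>; the condition \<open>Suc j = k\<close> makes
      it vanish for \<open>k = 0\<close>.\<close>
    define w where "w j = (if Suc j = k then complex_of_real (real k) *\<^sub>C v else 0)" for j
    have eq: "(\<Sum>j\<le>N. a j *\<^sub>C w j) = (a (k - 1) * of_nat k) *\<^sub>C v" if "k \<le> N" for N and a :: "nat \<Rightarrow> complex"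
    proof (cases k)
      case 0
      then show ?thesis by (simp add: w_def)
    next
      case (Suc i)
      then have "(\<Sum>j\<le>N. a j *\<^sub>C w j) = (\<Sum>j\<in>{i}. a j *\<^sub>C w j)"
        using that by (intro sum.mono_neutral_right) (auto simp: w_def)
      then show ?thesis by (simp add: w_def Suc scaleC_scaleC)
    qed
    have "complex_of_real (1 ^ k) *\<^sub>C v - complex_of_real (0 ^ k) *\<^sub>C v = (complex_of_real (1 / real (Suc (k - 1))) * of_nat k) *\<^sub>C v"
      by (cases k) (simp_all add: scaleC_one del: of_nat_Suc)
    then show ?case
      by (intro exI[of _ k] exI[of _ w]) (simp add: eq mult.commute)
  next
    case (add F F' G G')
    from add.IH(1) obtain n v where
      1: "\<And>N. n \<le> N \<Longrightarrow> (\<forall>s. F' s = (\<Sum>k\<le>N. complex_of_real (s ^ k) *\<^sub>C v k)) \<and>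
         F 1 - F 0 = (\<Sum>k\<le>N. complex_of_real (1 / real (Suc k)) *\<^sub>C v k)" by (elim exE) blast
    from add.IH(2) obtain n' v' where
      2: "\<And>N. n' \<le> N \<Longrightarrow> (\<forall>s. G' s = (\<Sum>k\<le>N. complex_of_real (s ^ k) *\<^sub>C v' k)) \<and>
         G 1 - G 0 = (\<Sum>k\<le>N. complex_of_real (1 / real (Suc k)) *\<^sub>C v' k)" by (elim exE) blast
    show ?case
    proof (intro exI[of _ "max n n'"] exI[of _ "\<lambda>k. v k + v' k"] allI impI conjI)
      fix N s assume "max n n' \<le> N"
      then have N: "n \<le> N" "n' \<le> N" by auto
      show "F' s + G' s = (\<Sum>k\<le>N. complex_of_real (s ^ k) *\<^sub>C (v k + v' k))"
        using 1[OF N(1), THEN conjunct1, rule_format, of s] 2[OF N(2), THEN conjunct1, rule_format, of s]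
        by (simp add: scaleC_add_right sum.distrib)
      have "F 1 + G 1 - (F 0 + G 0) = (F 1 - F 0) + (G 1 - G 0)" by simp
      then show "F 1 + G 1 - (F 0 + G 0) = (\<Sum>k\<le>N. complex_of_real (1 / real (Suc k)) *\<^sub>C (v k + v' k))"
        using 1[OF N(1), THEN conjunct2] 2[OF N(2), THEN conjunct2]
        by (simp only: scaleC_add_right sum.distrib)
    qed
  qed
  then obtain n v where "\<And>s. F s = (\<Sum>k\<le>n. complex_of_real (s ^ k) *\<^sub>C v k)"
     "G 1 - G 0 = (\<Sum>k\<le>n. complex_of_real (1 / real (Suc k)) *\<^sub>C v k)" by blast
  then show ?thesis using polynomial_integral_eq[where F = F and n = n and v = v] by simp
qed

section \<open>Seminorm bounds for integrals of polynomials\<close>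

lemma power_taylor_bound:
  fixes s t :: real
  assumes "0 \<le> s" "s \<le> 1" "0 \<le> t" "t \<le> 1"
  shows "\<bar>t ^ k - s ^ k - (t - s) * (real k * s ^ (k - 1))\<bar> \<le> (real k)\<^sup>2 * (t - s)\<^sup>2"
proof (induction k)
  case (Suc k)
  let ?E = "t ^ k - s ^ k - (t - s) * (real k * s ^ (k - 1))"
  \<comment> \<open>The remainder for \<open>Suc k\<close> is \<open>t\<close> times that for
    \<open>k\<close> plus a term of size at most \<open>k * (t - s)^2\<close>; the constants
    \<open>k^2\<close> satisfy \<open>k^2 + k \<le> (k + 1)^2\<close>.\<close>
  have "t ^ Suc k - s ^ Suc k - (t - s) * (real (Suc k) * s ^ (Suc k - 1)) = t * ?E + (real k * s ^ (k - 1)) * (t - s)\<^sup>2"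
    by (cases k) (simp_all add: algebra_simps power2_eq_square)
  also have "\<bar>\<dots>\<bar> \<le> \<bar>t * ?E\<bar> + \<bar>(real k * s ^ (k - 1)) * (t - s)\<^sup>2\<bar>" by (rule abs_triangle_ineq)
  also have "\<dots> \<le> 1 * ((real k)\<^sup>2 * (t - s)\<^sup>2) + (real k * 1) * (t - s)\<^sup>2"
  proof (rule add_mono)
    show "\<bar>t * ?E\<bar> \<le> 1 * ((real k)\<^sup>2 * (t - s)\<^sup>2)"
      unfolding abs_mult using Suc assms by (intro mult_mono) auto
    have "s ^ (k - 1) \<le> 1" "0 \<le> s ^ (k - 1)" using assms by (auto intro: power_le_one)
    then show "\<bar>(real k * s ^ (k - 1)) * (t - s)\<^sup>2\<bar> \<le> (real k * 1) * (t - s)\<^sup>2"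
      unfolding abs_mult by (intro mult_mono) auto
  qed
  also have "\<dots> = ((real k)\<^sup>2 + real k) * (t - s)\<^sup>2" by (simp add: algebra_simps)
  also have "\<dots> \<le> (real (Suc k))\<^sup>2 * (t - s)\<^sup>2" by (intro mult_right_mono zero_le_power2) (simp add: power2_eq_square algebra_simps)
  finally show ?case .
qed simp

lemma poly_deriv_taylor_bound:
  assumes p: "seminorm p" and "poly_deriv G F"
  shows "\<exists>M\<ge>0. \<forall>s\<in>{0..1}. \<forall>t\<in>{0..1}. p (G t - G s - complex_of_real (t - s) *\<^sub>C F s) \<le> M * (t - s)\<^sup>2"
  using assms(2)
proof induction
  case (monom k v)
  show ?case
  proof (intro exI[of _ "(real k)\<^sup>2 * p v"] conjI ballI)
    fix s t :: real assume st: "s \<in> {0..1}" "t \<in> {0..1}"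
    have "complex_of_real (t ^ k) *\<^sub>C v - complex_of_real (s ^ k) *\<^sub>C v
        - complex_of_real (t - s) *\<^sub>C complex_of_real (real k * s ^ (k - 1)) *\<^sub>C v
      = complex_of_real (t ^ k - s ^ k - (t - s) * (real k * s ^ (k - 1))) *\<^sub>C v"
      unfolding scaleC_scaleC by (simp add: complex_vector.scale_left_diff_distrib)
    then show "p (complex_of_real (t ^ k) *\<^sub>C v - complex_of_real (s ^ k) *\<^sub>C v
        - complex_of_real (t - s) *\<^sub>C complex_of_real (real k * s ^ (k - 1)) *\<^sub>C v) \<le> (real k)\<^sup>2 * p v * (t - s)\<^sup>2"
      using mult_right_mono[OF power_taylor_bound[of s t k] seminorm_nonneg[OF p, of v]] st
      by (simp add: seminorm_scaleC[OF p] mult_ac del: of_real_diff of_real_mult)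
  qed (simp add: seminorm_nonneg[OF p])
next
  case (add F F' G G')
  from add.IH(1) obtain M where M1: "0 \<le> M"
    "\<forall>s\<in>{0..1}. \<forall>t\<in>{0..1}. p (F t - F s - complex_of_real (t - s) *\<^sub>C F' s) \<le> M * (t - s)\<^sup>2"
    by (elim exE conjE)
  from add.IH(2) obtain M' where M2: "0 \<le> M'"
    "\<forall>s\<in>{0..1}. \<forall>t\<in>{0..1}. p (G t - G s - complex_of_real (t - s) *\<^sub>C G' s) \<le> M' * (t - s)\<^sup>2"
    by (elim exE conjE)
  note M = M1(1) M2(1) M1(2)[rule_format] M2(2)[rule_format]
  show ?case
  proof (intro exI[of _ "M + M'"] conjI ballI)
    fix s t :: real assume st: "s \<in> {0..1}" "t \<in> {0..1}"
    have "F t + G t - (F s + G s) - complex_of_real (t - s) *\<^sub>C (F' s + G' s) =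
       (F t - F s - complex_of_real (t - s) *\<^sub>C F' s) + (G t - G s - complex_of_real (t - s) *\<^sub>C G' s)"
      by (simp add: scaleC_add_right)
    then show "p (F t + G t - (F s + G s) - complex_of_real (t - s) *\<^sub>C (F' s + G' s)) \<le> (M + M') * (t - s)\<^sup>2"
      using seminorm_add[OF p, of "F t - F s - complex_of_real (t - s) *\<^sub>C F' s" "G t - G s - complex_of_real (t - s) *\<^sub>C G' s"]
        M(3)[OF st] M(4)[OF st] by (simp only: distrib_right)
  qed (use M in simp)
qed

text \<open>A mean value inequality by telescoping over \<open>n\<close> equal steps: each costs
  \<open>C / n\<close> plus a Taylor remainder \<open>M / n^2\<close>, so the total error is
  \<open>M / n\<close>.\<close>

lemma seminorm_poly_deriv_le:
  assumes p: "seminorm p" and G: "poly_deriv G F" and C: "\<And>s. 0 \<le> s \<Longrightarrow> s \<le> 1 \<Longrightarrow> p (F s) \<le> C"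
  shows "p (G 1 - G 0) \<le> C"
proof (rule field_le_epsilon)
  fix e :: real assume "0 < e"
  obtain M where "0 \<le> M"
    "\<forall>s\<in>{0..1}. \<forall>t\<in>{0..1}. p (G t - G s - complex_of_real (t - s) *\<^sub>C F s) \<le> M * (t - s)\<^sup>2"
    using poly_deriv_taylor_bound[OF p G] by (elim exE conjE)
  note M = this(1) this(2)[rule_format]
  obtain n where n: "M / e < real n" using reals_Archimedean2 by blast
  then have n0: "0 < real n" using M(1) \<open>0 < e\<close> by (meson divide_nonneg_pos le_less_trans)
  let ?x = "\<lambda>i. real i / real n"
  have step: "p (G (?x (Suc i)) - G (?x i)) \<le> C / real n + M / (real n)\<^sup>2" if "i < n" for i
  proof -
    have x: "?x i \<in> {0..1}" "?x (Suc i) \<in> {0..1}" "?x (Suc i) - ?x i = 1 / real n"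
      using that n0 by (auto simp: field_simps)
    let ?D = "G (?x (Suc i)) - G (?x i)" and ?L = "complex_of_real (1 / real n) *\<^sub>C F (?x i)"
    have "p (?D - ?L) \<le> M / (real n)\<^sup>2"
      using M(2)[OF x(1,2)] unfolding x(3) by (simp add: power_divide)
    moreover have "p ?L \<le> C / real n"
      using C[of "?x i"] x(1) n0 unfolding seminorm_scaleC[OF p] by (simp add: norm_divide divide_right_mono)
    moreover have "p ?D \<le> p (?D - ?L) + p ?L" using seminorm_add[OF p, of "?D - ?L" ?L] by simp
    ultimately show ?thesis by linarith
  qed
  have "G 1 - G 0 = (\<Sum>i<n. G (?x (Suc i)) - G (?x i))"
    using sum_lessThan_telescope[of "\<lambda>i. G (?x i)" n] n0 by simp
  then have "p (G 1 - G 0) \<le> (\<Sum>i<n. p (G (?x (Suc i)) - G (?x i)))"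
    by (simp only:) (rule seminorm_sum_le[OF p])
  also have "\<dots> \<le> (\<Sum>i<n. C / real n + M / (real n)\<^sup>2)" by (intro sum_mono step) simp
  also have "\<dots> = C + M / real n" using n0 by (simp add: field_simps power2_eq_square)
  also have "M / real n \<le> e" using n n0 \<open>0 < e\<close> by (simp add: field_simps)
  finally show "p (G 1 - G 0) \<le> C + e" by simp
qed

subsection \<open>Generalized traces as sums over index paths\<close>

text \<open>Slots are described by splitting the list instead of by an index and a length; fixing
  the first entry then preserves the property, as the recursion of \<open>path_sum\<close>
  requires.\<close>

definition slot_multilinear :: "('a::complex_vec list \<Rightarrow> 'b::complex_vec) \<Rightarrow> bool" where
  "slot_multilinear f \<longleftrightarrow>
     (\<forall>xs x y zs. f (xs @ (x + y) # zs) = f (xs @ x # zs) + f (xs @ y # zs)) \<and>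
     (\<forall>xs r x zs. f (xs @ (r *\<^sub>C x) # zs) = r *\<^sub>C f (xs @ x # zs))"

lemma slot_multilinear_tensor: "slot_multilinear (\<lambda>xs. tensor (ys @ xs))"
  unfolding slot_multilinear_def
  using tensor_slot_add[of "ys @ _"] tensor_slot_scaleC[of "ys @ _"] by simp

lemma slot_multilinear_Cons: "slot_multilinear f \<Longrightarrow> slot_multilinear (\<lambda>xs. f (x # xs))"
  unfolding slot_multilinear_def by (metis append_Cons)

lemma slot_multilinear_simps:
  assumes "slot_multilinear f"
  shows "f ((x + y) # zs) = f (x # zs) + f (y # zs)" "f ((r *\<^sub>C x) # zs) = r *\<^sub>C f (x # zs)" "f (0 # zs) = 0"
proof -
  show *: "f ((x + y) # zs) = f (x # zs) + f (y # zs)" "f ((r *\<^sub>C x) # zs) = r *\<^sub>C f (x # zs)" for x y zs r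
    using assms unfolding slot_multilinear_def by (metis append_Nil)+
  from *(2)[of 0 0 zs] show "f (0 # zs) = 0" by simp
qed

lemma slot_multilinear_sum: "slot_multilinear f \<Longrightarrow> f ((\<Sum>i\<in>I. u i) # zs) = (\<Sum>i\<in>I. f (u i # zs))"
  by (induction I rule: infinite_finite_induct) (simp_all add: slot_multilinear_simps)

text \<open>The sum of \<open>f [M\<^sub>1 i k\<^sub>1, M\<^sub>2 k\<^sub>1 k\<^sub>2, \<dots>]\<close> over all index paths from \<open>i\<close> to \<open>j\<close>; matrices are functions of
  two indices below \<open>m\<close>. The generalized trace is a \<open>loop_sum\<close> (\<open>generalized_trace_eq_loop_sum\<close>).\<close>

fun path_sum :: "nat \<Rightarrow> ('a list \<Rightarrow> 'b::ab_group_add) \<Rightarrow> (nat \<Rightarrow> nat \<Rightarrow> 'a) list \<Rightarrow> nat \<Rightarrow> nat \<Rightarrow> 'b" where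
  "path_sum m f [] i j = (if i = j then f [] else 0)"
| "path_sum m f (M # Ms) i j = (\<Sum>k<m. path_sum m (\<lambda>xs. f (M i k # xs)) Ms k j)"

definition loop_sum :: "nat \<Rightarrow> ('a list \<Rightarrow> 'b::ab_group_add) \<Rightarrow> (nat \<Rightarrow> nat \<Rightarrow> 'a) list \<Rightarrow> 'b" where
  "loop_sum m f Ms = (\<Sum>i<m. path_sum m f Ms i i)"

definition entries :: "nat \<Rightarrow> (nat \<Rightarrow> nat \<Rightarrow> 'a) \<Rightarrow> 'a set" where
  "entries m M = {M i j | i j. i < m \<and> j < m}"

definition mat_prod :: "nat \<Rightarrow> (nat \<Rightarrow> nat \<Rightarrow> 'a::semiring_0) \<Rightarrow> (nat \<Rightarrow> nat \<Rightarrow> 'a) \<Rightarrow> nat \<Rightarrow> nat \<Rightarrow> 'a" where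
  "mat_prod m M N i j = (\<Sum>k<m. M i k * N k j)"

lemma entriesI: "i < m \<Longrightarrow> j < m \<Longrightarrow> M i j \<in> entries m M"
  by (auto simp: entries_def)

lemma path_sum_cong:
  assumes "i < m" "\<And>xs. list_all2 (\<lambda>M x. x \<in> entries m M) Ms xs \<Longrightarrow> f xs = g xs"
  shows "path_sum m f Ms i j = path_sum m g Ms i j"
  using assms
proof (induction Ms arbitrary: f g i)
  case (Cons M Ms)
  show ?case
    unfolding path_sum.simps
  proof (rule sum.cong[OF refl])
    fix k assume "k \<in> {..<m}"
    with Cons.prems(1) have "k < m" "M i k \<in> entries m M" by (auto intro: entriesI)
    then show "path_sum m (\<lambda>xs. f (M i k # xs)) Ms k j = path_sum m (\<lambda>xs. g (M i k # xs)) Ms k j"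
      by (intro Cons.IH Cons.prems(2)) auto
  qed
qed simp

text \<open>Agreement on lists of matrix entries suffices. Their degrees are known, so formulas for
  homogeneous tuples can be applied under the sum.\<close>

lemma loop_sum_cong:
  "(\<And>xs. list_all2 (\<lambda>M x. x \<in> entries m M) Ms xs \<Longrightarrow> f xs = g xs) \<Longrightarrow> loop_sum m f Ms = loop_sum m g Ms"
  unfolding loop_sum_def by (intro sum.cong path_sum_cong) auto

lemma path_sum_linear:
  assumes L: "\<And>x y. L (x + y) = L x + L y"
  shows "L (path_sum m f Ms i j) = path_sum m (\<lambda>xs. L (f xs)) Ms i j"
proof -
  have L0: "L 0 = 0" using L[of 0 0] by simp
  have "L (sum u I) = (\<Sum>i\<in>I. L (u i))" for u and I :: "nat set"
    by (induction I rule: infinite_finite_induct) (simp_all add: L0 L)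
  then show ?thesis by (induction Ms arbitrary: f i) (simp_all add: L0)
qed

lemma loop_sum_linear:
  assumes L: "\<And>x y. L (x + y) = L x + L y"
  shows "L (loop_sum m f Ms) = loop_sum m (\<lambda>xs. L (f xs)) Ms"
proof -
  have L0: "L 0 = 0" using L[of 0 0] by simp
  have "L (sum u I) = (\<Sum>i\<in>I. L (u i))" for u and I :: "nat set"
    by (induction I rule: infinite_finite_induct) (simp_all add: L0 L)
  then show ?thesis unfolding loop_sum_def by (simp add: path_sum_linear[of L, OF L])
qed

lemma path_sum_zero [simp]: "path_sum m (\<lambda>xs. 0) Ms i j = 0"
  by (induction Ms arbitrary: i) simp_all

lemma path_sum_add: "path_sum m (\<lambda>xs. f xs + g xs) Ms i j = path_sum m f Ms i j + path_sum m g Ms i j"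
  by (induction Ms arbitrary: f g i) (simp_all add: sum.distrib)

lemma path_sum_sum: "path_sum m (\<lambda>xs. \<Sum>a\<in>A. f a xs) Ms i j = (\<Sum>a\<in>A. path_sum m (f a) Ms i j)"
  by (induction A rule: infinite_finite_induct) (simp_all add: path_sum_add)

lemma loop_sum_add: "loop_sum m (\<lambda>xs. f xs + g xs) Ms = loop_sum m f Ms + loop_sum m g Ms"
  by (simp add: loop_sum_def path_sum_add sum.distrib)

lemma loop_sum_sum: "loop_sum m (\<lambda>xs. \<Sum>a\<in>A. f a xs) Ms = (\<Sum>a\<in>A. loop_sum m (f a) Ms)"
  unfolding loop_sum_def path_sum_sum by (rule sum.swap)

lemma loop_sum_scaleC: "loop_sum m (\<lambda>xs. r *\<^sub>C f xs) Ms = r *\<^sub>C loop_sum m f Ms"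
  by (rule loop_sum_linear[symmetric]) (rule scaleC_add_right)

lemma loop_sum_uminus: "loop_sum m (\<lambda>xs. - f xs) Ms = - loop_sum m f Ms"
  by (rule loop_sum_linear[symmetric]) simp

lemma loop_sum_diff: "loop_sum m (\<lambda>xs. f xs - g xs) Ms = loop_sum m f Ms - loop_sum m g Ms"
  using loop_sum_add[of m f "\<lambda>xs. - g xs" Ms] by (simp add: loop_sum_uminus)

lemma path_sum_update:
  "k < length Ms \<Longrightarrow>
    path_sum m (\<lambda>xs. f (xs[k := L (xs ! k)])) Ms i j = path_sum m f (Ms[k := \<lambda>i j. L ((Ms ! k) i j)]) i j"
proof (induction Ms arbitrary: f i k)
  case (Cons M Ms)
  show ?case
  proof (cases k)
    case (Suc k')
    then show ?thesis using Cons.IH[of k' "\<lambda>xs. f (_ # xs)"] Cons.prems by simp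
  qed simp
qed simp

lemma loop_sum_update:
  "k < length Ms \<Longrightarrow> loop_sum m (\<lambda>xs. f (xs[k := L (xs ! k)])) Ms = loop_sum m f (Ms[k := \<lambda>i j. L ((Ms ! k) i j)])"
  unfolding loop_sum_def by (simp add: path_sum_update)

text \<open>The index shared by two adjacent matrices occurs only in the product of their entries;
  summing over it produces the matrix product.\<close>

lemma path_sum_merge:
  fixes f :: "'a::{complex_vec, semiring_0} list \<Rightarrow> 'b::complex_vec"
  assumes "Suc k < length Ms" "slot_multilinear f"
  shows "path_sum m (\<lambda>xs. f (take k xs @ [xs ! k * xs ! Suc k] @ drop (k + 2) xs)) Ms i j
     = path_sum m f (take k Ms @ [mat_prod m (Ms ! k) (Ms ! Suc k)] @ drop (k + 2) Ms) i j"
  using assms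
proof (induction Ms arbitrary: f i k)
  case (Cons M Ms)
  show ?case
  proof (cases k)
    case 0
    then obtain N Ns where Ms: "Ms = N # Ns" using Cons.prems by (cases Ms) auto
    have "(\<Sum>a<m. \<Sum>b<m. path_sum m (\<lambda>xs. f ((M i a * N a b) # xs)) Ns b j)
       = (\<Sum>b<m. path_sum m (\<lambda>xs. f (mat_prod m M N i b # xs)) Ns b j)"
      unfolding mat_prod_def slot_multilinear_sum[OF Cons.prems(2)] path_sum_sum by (rule sum.swap)
    then show ?thesis by (simp add: 0 Ms)
  next
    case (Suc k')
    then show ?thesis
      using Cons.IH[of k' "\<lambda>xs. f (_ # xs)"] Cons.prems by (simp add: slot_multilinear_Cons)
  qed
qed simp

lemma loop_sum_merge:
  fixes f :: "'a::{complex_vec, semiring_0} list \<Rightarrow> 'b::complex_vec"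
  assumes "Suc k < length Ms" "slot_multilinear f"
  shows "loop_sum m (\<lambda>xs. f (take k xs @ [xs ! k * xs ! Suc k] @ drop (k + 2) xs)) Ms
     = loop_sum m f (take k Ms @ [mat_prod m (Ms ! k) (Ms ! Suc k)] @ drop (k + 2) Ms)"
  unfolding loop_sum_def path_sum_merge[OF assms] ..

lemma path_sum_slot_add:
  "slot_multilinear f \<Longrightarrow> k < length Ms \<Longrightarrow> path_sum m f (Ms[k := \<lambda>i j. M i j + N i j]) i j
     = path_sum m f (Ms[k := M]) i j + path_sum m f (Ms[k := N]) i j"
proof (induction Ms arbitrary: f i k)
  case (Cons M' Ms)
  show ?case
  proof (cases k)
    case 0
    then show ?thesis by (simp add: slot_multilinear_simps(1)[OF Cons.prems(1)] path_sum_add sum.distrib)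
  next
    case (Suc k')
    with Cons.IH[of "\<lambda>xs. f (_ # xs)" k'] Cons.prems show ?thesis
      by (simp add: slot_multilinear_Cons sum.distrib)
  qed
qed simp

lemma path_sum_slot_scaleC:
  "slot_multilinear f \<Longrightarrow> k < length Ms \<Longrightarrow> path_sum m f (Ms[k := \<lambda>i j. r *\<^sub>C M i j]) i j
     = r *\<^sub>C path_sum m f (Ms[k := M]) i j"
proof (induction Ms arbitrary: f i k)
  case (Cons M' Ms)
  show ?case
  proof (cases k)
    case 0
    then show ?thesis
      by (simp add: slot_multilinear_simps(2)[OF Cons.prems(1)] complex_vector.scale_sum_right
          path_sum_linear[of "\<lambda>x. r *\<^sub>C x", OF scaleC_add_right])
  next
    case (Suc k')
    with Cons.IH[of "\<lambda>xs. f (_ # xs)" k'] Cons.prems show ?thesis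
      by (simp add: slot_multilinear_Cons complex_vector.scale_sum_right)
  qed
qed simp

lemma loop_sum_slot_add:
  "slot_multilinear f \<Longrightarrow> k < length Ms \<Longrightarrow> loop_sum m f (Ms[k := \<lambda>i j. M i j + N i j])
     = loop_sum m f (Ms[k := M]) + loop_sum m f (Ms[k := N])"
  by (simp add: loop_sum_def path_sum_slot_add sum.distrib)

lemma loop_sum_slot_scaleC:
  "slot_multilinear f \<Longrightarrow> k < length Ms \<Longrightarrow> loop_sum m f (Ms[k := \<lambda>i j. r *\<^sub>C M i j]) = r *\<^sub>C loop_sum m f (Ms[k := M])"
  by (simp add: loop_sum_def path_sum_slot_scaleC complex_vector.scale_sum_right)

lemma path_sum_snoc:
  "i < m \<Longrightarrow> j < m \<Longrightarrow> path_sum m f (Ms @ [M]) i j = (\<Sum>k<m. path_sum m (\<lambda>xs. f (xs @ [M k j])) Ms i k)"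
proof (induction Ms arbitrary: f i)
  case Nil
  then show ?case by (simp add: sum.delta' sum.delta)
next
  case (Cons N Ns)
  have "(\<Sum>a<m. path_sum m (\<lambda>xs. f (N i a # xs)) (Ns @ [M]) a j)
     = (\<Sum>a<m. \<Sum>k<m. path_sum m (\<lambda>xs. f (N i a # xs @ [M k j])) Ns a k)"
    using Cons.IH[of _ "\<lambda>xs. f (N i _ # xs)"] Cons.prems by (intro sum.cong) auto
  also have "\<dots> = (\<Sum>k<m. \<Sum>a<m. path_sum m (\<lambda>xs. f (N i a # xs @ [M k j])) Ns a k)" by (rule sum.swap)
  finally show ?case by simp
qed

text \<open>On a closed path the starting index is arbitrary: moving the last matrix to the front
  exchanges two index sums. This turns the cyclic term of \<open>b\<close> into a trace.\<close>

lemma loop_sum_rotate: "loop_sum m (\<lambda>xs. f (last xs # butlast xs)) (Ms @ [M]) = loop_sum m f (M # Ms)"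
proof -
  have "loop_sum m (\<lambda>xs. f (last xs # butlast xs)) (Ms @ [M])
     = (\<Sum>i<m. \<Sum>k<m. path_sum m (\<lambda>xs. f (M k i # xs)) Ms i k)"
    unfolding loop_sum_def by (intro sum.cong refl) (simp add: path_sum_snoc)
  also have "\<dots> = (\<Sum>k<m. \<Sum>i<m. path_sum m (\<lambda>xs. f (M k i # xs)) Ms i k)" by (rule sum.swap)
  finally show ?thesis by (simp add: loop_sum_def)
qed

text \<open>The Kronecker delta contracts the first index, so a leading scalar matrix becomes a
  fixed leading entry.\<close>

lemma loop_sum_unit:
  assumes "slot_multilinear f"
  shows "loop_sum m f ((\<lambda>i j. if i = j then u else 0) # Ms) = loop_sum m (\<lambda>xs. f (u # xs)) Ms"
  unfolding loop_sum_def
proof (rule sum.cong[OF refl])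
  fix i assume i: "i \<in> {..<m}"
  have "path_sum m (\<lambda>xs. f ((if i = k then u else 0) # xs)) Ms k i = (if i = k then path_sum m (\<lambda>xs. f (u # xs)) Ms k i else 0)" for k
    by (simp add: slot_multilinear_simps(3)[OF assms])
  then show "path_sum m f ((\<lambda>i j. if i = j then u else 0) # Ms) i i = path_sum m (\<lambda>xs. f (u # xs)) Ms i i"
    using i by simp
qed

lemma loop_sum_in_subspace:
  assumes V: "csubspace V" and f: "\<And>xs. list_all2 (\<lambda>M x. x \<in> entries m M) Ms xs \<Longrightarrow> f xs \<in> V"
  shows "loop_sum m f Ms \<in> V"
proof -
  have "path_sum m f Ms i j \<in> V" if "i < m" "\<And>xs. list_all2 (\<lambda>M x. x \<in> entries m M) Ms xs \<Longrightarrow> f xs \<in> V" for i j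
    using that
  proof (induction Ms arbitrary: f i)
    case Nil
    then show ?case using complex_vector.subspace_0[OF V] by simp
  next
    case (Cons M Ms)
    show ?case
      unfolding path_sum.simps
    proof (intro complex_vector.subspace_sum[OF V] Cons.IH)
      fix k xs assume k: "k \<in> {..<m}"
      then show "k < m" by simp
      assume "list_all2 (\<lambda>M x. x \<in> entries m M) Ms xs"
      with k Cons.prems(1) show "f (M i k # xs) \<in> V" by (intro Cons.prems(2)) (simp add: entriesI)
    qed
  qed
  then show ?thesis unfolding loop_sum_def using f by (intro complex_vector.subspace_sum[OF V]) auto
qed

lemma seminorm_path_sum_le:
  assumes p: "seminorm p" and "0 \<le> C" and "i < m"
    and "\<And>xs. list_all2 (\<lambda>M x. x \<in> entries m M) Ms xs \<Longrightarrow> p (f xs) \<le> C"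
  shows "p (path_sum m f Ms i j) \<le> real m ^ length Ms * C"
  using assms(3,4)
proof (induction Ms arbitrary: f i)
  case Nil
  then show ?case using assms(2) by (simp add: seminorm_zero[OF p])
next
  case (Cons M Ms)
  have "p (path_sum m f (M # Ms) i j) \<le> (\<Sum>k<m. p (path_sum m (\<lambda>xs. f (M i k # xs)) Ms k j))"
    unfolding path_sum.simps by (rule seminorm_sum_le[OF p])
  also have "\<dots> \<le> (\<Sum>k<m. real m ^ length Ms * C)"
    by (intro sum_mono Cons.IH Cons.prems) (auto intro: entriesI Cons.prems)
  finally show ?case by (simp add: mult.assoc)
qed

lemma seminorm_loop_sum_le:
  assumes p: "seminorm p" and "0 \<le> C"
    and "\<And>xs. list_all2 (\<lambda>M x. x \<in> entries m M) Ms xs \<Longrightarrow> p (f xs) \<le> C"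
  shows "p (loop_sum m f Ms) \<le> real m ^ Suc (length Ms) * C"
proof -
  have "p (loop_sum m f Ms) \<le> (\<Sum>i<m. p (path_sum m f Ms i i))"
    unfolding loop_sum_def by (rule seminorm_sum_le[OF p])
  also have "\<dots> \<le> (\<Sum>i<m. real m ^ length Ms * C)"
    by (intro sum_mono seminorm_path_sum_le[OF p assms(2)] assms(3)) auto
  finally show ?thesis by (simp add: mult.assoc)
qed

section \<open>Comparison with the generalized trace\<close>

lemma sum_lists_Suc:
  "(\<Sum>is | length is = Suc n \<and> set is \<subseteq> A. F is) = (\<Sum>i\<in>A. \<Sum>ks | length ks = n \<and> set ks \<subseteq> A. F (i # ks))"
proof -
  have eq: "{is. length is = Suc n \<and> set is \<subseteq> A} = (\<lambda>(i, ks). i # ks) ` (A \<times> {ks. length ks = n \<and> set ks \<subseteq> A})"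
    by (auto simp: length_Suc_conv image_iff)
  show ?thesis
    unfolding eq by (subst sum.reindex) (auto simp: inj_on_def sum.cartesian_product case_prod_unfold)
qed

text \<open>\<open>ks\<close> lists the inner indices of the path. Row indices are read from
  \<open>i # ks\<close>, column indices from \<open>i # ks @ [j]\<close> shifted by one.\<close>

lemma path_sum_Cons_eq_sum_lists:
  assumes "j < m"
  shows "path_sum m f (M # Ms) i j = (\<Sum>ks | length ks = length Ms \<and> set ks \<subseteq> {..<m}.
     f (map (\<lambda>p. ((M # Ms) ! p) ((i # ks) ! p) ((i # ks @ [j]) ! Suc p)) [0..<Suc (length Ms)]))"
proof (induction Ms arbitrary: M f i)
  case Nil
  have "{ks :: nat list. ks = [] \<and> set ks \<subseteq> {..<m}} = {[]}" by auto
  moreover have "(\<Sum>k<m. if k = j then f [M i k] else 0) = f [M i j]" using assms by simp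
  ultimately show ?case by simp
next
  case (Cons N Ns)
  show ?case
    unfolding path_sum.simps(2)[of m f M] Cons.IH length_Cons sum_lists_Suc map_upt_Suc
    by (simp add: map_upt_Suc del: upt_Suc)
qed

lemma generalized_trace_eq_loop_sum:
  assumes "\<Theta> \<noteq> []"
  shows "generalized_trace m \<Theta> = loop_sum m tensor (map (\<lambda>A i j. A $$ (i, j)) \<Theta>)"
proof -
  obtain A As where \<Theta>: "\<Theta> = A # As" using assms by (cases \<Theta>) auto
  let ?e = "\<lambda>A i j. A $$ (i, j)"
  have eq: "map (\<lambda>p. ((?e A # map ?e As) ! p) ((i # ks) ! p) ((i # ks @ [i]) ! Suc p)) [0..<Suc (length As)]
      = map (\<lambda>p. (\<Theta> ! p) $$ ((i # ks) ! p, (i # ks) ! (Suc p mod length \<Theta>))) [0..<length \<Theta>]"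
    if "length ks = length As" for i ks
  proof -
    have "((?e A # map ?e As) ! p) ((i # ks) ! p) ((i # ks @ [i]) ! Suc p) = (\<Theta> ! p) $$ ((i # ks) ! p, (i # ks) ! (Suc p mod length \<Theta>))"
      if p: "p \<le> length As" for p
    proof -
      have "(?e A # map ?e As) ! p = ?e (\<Theta> ! p)" using p by (cases p) (auto simp: \<Theta>)
      moreover have "(i # ks @ [i]) ! Suc p = (i # ks) ! (Suc p mod length \<Theta>)"
      \<comment> \<open>At the last matrix the column index wraps around to the starting index
        \<open>i\<close>, which is the entry appended to \<open>ks\<close>.\<close>
      proof (cases "p = length As")
        case True
        then show ?thesis using \<open>length ks = length As\<close> by (simp add: \<Theta> nth_append)
      next
        case False
        then show ?thesis using p \<open>length ks = length As\<close> by (simp add: \<Theta> nth_append)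
      qed
      ultimately show ?thesis by simp
    qed
    then show ?thesis by (simp add: \<Theta> del: upt_Suc)
  qed
  have "generalized_trace m \<Theta> = (\<Sum>i<m. \<Sum>ks | length ks = length As \<and> set ks \<subseteq> {..<m}.
     tensor (map (\<lambda>p. (\<Theta> ! p) $$ ((i # ks) ! p, (i # ks) ! (Suc p mod length \<Theta>))) [0..<length \<Theta>]))"
    unfolding generalized_trace_def by (simp only: \<Theta> length_Cons sum_lists_Suc)
  also have "\<dots> = (\<Sum>i<m. path_sum m tensor (?e A # map ?e As) i i)"
  proof (rule sum.cong[OF refl])
    fix i assume "i \<in> {..<m}"
    then have "path_sum m tensor (?e A # map ?e As) i i = (\<Sum>ks | length ks = length As \<and> set ks \<subseteq> {..<m}.
       tensor (map (\<lambda>p. ((?e A # map ?e As) ! p) ((i # ks) ! p) ((i # ks @ [i]) ! Suc p)) [0..<Suc (length As)]))"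
      by (subst path_sum_Cons_eq_sum_lists) (simp_all only: length_map lessThan_iff)
    then have *: "path_sum m tensor (?e A # map ?e As) i i = (\<Sum>ks | length ks = length As \<and> set ks \<subseteq> {..<m}.
       tensor (map (\<lambda>p. (\<Theta> ! p) $$ ((i # ks) ! p, (i # ks) ! (Suc p mod length \<Theta>))) [0..<length \<Theta>]))"
      by (simp only:) (rule sum.cong[OF refl], subst eq, auto)
    show "(\<Sum>ks | length ks = length As \<and> set ks \<subseteq> {..<m}.
       tensor (map (\<lambda>p. (\<Theta> ! p) $$ ((i # ks) ! p, (i # ks) ! (Suc p mod length \<Theta>))) [0..<length \<Theta>]))
       = path_sum m tensor (?e A # map ?e As) i i"
      by (rule *[symmetric])
  qed
  finally show ?thesis by (simp add: loop_sum_def \<Theta>)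
qed

text \<open>The Leibniz rule over the slots: the first matrix is split off by the bilinear product
  rule, the rest is the induction hypothesis.\<close>

lemma poly_deriv_path_sum:
  assumes "list_all2 (\<lambda>W W'. \<forall>i<m. \<forall>j<m. poly_deriv (\<lambda>s. W s i j) (\<lambda>s. W' s i j)) Ws Ws'"
    and "slot_multilinear f" and "i < m"
  shows "poly_deriv (\<lambda>s. path_sum m f (map (\<lambda>W. W s) Ws) i j)
    (\<lambda>s. \<Sum>a<length Ws. path_sum m f ((map (\<lambda>W. W s) Ws)[a := (Ws' ! a) s]) i j)"
  using assms
proof (induction arbitrary: f i)
  case Nil
  show ?case by (simp only: list.map path_sum.simps list.size lessThan_0 sum.empty) (rule poly_deriv_const)
next
  case (Cons W Ws W' Ws')
  note f = Cons.prems(1) and fx = slot_multilinear_Cons[OF Cons.prems(1)]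
  let ?Ms = "\<lambda>s. map (\<lambda>W. W s) Ws"
  let ?F = "\<lambda>k x s. path_sum m (\<lambda>xs. f (x # xs)) (?Ms s) k j"
  let ?F' = "\<lambda>k x s. \<Sum>a<length Ws. path_sum m (\<lambda>xs. f (x # xs)) ((?Ms s)[a := (Ws' ! a) s]) k j"
  have "poly_deriv (\<lambda>s. ?F k (W s i k) s) (\<lambda>s. ?F k (W' s i k) s + ?F' k (W s i k) s)" if k: "k < m" for k
  proof (rule poly_deriv_bilinear[where F = "?F k" and F' = "?F' k"])
    show "poly_deriv (\<lambda>s. W s i k) (\<lambda>s. W' s i k)" using Cons.hyps(1) Cons.prems(2) k by blast
    show "poly_deriv (?F k x) (?F' k x)" for x by (rule Cons.IH[OF fx k])
    have scale: "path_sum m (\<lambda>xs. r *\<^sub>C f (x # xs)) Ms k j = r *\<^sub>C path_sum m (\<lambda>xs. f (x # xs)) Ms k j" for r x Ms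
      by (rule path_sum_linear[symmetric]) (rule scaleC_add_right)
    show "?F k (x + y) s = ?F k x s + ?F k y s" "?F k (r *\<^sub>C x) s = r *\<^sub>C ?F k x s" for x y s r
      by (simp_all add: slot_multilinear_simps[OF f] path_sum_add scale)
    show "?F' k (x + y) s = ?F' k x s + ?F' k y s" "?F' k (r *\<^sub>C x) s = r *\<^sub>C ?F' k x s" for x y s r
      by (simp_all add: slot_multilinear_simps[OF f] path_sum_add scale sum.distrib complex_vector.scale_sum_right)
  qed
  then have "poly_deriv (\<lambda>s. \<Sum>k<m. ?F k (W s i k) s) (\<lambda>s. \<Sum>k<m. ?F k (W' s i k) s + ?F' k (W s i k) s)"
    by (intro poly_deriv_sum) simp
  moreover have "(\<Sum>k<m. ?F k (W' s i k) s + ?F' k (W s i k) s)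
     = (\<Sum>a<length (W # Ws). path_sum m f ((map (\<lambda>W. W s) (W # Ws))[a := ((W' # Ws') ! a) s]) i j)" for s
    unfolding sum.distrib sum.swap[of _ "{..<length Ws}"] by (simp add: sum.lessThan_Suc_shift del: sum.lessThan_Suc)
  ultimately show ?case by simp
qed

lemma poly_deriv_loop_sum:
  assumes "list_all2 (\<lambda>W W'. \<forall>i<m. \<forall>j<m. poly_deriv (\<lambda>s. W s i j) (\<lambda>s. W' s i j)) Ws Ws'"
    and "slot_multilinear f"
  shows "poly_deriv (\<lambda>s. loop_sum m f (map (\<lambda>W. W s) Ws))
    (\<lambda>s. \<Sum>a<length Ws. loop_sum m f ((map (\<lambda>W. W s) Ws)[a := (Ws' ! a) s]))"
proof -
  have "(\<lambda>s. \<Sum>a<length Ws. loop_sum m f ((map (\<lambda>W. W s) Ws)[a := (Ws' ! a) s]))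
     = (\<lambda>s. \<Sum>i<m. \<Sum>a<length Ws. path_sum m f ((map (\<lambda>W. W s) Ws)[a := (Ws' ! a) s]) i i)"
    unfolding loop_sum_def by (rule ext) (rule sum.swap)
  then show ?thesis
    unfolding loop_sum_def[of m f "map _ _"] by (simp only:) (intro poly_deriv_sum poly_deriv_path_sum assms, simp)
qed

lemma path_sum_mat_cong:
  "list_all2 (\<lambda>M N. \<forall>i<m. \<forall>j<m. M i j = N i j) Ms Ns \<Longrightarrow> i < m \<Longrightarrow> path_sum m f Ms i j = path_sum m f Ns i j"
  by (induction arbitrary: f i rule: list_all2_induct) simp_all

lemma loop_sum_mat_cong:
  "list_all2 (\<lambda>M N. \<forall>i<m. \<forall>j<m. M i j = N i j) Ms Ns \<Longrightarrow> loop_sum m f Ms = loop_sum m f Ns"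
  unfolding loop_sum_def by (intro sum.cong refl path_sum_mat_cong) auto

lemma loop_sum_update_cong:
  "(\<And>i j. i < m \<Longrightarrow> j < m \<Longrightarrow> M i j = N i j) \<Longrightarrow> loop_sum m f (Ms[k := M]) = loop_sum m f (Ms[k := N])"
  by (intro loop_sum_mat_cong list_all2_update_cong) (auto intro: list.rel_refl)

section \<open>The operators d, b and B on traces with leading unit\<close>

abbreviation unit_loop_sum :: "nat \<Rightarrow> (nat \<Rightarrow> nat \<Rightarrow> 'a::locally_convex_dga) list \<Rightarrow> 'a chain" where
  "unit_loop_sum m \<equiv> loop_sum m (\<lambda>xs. tensor (1 # xs))"

lemma slot_multilinear_unit_tensor: "slot_multilinear (\<lambda>xs. tensor (1 # xs))"
  using slot_multilinear_tensor[of "[1]"] by simp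

lemma homogeneous_tuple_entries:
  assumes "list_all2 (\<lambda>n M. entries m M \<subseteq> homog n) ns Ms" "list_all2 (\<lambda>M x. x \<in> entries m M) Ms xs"
  shows "homogeneous_tuple (0 # ns) (1 # xs)"
proof -
  have "list_all2 (\<lambda>n x. x \<in> homog n) ns xs"
    using assms unfolding list_all2_conv_all_nth by (metis subsetD)
  then show ?thesis by (simp add: homogeneous_tuple_def homog_one)
qed

text \<open>The term differentiating the leading unit vanishes, so only the terms with the overall
  minus sign remain. The unit occupies position 0, which shifts the index of \<open>mdeg\<close> by
  one.\<close>

lemma chain_d_unit_loop_sum:
  assumes "list_all2 (\<lambda>n M. entries m M \<subseteq> homog n) ns Ms"
  shows "chain_d (unit_loop_sum m Ms) = - (\<Sum>k<length Ms. (-1) powi mdeg (0 # ns) (Suc k) *\<^sub>C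
     unit_loop_sum m (Ms[k := \<lambda>i j. diff ((Ms ! k) i j)]))"
proof -
  have "chain_d (unit_loop_sum m Ms) = loop_sum m (\<lambda>xs. chain_d (tensor (1 # xs))) Ms"
    by (rule loop_sum_linear) (rule chain_ops_add)
  also have "\<dots> = loop_sum m (\<lambda>xs. - (\<Sum>k<length Ms. (-1) powi mdeg (0 # ns) (Suc k) *\<^sub>C tensor (1 # xs[k := diff (xs ! k)]))) Ms"
  proof (rule loop_sum_cong)
    fix xs assume xs: "list_all2 (\<lambda>M x. x \<in> entries m M) Ms xs"
    then have "length xs = length Ms" by (simp add: list_all2_lengthD)
    moreover have "tensor (0 # xs) = 0" by (rule tensor_zero) simp
    ultimately show "chain_d (tensor (1 # xs)) = - (\<Sum>k<length Ms. (-1) powi mdeg (0 # ns) (Suc k) *\<^sub>C tensor (1 # xs[k := diff (xs ! k)]))"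
      unfolding chain_d_tensor[OF homogeneous_tuple_entries[OF assms xs]] d_tensor_def
      by (simp add: sum.shift_bounds_Suc_ivl lessThan_atLeast0 del: sum.op_ivl_Suc)
  qed
  finally show ?thesis
    by (simp add: loop_sum_uminus loop_sum_sum loop_sum_scaleC loop_sum_update[where f = "\<lambda>xs. tensor (1 # xs)"])
qed

text \<open>The two products involving the leading unit, with its right neighbour and cyclically
  with the last entry, leave traces without unit; all others merge adjacent matrices. The first
  carries the sign of m_0 = 0.\<close>

lemma chain_b_unit_loop_sum:
  assumes "list_all2 (\<lambda>n M. entries m M \<subseteq> homog n) ns Ms" and N: "length Ms = Suc N"
  shows "chain_b (unit_loop_sum m Ms) = - loop_sum m tensor Ms
     + (-1) powi ((ns ! N - 1) * mdeg (0 # ns) (Suc N)) *\<^sub>C loop_sum m tensor (last Ms # butlast Ms)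
     - (\<Sum>k<N. (-1) powi mdeg (0 # ns) (Suc (Suc k)) *\<^sub>C
         unit_loop_sum m (take k Ms @ [mat_prod m (Ms ! k) (Ms ! Suc k)] @ drop (k + 2) Ms))"
proof -
  let ?e = "(-1) powi ((ns ! N - 1) * mdeg (0 # ns) (Suc N)) :: complex"
  let ?t = "\<lambda>k xs. tensor (1 # take k xs @ [xs ! k * xs ! Suc k] @ drop (k + 2) xs)"
  have "chain_b (unit_loop_sum m Ms) = loop_sum m (\<lambda>xs. chain_b (tensor (1 # xs))) Ms"
    by (rule loop_sum_linear) (rule chain_ops_add)
  also have "\<dots> = loop_sum m (\<lambda>xs. - tensor xs + ?e *\<^sub>C tensor (last xs # butlast xs)
       - (\<Sum>k<N. (-1) powi mdeg (0 # ns) (Suc (Suc k)) *\<^sub>C ?t k xs)) Ms"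
  proof (rule loop_sum_cong)
    fix xs assume xs: "list_all2 (\<lambda>M x. x \<in> entries m M) Ms xs"
    then have l: "length xs = Suc N" using N by (simp add: list_all2_lengthD[symmetric])
    then have "xs \<noteq> []" by auto
    then have "(xs ! N) # take N xs = last xs # butlast xs" using l by (simp add: last_conv_nth butlast_conv_take)
    moreover have "xs ! 0 # drop (Suc 0) xs = xs" using \<open>xs \<noteq> []\<close> by (cases xs) auto
    moreover have "mdeg (0 # ns) (Suc 0) = 0" by (simp add: mdeg_def)
    ultimately show "chain_b (tensor (1 # xs)) = - tensor xs + ?e *\<^sub>C tensor (last xs # butlast xs)
       - (\<Sum>k<N. (-1) powi mdeg (0 # ns) (Suc (Suc k)) *\<^sub>C ?t k xs)"
      unfolding chain_b_tensor[OF homogeneous_tuple_entries[OF assms(1) xs]] b_tensor_def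
      by (simp add: Let_def l sum.lessThan_Suc_shift scaleC_one del: sum.lessThan_Suc)
  qed
  also have "\<dots> = - loop_sum m tensor Ms + ?e *\<^sub>C loop_sum m (\<lambda>xs. tensor (last xs # butlast xs)) Ms
     - (\<Sum>k<N. (-1) powi mdeg (0 # ns) (Suc (Suc k)) *\<^sub>C loop_sum m (?t k) Ms)"
    by (simp only: loop_sum_diff loop_sum_add loop_sum_uminus loop_sum_sum loop_sum_scaleC)
  also have "loop_sum m (\<lambda>xs. tensor (last xs # butlast xs)) Ms = loop_sum m tensor (last Ms # butlast Ms)"
  proof -
    have "Ms \<noteq> []" using N by auto
    then show ?thesis using loop_sum_rotate[of m tensor "butlast Ms" "last Ms"] by simp
  qed
  also have "(\<Sum>k<N. (-1) powi mdeg (0 # ns) (Suc (Suc k)) *\<^sub>C loop_sum m (?t k) Ms) = (\<Sum>k<N. (-1) powi mdeg (0 # ns) (Suc (Suc k)) *\<^sub>C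
         unit_loop_sum m (take k Ms @ [mat_prod m (Ms ! k) (Ms ! Suc k)] @ drop (k + 2) Ms))"
  proof (intro sum.cong refl arg_cong2[where f = scaleC])
    fix k assume "k \<in> {..<N}"
    then have "Suc k < length Ms" using N by simp
    from loop_sum_merge[OF this slot_multilinear_unit_tensor]
    show "loop_sum m (?t k) Ms = unit_loop_sum m (take k Ms @ [mat_prod m (Ms ! k) (Ms ! Suc k)] @ drop (k + 2) Ms)"
      by simp
  qed
  finally show ?thesis .
qed

text \<open>A new unit is put in front, so the old one lands in a position where units are
  zero.\<close>

lemma chain_B_unit_loop_sum:
  assumes "list_all2 (\<lambda>n M. entries m M \<subseteq> homog n) ns Ms"
  shows "chain_B (unit_loop_sum m Ms) = 0"
proof -
  have "chain_B (unit_loop_sum m Ms) = loop_sum m (\<lambda>xs. chain_B (tensor (1 # xs))) Ms"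
    by (rule loop_sum_linear) (rule chain_ops_add)
  also have "\<dots> = loop_sum m (\<lambda>xs. 0) Ms"
  proof (rule loop_sum_cong)
    fix xs assume xs: "list_all2 (\<lambda>M x. x \<in> entries m M) Ms xs"
    have "tensor (1 # drop k (1 # xs) @ take k (1 # xs)) = 0" for k
    proof (cases k)
      case 0
      then show ?thesis using tensor_slot_one[of "[1]" xs] by simp
    next
      case (Suc k')
      then show ?thesis using tensor_slot_one[of "1 # drop k' xs" "take k' xs"] by simp
    qed
    then show "chain_B (tensor (1 # xs)) = 0"
      unfolding chain_B_tensor[OF homogeneous_tuple_entries[OF assms xs]] B_tensor_def by simp
  qed
  finally show ?thesis by (simp add: loop_sum_def)
qed

subsection \<open>Flat connections\<close>

lemma sum_lessThan_add: "(\<Sum>k<a + c. f k) = (\<Sum>k<a. f k) + (\<Sum>k<c. f (a + k))"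
  for f :: "nat \<Rightarrow> 'b::comm_monoid_add" and a c :: nat
  by (induction c) (simp_all add: add_ac)

text \<open>An entry of degree 1 leaves the exponent unchanged and one of degree 0 lowers it by one,
  so after the leading unit the sign changes exactly once, behind the distinguished letter.\<close>

lemma mdeg_replicate:
  assumes "k \<le> a + c"
  shows "mdeg (0 # replicate a 1 @ [0] @ replicate c 1) (Suc k) = (if k \<le> a then 0 else - 1)"
  using assms
proof (induction k)
  case 0
  show ?case by (simp add: mdeg_def)
next
  case (Suc k)
  then show ?case using mdeg_Suc[of "0 # replicate a 1 @ [0] @ replicate c 1" "Suc k"]
    by (auto simp: nth_append nth_Cons')
qed

text \<open>The tensor words of the Chern character, with \<open>a = k - 1\<close> and
  \<open>c = N - k\<close>.\<close>

definition word :: "nat \<Rightarrow> nat \<Rightarrow> 'b \<Rightarrow> 'b \<Rightarrow> 'b list" where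
  "word a c A B = replicate a A @ [B] @ replicate c A"

lemma length_word [simp]: "length (word a c A B) = Suc (a + c)"
  by (simp add: word_def)

lemma nth_word: "k \<le> a + c \<Longrightarrow> word a c A B ! k = (if k = a then B else A)"
  by (auto simp: word_def nth_append nth_Cons')

lemma word_update: "(word a c A B)[a := M] = (replicate (Suc (a + c)) A)[a := M]"
  by (rule nth_equalityI) (auto simp: nth_word nth_list_update simp del: replicate_Suc)

lemma word_merge_left:
  assumes "k \<le> a"
  shows "take k (word (Suc a) c A B) @ [M] @ drop (k + 2) (word (Suc a) c A B)
     = (word a c A B)[k := M]"
  using assms by (intro nth_equalityI) (auto simp: nth_word nth_append nth_Cons' nth_list_update)

lemma word_merge_right:
  assumes "k \<le> c"
  shows "take (a + k) (word a (Suc c) A B) @ [M] @ drop (a + k + 2) (word a (Suc c) A B)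
     = (word a c A B)[a + k := M]"
  using assms by (intro nth_equalityI) (auto simp: nth_word nth_append nth_Cons' nth_list_update)

lemma word_rotate:
  "last (word a c A B) # butlast (word a c A B) = (if c = 0 then word 0 a A B else word (Suc a) (c - 1) A B)"
proof (cases c)
  case 0
  then show ?thesis by (simp add: word_def)
next
  case (Suc c')
  have "replicate (Suc c') A = replicate c' A @ [A]" by (simp add: replicate_append_same)
  then have "word a c A B = (replicate a A @ [B] @ replicate c' A) @ [A]" unfolding word_def Suc by simp
  then show ?thesis by (simp add: word_def Suc butlast_append)
qed

text \<open>The boundary before any Chen relation depends on the gauge transformation only through
  its Maurer-Cartan form, here \<open>w\<close>.\<close>

locale flat_connection =
  fixes m :: nat and w :: "nat \<Rightarrow> nat \<Rightarrow> 'a::locally_convex_dga"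
  assumes homog: "i < m \<Longrightarrow> j < m \<Longrightarrow> w i j \<in> homog 1"
    and flat: "i < m \<Longrightarrow> j < m \<Longrightarrow> diff (w i j) = - mat_prod m w w i j"
begin

definition A :: "real \<Rightarrow> nat \<Rightarrow> nat \<Rightarrow> 'a acyc" where
  "A s i j = Acyc (complex_of_real s *\<^sub>C w i j) (- (complex_of_real (s * (1 - s)) *\<^sub>C mat_prod m w w i j))"

text \<open>The derivative of \<open>A\<close> in \<open>s\<close>; \<open>2 * s - 1\<close> is the
  derivative of \<open>- (s * (1 - s))\<close>.\<close>

definition A' :: "real \<Rightarrow> nat \<Rightarrow> nat \<Rightarrow> 'a acyc" where
  "A' s i j = Acyc (w i j) (complex_of_real (2 * s - 1) *\<^sub>C mat_prod m w w i j)"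

definition B :: "nat \<Rightarrow> nat \<Rightarrow> 'a acyc" where
  "B i j = Acyc 0 (w i j)"

lemma homog_square: "i < m \<Longrightarrow> j < m \<Longrightarrow> mat_prod m w w i j \<in> homog 2"
  unfolding mat_prod_def by (intro homog_sum homog_mult[of _ 1 _ 1, simplified] homog) auto

lemma diff_square: "i < m \<Longrightarrow> j < m \<Longrightarrow> diff (mat_prod m w w i j) = 0"
  using flat[of i j] diff_diff[of "w i j"] by (simp add: diff_uminus)

lemma homog_A: "entries m (A s) \<subseteq> homog 1"
  by (auto simp: entries_def A_def homog_acyc_def intro!: homog_scaleC homog_uminus homog homog_square)

lemma homog_B: "entries m B \<subseteq> homog 0"
  by (auto simp: entries_def B_def homog_acyc_def homog_zero homog)

lemma homog_word: "list_all2 (\<lambda>n M. entries m M \<subseteq> homog n) (replicate a 1 @ [0] @ replicate c 1) (word a c (A s) B)"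
  using homog_A homog_B unfolding word_def
  by (intro list_all2_appendI) (auto simp: list_all2_conv_all_nth dest: subsetD)

lemma sgn_grading_w: "i < m \<Longrightarrow> j < m \<Longrightarrow> sgn_grading (w i j) = - w i j"
  using sgn_grading_homog[OF homog] by simp

lemma square_assoc: "(\<Sum>k<m. mat_prod m w w i k * w k j) = (\<Sum>k<m. w i k * mat_prod m w w k j)"
  unfolding mat_prod_def sum_distrib_left sum_distrib_right by (subst sum.swap) (simp add: mult.assoc)

text \<open>Moving \<sigma> past the odd form changes a sign, so the \<sigma>-part is a multiple of
  \<omega> \<omega>^2 - \<omega>^2 \<omega> and vanishes by associativity.\<close>

lemma mat_prod_A: 
  assumes "i < m" "j < m"
  shows "mat_prod m (A s) (A s) i j = Acyc (complex_of_real (s\<^sup>2) *\<^sub>C mat_prod m w w i j) 0"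
proof -
  have "form (mat_prod m (A s) (A s) i j) = complex_of_real (s\<^sup>2) *\<^sub>C mat_prod m w w i j"
    by (simp add: mat_prod_def form_sum A_def times_acyc_def mult_scaleC_left mult_scaleC_right scaleC_scaleC
        complex_vector.scale_sum_right power2_eq_square)
  moreover have "sform (mat_prod m (A s) (A s) i j)
     = complex_of_real (s * (1 - s) * s) *\<^sub>C ((\<Sum>k<m. w i k * mat_prod m w w k j) - (\<Sum>k<m. mat_prod m w w i k * w k j))"
    unfolding complex_vector.scale_right_diff_distrib complex_vector.scale_sum_right sum_subtractf[symmetric]
      mat_prod_def[of m "A s"] sform_sum
  proof (rule sum.cong[OF refl])
    fix k assume "k \<in> {..<m}"
    then show "sform (A s i k * A s k j) = complex_of_real (s * (1 - s) * s) *\<^sub>C (w i k * mat_prod m w w k j)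
         - complex_of_real (s * (1 - s) * s) *\<^sub>C (mat_prod m w w i k * w k j)"
      using assms(1) by (simp add: A_def times_acyc_def mult_scaleC_left mult_scaleC_right scaleC_scaleC sgn_grading_scaleC
          sgn_grading_w mult_ac)
  qed
  ultimately show ?thesis by (simp add: acyc_eq_iff square_assoc)
qed

text \<open>This identity explains the coefficient s(1 - s): contracting \<sigma> contributes s(1 -
  s) \<omega>^2 and d\<omega> contributes - s \<omega>^2, together - s^2 \<omega>^2. The
  \<sigma>-part vanishes since d(\<omega>^2) = 0.\<close>

lemma diff_A:
  assumes "i < m" "j < m"
  shows "diff (A s i j) = - mat_prod m (A s) (A s) i j"
proof -
  have "complex_of_real (s * (1 - s)) - complex_of_real s = - complex_of_real (s\<^sup>2)"
    by (simp add: algebra_simps power2_eq_square)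
  then have "complex_of_real (s * (1 - s)) *\<^sub>C x - complex_of_real s *\<^sub>C x = - (complex_of_real (s\<^sup>2) *\<^sub>C x)" for x :: 'a
    by (metis complex_vector.scale_left_diff_distrib complex_vector.scale_minus_left)
  then show ?thesis
    unfolding mat_prod_A[OF assms] using assms
    by (simp add: acyc_eq_iff diff_acyc_def A_def diff_scaleC diff_uminus flat diff_square del: of_real_mult of_real_diff of_real_power)
qed

text \<open>The contraction in dB gives - \<omega>, cancelling the form part of \<open>A'\<close>.
  The \<sigma>-parts are multiples of \<omega>^2, and (2s - 1) + 1 - s = s.\<close>

lemma A'_eq:
  assumes "i < m" "j < m"
  shows "mat_prod m B (A s) i j = A' s i j + diff (B i j) + mat_prod m (A s) B i j"
proof -
  have BA: "mat_prod m B (A s) i j = Acyc 0 (complex_of_real s *\<^sub>C mat_prod m w w i j)"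
    by (simp add: acyc_eq_iff mat_prod_def form_sum sform_sum A_def B_def times_acyc_def mult_scaleC_right
        complex_vector.scale_sum_right)
  have AB: "mat_prod m (A s) B i j = Acyc 0 (- (complex_of_real s *\<^sub>C mat_prod m w w i j))"
    using assms by (auto simp: acyc_eq_iff mat_prod_def form_sum sform_sum A_def B_def times_acyc_def mult_scaleC_left
        sgn_grading_scaleC sgn_grading_w complex_vector.scale_sum_right sum_negf[symmetric] intro!: sum.cong)
  have "complex_of_real (2 * s - 1) *\<^sub>C x + x - complex_of_real s *\<^sub>C x = complex_of_real s *\<^sub>C x" for x :: 'a
  proof -
    have "complex_of_real (2 * s - 1) *\<^sub>C x + 1 *\<^sub>C x - complex_of_real s *\<^sub>C x = (complex_of_real (2 * s - 1) + 1 - complex_of_real s) *\<^sub>C x"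
      unfolding scaleC_add_left complex_vector.scale_left_diff_distrib ..
    then show ?thesis by (simp add: scaleC_one)
  qed
  then show ?thesis
    unfolding BA AB using assms by (simp add: acyc_eq_iff A'_def B_def diff_acyc_def flat)
qed

lemma A_0: "i < m \<Longrightarrow> j < m \<Longrightarrow> A 0 i j = 0"
  and A_1: "A 1 i j = incl (w i j)"
  by (simp_all add: A_def acyc_eq_iff incl_def scaleC_one)

lemma poly_deriv_A: "poly_deriv (\<lambda>s. A s i j) (\<lambda>s. A' s i j)"
proof -
  have "A s i j = complex_of_real (s ^ 1) *\<^sub>C Acyc (w i j) (- mat_prod m w w i j) + complex_of_real (s ^ 2) *\<^sub>C Acyc 0 (mat_prod m w w i j)" for s
    unfolding A_def acyc_eq_iff
    by (simp add: complex_vector.scale_left_diff_distrib algebra_simps power2_eq_square)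
  moreover have "A' s i j = complex_of_real (real 1 * s ^ (1 - 1)) *\<^sub>C Acyc (w i j) (- mat_prod m w w i j) + complex_of_real (real 2 * s ^ (2 - 1)) *\<^sub>C Acyc 0 (mat_prod m w w i j)" for s
    unfolding A'_def acyc_eq_iff
    by (simp add: complex_vector.scale_left_diff_distrib scaleC_one)
  ultimately show ?thesis
    using poly_deriv.add[OF poly_deriv.monom[of 1 "Acyc (w i j) (- mat_prod m w w i j)"] poly_deriv.monom[of 2 "Acyc 0 (mat_prod m w w i j)"]]
    by (simp only:)
qed

abbreviation (input) "W a c s \<equiv> word a c (A s) B"

text \<open>The sign exponent is even up to and including the slot of \<open>B\<close> and odd
  behind it. With the overall minus sign and dA = - A^2 the three groups get the signs +, -,
  -.\<close>

lemma chain_d_word: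
  "chain_d (unit_loop_sum m (W a c s)) =
     (\<Sum>k<a. unit_loop_sum m ((W a c s)[k := mat_prod m (A s) (A s)]))
     - unit_loop_sum m ((W a c s)[a := \<lambda>i j. diff (B i j)])
     - (\<Sum>k<c. unit_loop_sum m ((W a c s)[Suc a + k := mat_prod m (A s) (A s)]))"
proof -
  let ?u = "\<lambda>k M. unit_loop_sum m ((W a c s)[k := M])" and ?AA = "mat_prod m (A s) (A s)"
  let ?e = "\<lambda>k. (-1) powi mdeg (0 # replicate a 1 @ [0] @ replicate c 1) (Suc k) :: complex"
  have dA: "?u k (\<lambda>i j. diff (A s i j)) = - ?u k ?AA" if "k < Suc (a + c)" for k
  proof -
    have "?u k (\<lambda>i j. diff (A s i j)) = ?u k (\<lambda>i j. (-1) *\<^sub>C ?AA i j)"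
      by (rule loop_sum_update_cong) (simp add: diff_A)
    also have "\<dots> = (-1) *\<^sub>C ?u k ?AA"
      using that by (intro loop_sum_slot_scaleC[OF slot_multilinear_unit_tensor]) simp
    finally show ?thesis by simp
  qed
  have "chain_d (unit_loop_sum m (W a c s)) = - (\<Sum>k<Suc (a + c). ?e k *\<^sub>C ?u k (\<lambda>i j. diff ((W a c s ! k) i j)))"
    using chain_d_unit_loop_sum[OF homog_word[of a c s]] by simp
  also have "(\<Sum>k<Suc (a + c). ?e k *\<^sub>C ?u k (\<lambda>i j. diff ((W a c s ! k) i j))) =
     (\<Sum>k<Suc (a + c). if k < a then - ?u k ?AA else if k = a then ?u a (\<lambda>i j. diff (B i j)) else ?u k ?AA)"
    by (rule sum.cong[OF refl]) (auto simp: mdeg_replicate[simplified] nth_word dA scaleC_one)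
  also have "\<dots> = (\<Sum>k<a. - ?u k ?AA) + ?u a (\<lambda>i j. diff (B i j)) + (\<Sum>k<c. ?u (Suc a + k) ?AA)"
    unfolding add_Suc[symmetric] sum_lessThan_add by simp
  finally show ?thesis by (simp add: sum_negf)
qed

text \<open>The truncated differences \<open>a - 1\<close> and \<open>c - 1\<close> are harmless:
  they occur only where \<open>a\<close> or \<open>c\<close> is positive.\<close>

lemma chain_b_word:
  "chain_b (unit_loop_sum m (W a c s)) =
     loop_sum m tensor (if c = 0 then W 0 a s else W (Suc a) (c - 1) s) - loop_sum m tensor (W a c s)
     - (\<Sum>k<a. unit_loop_sum m ((W (a - 1) c s)[k := mat_prod m (A s) (if Suc k = a then B else A s)]))
     + (\<Sum>k<c. unit_loop_sum m ((W a (c - 1) s)[a + k := mat_prod m (if k = 0 then B else A s) (A s)]))"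
proof -
  let ?ns = "replicate a 1 @ [0] @ replicate c 1 :: int list"
  let ?e = "\<lambda>k. (-1) powi mdeg (0 # ?ns) (Suc (Suc k)) :: complex"
  let ?u = "\<lambda>k. unit_loop_sum m (take k (W a c s) @ [mat_prod m (W a c s ! k) (W a c s ! Suc k)] @ drop (k + 2) (W a c s))"
  \<comment> \<open>The cyclic sign is trivial in both cases: if the last letter is
    \<open>B\<close>, then \<open>mdeg\<close> is zero there; otherwise the last entry has degree 1
    and the factor \<open>ns ! N - 1\<close> is zero.\<close>
  have "(-1 :: complex) powi ((?ns ! (a + c) - 1) * mdeg (0 # ?ns) (Suc (a + c))) = 1"
  proof -
    have "(?ns ! (a + c) - 1) * mdeg (0 # ?ns) (Suc (a + c)) = 0"
    proof (cases "c = 0")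
      case True
      have "mdeg (0 # ?ns) (Suc (a + c)) = 0" by (subst mdeg_replicate) (simp_all add: True)
      then show ?thesis by simp
    next
      case False
      then have "?ns ! (a + c) = 1" by (simp add: nth_append nth_Cons')
      then show ?thesis by simp
    qed
    then show ?thesis by (simp only: power_int_0_right)
  qed
  then have "chain_b (unit_loop_sum m (W a c s)) = - loop_sum m tensor (W a c s)
     + loop_sum m tensor (if c = 0 then W 0 a s else W (Suc a) (c - 1) s) - (\<Sum>k<a + c. ?e k *\<^sub>C ?u k)"
    using chain_b_unit_loop_sum[OF homog_word[of a c s] length_word] by (simp only: word_rotate scaleC_one)
  also have "(\<Sum>k<a + c. ?e k *\<^sub>C ?u k) = (\<Sum>k<a. ?e k *\<^sub>C ?u k) + (\<Sum>k<c. ?e (a + k) *\<^sub>C ?u (a + k))"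
    by (rule sum_lessThan_add)
  also have "(\<Sum>k<a. ?e k *\<^sub>C ?u k) = (\<Sum>k<a. unit_loop_sum m ((W (a - 1) c s)[k := mat_prod m (A s) (if Suc k = a then B else A s)]))"
  proof (rule sum.cong[OF refl])
    fix k assume "k \<in> {..<a}"
    then have k: "k < a" by simp
    then obtain a' where a: "a = Suc a'" by (cases a) auto
    have "mdeg (0 # ?ns) (Suc (Suc k)) = 0" using k by (subst mdeg_replicate) auto
    moreover have "W a c s ! k = A s" "W a c s ! Suc k = (if Suc k = a then B else A s)"
      using k by (auto simp: nth_word)
    ultimately show "?e k *\<^sub>C ?u k = unit_loop_sum m ((W (a - 1) c s)[k := mat_prod m (A s) (if Suc k = a then B else A s)])"
      using word_merge_left[of k a' c "A s" B] k a by (simp add: scaleC_one)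
  qed
  also have "(\<Sum>k<c. ?e (a + k) *\<^sub>C ?u (a + k)) = - (\<Sum>k<c. unit_loop_sum m ((W a (c - 1) s)[a + k := mat_prod m (if k = 0 then B else A s) (A s)]))"
    unfolding sum_negf[symmetric]
  proof (rule sum.cong[OF refl])
    fix k assume "k \<in> {..<c}"
    then have k: "k < c" by simp
    then obtain c' where c: "c = Suc c'" by (cases c) auto
    have "mdeg (0 # ?ns) (Suc (Suc (a + k))) = -1" using k by (subst mdeg_replicate) auto
    moreover have "W a c s ! (a + k) = (if k = 0 then B else A s)" "W a c s ! Suc (a + k) = A s"
      using k by (auto simp: nth_word)
    ultimately show "?e (a + k) *\<^sub>C ?u (a + k) = - unit_loop_sum m ((W a (c - 1) s)[a + k := mat_prod m (if k = 0 then B else A s) (A s)])"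
      using word_merge_right[of k c' a "A s" B] k c by simp
  qed
  finally show ?thesis by simp
qed

text \<open>The integrand of the Chern character in tensor degree \<open>n\<close>.\<close>

definition F :: "nat \<Rightarrow> real \<Rightarrow> 'a acyc chain" where
  "F n s = (\<Sum>a<n. unit_loop_sum m (W a (n - Suc a) s))"

text \<open>The terms of \<open>b\<close> that multiply by the leading unit cancel against the cyclic ones; the remaining ones combine
  with \<open>d\<close> through \<open>dA + A\<^sup>2 = 0\<close> and \<open>dB + AB - BA = - dA/ds\<close>.\<close>

lemma chain_d_F_plus_chain_b_F:
  "chain_d (F n s) + chain_b (F (Suc n) s) = (\<Sum>a<n. unit_loop_sum m ((replicate n (A s))[a := A' s]))"
proof -
  let ?AA = "mat_prod m (A s) (A s)" and ?AB = "mat_prod m (A s) B" and ?BA = "mat_prod m B (A s)"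
  let ?u = "\<lambda>a c k M. unit_loop_sum m ((W a c s)[k := M])"
  define E where "E a c = loop_sum m tensor (W a c s)" for a c
  define L where "L a c = (\<Sum>k<a. ?u (a - 1) c k (mat_prod m (A s) (if Suc k = a then B else A s)))" for a c
  define R where "R a c = (\<Sum>k<c. ?u a (c - 1) (a + k) (mat_prod m (if k = 0 then B else A s) (A s)))" for a c
  have cd: "chain_d (sum f I) = (\<Sum>i\<in>I. chain_d (f i))" and cb: "chain_b (sum f I) = (\<Sum>i\<in>I. chain_b (f i))"
    for f :: "nat \<Rightarrow> 'a acyc chain" and I
    using chain_ops_scaleC(1,2)[of 0 "0 :: 'a acyc chain"]
    by (induction I rule: infinite_finite_induct) (simp_all add: chain_ops_add)
  have "chain_b (F (Suc n) s) = (\<Sum>a<Suc n. (if n - a = 0 then E 0 a else E (Suc a) (n - a - 1))) - (\<Sum>a<Suc n. E a (n - a))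
     - (\<Sum>a<Suc n. L a (n - a)) + (\<Sum>a<Suc n. R a (n - a))"
    unfolding F_def cb chain_b_word sum_subtractf[symmetric] sum.distrib[symmetric]
    by (rule sum.cong[OF refl]) (simp add: E_def L_def R_def)
  \<comment> \<open>Rotation by one slot permutes the words with \<open>n + 1\<close> letters, so
    the cyclic terms sum to the terms they have to cancel.\<close>
  also have "(\<Sum>a<Suc n. (if n - a = 0 then E 0 a else E (Suc a) (n - a - 1))) = (\<Sum>a<Suc n. E a (n - a))"
    unfolding sum.lessThan_Suc_shift[of "\<lambda>a. E a (n - a)"] by (simp add: add.commute)
  \<comment> \<open>Merging to the left is void for \<open>a = 0\<close> and merging to the right
    for \<open>a = n\<close>; without these terms both sums match the words with \<open>n\<close>
    letters on which \<open>d\<close> acts.\<close>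
  also have "(\<Sum>a<Suc n. L a (n - a)) = (\<Sum>a<n. L (Suc a) (n - Suc a))"
    unfolding sum.lessThan_Suc_shift by (simp add: L_def)
  also have "(\<Sum>a<Suc n. R a (n - a)) = (\<Sum>a<n. R a (Suc (n - Suc a)))"
    by (simp add: R_def Suc_diff_Suc)
  finally have "chain_d (F n s) + chain_b (F (Suc n) s)
     = (\<Sum>a<n. chain_d (unit_loop_sum m (W a (n - Suc a) s)) - L (Suc a) (n - Suc a) + R a (Suc (n - Suc a)))"
    unfolding F_def cd by (simp add: sum.distrib sum_subtractf)
  also have "\<dots> = (\<Sum>a<n. unit_loop_sum m ((replicate n (A s))[a := A' s]))"
  proof (rule sum.cong[OF refl])
    fix a assume "a \<in> {..<n}"
    then have a: "Suc (a + (n - Suc a)) = n" by simp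
    define c where "c = n - Suc a"
    \<comment> \<open>Only the last product on the left meets \<open>B\<close>; the others are
      squares of \<open>A\<close>. On the right it is the first one.\<close>
    have L: "L (Suc a) c = (\<Sum>k<a. ?u a c k ?AA) + ?u a c a ?AB"
      by (simp add: L_def)
    have R: "R a (Suc c) = ?u a c a ?BA + (\<Sum>k<c. ?u a c (Suc a + k) ?AA)"
      unfolding R_def sum.lessThan_Suc_shift by simp
    have "?u a c a ?BA = ?u a c a (\<lambda>i j. A' s i j + diff (B i j) + ?AB i j)"
      by (rule loop_sum_update_cong) (rule A'_eq)
    also have "\<dots> = ?u a c a (A' s) + ?u a c a (\<lambda>i j. diff (B i j)) + ?u a c a ?AB"
      by (simp add: loop_sum_slot_add[OF slot_multilinear_unit_tensor])
    finally have "chain_d (unit_loop_sum m (W a c s)) - L (Suc a) c + R a (Suc c) = ?u a c a (A' s)"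
      unfolding chain_d_word L R by simp
    then show "chain_d (unit_loop_sum m (W a (n - Suc a) s)) - L (Suc a) (n - Suc a) + R a (Suc (n - Suc a))
       = unit_loop_sum m ((replicate n (A s))[a := A' s])"
      unfolding c_def word_update a .
  qed
  finally show ?thesis .
qed

end

subsection \<open>Sequences in the completion\<close>

definition entire_Cauchy :: "(nat \<Rightarrow> 'a::locally_convex_dga chain) \<Rightarrow> bool" where
  "entire_Cauchy c \<longleftrightarrow> (\<forall>\<nu> e. cont_seminorm \<nu> \<longrightarrow> 0 < e \<longrightarrow> (\<exists>M. \<forall>n\<ge>M. \<forall>k\<ge>M. entire_seminorm \<nu> (c n - c k) < e))"

text \<open>The limit of a Cauchy sequence, represented by its filter of tails; partial sums are the
  only limits required.\<close>

definition seq_completion :: "(nat \<Rightarrow> 'a::locally_convex_dga chain) \<Rightarrow> 'a entire_chain" where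
  "seq_completion c = abs_completion (filtermap c sequentially)"

text \<open>For \<open>a = b\<close> this is the Cauchy property; for different sequences it
  identifies their limits.\<close>

lemma cauchy_equiv_sequences:
  assumes "\<And>\<nu> e. cont_seminorm \<nu> \<Longrightarrow> 0 < e \<Longrightarrow> \<exists>M. \<forall>n\<ge>M. \<forall>k\<ge>M. entire_seminorm \<nu> (a n - b k) < e"
  shows "cauchy_equiv (filtermap a sequentially) (filtermap b sequentially)"
  unfolding cauchy_equiv_def
proof (intro conjI filter_leI)
  show "filtermap a sequentially \<noteq> bot" "filtermap b sequentially \<noteq> bot" by (simp_all add: filtermap_bot_iff)
  fix E :: "'a chain \<times> 'a chain \<Rightarrow> bool" assume "eventually E uniformity"
  then obtain \<nu> e where \<nu>: "cont_seminorm \<nu>" "0 < e" "\<And>c d. entire_seminorm \<nu> (c - d) < e \<Longrightarrow> E (c, d)"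
    unfolding eventually_uniformity_chain by blast
  from assms[OF \<nu>(1,2)] obtain M where M: "\<And>n k. M \<le> n \<Longrightarrow> M \<le> k \<Longrightarrow> entire_seminorm \<nu> (a n - b k) < e" by blast
  have "eventually (\<lambda>x. \<exists>n\<ge>M. x = a n) (filtermap a sequentially)"
    "eventually (\<lambda>x. \<exists>n\<ge>M. x = b n) (filtermap b sequentially)"
    unfolding eventually_filtermap eventually_sequentially by blast+
  then show "eventually E (filtermap a sequentially \<times>\<^sub>F filtermap b sequentially)"
    unfolding eventually_prod_filter using \<nu>(3) M by blast
qed

lemma entire_Cauchy_cauchy_equiv:
  "entire_Cauchy c \<Longrightarrow> cauchy_equiv (filtermap c sequentially) (filtermap c sequentially)"
  unfolding entire_Cauchy_def by (rule cauchy_equiv_sequences) blast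

lemma tendsto_seq_completion:
  assumes "entire_Cauchy c"
  shows "(\<lambda>n. to_completion (c n)) \<longlonglongrightarrow> seq_completion c"
  using tendsto_to_completion[OF entire_Cauchy_cauchy_equiv[OF assms]]
  by (simp add: seq_completion_def filterlim_filtermap)

lemma seq_completion_in_closure:
  assumes "entire_Cauchy c" "eventually (\<lambda>n. c n \<in> S) sequentially"
  shows "seq_completion c \<in> closure (to_completion ` S)"
proof (rule Lim_in_closed_set[OF closed_closure _ _ tendsto_seq_completion[OF assms(1)]])
  show "\<forall>\<^sub>F n in sequentially. to_completion (c n) \<in> closure (to_completion ` S)"
    using assms(2) by eventually_elim (use closure_subset in blast)
qed simp

lemma entire_Cauchy_bounded_chain_map:
  assumes L: "\<And>c d. L (c - d) = L c - L d" and "bounded_chain_map L" and c: "entire_Cauchy c"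
  shows "entire_Cauchy (\<lambda>n. L (c n))"
  unfolding entire_Cauchy_def
proof (intro allI impI)
  fix \<nu> :: "'b \<Rightarrow> real" and e :: real assume \<nu>: "cont_seminorm \<nu>" and e: "0 < e"
  then obtain C \<mu> where C: "0 \<le> C" "cont_seminorm \<mu>" "\<And>c. entire_seminorm \<nu> (L c) \<le> C * entire_seminorm \<mu> c"
    using assms(2) unfolding bounded_chain_map_def by metis
  have "0 < e / (C + 1)" using C(1) e by simp
  with c C(2) obtain M where M: "\<And>n k. M \<le> n \<Longrightarrow> M \<le> k \<Longrightarrow> entire_seminorm \<mu> (c n - c k) < e / (C + 1)"
    unfolding entire_Cauchy_def by metis
  have "entire_seminorm \<nu> (L (c n) - L (c k)) < e" if "M \<le> n" "M \<le> k" for n k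
  proof -
    have "0 \<le> entire_seminorm \<mu> (c n - c k)"
      using C(2) by (intro seminorm_nonneg seminorm_entire_seminorm cont_seminorm_seminorm)
    then have "C * entire_seminorm \<mu> (c n - c k) \<le> (C + 1) * entire_seminorm \<mu> (c n - c k)" by (simp add: mult_right_mono)
    also have "\<dots> < e" using M[OF that] C(1) by (simp add: field_simps)
    finally show ?thesis using C(3)[of "c n - c k"] by (simp add: L)
  qed
  then show "\<exists>M. \<forall>n\<ge>M. \<forall>k\<ge>M. entire_seminorm \<nu> (L (c n) - L (c k)) < e" by blast
qed

lemma completion_ext_seq_completion:
  assumes L: "\<And>c d. L (c - d) = L c - L d" and "bounded_chain_map L" and "entire_Cauchy c"
  shows "completion_ext L (seq_completion c) = seq_completion (\<lambda>n. L (c n))"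
  unfolding seq_completion_def
  by (simp add: completion_ext_abs[OF bounded_chain_map_uniformly_continuous[OF L assms(2)]
        entire_Cauchy_cauchy_equiv[OF assms(3)]] filtermap_filtermap)

lemma entire_Cauchy_add:
  assumes "entire_Cauchy a" "entire_Cauchy b"
  shows "entire_Cauchy (\<lambda>n. a n + b n)"
  unfolding entire_Cauchy_def
proof (intro allI impI)
  fix \<nu> :: "'a \<Rightarrow> real" and e :: real assume \<nu>: "cont_seminorm \<nu>" and e: "0 < e"
  then have "0 < e / 2" by simp
  with \<nu> assms obtain M M' where M: "\<And>n k. M \<le> n \<Longrightarrow> M \<le> k \<Longrightarrow> entire_seminorm \<nu> (a n - a k) < e / 2"
    "\<And>n k. M' \<le> n \<Longrightarrow> M' \<le> k \<Longrightarrow> entire_seminorm \<nu> (b n - b k) < e / 2"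
    unfolding entire_Cauchy_def by metis
  have "entire_seminorm \<nu> (a n + b n - (a k + b k)) < e" if "max M M' \<le> n" "max M M' \<le> k" for n k
    using entire_seminorm_add[OF cont_seminorm_seminorm[OF \<nu>], of "a n - a k" "b n - b k"] M(1)[of n k] M(2)[of n k] that
    by (simp add: algebra_simps)
  then show "\<exists>M. \<forall>n\<ge>M. \<forall>k\<ge>M. entire_seminorm \<nu> (a n + b n - (a k + b k)) < e" by blast
qed

lemma entire_Cauchy_uminus: "entire_Cauchy a \<Longrightarrow> entire_Cauchy (\<lambda>n. - a n)"
  unfolding entire_Cauchy_def
  by (simp add: entire_seminorm_minus_commute[OF cont_seminorm_seminorm])

text \<open>Addition in the completion uses all sums \<open>a n + b k\<close>. The diagonal sums
  form a finer filter, and a proper filter finer than a Cauchy filter is equivalent to it.\<close>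

lemma seq_completion_add:
  assumes a: "entire_Cauchy a" and b: "entire_Cauchy b"
  shows "seq_completion a + seq_completion b = seq_completion (\<lambda>n. a n + b n)"
proof -
  note r = entire_Cauchy_cauchy_equiv[OF a] entire_Cauchy_cauchy_equiv[OF b]
    entire_Cauchy_cauchy_equiv[OF entire_Cauchy_add[OF a b]]
  let ?S = "filtermap (\<lambda>(a, b). a + b) (filtermap a sequentially \<times>\<^sub>F filtermap b sequentially)"
  have S: "cauchy_equiv ?S ?S" by (rule cauchy_equiv_filtermap_plus[OF r(1,2)])
  have "filtermap (\<lambda>n. a n + b n) sequentially \<le> ?S"
  proof (rule filter_leI)
    fix P assume "eventually P ?S"
    then obtain Q R where "eventually Q (filtermap a sequentially)" "eventually R (filtermap b sequentially)"
      "\<And>x y. Q x \<Longrightarrow> R y \<Longrightarrow> P (x + y)"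
      unfolding eventually_filtermap eventually_prod_filter by auto
    then show "eventually P (filtermap (\<lambda>n. a n + b n) sequentially)"
      unfolding eventually_filtermap by (auto elim: eventually_elim2)
  qed
  then have "?S \<times>\<^sub>F filtermap (\<lambda>n. a n + b n) sequentially \<le> ?S \<times>\<^sub>F ?S" by (rule prod_filter_mono[OF order_refl])
  then have "cauchy_equiv ?S (filtermap (\<lambda>n. a n + b n) sequentially)"
    using S r(3) unfolding cauchy_equiv_def by (blast intro: order_trans)
  then show ?thesis
    unfolding seq_completion_def abs_completion_add[OF r(1,2)] by (simp add: abs_completion_eq S r(3))
qed

lemma seq_completion_uminus:
  assumes "entire_Cauchy a"
  shows "- seq_completion a = seq_completion (\<lambda>n. - a n)"
  unfolding seq_completion_def
  by (simp add: uminus_completion.abs_eq[OF entire_Cauchy_cauchy_equiv[OF assms]] filtermap_filtermap)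

lemma seq_completion_diff:
  assumes "entire_Cauchy a" "entire_Cauchy b"
  shows "seq_completion a - seq_completion b = seq_completion (\<lambda>n. a n - b n)"
  using seq_completion_add[OF assms(1) entire_Cauchy_uminus[OF assms(2)]]
  by (simp add: seq_completion_uminus[OF assms(2), symmetric])

lemma seq_completion_null_diff:
  assumes a: "entire_Cauchy a" and null: "\<And>\<nu>. cont_seminorm \<nu> \<Longrightarrow> (\<lambda>n. entire_seminorm \<nu> (a n - b n)) \<longlonglongrightarrow> 0"
  shows "entire_Cauchy b" "seq_completion a = seq_completion b"
proof -
  have ab: "\<exists>M. \<forall>n\<ge>M. \<forall>k\<ge>M. entire_seminorm \<nu> (a n - b k) < e" if \<nu>: "cont_seminorm \<nu>" and e: "0 < e" for \<nu> e
  proof -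
    have "0 < e / 2" using e by simp
    with \<nu> a obtain M where M: "\<And>n k. M \<le> n \<Longrightarrow> M \<le> k \<Longrightarrow> entire_seminorm \<nu> (a n - a k) < e / 2"
      unfolding entire_Cauchy_def by metis
    from order_tendstoD(2)[OF null[OF \<nu>] \<open>0 < e / 2\<close>]
    obtain M' where M': "\<And>n. M' \<le> n \<Longrightarrow> entire_seminorm \<nu> (a n - b n) < e / 2"
      unfolding eventually_sequentially by blast
    have "entire_seminorm \<nu> (a n - b k) < e" if "max M M' \<le> n" "max M M' \<le> k" for n k
      using entire_seminorm_add[OF cont_seminorm_seminorm[OF \<nu>], of "a n - a k" "a k - b k"] M[of n k] M'[of k] that by simp
    then show ?thesis by blast
  qed
  then have e: "cauchy_equiv (filtermap a sequentially) (filtermap b sequentially)"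
    by (rule cauchy_equiv_sequences)
  then have bb: "cauchy_equiv (filtermap b sequentially) (filtermap b sequentially)"
    using cauchy_equiv_sym cauchy_equiv_trans by blast
  show "seq_completion a = seq_completion b"
    using e unfolding seq_completion_def by (simp add: abs_completion_eq entire_Cauchy_cauchy_equiv[OF a] bb)
  show "entire_Cauchy b"
    unfolding entire_Cauchy_def
  proof (intro allI impI)
    fix \<nu> :: "'a \<Rightarrow> real" and e :: real assume \<nu>: "cont_seminorm \<nu>" and e: "0 < e"
    then have "0 < e / 2" by simp
    from ab[OF \<nu> this] obtain M where M: "\<And>n k. M \<le> n \<Longrightarrow> M \<le> k \<Longrightarrow> entire_seminorm \<nu> (a n - b k) < e / 2" by blast
    have "entire_seminorm \<nu> (b n - b k) < e" if "M \<le> n" "M \<le> k" for n k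
      using entire_seminorm_add[OF cont_seminorm_seminorm[OF \<nu>], of "b n - a n" "a n - b k"] M[of n n] M[of n k] that
        entire_seminorm_minus_commute[OF cont_seminorm_seminorm[OF \<nu>], of "b n" "a n"] by simp
    then show "\<exists>M. \<forall>n\<ge>M. \<forall>k\<ge>M. entire_seminorm \<nu> (b n - b k) < e" by blast
  qed
qed

lemma entire_Cauchy_partial_sums:
  assumes "\<And>\<nu>. cont_seminorm \<nu> \<Longrightarrow> \<exists>b. summable b \<and> (\<forall>N. entire_seminorm \<nu> (a N) \<le> b N)"
  shows "entire_Cauchy (\<lambda>n. \<Sum>N<n. a N)"
  unfolding entire_Cauchy_def
proof (intro allI impI)
  fix \<nu> :: "'a \<Rightarrow> real" and e :: real assume \<nu>: "cont_seminorm \<nu>" and e: "0 < e"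
  have s: "seminorm \<nu>" "seminorm (entire_seminorm \<nu>)"
    using \<nu> by (auto intro: seminorm_entire_seminorm cont_seminorm_seminorm)
  obtain b where b: "summable b" "\<And>N. entire_seminorm \<nu> (a N) \<le> b N" using assms[OF \<nu>] by blast
  obtain M where M: "\<And>k n. M \<le> k \<Longrightarrow> norm (sum b {k..<n}) < e"
    using b(1) e unfolding summable_Cauchy by blast
  have lt: "entire_seminorm \<nu> ((\<Sum>N<n. a N) - (\<Sum>N<k. a N)) < e" if "M \<le> k" "k \<le> n" for n k
  proof -
    have "(\<Sum>N<n. a N) - (\<Sum>N<k. a N) = (\<Sum>N=k..<n. a N)"
      using that(2) by (simp add: lessThan_atLeast0 sum_diff_nat_ivl)
    then have "entire_seminorm \<nu> ((\<Sum>N<n. a N) - (\<Sum>N<k. a N)) \<le> (\<Sum>N=k..<n. entire_seminorm \<nu> (a N))"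
      by (simp add: seminorm_sum_le[OF s(2)])
    also have "\<dots> \<le> sum b {k..<n}" by (intro sum_mono b(2))
    also have "\<dots> < e" using M[OF that(1), of n] by simp
    finally show ?thesis .
  qed
  have "entire_seminorm \<nu> ((\<Sum>N<n. a N) - (\<Sum>N<k. a N)) < e" if "M \<le> n" "M \<le> k" for n k
    using lt[of k n] lt[of n k] that entire_seminorm_minus_commute[OF s(1), of "\<Sum>N<n. a N"] by (cases "k \<le> n") auto
  then show "\<exists>M. \<forall>n\<ge>M. \<forall>k\<ge>M. entire_seminorm \<nu> ((\<Sum>N<n. a N) - (\<Sum>N<k. a N)) < e" by blast
qed

lemma to_completion_sum: "to_completion (\<Sum>i<n. a i) = (\<Sum>i<n. to_completion (a i))"
  for a :: "nat \<Rightarrow> 'a::locally_convex_dga chain"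
proof (induction n)
  case 0
  show ?case by (simp add: to_completion_principal zero_completion_def)
qed (simp add: to_completion_add)

lemma sums_seq_completion:
  "entire_Cauchy (\<lambda>n. \<Sum>N<n. a N) \<Longrightarrow> (\<lambda>N. to_completion (a N)) sums seq_completion (\<lambda>n. \<Sum>N<n. a N)"
  using tendsto_seq_completion[of "\<lambda>n. \<Sum>N<n. a N"] by (simp add: sums_def to_completion_sum)

text \<open>The even terms form the exponential series of \<open>R\<^sup>2\<close>, the odd terms
  \<open>R\<close> times the same series.\<close>

lemma summable_power_div_fact_half: "summable (\<lambda>N. R ^ N / fact (N div 2) :: real)"
proof -
  have e: "(\<lambda>j. inverse (fact j) * (R\<^sup>2) ^ j) sums exp (R\<^sup>2)" using exp_converges[of "R\<^sup>2"] by (simp add: divide_inverse)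
  have "(\<lambda>N. if even N then inverse (fact (N div 2)) * (R\<^sup>2) ^ (N div 2) else R * (inverse (fact ((N - 1) div 2)) * (R\<^sup>2) ^ ((N - 1) div 2)))
     sums (R * exp (R\<^sup>2) + exp (R\<^sup>2))"
    by (rule sums_if[OF sums_mult[OF e] e])
  moreover have "(if even N then inverse (fact (N div 2)) * (R\<^sup>2) ^ (N div 2) else R * (inverse (fact ((N - 1) div 2)) * (R\<^sup>2) ^ ((N - 1) div 2)))
      = R ^ N / fact (N div 2)" for N
  proof (cases "even N")
    case True
    then show ?thesis by (auto elim!: evenE simp: power_mult divide_inverse)
  next
    case False
    then show ?thesis by (auto elim!: oddE simp: power_mult divide_inverse)
  qed
  ultimately show ?thesis using sums_summable by simp
qed

subsection \<open>The Chern character of a flat connection\<close>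

text \<open>A linear projection onto the subspace reduces the claim to the uniqueness of the integral of zero.\<close>

lemma poly_deriv_diff_in_subspace:
  fixes V :: "'b::complex_vec set"
  assumes V: "csubspace V" and G: "poly_deriv G F" and F: "\<And>s. F s \<in> V"
  shows "G 1 - G 0 \<in> V"
proof -
  interpret vector_space_pair "scaleC :: complex \<Rightarrow> 'b \<Rightarrow> 'b" "scaleC :: complex \<Rightarrow> 'b \<Rightarrow> 'b" ..
  have "Vector_Spaces.linear scaleC scaleC (\<lambda>x :: 'b. x)" by (rule complex_vector.linear_ident)
  then obtain p where p: "range p \<subseteq> V" "Vector_Spaces.linear scaleC scaleC p" "\<And>v. v \<in> V \<Longrightarrow> p v = v"
    using linear_exists_left_inverse_on[of "\<lambda>x. x" V] V by (auto simp: csubspace_def)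
  have padd: "p (x + y) = p x + p y" and pscale: "p (r *\<^sub>C x) = r *\<^sub>C p x" for x y r
    using p(2) by (simp_all add: linear_add linear_scale)
  let ?L = "\<lambda>x. x - p x"
  have "poly_deriv (\<lambda>s. ?L (G s)) (\<lambda>s. ?L (F s))"
    by (rule poly_deriv_linear[OF G]) (simp_all add: padd pscale complex_vector.scale_right_diff_distrib)
  then have "?L (G 1) - ?L (G 0) = polynomial_integral (\<lambda>s. ?L (F s))"
    by (simp add: polynomial_integral_poly_deriv)
  also have "\<dots> = polynomial_integral (\<lambda>s. 0)" using F by (simp add: p(3))
  also have "\<dots> = 0" using polynomial_integral_poly_deriv[OF poly_deriv_const[of 0]] by simp
  finally have "G 1 - G 0 = p (G 1) - p (G 0)" by (simp add: algebra_simps)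
  moreover have "p (G 1) \<in> V" "p (G 0) \<in> V" using p(1) by auto
  ultimately show ?thesis using complex_vector.subspace_diff[OF V] by simp
qed

text \<open>The prefix \<open>ys\<close> is \<open>[1]\<close> for the Chern character and empty for
  \<open>U\<close>. The power of \<open>m\<close> counts all index paths, closed or not.\<close>

lemma entire_seminorm_loop_sum_le:
  assumes \<nu>: "seminorm \<nu>" and K: "0 \<le> K" and le: "\<And>M x. M \<in> set Ms \<Longrightarrow> x \<in> entries m M \<Longrightarrow> \<nu> x \<le> K"
  shows "entire_seminorm \<nu> (loop_sum m (\<lambda>xs. tensor (ys @ xs)) Ms)
    \<le> real m ^ Suc (length Ms) * (prod_list (map \<nu> ys) * K ^ length Ms / fact ((length ys + length Ms - 1) div 2))"
proof (rule seminorm_loop_sum_le[OF seminorm_entire_seminorm[OF \<nu>]])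
  show "0 \<le> prod_list (map \<nu> ys) * K ^ length Ms / fact ((length ys + length Ms - 1) div 2)"
    using K prod_list_seminorm_nonneg[OF \<nu>] by simp
  fix xs assume "list_all2 (\<lambda>M x. x \<in> entries m M) Ms xs"
  then have l: "length xs = length Ms" and x: "\<And>x. x \<in> set xs \<Longrightarrow> \<nu> x \<le> K"
    using le by (auto simp: list_all2_conv_all_nth in_set_conv_nth) (metis nth_mem)
  have "prod_list (map \<nu> xs) \<le> K ^ length Ms"
    unfolding l[symmetric] by (rule prod_list_map_le_power) (auto simp: seminorm_nonneg \<nu> x)
  then have "prod_list (map \<nu> (ys @ xs)) \<le> prod_list (map \<nu> ys) * K ^ length Ms"
    using prod_list_seminorm_nonneg[OF \<nu>] by (simp add: mult_left_mono)
  then have "prod_list (map \<nu> (ys @ xs)) / fact ((length (ys @ xs) - 1) div 2) \<le> prod_list (map \<nu> ys) * K ^ length Ms / fact ((length ys + length Ms - 1) div 2)"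
    by (simp add: l divide_right_mono)
  with entire_seminorm_tensor_le[OF \<nu>, of "ys @ xs"]
  show "entire_seminorm \<nu> (tensor (ys @ xs)) \<le> prod_list (map \<nu> ys) * K ^ length Ms / fact ((length ys + length Ms - 1) div 2)"
    by linarith
qed

lemma entries_bounded: "\<exists>K\<ge>0. \<forall>x\<in>entries m M. f x \<le> (K::real)"
proof -
  have "entries m M = (\<lambda>(i, j). M i j) ` ({..<m} \<times> {..<m})" by (auto simp: entries_def)
  then have fin: "finite (f ` entries m M)" by simp
  then show ?thesis by (intro exI[of _ "Max (insert 0 (f ` entries m M))"]) auto
qed

lemma subspace_odd_chains: "csubspace odd_chains"
  unfolding odd_chains_def by (rule complex_vector.subspace_span)

context flat_connection
begin

lemma map_word: "map f (word a c x y) = word a c (f x) (f y)"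
  by (simp add: word_def)

lemma poly_deriv_F: "\<exists>F'. poly_deriv (F n) F'"
proof -
  have "\<exists>H'. poly_deriv (\<lambda>s. unit_loop_sum m (W a c s)) H'" for a c
  proof -
    have "list_all2 (\<lambda>W W'. \<forall>i<m. \<forall>j<m. poly_deriv (\<lambda>s. W s i j) (\<lambda>s. W' s i j)) (word a c A (\<lambda>s. B)) (word a c A' (\<lambda>s i j. 0))"
      unfolding word_def
      by (intro list_all2_appendI) (auto simp: list_all2_conv_all_nth poly_deriv_A poly_deriv_const)
    from poly_deriv_loop_sum[OF this slot_multilinear_unit_tensor] show ?thesis
      unfolding map_word by blast
  qed
  then obtain H' where "\<And>a c. poly_deriv (\<lambda>s. unit_loop_sum m (W a c s)) (H' a c)" by metis
  then have "poly_deriv (F n) (\<lambda>s. \<Sum>a<n. H' a (n - Suc a) s)"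
    unfolding F_def[abs_def] by (rule poly_deriv_sum)
  then show ?thesis by (intro exI[of _ "\<lambda>s. \<Sum>a<n. H' a (n - Suc a) s"])
qed

definition Ch :: "nat \<Rightarrow> 'a acyc chain" where
  "Ch n = polynomial_integral (F n)"

text \<open>In this form linear maps, subspaces and seminorms pass through the integral.\<close>

lemma Ch_antiderivative:
  obtains G where "poly_deriv G (F n)" "Ch n = G 1 - G 0"
  using poly_deriv_F poly_deriv_antiderivative polynomial_integral_poly_deriv unfolding Ch_def by metis

lemma Ch_0: "Ch 0 = 0"
proof -
  have "F 0 = (\<lambda>s. 0)" by (simp add: F_def fun_eq_iff)
  then show ?thesis unfolding Ch_def using polynomial_integral_poly_deriv[OF poly_deriv_const[of 0]] by simp
qed

text \<open>There are \<open>a + c\<close> entries of degree 1 in a tensor with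
  \<open>a + c + 1\<close> shifted slots, so the total degree is -1.\<close>

lemma unit_loop_sum_word_odd: "unit_loop_sum m (W a c s) \<in> odd_chains"
proof (rule loop_sum_in_subspace[OF subspace_odd_chains])
  fix xs assume xs: "list_all2 (\<lambda>M x. x \<in> entries m M) (W a c s) xs"
  let ?ns = "0 # replicate a 1 @ [0] @ replicate c 1 :: int list"
  have "homogeneous_tuple ?ns (1 # xs)" by (rule homogeneous_tuple_entries[OF homog_word xs])
  moreover have "sum_list ?ns - int (length (1 # xs) - 1) = - 1"
    using list_all2_lengthD[OF xs] by (simp add: sum_list_replicate)
  moreover have "odd (- 1 :: int)" by simp
  ultimately show "tensor (1 # xs) \<in> odd_chains"
    unfolding odd_chains_def by (intro complex_vector.span_base CollectI exI conjI) (auto simp only:)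
qed

lemma Ch_odd: "Ch n \<in> odd_chains"
proof -
  obtain G where G: "poly_deriv G (F n)" "Ch n = G 1 - G 0" by (rule Ch_antiderivative)
  have "F n s \<in> odd_chains" for s
    unfolding F_def by (intro complex_vector.subspace_sum[OF subspace_odd_chains] unit_loop_sum_word_odd)
  with G show ?thesis using poly_deriv_diff_in_subspace[OF subspace_odd_chains] by metis
qed

definition \<Omega> :: "nat \<Rightarrow> nat \<Rightarrow> 'a acyc" where
  "\<Omega> i j = incl (w i j)"

text \<open>Only the endpoints of the integrated derivative remain: \<open>A 1\<close> is the
  Maurer-Cartan form without \<sigma>-part, and \<open>A 0\<close> is zero. For \<open>n = 0\<close>
  the two endpoint values coincide.\<close>

lemma chain_d_Ch_plus_chain_b_Ch:
  "chain_d (Ch n) + chain_b (Ch (Suc n)) = (if n = 0 then 0 else unit_loop_sum m (replicate n \<Omega>))"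
proof -
  obtain G where G: "poly_deriv G (F n)" "Ch n = G 1 - G 0" by (rule Ch_antiderivative)
  obtain G' where G': "poly_deriv G' (F (Suc n))" "Ch (Suc n) = G' 1 - G' 0" by (rule Ch_antiderivative)
  have "poly_deriv (\<lambda>s. chain_d (G s) + chain_b (G' s)) (\<lambda>s. chain_d (F n s) + chain_b (F (Suc n) s))"
    using poly_deriv.add[OF poly_deriv_linear[OF G(1), of chain_d, OF chain_ops_add(1) chain_ops_scaleC(1)]
        poly_deriv_linear[OF G'(1), of chain_b, OF chain_ops_add(2) chain_ops_scaleC(2)]] .
  then have "chain_d (G 1) + chain_b (G' 1) - (chain_d (G 0) + chain_b (G' 0))
     = polynomial_integral (\<lambda>s. chain_d (F n s) + chain_b (F (Suc n) s))"
    by (simp add: polynomial_integral_poly_deriv)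
  also have "\<dots> = polynomial_integral (\<lambda>s. \<Sum>a<n. unit_loop_sum m ((replicate n (A s))[a := A' s]))"
    by (simp only: chain_d_F_plus_chain_b_F)
  also have "\<dots> = unit_loop_sum m (replicate n (A 1)) - unit_loop_sum m (replicate n (A 0))"
  proof (rule polynomial_integral_poly_deriv)
    have "list_all2 (\<lambda>W W'. \<forall>i<m. \<forall>j<m. poly_deriv (\<lambda>s. W s i j) (\<lambda>s. W' s i j)) (replicate n A) (replicate n A')"
      by (auto simp: list_all2_conv_all_nth poly_deriv_A)
    from poly_deriv_loop_sum[OF this slot_multilinear_unit_tensor]
    have "poly_deriv (\<lambda>s. unit_loop_sum m (replicate n (A s)))
       (\<lambda>s. \<Sum>a<n. unit_loop_sum m ((replicate n (A s))[a := (replicate n A' ! a) s]))"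
      by (simp only: map_replicate length_replicate)
    moreover have "(\<Sum>a<n. unit_loop_sum m ((replicate n (A s))[a := (replicate n A' ! a) s]))
       = (\<Sum>a<n. unit_loop_sum m ((replicate n (A s))[a := A' s]))" for s
      by (rule sum.cong) simp_all
    ultimately show "poly_deriv (\<lambda>s. unit_loop_sum m (replicate n (A s))) (\<lambda>s. \<Sum>a<n. unit_loop_sum m ((replicate n (A s))[a := A' s]))"
      by (simp only:)
  qed
  also have "\<dots> = (if n = 0 then 0 else unit_loop_sum m (replicate n \<Omega>))"
  proof (cases n)
    case (Suc k)
    have "unit_loop_sum m (replicate n (A 0)) = loop_sum m (\<lambda>xs. 0) (replicate n (A 0))"
    proof (rule loop_sum_cong)
      fix xs assume "list_all2 (\<lambda>M x. x \<in> entries m M) (replicate n (A 0)) xs"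
      then obtain x ys where "xs = x # ys" "x \<in> entries m (A 0)" unfolding Suc by (auto simp: list_all2_Cons1)
      then show "tensor (1 # xs) = 0" by (intro tensor_zero) (auto simp: entries_def A_0)
    qed
    moreover have "A 1 = \<Omega>" by (simp add: fun_eq_iff A_1 \<Omega>_def)
    ultimately show ?thesis by (simp add: loop_sum_def Suc)
  qed simp
  finally show ?thesis by (simp add: G(2) G'(2) chain_ops_minus algebra_simps)
qed

lemma chain_B_Ch: "chain_B (Ch n) = 0"
proof -
  obtain G where G: "poly_deriv G (F n)" "Ch n = G 1 - G 0" by (rule Ch_antiderivative)
  have B0: "chain_B 0 = (0 :: 'a acyc chain)" using chain_ops_scaleC(3)[of 0 "0 :: 'a acyc chain"] by simp
  have "chain_B (sum f I) = (\<Sum>i\<in>I. chain_B (f i))" for f :: "nat \<Rightarrow> 'a acyc chain" and I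
    by (induction I rule: infinite_finite_induct) (simp_all add: chain_ops_add B0)
  then have "chain_B (F n s) = 0" for s
    by (simp add: F_def chain_B_unit_loop_sum[OF homog_word])
  moreover have "poly_deriv (\<lambda>s. chain_B (G s)) (\<lambda>s. chain_B (F n s))"
    by (rule poly_deriv_linear[OF G(1) chain_ops_add(3) chain_ops_scaleC(3)])
  ultimately have "chain_B (G 1) - chain_B (G 0) = polynomial_integral (\<lambda>s. 0)"
    by (simp add: polynomial_integral_poly_deriv)
  also have "\<dots> = 0" using polynomial_integral_poly_deriv[OF poly_deriv_const[of 0]] by simp
  finally show ?thesis by (simp add: G(2) chain_ops_minus)
qed

text \<open>In \<open>R = 2 * real m * K\<close>, \<open>2 ^ n\<close> covers the \<open>n\<close>
  words, \<open>m ^ n\<close> the index paths and \<open>K ^ n\<close> the entries, which are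
  bounded uniformly for \<open>s\<close> in the unit interval. The leading unit and one more index
  sum give the constant.\<close>

lemma Ch_bound:
  assumes "cont_seminorm \<nu>"
  shows "\<exists>C R. \<forall>n. entire_seminorm \<nu> (Ch n) \<le> C * (R ^ n / fact (n div 2))"
proof -
  have s: "seminorm \<nu>" "seminorm (entire_seminorm \<nu>)"
    using assms by (auto intro: seminorm_entire_seminorm cont_seminorm_seminorm)
  obtain K1 where K1: "0 \<le> K1" "\<And>x. x \<in> entries m w \<Longrightarrow> \<nu> (Acyc x 0) \<le> K1"
    using entries_bounded[of m w "\<lambda>x. \<nu> (Acyc x 0)"] by blast
  obtain K2 where K2: "0 \<le> K2" "\<And>x. x \<in> entries m (mat_prod m w w) \<Longrightarrow> \<nu> (Acyc 0 x) \<le> K2"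
    using entries_bounded[of m "mat_prod m w w" "\<lambda>x. \<nu> (Acyc 0 x)"] by blast
  obtain K3 where K3: "0 \<le> K3" "\<And>x. x \<in> entries m B \<Longrightarrow> \<nu> x \<le> K3"
    using entries_bounded[of m B \<nu>] by blast
  define K where "K = K1 + K2 + K3"
  have K: "0 \<le> K" using K1 K2 K3 by (simp add: K_def)
  have A: "\<nu> x \<le> K" if st: "0 \<le> t" "t \<le> 1" and x: "x \<in> entries m (A t)" for x t
  proof -
    obtain i j where ij: "i < m" "j < m" "x = A t i j" using x by (auto simp: entries_def)
    have "x = complex_of_real t *\<^sub>C Acyc (w i j) 0 + complex_of_real (- (t * (1 - t))) *\<^sub>C Acyc 0 (mat_prod m w w i j)"
      by (simp add: ij A_def acyc_eq_iff)
    then have "\<nu> x \<le> cmod (complex_of_real t) * \<nu> (Acyc (w i j) 0) + cmod (complex_of_real (- (t * (1 - t)))) * \<nu> (Acyc 0 (mat_prod m w w i j))"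
      by (metis seminorm_add[OF s(1)] seminorm_scaleC[OF s(1)])
    also have "\<dots> \<le> 1 * K1 + 1 * K2"
    proof (intro add_mono mult_mono)
      have "\<bar>t * (1 - t)\<bar> \<le> 1 * 1" unfolding abs_mult using st by (intro mult_mono) auto
      then show "cmod (complex_of_real (- (t * (1 - t)))) \<le> 1" by (simp only: norm_of_real)
    qed (use st K1 K2 ij in \<open>auto simp: entriesI seminorm_nonneg s\<close>)
    also have "\<dots> \<le> K" using K3(1) by (simp add: K_def)
    finally show ?thesis .
  qed
  have B: "\<nu> x \<le> K" if "x \<in> entries m B" for x
    using K3(2)[OF that] K1(1) K2(1) by (simp add: K_def)
  have "entire_seminorm \<nu> (Ch n) \<le> (real m * \<nu> 1) * ((2 * real m * K) ^ n / fact (n div 2))" for n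
  proof -
    let ?D = "real m ^ Suc n * (\<nu> 1 * K ^ n / fact (n div 2))"
    obtain G where G: "poly_deriv G (F n)" "Ch n = G 1 - G 0" by (rule Ch_antiderivative)
    have D: "0 \<le> ?D" using K by (simp add: seminorm_nonneg s)
    have F: "entire_seminorm \<nu> (F n t) \<le> real n * ?D" if t: "0 \<le> t" "t \<le> 1" for t
    proof -
      have "entire_seminorm \<nu> (F n t) \<le> (\<Sum>a<n. entire_seminorm \<nu> (unit_loop_sum m (W a (n - Suc a) t)))"
        unfolding F_def by (rule seminorm_sum_le[OF s(2)])
      also have "\<dots> \<le> (\<Sum>a<n. ?D)"
      proof (rule sum_mono)
        fix a assume "a \<in> {..<n}"
        then have l: "Suc (a + (n - Suc a)) = n" by simp
        have "entire_seminorm \<nu> (loop_sum m (\<lambda>xs. tensor ([1] @ xs)) (W a (n - Suc a) t))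
           \<le> real m ^ Suc (length (W a (n - Suc a) t)) * (prod_list (map \<nu> [1]) * K ^ length (W a (n - Suc a) t)
             / fact ((length [1 :: 'a acyc] + length (W a (n - Suc a) t) - 1) div 2))"
          by (rule entire_seminorm_loop_sum_le[OF s(1) K]) (use A[OF t] B in \<open>auto simp: word_def\<close>)
        then show "entire_seminorm \<nu> (unit_loop_sum m (W a (n - Suc a) t)) \<le> ?D"
          unfolding length_word l by simp
      qed
      finally show ?thesis by simp
    qed
    have "entire_seminorm \<nu> (Ch n) \<le> real n * ?D"
      unfolding G(2) by (rule seminorm_poly_deriv_le[OF s(2) G(1) F])
    also have "\<dots> \<le> 2 ^ n * ?D" by (intro mult_right_mono real_le_two_power D)
    also have "\<dots> = (real m * \<nu> 1) * ((2 * real m * K) ^ n / fact (n div 2))"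
      by (simp add: power_mult_distrib algebra_simps)
    finally show ?thesis .
  qed
  then show ?thesis by blast
qed

end

subsection \<open>The Chen relations for a gauge transformation\<close>

lemma subspace_chen_subcomplex: "csubspace chen_subcomplex"
  unfolding chen_subcomplex_def csubspace_def[symmetric]
  by (rule complex_vector.subspace_Inter) auto

lemma chen_Ti_in_chen_subcomplex:
  assumes "homogeneous_tuple ns \<theta>" "f \<in> homog 0"
  shows "chen_Ti f i \<theta> \<in> chen_subcomplex"
proof -
  have "chen_Ti f i \<theta> \<in> chen_generators" unfolding chen_generators_def using assms by blast
  then show ?thesis unfolding chen_subcomplex_def by blast
qed

lemma mat_prod_cong:
  "(\<And>k. k < m \<Longrightarrow> M i k = M' i k) \<Longrightarrow> (\<And>k. k < m \<Longrightarrow> N k j = N' k j) \<Longrightarrow> mat_prod m M N i j = mat_prod m M' N' i j"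
  by (simp add: mat_prod_def)

lemma mat_prod_assoc: "mat_prod m (mat_prod m M N) P i j = mat_prod m M (mat_prod m N P) i j"
  unfolding mat_prod_def sum_distrib_left sum_distrib_right by (subst sum.swap) (simp add: mult.assoc)

definition mat_unit :: "nat \<Rightarrow> nat \<Rightarrow> 'a::{zero, one}" where
  "mat_unit i j = (if i = j then 1 else 0)"

lemma mat_prod_unit:
  fixes M :: "nat \<Rightarrow> nat \<Rightarrow> 'a::locally_convex_dga"
  shows "i < m \<Longrightarrow> mat_prod m mat_unit M i j = M i j" "j < m \<Longrightarrow> mat_prod m M mat_unit i j = M i j"
proof -
  have "mat_unit i k * M k j = (if i = k then M k j else 0)" "M i k * mat_unit k j = (if k = j then M i k else 0)" for k
    by (simp_all add: mat_unit_def)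
  then show "i < m \<Longrightarrow> mat_prod m mat_unit M i j = M i j" "j < m \<Longrightarrow> mat_prod m M mat_unit i j = M i j"
    by (simp_all add: mat_prod_def)
qed

text \<open>\<open>h\<close> is the inverse of \<open>g\<close>. Degree 0 need not be commutative,
  so both products are prescribed.\<close>

locale gauge =
  fixes m :: nat and g h :: "nat \<Rightarrow> nat \<Rightarrow> 'a::locally_convex_dga"
  assumes homog_g: "i < m \<Longrightarrow> j < m \<Longrightarrow> g i j \<in> homog 0"
    and homog_h: "i < m \<Longrightarrow> j < m \<Longrightarrow> h i j \<in> homog 0"
    and gh: "i < m \<Longrightarrow> j < m \<Longrightarrow> mat_prod m g h i j = mat_unit i j"
    and hg: "i < m \<Longrightarrow> j < m \<Longrightarrow> mat_prod m h g i j = mat_unit i j"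
begin

definition dg :: "nat \<Rightarrow> nat \<Rightarrow> 'a" where
  "dg i j = diff (g i j)"

definition w :: "nat \<Rightarrow> nat \<Rightarrow> 'a" where
  "w = mat_prod m h dg"

lemma homog_dg: "i < m \<Longrightarrow> j < m \<Longrightarrow> dg i j \<in> homog 1"
  using diff_homog[OF homog_g, of i j] by (simp add: dg_def)

lemma diff_mult_0: "x \<in> homog 0 \<Longrightarrow> diff (x * y) = diff x * y + x * diff y"
  using diff_mult[of x 0 y] by (simp add: scaleC_one)

lemma diff_sum: "diff (\<Sum>i\<in>I. u i) = (\<Sum>i\<in>I. diff (u i :: 'a))"
  by (induction I rule: infinite_finite_induct) (simp_all add: diff_add)

text \<open>Differentiating h g = 1 gives (dh) g = - w; multiplying by h on the right isolates
  dh.\<close>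

lemma diff_h:
  assumes "i < m" "j < m"
  shows "diff (h i j) = - mat_prod m w h i j"
proof -
  let ?dh = "\<lambda>i j. diff (h i j)"
  have "mat_prod m ?dh g i l = - w i l" if "l < m" for l
  proof -
    have "diff (mat_prod m h g i l) = mat_prod m ?dh g i l + w i l"
      unfolding mat_prod_def w_def diff_sum sum.distrib[symmetric] dg_def
      by (intro sum.cong refl diff_mult_0 homog_h) (use assms that in auto)
    moreover have "diff (mat_prod m h g i l) = 0"
      using hg[OF assms(1) that] by (simp add: mat_unit_def)
    ultimately show ?thesis by (simp add: add_eq_0_iff)
  qed
  then have "mat_prod m (mat_prod m ?dh g) h i j = mat_prod m (\<lambda>i j. - w i j) h i j"
    by (intro mat_prod_cong) auto
  moreover have "mat_prod m (mat_prod m ?dh g) h i j = mat_prod m ?dh mat_unit i j"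
    unfolding mat_prod_assoc by (rule mat_prod_cong) (simp_all add: gh assms)
  ultimately have "diff (h i j) = mat_prod m (\<lambda>i j. - w i j) h i j" by (simp add: mat_prod_unit assms)
  then show ?thesis by (simp add: mat_prod_def sum_negf)
qed

text \<open>As d(dg) = 0, dw = (dh)(dg) = - w h dg = - w w.\<close>

lemma diff_w:
  assumes "i < m" "j < m"
  shows "diff (w i j) = - mat_prod m w w i j"
proof -
  have "diff (w i j) = mat_prod m (\<lambda>i j. diff (h i j)) dg i j"
    unfolding w_def mat_prod_def diff_sum
    by (intro sum.cong refl) (use assms in \<open>simp add: diff_mult_0 homog_h dg_def diff_diff\<close>)
  also have "\<dots> = mat_prod m (\<lambda>i j. - mat_prod m w h i j) dg i j"
    by (rule mat_prod_cong) (simp_all add: diff_h assms)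
  also have "\<dots> = - mat_prod m (mat_prod m w h) dg i j" by (simp add: mat_prod_def sum_negf)
  also have "\<dots> = - mat_prod m w w i j" unfolding mat_prod_assoc by (simp add: w_def)
  finally show ?thesis .
qed

sublocale flat_connection m w
proof
  fix i j assume ij: "i < m" "j < m"
  show "w i j \<in> homog 1"
    unfolding w_def mat_prod_def
    by (intro homog_sum homog_mult[of _ 0 _ 1, simplified] homog_h homog_dg) (use ij in auto)
  show "diff (w i j) = - mat_prod m w w i j" by (rule diff_w[OF ij])
qed

definition "G i j = incl (g i j)"
definition "H i j = incl (h i j)"
definition "DG i j = incl (dg i j)"

definition U :: "nat \<Rightarrow> 'a acyc chain" where
  "U n = loop_sum m tensor (H # DG # replicate n \<Omega>)"

lemma incl_mat_prod:
  fixes M N :: "nat \<Rightarrow> nat \<Rightarrow> 'a"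
  shows "mat_prod m (\<lambda>i j. incl (M i j)) (\<lambda>i j. incl (N i j)) i j = incl (mat_prod m M N i j)"
proof -
  have "incl (\<Sum>k\<in>K. u k) = (\<Sum>k\<in>K. incl (u k :: 'a))" for u and K :: "nat set"
    by (induction K rule: infinite_finite_induct) (simp_all add: incl_simps(1), simp_all add: incl_def acyc_eq_iff)
  then show ?thesis by (simp add: mat_prod_def incl_simps(2))
qed

lemma mat_prod_HG: "i < m \<Longrightarrow> j < m \<Longrightarrow> mat_prod m H G i j = mat_unit i j"
  and mat_prod_GH: "i < m \<Longrightarrow> j < m \<Longrightarrow> mat_prod m G H i j = mat_unit i j"
  and mat_prod_G\<Omega>: "i < m \<Longrightarrow> j < m \<Longrightarrow> mat_prod m G \<Omega> i j = DG i j"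
proof -
  assume ij: "i < m" "j < m"
  have i0: "incl 0 = (0 :: 'a acyc)" by (simp add: incl_def acyc_eq_iff)
  have fn: "G = (\<lambda>i j. incl (g i j))" "H = (\<lambda>i j. incl (h i j))" "\<Omega> = (\<lambda>i j. incl (w i j))"
    by (simp_all add: fun_eq_iff G_def H_def \<Omega>_def)
  show "mat_prod m H G i j = mat_unit i j" "mat_prod m G H i j = mat_unit i j"
    unfolding fn incl_mat_prod gh[OF ij] hg[OF ij] by (simp_all add: mat_unit_def incl_simps(3) i0)
  have "mat_prod m g w i j = mat_prod m (mat_prod m g h) dg i j" by (simp add: w_def mat_prod_assoc)
  also have "\<dots> = mat_prod m mat_unit dg i j" by (rule mat_prod_cong) (simp_all add: gh ij)
  finally show "mat_prod m G \<Omega> i j = DG i j"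
    unfolding fn incl_mat_prod by (simp add: DG_def mat_prod_unit ij)
qed

lemma slot_multilinear_tensor0: "slot_multilinear tensor"
  using slot_multilinear_tensor[of "[]"] by simp

lemma homog_entries: "entries m G \<subseteq> homog 0" "entries m H \<subseteq> homog 0" "entries m \<Omega> \<subseteq> homog 1"
  by (auto simp: entries_def G_def H_def \<Omega>_def intro!: incl_simps(4) homog_g homog_h homog)

lemma homog_form_G: "x \<in> entries m G \<Longrightarrow> form x \<in> homog 0 \<and> incl (form x) = x"
  by (auto simp: entries_def G_def incl_def homog_g)

text \<open>The entry of \<open>g\<close> to which \<open>T\<close> refers is carried as an extra
  matrix between \<open>H\<close> and the forms. Summing the relations over matching indices is then
  again a loop sum, and the products on its left and right become H G = 1 and G \<Omega> =
  DG.\<close>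

lemma U_step: "unit_loop_sum m (replicate (Suc n) \<Omega>) + U (Suc n) - U n \<in> chen_subcomplex"
proof -
  let ?Ms = "H # G # replicate (Suc n) \<Omega>"
  let ?t = "\<lambda>k xs. tensor (take k xs @ [xs ! k * xs ! Suc k] @ drop (k + 2) xs)"
  let ?L = "\<lambda>x :: 'a acyc. incl (diff (form x))"
  let ?f = "\<lambda>xs. ?t 1 xs - ?t 0 xs - tensor (xs[1 := ?L (xs ! 1)])"
  have "loop_sum m ?f ?Ms \<in> chen_subcomplex"
  proof (rule loop_sum_in_subspace[OF subspace_chen_subcomplex])
    fix xs assume "list_all2 (\<lambda>M x. x \<in> entries m M) ?Ms xs"
    \<comment> \<open>\<open>Suc n\<close> provides a second entry \<open>z\<close>, so
      \<open>T\<close> at position 0 is not the cyclic relation.\<close>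
    then obtain x y z zs where xs: "xs = x # y # z # zs" and e: "x \<in> entries m H" "y \<in> entries m G" "z \<in> entries m \<Omega>"
      "list_all2 (\<lambda>M x. x \<in> entries m M) (replicate n \<Omega>) zs"
      by (auto simp: list_all2_Cons1)
    have "list_all2 (\<lambda>n x. x \<in> homog n) (replicate n 1) zs"
      using e(4) homog_entries(3) by (auto simp: list_all2_conv_all_nth)
    then have h: "homogeneous_tuple (0 # 1 # replicate n 1) (x # z # zs)"
      using e homog_entries by (auto simp: homogeneous_tuple_def)
    have "?f xs = chen_Ti (form y) 0 (x # z # zs)"
      using homog_form_G[OF e(2)] by (simp add: xs chen_Ti_def)
    then show "?f xs \<in> chen_subcomplex"
      using chen_Ti_in_chen_subcomplex[OF h, of "form y" 0] homog_form_G[OF e(2)] by simp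
  qed
  also have "loop_sum m ?f ?Ms = loop_sum m (?t 1) ?Ms - loop_sum m (?t 0) ?Ms - loop_sum m (\<lambda>xs. tensor (xs[1 := ?L (xs ! 1)])) ?Ms"
    by (simp only: loop_sum_diff)
  also have "loop_sum m (?t 1) ?Ms = loop_sum m tensor ((H # H # replicate n \<Omega>)[1 := mat_prod m G \<Omega>])"
    using loop_sum_merge[of 1 ?Ms tensor m] slot_multilinear_tensor0 by simp
  also have "\<dots> = U n"
    unfolding U_def by (subst loop_sum_update_cong[OF mat_prod_G\<Omega>]) simp_all
  also have "loop_sum m (?t 0) ?Ms = loop_sum m tensor ((H # replicate (Suc n) \<Omega>)[0 := mat_prod m H G])"
    using loop_sum_merge[of 0 ?Ms tensor m] slot_multilinear_tensor0 by simp
  also have "\<dots> = loop_sum m tensor ((H # replicate (Suc n) \<Omega>)[0 := mat_unit])"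
    by (rule loop_sum_update_cong[OF mat_prod_HG])
  also have "\<dots> = unit_loop_sum m (replicate (Suc n) \<Omega>)"
    using loop_sum_unit[OF slot_multilinear_tensor0, of m 1] by (simp add: mat_unit_def[abs_def])
  also have "loop_sum m (\<lambda>xs. tensor (xs[1 := ?L (xs ! 1)])) ?Ms = U (Suc n)"
  proof -
    have "loop_sum m (\<lambda>xs. tensor (xs[1 := ?L (xs ! 1)])) ?Ms = loop_sum m tensor (?Ms[1 := \<lambda>i j. ?L ((?Ms ! 1) i j)])"
      by (rule loop_sum_update) simp
    also have "(\<lambda>i j. ?L ((?Ms ! 1) i j)) = DG" by (simp add: fun_eq_iff G_def DG_def dg_def incl_def)
    finally show ?thesis by (simp add: U_def)
  qed
  finally have "- (U n - unit_loop_sum m (replicate (Suc n) \<Omega>) - U (Suc n)) \<in> chen_subcomplex"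
    by (rule complex_vector.subspace_neg[OF subspace_chen_subcomplex])
  then show ?thesis by (simp add: algebra_simps)
qed

text \<open>On a single entry the relation is (g h) - (h g) - (h, dg). In general the entries do not
  commute, but the matrices G H and H G are both the identity, so after summation the first two
  terms cancel.\<close>

lemma U_0: "U 0 \<in> chen_subcomplex"
proof -
  let ?L = "\<lambda>x :: 'a acyc. incl (diff (form x))"
  let ?t = "\<lambda>xs. tensor (take 0 xs @ [xs ! 0 * xs ! Suc 0] @ drop (0 + 2) xs)"
  let ?f = "\<lambda>xs. ?t (last xs # butlast xs) - ?t xs - tensor (xs[1 := ?L (xs ! 1)])"
  have "loop_sum m ?f [H, G] \<in> chen_subcomplex"
  proof (rule loop_sum_in_subspace[OF subspace_chen_subcomplex])
    fix xs assume "list_all2 (\<lambda>M x. x \<in> entries m M) [H, G] xs"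
    then obtain x y where xs: "xs = [x, y]" and e: "x \<in> entries m H" "y \<in> entries m G"
      by (auto simp: list_all2_Cons1)
    have h: "homogeneous_tuple [0] [x]" using e homog_entries by (auto simp: homogeneous_tuple_def)
    have "?f xs = chen_Ti (form y) 0 [x]"
      using homog_form_G[OF e(2)] by (simp add: xs chen_Ti_def)
    then show "?f xs \<in> chen_subcomplex"
      using chen_Ti_in_chen_subcomplex[OF h, of "form y" 0] homog_form_G[OF e(2)] by simp
  qed
  also have "loop_sum m ?f [H, G] = loop_sum m (\<lambda>xs. ?t (last xs # butlast xs)) [H, G] - loop_sum m ?t [H, G]
     - loop_sum m (\<lambda>xs. tensor (xs[1 := ?L (xs ! 1)])) [H, G]"
    by (simp only: loop_sum_diff)
  also have "loop_sum m (\<lambda>xs. ?t (last xs # butlast xs)) [H, G] = loop_sum m ?t [G, H]"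
    using loop_sum_rotate[of m ?t "[H]" G] by simp
  also have "\<dots> = loop_sum m tensor ([H][0 := mat_prod m G H])"
    using loop_sum_merge[of 0 "[G, H]" tensor m] slot_multilinear_tensor0 by simp
  also have "\<dots> = loop_sum m tensor ([H][0 := mat_prod m H G])"
    by (rule loop_sum_update_cong) (simp add: mat_prod_GH mat_prod_HG)
  also have "\<dots> = loop_sum m ?t [H, G]"
    using loop_sum_merge[OF _ slot_multilinear_tensor0, of 0 "[H, G]" m] by simp
  also have "loop_sum m (\<lambda>xs. tensor (xs[1 := ?L (xs ! 1)])) [H, G] = U 0"
  proof -
    have "loop_sum m (\<lambda>xs. tensor (xs[1 := ?L (xs ! 1)])) [H, G] = loop_sum m tensor ([H, G][1 := \<lambda>i j. ?L (([H, G] ! 1) i j)])"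
      by (rule loop_sum_update) simp
    also have "(\<lambda>i j. ?L (([H, G] ! 1) i j)) = DG" by (simp add: fun_eq_iff G_def DG_def dg_def incl_def)
    finally show ?thesis by (simp add: U_def)
  qed
  finally have "- U 0 \<in> chen_subcomplex" by simp
  from complex_vector.subspace_neg[OF subspace_chen_subcomplex this] show ?thesis by simp
qed

lemma sum_unit_loop_sum_plus_U:
  "(\<Sum>k<n. unit_loop_sum m (replicate (Suc k) \<Omega>)) + U n \<in> chen_subcomplex"
proof (induction n)
  case 0
  show ?case using U_0 by simp
next
  case (Suc n)
  from complex_vector.subspace_add[OF subspace_chen_subcomplex Suc U_step[of n]] show ?case
    by (simp add: algebra_simps)
qed

text \<open>The constant \<open>real m ^ 3 * K\<^sup>2\<close> comes from the two extra slots
  \<open>H\<close> and \<open>DG\<close> and the closing index; otherwise the growth is that of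
  \<open>n\<close> slots.\<close>

lemma U_bound:
  assumes "cont_seminorm \<nu>"
  shows "\<exists>C R. \<forall>n. entire_seminorm \<nu> (U n) \<le> C * (R ^ n / fact (n div 2))"
proof -
  have s: "seminorm \<nu>" using assms by (rule cont_seminorm_seminorm)
  obtain K1 where K1: "0 \<le> K1" "\<And>x. x \<in> entries m H \<Longrightarrow> \<nu> x \<le> K1" using entries_bounded[of m H \<nu>] by blast
  obtain K2 where K2: "0 \<le> K2" "\<And>x. x \<in> entries m DG \<Longrightarrow> \<nu> x \<le> K2" using entries_bounded[of m DG \<nu>] by blast
  obtain K3 where K3: "0 \<le> K3" "\<And>x. x \<in> entries m \<Omega> \<Longrightarrow> \<nu> x \<le> K3" using entries_bounded[of m \<Omega> \<nu>] by blast
  define K where "K = K1 + K2 + K3"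
  have K: "0 \<le> K" using K1 K2 K3 by (simp add: K_def)
  have "entire_seminorm \<nu> (U n) \<le> (real m ^ 3 * K\<^sup>2) * ((real m * K) ^ n / fact (n div 2))" for n
  proof -
    have "entire_seminorm \<nu> (loop_sum m (\<lambda>xs. tensor ([] @ xs)) (H # DG # replicate n \<Omega>))
      \<le> real m ^ Suc (length (H # DG # replicate n \<Omega>)) * (prod_list (map \<nu> []) * K ^ length (H # DG # replicate n \<Omega>)
          / fact ((length ([] :: 'a acyc list) + length (H # DG # replicate n \<Omega>) - 1) div 2))"
    proof (rule entire_seminorm_loop_sum_le[OF s K])
      fix M x assume "M \<in> set (H # DG # replicate n \<Omega>)" "x \<in> entries m M"
      then show "\<nu> x \<le> K" using K1 K2 K3 unfolding K_def by (auto split: if_splits) (smt (verit))+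
    qed
    then have "entire_seminorm \<nu> (U n) \<le> (real m ^ 3 * K\<^sup>2) * (real m * K) ^ n / fact (Suc n div 2)"
      by (simp add: U_def power_mult_distrib power2_eq_square power3_eq_cube algebra_simps)
    also have "\<dots> \<le> (real m ^ 3 * K\<^sup>2) * (real m * K) ^ n / fact (n div 2)"
      using K by (intro divide_left_mono fact_mono mult_nonneg_nonneg) (auto simp: div_le_mono)
    finally show ?thesis by simp
  qed
  then show ?thesis by blast
qed

end

subsection \<open>The Chern character is closed\<close>

context gauge
begin

abbreviation "Ch_sums n \<equiv> (\<Sum>N<n. Ch N)"

lemma entire_Cauchy_Ch: "entire_Cauchy Ch_sums"
proof (rule entire_Cauchy_partial_sums)
  fix \<nu> :: "'a acyc \<Rightarrow> real" assume "cont_seminorm \<nu>"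
  then obtain C R where "\<And>n. entire_seminorm \<nu> (Ch n) \<le> C * (R ^ n / fact (n div 2))"
    using Ch_bound by blast
  then show "\<exists>b. summable b \<and> (\<forall>N. entire_seminorm \<nu> (Ch N) \<le> b N)"
    using summable_mult[OF summable_power_div_fact_half] by blast
qed

lemma Ch_sums_odd: "seq_completion Ch_sums \<in> odd_entire_chains"
  unfolding odd_entire_chains_def
  by (intro seq_completion_in_closure[OF entire_Cauchy_Ch] always_eventually allI
      complex_vector.subspace_sum[OF subspace_odd_chains] Ch_odd)

text \<open>Each \<open>d\<close> of a component is paired with \<open>b\<close> of the next one.
  The sum ends with \<open>Ch (Suc n)\<close>, whose \<open>d\<close> has no partner.\<close>

lemma boundary_Ch_sums:
  "chain_d (Ch_sums (Suc (Suc n))) + chain_b (Ch_sums (Suc (Suc n))) - chain_B (Ch_sums (Suc (Suc n)))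
     = (\<Sum>k<n. unit_loop_sum m (replicate (Suc k) \<Omega>)) + chain_d (Ch (Suc n))"
proof -
  have zero: "chain_d 0 = (0 :: 'a acyc chain)" "chain_b 0 = (0 :: 'a acyc chain)" "chain_B 0 = (0 :: 'a acyc chain)"
    using chain_ops_scaleC[of 0 "0 :: 'a acyc chain"] by simp_all
  have sums: "chain_d (Ch_sums n) = (\<Sum>N<n. chain_d (Ch N))" "chain_b (Ch_sums n) = (\<Sum>N<n. chain_b (Ch N))"
    "chain_B (Ch_sums n) = (\<Sum>N<n. chain_B (Ch N))" for n
    by (induction n) (simp_all add: zero chain_ops_add)
  have "chain_d (Ch_sums (Suc (Suc n))) + chain_b (Ch_sums (Suc (Suc n)))
     = (\<Sum>N<Suc n. chain_d (Ch N) + chain_b (Ch (Suc N))) + chain_d (Ch (Suc n))"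
    unfolding sums sum.distrib sum.lessThan_Suc_shift[of "\<lambda>N. chain_b (Ch N)"]
    by (simp add: Ch_0 zero)
  also have "(\<Sum>N<Suc n. chain_d (Ch N) + chain_b (Ch (Suc N))) = (\<Sum>k<n. unit_loop_sum m (replicate (Suc k) \<Omega>))"
    unfolding chain_d_Ch_plus_chain_b_Ch sum.lessThan_Suc_shift by (simp del: replicate_Suc)
  finally show ?thesis unfolding sums(3) chain_B_Ch by simp
qed

lemma boundary_Ch_sums_in_closure:
  "completion_ext chain_d (seq_completion Ch_sums) + completion_ext chain_b (seq_completion Ch_sums)
     - completion_ext chain_B (seq_completion Ch_sums) \<in> closure (to_completion ` chen_subcomplex)"
proof -
  let ?a = "\<lambda>n. chain_d (Ch_sums n) + chain_b (Ch_sums n) - chain_B (Ch_sums n)"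
  let ?e = "\<lambda>n. (\<Sum>k<n. unit_loop_sum m (replicate (Suc k) \<Omega>)) + U n"
  note c = entire_Cauchy_Ch
  have dC: "entire_Cauchy (\<lambda>n. chain_d (Ch_sums n))"
    by (rule entire_Cauchy_bounded_chain_map[OF chain_ops_minus(1) bounded_chain_map_d c])
  have bC: "entire_Cauchy (\<lambda>n. chain_b (Ch_sums n))"
    by (rule entire_Cauchy_bounded_chain_map[OF chain_ops_minus(2) bounded_chain_map_b c])
  have BC: "entire_Cauchy (\<lambda>n. chain_B (Ch_sums n))"
    by (rule entire_Cauchy_bounded_chain_map[OF chain_ops_minus(3) bounded_chain_map_B c])
  have aC: "entire_Cauchy ?a"
    using entire_Cauchy_add[OF entire_Cauchy_add[OF dC bC] entire_Cauchy_uminus[OF BC]] by simp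
  have eq: "completion_ext chain_d (seq_completion Ch_sums) + completion_ext chain_b (seq_completion Ch_sums)
     - completion_ext chain_B (seq_completion Ch_sums) = seq_completion ?a"
    by (simp only: completion_ext_seq_completion[OF chain_ops_minus(1) bounded_chain_map_d c]
        completion_ext_seq_completion[OF chain_ops_minus(2) bounded_chain_map_b c]
        completion_ext_seq_completion[OF chain_ops_minus(3) bounded_chain_map_B c]
        seq_completion_add[OF dC bC] seq_completion_diff[OF entire_Cauchy_add[OF dC bC] BC])
  \<comment> \<open>With the shift by 2, the boundary of the partial sum and the element
    \<open>?e n\<close> of the Chen subcomplex differ by \<open>chain_d (Ch (Suc n)) - U n\<close>,
    and both terms tend to zero.\<close>
  have null: "(\<lambda>n. entire_seminorm \<nu> (?a n - ?e (n - 2))) \<longlonglongrightarrow> 0" if \<nu>: "cont_seminorm \<nu>" for \<nu>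
  proof (rule LIMSEQ_offset[of _ 2])
    have s: "seminorm (entire_seminorm \<nu>)" using \<nu> by (intro seminorm_entire_seminorm cont_seminorm_seminorm)
    obtain C \<mu> where C: "0 \<le> C" "cont_seminorm \<mu>" "\<And>c. entire_seminorm \<nu> (chain_d c) \<le> C * entire_seminorm \<mu> c"
      using bounded_chain_map_d \<nu> unfolding bounded_chain_map_def by blast
    obtain C1 R1 where 1: "\<And>n. entire_seminorm \<mu> (Ch n) \<le> C1 * (R1 ^ n / fact (n div 2))"
      using Ch_bound[OF C(2)] by blast
    obtain C2 R2 where 2: "\<And>n. entire_seminorm \<nu> (U n) \<le> C2 * (R2 ^ n / fact (n div 2))"
      using U_bound[OF \<nu>] by blast
    have "(\<lambda>n. C * (C1 * (R1 ^ Suc n / fact (Suc n div 2))) + C2 * (R2 ^ n / fact (n div 2))) \<longlonglongrightarrow> C * (C1 * 0) + C2 * 0"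
      by (intro tendsto_intros LIMSEQ_Suc[of "\<lambda>n. R1 ^ n / fact (n div 2)"]
          summable_LIMSEQ_zero[OF summable_power_div_fact_half])
    then have lim: "(\<lambda>n. C * (C1 * (R1 ^ Suc n / fact (Suc n div 2))) + C2 * (R2 ^ n / fact (n div 2))) \<longlonglongrightarrow> 0" by simp
    have le: "entire_seminorm \<nu> (?a (n + 2) - ?e (n + 2 - 2)) \<le> C * (C1 * (R1 ^ Suc n / fact (Suc n div 2))) + C2 * (R2 ^ n / fact (n div 2))" for n
    proof -
      have "?a (n + 2) - ?e (n + 2 - 2) = chain_d (Ch (Suc n)) + - U n"
        using boundary_Ch_sums[of n] by simp
      then have "entire_seminorm \<nu> (?a (n + 2) - ?e (n + 2 - 2)) \<le> entire_seminorm \<nu> (chain_d (Ch (Suc n))) + entire_seminorm \<nu> (U n)"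
        using seminorm_add[OF s, of "chain_d (Ch (Suc n))" "- U n"] by (simp only: seminorm_uminus[OF s])
      then show ?thesis
        using C(3)[of "Ch (Suc n)"] mult_left_mono[OF 1[of "Suc n"] C(1)] 2[of n] by linarith
    qed
    show "(\<lambda>n. entire_seminorm \<nu> (?a (n + 2) - ?e (n + 2 - 2))) \<longlonglongrightarrow> 0"
      by (rule tendsto_sandwich[OF always_eventually always_eventually tendsto_const lim])
         (intro allI seminorm_nonneg[OF s] le)+
  qed
  have "seq_completion (\<lambda>n. ?e (n - 2)) \<in> closure (to_completion ` chen_subcomplex)"
    by (intro seq_completion_in_closure[OF seq_completion_null_diff(1)[OF aC null]] always_eventually allI
        sum_unit_loop_sum_plus_U)
  moreover have "seq_completion ?a = seq_completion (\<lambda>n. ?e (n - 2))"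
    by (rule seq_completion_null_diff(2)[OF aC null])
  ultimately show ?thesis by (simp only: eq)
qed

end

section \<open>Translation to matrices\<close>

lemma index_mult_mat_prod:
  "M \<in> carrier_mat m m \<Longrightarrow> N \<in> carrier_mat m m \<Longrightarrow> i < m \<Longrightarrow> j < m \<Longrightarrow>
    (M * N) $$ (i, j) = mat_prod m (\<lambda>i j. M $$ (i, j)) (\<lambda>i j. N $$ (i, j)) i j"
  by (auto simp: scalar_prod_def mat_prod_def lessThan_atLeast0 intro!: sum.cong)

text \<open>Uniqueness of inverses, h' = h' (g h) = (h' g) h = h, carried out on entries; it turns
  the definite description into the given inverse.\<close>

lemma mat_inverse_eq:
  fixes g h :: "'a::locally_convex_dga mat"
  assumes g: "g \<in> carrier_mat m m" and h: "h \<in> carrier_mat m m" and gh: "g * h = 1\<^sub>m m" and hg: "h * g = 1\<^sub>m m"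
  shows "mat_inverse g = h"
proof -
  have dim: "dim_row g = m" using g by simp
  have "h' = h" if h': "h' \<in> carrier_mat m m" and gh': "g * h' = 1\<^sub>m m" and hg': "h' * g = 1\<^sub>m m" for h'
  proof (rule eq_matI)
    fix i j assume "i < dim_row h" "j < dim_col h"
    then have ij: "i < m" "j < m" using h by auto
    let ?e = "\<lambda>M i j. M $$ (i, j)"
    have "h' $$ (i, j) = mat_prod m (?e h') mat_unit i j" by (simp add: mat_prod_unit ij)
    also have "\<dots> = mat_prod m (?e h') (mat_prod m (?e g) (?e h)) i j"
      by (rule mat_prod_cong) (use ij gh in \<open>simp_all add: index_mult_mat_prod[OF g h, symmetric] mat_unit_def\<close>)
    also have "\<dots> = mat_prod m (mat_prod m (?e h') (?e g)) (?e h) i j" by (simp add: mat_prod_assoc)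
    also have "\<dots> = mat_prod m mat_unit (?e h) i j"
      by (rule mat_prod_cong) (use ij hg' in \<open>simp_all add: index_mult_mat_prod[OF h' g, symmetric] mat_unit_def\<close>)
    finally show "h' $$ (i, j) = h $$ (i, j)" by (simp add: mat_prod_unit ij)
  qed (use h h' in auto)
  then show ?thesis
    unfolding mat_inverse_def dim using h gh hg by (intro the_equality) blast+
qed

theorem theoremB:
  fixes g :: "'a::locally_convex_dga mat" and m :: nat
  assumes "0 < m" and "g \<in> GL m (homog 0)"
  shows "((\<lambda>N. to_completion (chern_component g N)) sums chern_character g \<and> chern_character g \<in> odd_entire_chains)
    \<and> chen_normalized_eq (completion_ext chain_d (chern_character g) + completion_ext chain_b (chern_character g)
        - completion_ext chain_B (chern_character g)) 0"
proof -
  obtain h where g: "g \<in> mat_over m (homog 0)" and h: "h \<in> mat_over m (homog 0)" and inv: "g * h = 1\<^sub>m m" "h * g = 1\<^sub>m m"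
    using assms(2) by (auto simp: GL_def)
  have cg: "g \<in> carrier_mat m m" and ch: "h \<in> carrier_mat m m" using g h by (auto simp: mat_over_def)
  have dim: "dim_row g = m" using cg by simp
  let ?e = "\<lambda>M i j. M $$ (i, j)"
  \<comment> \<open>From here matrices are replaced by functions of two indices; what remains is to
    match the entries of the defined forms with those of the locale.\<close>
  interpret gauge m "?e g" "?e h"
  proof
    fix i j assume ij: "i < m" "j < m"
    show "g $$ (i, j) \<in> homog 0" "h $$ (i, j) \<in> homog 0" using g h ij by (auto simp: mat_over_def)
    show "mat_prod m (?e g) (?e h) i j = mat_unit i j" "mat_prod m (?e h) (?e g) i j = mat_unit i j"
      unfolding index_mult_mat_prod[OF cg ch ij, symmetric] index_mult_mat_prod[OF ch cg ij, symmetric] inv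
      using ij by (simp_all add: mat_unit_def)
  qed
  let ?\<omega> = "maurer_cartan g"
  have \<omega>: "?\<omega> = h * map_mat diff g" by (simp add: maurer_cartan_def mat_inverse_eq[OF cg ch inv])
  have c\<omega>: "?\<omega> \<in> carrier_mat m m" unfolding \<omega> using cg ch by auto
  have \<omega>_entry: "?\<omega> $$ (i, j) = w i j" if ij: "i < m" "j < m" for i j
  proof -
    have "?\<omega> $$ (i, j) = mat_prod m (?e h) (?e (map_mat diff g)) i j"
      unfolding \<omega> using cg by (intro index_mult_mat_prod ch ij) auto
    also have "\<dots> = w i j" unfolding w_def by (rule mat_prod_cong) (use cg ij in \<open>auto simp: dg_def\<close>)
    finally show ?thesis .
  qed
  have \<omega>2_entry: "(?\<omega> * ?\<omega>) $$ (i, j) = mat_prod m w w i j" if ij: "i < m" "j < m" for i j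
    unfolding index_mult_mat_prod[OF c\<omega> c\<omega> ij] by (rule mat_prod_cong) (simp_all add: \<omega>_entry ij)
  have A_entry: "form_A g s $$ (i, j) = A s i j" if ij: "i < m" "j < m" for s i j
  proof -
    have "form_A g s $$ (i, j) = complex_of_real s *\<^sub>C incl (?\<omega> $$ (i, j)) - complex_of_real (s * (1 - s)) *\<^sub>C (sigma * incl ((?\<omega> * ?\<omega>) $$ (i, j)))"
      unfolding form_A_def Let_def using c\<omega> ij by simp
    then show ?thesis
      unfolding \<omega>_entry[OF ij] \<omega>2_entry[OF ij] by (simp add: A_def incl_def sigma_def times_acyc_def acyc_eq_iff)
  qed
  have B_entry: "form_B g $$ (i, j) = B i j" if ij: "i < m" "j < m" for i j
    using c\<omega> ij by (simp add: form_B_def \<omega>_entry B_def incl_def sigma_def times_acyc_def acyc_eq_iff)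
  have trace: "generalized_trace m ([1\<^sub>m m] @ replicate a (form_A g s) @ [form_B g] @ replicate c (form_A g s))
     = unit_loop_sum m (W a c s)" for a c s
  proof -
    have "generalized_trace m ([1\<^sub>m m] @ replicate a (form_A g s) @ [form_B g] @ replicate c (form_A g s))
      = loop_sum m tensor (?e (1\<^sub>m m) # replicate a (?e (form_A g s)) @ [?e (form_B g)] @ replicate c (?e (form_A g s)))"
      by (simp add: generalized_trace_eq_loop_sum)
    also have "\<dots> = loop_sum m tensor (mat_unit # W a c s)"
      unfolding word_def
      by (intro loop_sum_mat_cong list_all2_Cons[THEN iffD2] conjI list_all2_appendI)
         (auto simp: list_all2_conv_all_nth A_entry B_entry mat_unit_def)
    also have "\<dots> = unit_loop_sum m (W a c s)"
      using loop_sum_unit[OF slot_multilinear_tensor0, of m 1] by (simp add: mat_unit_def[abs_def])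
    finally show ?thesis .
  qed
  have comp: "chern_component g N = Ch N" for N
  proof (cases "N = 0")
    case True
    then show ?thesis by (simp add: chern_component_def Ch_0)
  next
    case False
    \<comment> \<open>The position \<open>k\<close> of the distinguished factor starts at 1, whereas
      \<open>F\<close> counts the \<open>a = k - 1\<close> factors in front of it.\<close>
    have "(\<Sum>k=1..N. generalized_trace m ([1\<^sub>m m] @ replicate (k - 1) (form_A g s) @ [form_B g] @ replicate (N - k) (form_A g s))) = F N s" for s
      unfolding trace F_def using sum.atLeast1_atMost_eq[of "\<lambda>k. unit_loop_sum m (W (k - 1) (N - k) s)" N] by simp
    with False show ?thesis by (simp only: chern_component_def Ch_def dim if_False)
  qed
  have sums: "(\<lambda>N. to_completion (Ch N)) sums seq_completion Ch_sums"
    by (rule sums_seq_completion[OF entire_Cauchy_Ch])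
  then have ch: "chern_character g = seq_completion Ch_sums"
    unfolding chern_character_def comp by (rule sums_unique[symmetric])
  show ?thesis
    unfolding ch comp chen_normalized_eq_def diff_0_right
    by (intro conjI sums Ch_sums_odd boundary_Ch_sums_in_closure)
qed

end
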